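(* Let $X_t$ be a one-dimensional, non-constant symmetric Lévy process with $\mathbf{E}_0 e^{i\xi X_t}=e^{-t\psi(\xi^2)}$ for $\xi\in\mathbf{R}$, where $\psi$ is a complete Bernstein function, and for $\lambda>0$ let $F_\lambda$ be the bounded function on $(0,\infty)$ defined in the context. Let $t>0$. If $e^{-t\psi(\xi^2)}$ is integrable in $\xi>0$, then the transition density $p^{(0,\infty)}_t(x,y)$ of $X_t$ killed upon leaving $(0,\infty)$ is given by $$p^{(0,\infty)}_t(x,y)=\frac2\pi\int_0^\infty e^{-t\psi(\lambda^2)}F_\lambda(x)F_\lambda(y)\,d\lambda\qquad\text{for } x,y>0.$$
   Context: A complete Bernstein function is a function $\psi:(0,\infty)\to[0,\infty)$ of the form $\psi(\xi)=c_1+c_2\xi+\int_0^\infty(1-e^{-\xi s})\,m(s)\,ds$ with $c_1,c_2\ge0$, $m$ completely monotone on $(0,\infty)$ and $\int_0^\infty\min(1,s)m(s)\,ds<\infty$. Here $\psi(0^+)=0$ automatically. $\mathbf{E}_x$ is the expectation for the process started at $x$, $\tau_{(0,\infty)}=\inf\{t\ge0:X_t\notin(0,\infty)\}$, and $P^{(0,\infty)}_tf(x)=\mathbf{E}_x\bigl(f(X_t)\mathbf{1}_{\{t<\tau_{(0,\infty)}\}}\bigr)$. The transition density $p^{(0,\infty)}_t(x,y)$ is the kernel of $P^{(0,\infty)}_t$, i.e. $P^{(0,\infty)}_tf(x)=\int_0^\infty p^{(0,\infty)}_t(x,y)f(y)\,dy$; the claim means that the kernel of $P_t^{(0,\infty)}$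 has the stated density. For $\lambda>0$, $F_\lambda$ is the (unique) bounded continuous function on $(0,\infty)$ whose Laplace transform, for $\operatorname{Re}\xi>0$, is $$\int_0^\infty e^{-\xi x}F_\lambda(x)\,dx=\frac{\lambda}{\lambda^2+\xi^2}\exp\left(\frac1\pi\int_0^\infty\frac{\xi}{\xi^2+\zeta^2}\log\frac{\psi'(\lambda^2)(\lambda^2-\zeta^2)}{\psi(\lambda^2)-\psi(\zeta^2)}\,d\zeta\right)$$ (the expression inside the logarithm is extended continuously at $\zeta=\lambda$ by the value $1$). Such a function exists, and it satisfies $P^{(0,\infty)}_tF_\lambda=e^{-t\psi(\lambda^2)}F_\lambda$ on $(0,\infty)$. *)

theory Defs
  imports "HOL-Probability.Probability"
begin

definition completely_monotone :: "(real \<Rightarrow> real) \<Rightarrow> bool" where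
  "completely_monotone m \<longleftrightarrow>
     (\<forall>n. \<forall>x>0. (deriv ^^ n) m differentiable at x \<and> 0 \<le> (-1) ^ n * (deriv ^^ n) m x)"

text \<open>A complete Bernstein function lives on the open half-line; the value of the HOL function
  at nonpositive arguments is not constrained here.\<close>

definition complete_Bernstein :: "(real \<Rightarrow> real) \<Rightarrow> bool" where
  "complete_Bernstein \<psi> \<longleftrightarrow>
     (\<exists>c\<^sub>1 c\<^sub>2 m. 0 \<le> c\<^sub>1 \<and> 0 \<le> c\<^sub>2 \<and> completely_monotone m \<and>
        set_integrable lborel {0<..} (\<lambda>s. min 1 s * m s) \<and>
        (\<forall>\<xi>>0. \<psi> \<xi> = c\<^sub>1 + c\<^sub>2 * \<xi> + (LBINT s:{0<..}. (1 - exp (- \<xi> * s)) * m s)))"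

text \<open>Time is the set of nonnegative reals; \<open>X t\<close> for negative \<open>t\<close> is irrelevant.
  The process starts at 0, and the process started at \<open>x\<close> is \<open>\<lambda>t \<omega>. x + X t \<omega>\<close>.\<close>

definition levy_process :: "'a measure \<Rightarrow> (real \<Rightarrow> 'a \<Rightarrow> real) \<Rightarrow> bool" where
  "levy_process M X \<longleftrightarrow>
     prob_space M \<and>
     (\<forall>t\<ge>0. X t \<in> borel_measurable M) \<and>
     (AE \<omega> in M. X 0 \<omega> = 0) \<and>
     (\<forall>n (t::nat \<Rightarrow> real). 0 \<le> t 0 \<and> mono t \<longrightarrow>
        prob_space.indep_vars M (\<lambda>_. borel) (\<lambda>k \<omega>. X (t (Suc k)) \<omega> - X (t k) \<omega>) {..<n}) \<and>
     (\<forall>s\<ge>0. \<forall>t\<ge>0. distr M borel (\<lambda>\<omega>. X (s + t) \<omega> - X s \<omega>) = distr M borel (X t)) \<and>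
     (AE \<omega> in M. \<forall>t\<ge>0. ((\<lambda>s. X s \<omega>) \<longlongrightarrow> X t \<omega>) (at_right t) \<and>
        (0 < t \<longrightarrow> (\<exists>l. ((\<lambda>s. X s \<omega>) \<longlongrightarrow> l) (at_left t))))"

definition symmetric_process :: "'a measure \<Rightarrow> (real \<Rightarrow> 'a \<Rightarrow> real) \<Rightarrow> bool" where
  "symmetric_process M X \<longleftrightarrow>
     (\<forall>t\<ge>0. distr M borel (\<lambda>\<omega>. - X t \<omega>) = distr M borel (X t))"

definition constant_process :: "'a measure \<Rightarrow> (real \<Rightarrow> 'a \<Rightarrow> real) \<Rightarrow> bool" where
  "constant_process M X \<longleftrightarrow> (\<forall>t\<ge>0. AE \<omega> in M. X t \<omega> = X 0 \<omega>)"

text \<open>First exit time of a path from the positive half-line; it is \<open>\<infinity>\<close> if the path never exits.\<close>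

definition exit_time :: "(real \<Rightarrow> real) \<Rightarrow> ereal" where
  "exit_time w = Inf {ereal s | s. 0 \<le> s \<and> w s \<notin> {0<..}}"

text \<open>The expectation is taken with respect to the completion of \<open>M\<close>, because the event
  \<open>t < \<tau>\<close> involves uncountably many times and need not belong to the sigma-algebra of \<open>M\<close>
  itself.  On \<open>M\<close>-measurable functions both integrals agree.\<close>

definition killed_semigroup ::
    "'a measure \<Rightarrow> (real \<Rightarrow> 'a \<Rightarrow> real) \<Rightarrow> real \<Rightarrow> (real \<Rightarrow> real) \<Rightarrow> real \<Rightarrow> real" where
  "killed_semigroup M X t f x =
     (LINT \<omega>|completion M.
        f (x + X t \<omega>) * indicator {\<omega>. ereal t < exit_time (\<lambda>s. x + X s \<omega>)} \<omega>)"

text \<open>Functions on the half-line are represented by functions on the whole line; the values at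
  nonpositive arguments do not enter.  Integrability is demanded explicitly, since otherwise a
  divergent integral would count as 0.\<close>

definition killed_transition_density ::
    "'a measure \<Rightarrow> (real \<Rightarrow> 'a \<Rightarrow> real) \<Rightarrow> real \<Rightarrow> (real \<Rightarrow> real \<Rightarrow> real) \<Rightarrow> bool" where
  "killed_transition_density M X t p \<longleftrightarrow>
     (\<forall>x>0. \<forall>f \<in> borel_measurable borel. bounded (range f) \<longrightarrow>
        set_integrable lborel {0<..} (\<lambda>y. p x y * f y) \<and>
        killed_semigroup M X t f x = (LBINT y:{0<..}. p x y * f y))"

definition eigenfunction_log :: "(real \<Rightarrow> real) \<Rightarrow> real \<Rightarrow> real \<Rightarrow> real" where
  "eigenfunction_log \<psi> l \<zeta> =
     (if \<zeta> = l then ln 1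
      else ln (deriv \<psi> (l\<^sup>2) * (l\<^sup>2 - \<zeta>\<^sup>2) / (\<psi> (l\<^sup>2) - \<psi> (\<zeta>\<^sup>2))))"

definition eigenfunction_laplace :: "(real \<Rightarrow> real) \<Rightarrow> real \<Rightarrow> complex \<Rightarrow> complex" where
  "eigenfunction_laplace \<psi> l \<xi> =
     of_real l / ((of_real l)\<^sup>2 + \<xi>\<^sup>2) *
     exp (1 / of_real pi *
       (LBINT \<zeta>:{0<..}. \<xi> / (\<xi>\<^sup>2 + (of_real \<zeta>)\<^sup>2) * of_real (eigenfunction_log \<psi> l \<zeta>)))"

text \<open>The generalized eigenfunction \<open>F\<^sub>\<lambda>\<close> (with \<open>l\<close> for the spectral parameter) is
  characterised by its Laplace transform; being bounded and continuous, it is unique on the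
  half-line.\<close>

definition halfline_eigenfunction :: "(real \<Rightarrow> real) \<Rightarrow> real \<Rightarrow> (real \<Rightarrow> real) \<Rightarrow> bool" where
  "halfline_eigenfunction \<psi> l F \<longleftrightarrow>
     continuous_on {0<..} F \<and> bounded (F ` {0<..}) \<and>
     (\<forall>\<xi>. 0 < Re \<xi> \<longrightarrow>
        (LBINT x:{0<..}. exp (- \<xi> * of_real x) * of_real (F x)) = eigenfunction_laplace \<psi> l \<xi>)"

end

theory Submission
  imports Defs "HOL-Real_Asymp.Real_Asymp" "HOL-Complex_Analysis.Complex_Analysis"
begin

text \<open>
  At times \<open>k \<delta>\<close> with \<open>\<delta> = t / 2 ^ n\<close> the process is a symmetric random walk.  For the walk killed on leaving
  the half-line, a Wiener-Hopf argument gives the generating function in \<open>k\<close> of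
  \<open>\<integral> exp (- a x) v\<^sub>k x dx\<close>, where \<open>v\<^sub>k x\<close> is the killed expectation of \<open>exp (- b (x + X (k \<delta>)))\<close>.  Its
  coefficient at \<open>k = 2 ^ n\<close> is a Cauchy integral; deforming the contour onto the branch cut and substituting
  along it yields an integral over \<open>l\<close> with weight \<open>exp (- t * \<psi> (l\<^sup>2))\<close>.  Letting \<open>n\<close> tend to infinity,
  the double Laplace transform of the killed semigroup becomes the corresponding integral of products of Laplace
  transforms of the eigenfunctions.

  To undo the Laplace transforms, nonnegative functions in the span of the \<open>exp (- k y)\<close> approximate the
  point mass at \<open>x\<close>.  Comparison with the free process bounds the functions \<open>l \<mapsto> F l x\<close> in the \<open>L\<^sup>2\<close> space of the weight,
  uniformly in \<open>x\<close>, so that weak limits and Fubini's theorem apply.  The kernel so obtained is nonnegative, and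
  measures on the half-line are determined by their Laplace transforms at the positive integers.
\<close>

section \<open>Integrals and Laplace transforms on the half-line\<close>

text \<open>The generating function has the form \<open>exp (E a + E b) / (a + b)\<close>. On the
  cut, parametrised by \<open>x = - \<delta> * \<psi> (l\<^sup>2)\<close>, its modulus splits into a
  factor in \<open>a\<close> and a factor in \<open>b\<close>, and its argument is
  \<open>arctan (l / a) + arctan (l / b)\<close> up to sign. The sine of that angle is
  \<open>l * (a + b)\<close> over two square roots: it cancels the denominator \<open>a + b\<close>,
  and the jump becomes a product of one function of \<open>a\<close> and one of \<open>b\<close>.
  Three obstacles shape the estimates. The logarithm in the exponent is singular at
  \<open>z = l\<close>, on the path of integration; the factor
  \<open>\<bar>z\<^sup>2 - l\<^sup>2\<bar>\<close>, whose Poisson integral is explicit, is split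
  off, and the remaining \<open>ratio_step\<close> has logarithmic bounds uniform in the step. The
  bound on \<open>F l\<close> may depend on \<open>l\<close>, so the spectral integral is controlled
  in mean square only. Finally, a path may survive on all grids without staying positive; that this
  has probability 0 rests on the absence of concentration of the minimum at 0.\<close>

lemma norm_integral_le:
  fixes f :: "'b \<Rightarrow> 'c::{banach, second_countable_topology}" and g :: "'b \<Rightarrow> real"
  assumes f: "integrable M f" and g: "integrable M g" and le: "AE x in M. norm (f x) \<le> g x"
  shows "norm (\<integral>x. f x \<partial>M) \<le> (\<integral>x. g x \<partial>M)"
  using integral_norm_bound[of M f] integral_mono_AE[OF integrable_norm[OF f] g le] by linarith

text \<open>By Tonelli the dominating product integrates to a product of two finite integrals. The
  bounds \<open>g\<close> and \<open>h\<close> are first replaced by their absolute values, since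
  only the product is known to be nonnegative.\<close>

lemma integrable_pair_dominated:
  fixes f :: "'b \<times> 'c \<Rightarrow> 'd::{banach, second_countable_topology}" and g :: "'b \<Rightarrow> real" and h :: "'c \<Rightarrow> real"
  assumes "sigma_finite_measure M1" "sigma_finite_measure M2"
    and f [measurable]: "f \<in> borel_measurable (M1 \<Otimes>\<^sub>M M2)"
    and g: "integrable M1 g" and h: "integrable M2 h"
    and le: "\<And>x y. x \<in> space M1 \<Longrightarrow> y \<in> space M2 \<Longrightarrow> norm (f (x, y)) \<le> g x * h y"
  shows "integrable (M1 \<Otimes>\<^sub>M M2) f"
proof -
  interpret M1: sigma_finite_measure M1 by fact
  interpret M2: sigma_finite_measure M2 by fact
  interpret P: pair_sigma_finite M1 M2 by standard
  have [measurable]: "g \<in> borel_measurable M1" "h \<in> borel_measurable M2" using g h by auto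
  have "(\<integral>\<^sup>+z. norm (f z) \<partial>(M1 \<Otimes>\<^sub>M M2)) = (\<integral>\<^sup>+x. \<integral>\<^sup>+y. norm (f (x, y)) \<partial>M2 \<partial>M1)"
    by (rule M2.nn_integral_fst[symmetric]) measurable
  also have "\<dots> \<le> (\<integral>\<^sup>+x. \<integral>\<^sup>+y. ennreal (norm (g x)) * ennreal (norm (h y)) \<partial>M2 \<partial>M1)"
  proof (intro nn_integral_mono)
    fix x y assume "x \<in> space M1" "y \<in> space M2"
    from le[OF this] have "norm (f (x, y)) \<le> norm (g x) * norm (h y)"
      by (metis abs_ge_self abs_mult order_trans real_norm_def)
    then show "ennreal (norm (f (x, y))) \<le> ennreal (norm (g x)) * ennreal (norm (h y))"
      by (simp add: ennreal_mult[symmetric] ennreal_leI)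
  qed
  also have "\<dots> = (\<integral>\<^sup>+x. ennreal (norm (g x)) \<partial>M1) * (\<integral>\<^sup>+y. ennreal (norm (h y)) \<partial>M2)"
    by (simp add: nn_integral_cmult nn_integral_multc)
  also have "\<dots> < \<infinity>"
    using g h by (simp add: integrable_iff_bounded ennreal_mult_less_top)
  finally show ?thesis by (intro integrableI_bounded) auto
qed

text \<open>The mean value inequality on the ball bounds all difference quotients by
  \<open>g\<close>, so dominated convergence applies along every sequence. The field is generic
  because the lemma serves both the real derivative of a Bernstein function and the holomorphy of
  Laplace transforms and of integrals of logarithms.\<close>

lemma has_field_derivative_integral:
  fixes f f' :: "'k::{real_normed_field, banach, second_countable_topology} \<Rightarrow> 'b \<Rightarrow> 'k"
  assumes r: "0 < r"
    and int: "\<And>w. w \<in> ball z r \<Longrightarrow> integrable M (f w)"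
    and der: "\<And>w x. w \<in> ball z r \<Longrightarrow> x \<in> space M \<Longrightarrow>
                ((\<lambda>w. f w x) has_field_derivative f' w x) (at w)"
    and bound: "\<And>w x. w \<in> ball z r \<Longrightarrow> x \<in> space M \<Longrightarrow> norm (f' w x) \<le> g x"
    and g: "integrable M g"
  shows "((\<lambda>w. \<integral>x. f w x \<partial>M) has_field_derivative (\<integral>x. f' z x \<partial>M)) (at z)"
    and "integrable M (f' z)"
proof -
  have quot: "norm ((f w x - f z x) / (w - z)) \<le> g x"
    if "w \<in> ball z r" "w \<noteq> z" "x \<in> space M" for w x
  proof -
    have "norm (f w x - f z x) \<le> g x * norm (w - z)"
    proof (rule field_differentiable_bound[where S="ball z r"])
      show "((\<lambda>w. f w x) has_field_derivative f' y x) (at y within ball z r)" if "y \<in> ball z r" for y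
        using der[OF that \<open>x \<in> space M\<close>] has_field_derivative_at_within by blast
    qed (use that bound r in auto)
    with that show ?thesis by (simp add: norm_divide divide_le_eq)
  qed
  have conv: "(\<lambda>n. (f (s n) x - f z x) / (s n - z)) \<longlonglongrightarrow> f' z x"
    if s: "s \<longlonglongrightarrow> z" "\<And>n. s n \<noteq> z" and "x \<in> space M" for s x
  proof -
    have "((\<lambda>w. (f w x - f z x) / (w - z)) \<longlongrightarrow> f' z x) (at z)"
      using der[of z x] r that(3) by (simp add: has_field_derivative_iff)
    then show ?thesis using s unfolding tendsto_at_iff_sequentially comp_def by auto
  qed
  \<comment> \<open>A concrete sequence in the ball exhibits \<open>f' z\<close> as a limit of
    measurable difference quotients.\<close>
  define s0 :: "nat \<Rightarrow> 'k" where "s0 n = z + of_real (r / (real n + 2))" for n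
  have s0: "s0 \<longlonglongrightarrow> z" "\<And>n. s0 n \<noteq> z" "\<And>n. s0 n \<in> ball z r"
  proof -
    have "(\<lambda>n. r / (real n + 2)) \<longlonglongrightarrow> 0" by real_asymp
    then have "(\<lambda>n. z + of_real (r / (real n + 2)) :: 'k) \<longlonglongrightarrow> z + of_real 0"
      by (intro tendsto_intros)
    then show "s0 \<longlonglongrightarrow> z" by (simp add: s0_def[abs_def])
    define q where "q n = r / (real n + 2)" for n :: nat
    have q: "q n > 0" "q n < r" for n using r by (auto simp: q_def divide_less_eq algebra_simps add_pos_nonneg)
    have s0q: "s0 n = z + of_real (q n)" for n by (simp add: s0_def q_def)
    show "s0 n \<noteq> z" for n using q(1)[of n] by (simp add: s0q)
    show "s0 n \<in> ball z r" for n using q[of n] by (simp add: s0q dist_norm)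
  qed
  have meas: "f' z \<in> borel_measurable M"
    by (rule borel_measurable_LIMSEQ_metric[where f="\<lambda>n x. (f (s0 n) x - f z x) / (s0 n - z)"])
      (use int r s0 conv in \<open>auto intro!: borel_measurable_divide borel_measurable_diff borel_measurable_integrable\<close>)
  show "integrable M (f' z)"
    by (rule Bochner_Integration.integrable_bound[OF g meas])
       (use bound[of z] r in \<open>auto intro!: AE_I2 intro: order_trans[OF _ abs_ge_self]\<close>)
  show "((\<lambda>w. \<integral>x. f w x \<partial>M) has_field_derivative (\<integral>x. f' z x \<partial>M)) (at z)"
    unfolding has_field_derivative_iff tendsto_at_iff_sequentially comp_def
  proof (intro allI impI)
    fix s :: "nat \<Rightarrow> 'k"
    assume ne: "\<forall>i. s i \<in> UNIV - {z}" and lim: "s \<longlonglongrightarrow> z"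
    have "\<forall>\<^sub>F n in sequentially. s n \<in> ball z r"
      using lim r by (metis centre_in_ball open_ball topological_tendstoD)
    then obtain N where N: "\<And>n. n \<ge> N \<Longrightarrow> s n \<in> ball z r" by (auto simp: eventually_sequentially)
    define s1 where "s1 n = s (n + N)" for n
    have s1: "s1 \<longlonglongrightarrow> z" "\<And>n. s1 n \<noteq> z" "\<And>n. s1 n \<in> ball z r"
      using lim ne N by (auto simp: s1_def[abs_def] intro: LIMSEQ_ignore_initial_segment)
    have "(\<lambda>n. \<integral>x. (f (s1 n) x - f z x) / (s1 n - z) \<partial>M) \<longlonglongrightarrow> (\<integral>x. f' z x \<partial>M)"
      by (rule integral_dominated_convergence[where w=g])
         (use meas int r s1 conv quot g in \<open>auto intro!: AE_I2 borel_measurable_divide borel_measurable_diff borel_measurable_integrable\<close>)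
    also have "(\<lambda>n. \<integral>x. (f (s1 n) x - f z x) / (s1 n - z) \<partial>M)
        = (\<lambda>n. ((\<integral>x. f (s1 n) x \<partial>M) - (\<integral>x. f z x \<partial>M)) / (s1 n - z))"
      using int r s1 by (intro ext) (simp add: Bochner_Integration.integral_diff)
    finally show "(\<lambda>n. ((\<integral>x. f (s n) x \<partial>M) - (\<integral>x. f z x \<partial>M)) / (s n - z)) \<longlonglongrightarrow> (\<integral>x. f' z x \<partial>M)"
      unfolding s1_def by (rule LIMSEQ_offset)
  qed
qed

text \<open>Fatou's lemma bounds the limit \<open>v\<close>. For the weak convergence
  \<open>\<bar>d n x * h x\<bar>\<close> is cut off at \<open>K * (h x)\<^sup>2\<close>: the part
  below is dominated, and the excess is at most \<open>(d n x)\<^sup>2 / K\<close>, hence small in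
  the mean by the uniform bound.\<close>

lemma L2_bounded_weak_limit:
  fixes u :: "nat \<Rightarrow> 'b \<Rightarrow> real"
  assumes u: "\<And>n. u n \<in> borel_measurable M" "\<And>n. integrable M (\<lambda>x. (u n x)\<^sup>2)"
    and C: "\<And>n. (\<integral>x. (u n x)\<^sup>2 \<partial>M) \<le> C"
    and lim: "\<And>x. x \<in> space M \<Longrightarrow> (\<lambda>n. u n x) \<longlonglongrightarrow> v x"
  shows "v \<in> borel_measurable M" "integrable M (\<lambda>x. (v x)\<^sup>2)" "(\<integral>x. (v x)\<^sup>2 \<partial>M) \<le> C"
    and "\<lbrakk>h \<in> borel_measurable M; integrable M (\<lambda>x. (h x)\<^sup>2)\<rbrakk> \<Longrightarrow>
      (\<lambda>n. \<integral>x. u n x * h x \<partial>M) \<longlonglongrightarrow> (\<integral>x. v x * h x \<partial>M)"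
proof -
  show v: "v \<in> borel_measurable M"
    by (rule borel_measurable_LIMSEQ_real[OF lim u(1)])
  have "0 \<le> (\<integral>x. (u 0 x)\<^sup>2 \<partial>M)" by (rule Bochner_Integration.integral_nonneg) simp
  with C[of 0] have C0: "0 \<le> C" by linarith
  have "(\<integral>\<^sup>+x. ennreal ((v x)\<^sup>2) \<partial>M) = (\<integral>\<^sup>+x. liminf (\<lambda>n. ennreal ((u n x)\<^sup>2)) \<partial>M)"
  proof (rule nn_integral_cong)
    fix x assume "x \<in> space M"
    then have "(\<lambda>n. ennreal ((u n x)\<^sup>2)) \<longlonglongrightarrow> ennreal ((v x)\<^sup>2)"
      using lim by (intro tendsto_ennrealI tendsto_power) auto
    then show "ennreal ((v x)\<^sup>2) = liminf (\<lambda>n. ennreal ((u n x)\<^sup>2))"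
      using lim_imp_Liminf[OF sequentially_bot] by metis
  qed
  also have "\<dots> \<le> liminf (\<lambda>n. \<integral>\<^sup>+x. ennreal ((u n x)\<^sup>2) \<partial>M)"
    using u(1) by (intro nn_integral_liminf) measurable
  also have "\<dots> \<le> liminf (\<lambda>n. ennreal C)"
    using u(2) C by (intro Liminf_mono always_eventually allI) (simp add: nn_integral_eq_integral ennreal_leI)
  also have "\<dots> = ennreal C" by (simp add: Liminf_const)
  finally have nn: "(\<integral>\<^sup>+x. ennreal ((v x)\<^sup>2) \<partial>M) \<le> ennreal C" .
  show v2: "integrable M (\<lambda>x. (v x)\<^sup>2)"
    using v nn by (intro integrableI_bounded) (auto simp: order_le_less_trans[OF _ ennreal_less_top])
  show vC: "(\<integral>x. (v x)\<^sup>2 \<partial>M) \<le> C"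
    using nn v2 C0 by (simp add: nn_integral_eq_integral)
  assume h: "h \<in> borel_measurable M" "integrable M (\<lambda>x. (h x)\<^sup>2)"
  have prod_int: "integrable M (\<lambda>x. p x * q x)"
    if "p \<in> borel_measurable M" "q \<in> borel_measurable M" "integrable M (\<lambda>x. (p x)\<^sup>2)" "integrable M (\<lambda>x. (q x)\<^sup>2)"
    for p q :: "'b \<Rightarrow> real"
  proof (rule Bochner_Integration.integrable_bound[OF Bochner_Integration.integrable_add[OF that(3,4)]])
    have "\<bar>p x * q x\<bar> \<le> (p x)\<^sup>2 + (q x)\<^sup>2" for x
    proof -
      have "2 * (\<bar>p x\<bar> * \<bar>q x\<bar>) \<le> (p x)\<^sup>2 + (q x)\<^sup>2"
        using sum_squares_bound[of "\<bar>p x\<bar>" "\<bar>q x\<bar>"] by (simp add: mult.assoc)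
      moreover have "0 \<le> \<bar>p x\<bar> * \<bar>q x\<bar>" by simp
      ultimately show ?thesis unfolding abs_mult by linarith
    qed
    then show "AE x in M. norm (p x * q x) \<le> norm ((p x)\<^sup>2 + (q x)\<^sup>2)" by auto
  qed (use that in measurable)
  define d where "d n x = u n x - v x" for n x
  have dm: "d n \<in> borel_measurable M" for n unfolding d_def using u v by measurable
  have d2le: "(d n x)\<^sup>2 \<le> 2 * (u n x)\<^sup>2 + 2 * (v x)\<^sup>2" for n x
    unfolding d_def using zero_le_power2[of "u n x + v x"] by (simp add: power2_eq_square algebra_simps)
  have d2: "integrable M (\<lambda>x. (d n x)\<^sup>2)" for n
  proof (rule Bochner_Integration.integrable_bound)
    show "integrable M (\<lambda>x. 2 * (u n x)\<^sup>2 + 2 * (v x)\<^sup>2)" using u v2 by auto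
  qed (use dm d2le in \<open>auto intro!: AE_I2\<close>)
  have dC: "(\<integral>x. (d n x)\<^sup>2 \<partial>M) \<le> 4 * C" for n
  proof -
    have "(\<integral>x. (d n x)\<^sup>2 \<partial>M) \<le> (\<integral>x. 2 * (u n x)\<^sup>2 + 2 * (v x)\<^sup>2 \<partial>M)"
      using d2 d2le u v2 by (intro integral_mono) auto
    also have "\<dots> = 2 * (\<integral>x. (u n x)\<^sup>2 \<partial>M) + 2 * (\<integral>x. (v x)\<^sup>2 \<partial>M)" using u v2 by simp
    finally show ?thesis using C[of n] vC by linarith
  qed
  have "(\<lambda>n. \<integral>x. \<bar>d n x * h x\<bar> \<partial>M) \<longlonglongrightarrow> 0"
  proof (rule LIMSEQ_I)
    fix e :: real assume "e > 0"
    \<comment> \<open>The square integrals of the \<open>d n\<close> are at most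
      \<open>4 * C\<close>, so the excess is at most \<open>4 * C / K\<close>, which this choice
      keeps below \<open>e / 2\<close>; the \<open>+ 1\<close> keeps \<open>K\<close> positive when
      \<open>C = 0\<close>.\<close>
    define K where "K = (8 * C + 1) / e"
    have K: "K > 0" "4 * C / K < e / 2" using \<open>e > 0\<close> C0 by (auto simp: K_def field_simps add_nonneg_pos)
    have "(\<lambda>n. \<integral>x. min \<bar>d n x * h x\<bar> (K * (h x)\<^sup>2) \<partial>M) \<longlonglongrightarrow> (\<integral>x. 0 \<partial>M)"
    proof (rule integral_dominated_convergence[where w="\<lambda>x. K * (h x)\<^sup>2"])
      show "AE x in M. (\<lambda>n. min \<bar>d n x * h x\<bar> (K * (h x)\<^sup>2)) \<longlonglongrightarrow> 0"
      proof (rule AE_I2)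
        fix x assume "x \<in> space M"
        then have "(\<lambda>n. min \<bar>(u n x - v x) * h x\<bar> (K * (h x)\<^sup>2)) \<longlonglongrightarrow> min \<bar>(v x - v x) * h x\<bar> (K * (h x)\<^sup>2)"
          using lim by (intro tendsto_intros) auto
        then show "(\<lambda>n. min \<bar>d n x * h x\<bar> (K * (h x)\<^sup>2)) \<longlonglongrightarrow> 0" using K by (simp add: d_def)
      qed
    qed (use h dm K in auto)
    then have "(\<lambda>n. \<integral>x. min \<bar>d n x * h x\<bar> (K * (h x)\<^sup>2) \<partial>M) \<longlonglongrightarrow> 0" by simp
    from LIMSEQ_D[OF this, of "e/2"] \<open>e > 0\<close> obtain N
      where N0: "\<forall>n\<ge>N. norm ((\<integral>x. min \<bar>d n x * h x\<bar> (K * (h x)\<^sup>2) \<partial>M) - 0) < e / 2" by auto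
    then have N: "\<bar>\<integral>x. min \<bar>d n x * h x\<bar> (K * (h x)\<^sup>2) \<partial>M\<bar> < e / 2" if "n \<ge> N" for n
      using N0 that by (simp only: diff_zero real_norm_def)
    have "\<bar>\<integral>x. \<bar>d n x * h x\<bar> \<partial>M\<bar> < e" if "n \<ge> N" for n
    proof -
      have pt: "\<bar>d n x * h x\<bar> \<le> min \<bar>d n x * h x\<bar> (K * (h x)\<^sup>2) + (d n x)\<^sup>2 / K" for x
      proof (cases "\<bar>d n x\<bar> \<le> K * \<bar>h x\<bar>")
        case True
        then have "\<bar>d n x * h x\<bar> \<le> K * (h x)\<^sup>2"
          using mult_right_mono[OF True, of "\<bar>h x\<bar>"] by (simp add: abs_mult power2_eq_square)
        then show ?thesis using K by auto
      next
        case False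
        then have "K * \<bar>d n x * h x\<bar> \<le> (d n x)\<^sup>2"
          using mult_left_mono[of "K * \<bar>h x\<bar>" "\<bar>d n x\<bar>" "\<bar>d n x\<bar>"] by (simp add: abs_mult power2_eq_square mult_ac)
        then have "\<bar>d n x * h x\<bar> \<le> (d n x)\<^sup>2 / K" using K by (simp add: field_simps)
        moreover have "0 \<le> min \<bar>d n x * h x\<bar> (K * (h x)\<^sup>2)" using K by simp
        ultimately show ?thesis by linarith
      qed
      have i1: "integrable M (\<lambda>x. min \<bar>d n x * h x\<bar> (K * (h x)\<^sup>2))"
        by (rule Bochner_Integration.integrable_bound[where f="\<lambda>x. K * (h x)\<^sup>2"]) (use h dm K in auto)
      have "(\<integral>x. \<bar>d n x * h x\<bar> \<partial>M) \<le> (\<integral>x. min \<bar>d n x * h x\<bar> (K * (h x)\<^sup>2) + (d n x)\<^sup>2 / K \<partial>M)"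
        using i1 d2 pt prod_int[OF dm h(1) d2 h(2)] by (intro integral_mono) auto
      also have "\<dots> = (\<integral>x. min \<bar>d n x * h x\<bar> (K * (h x)\<^sup>2) \<partial>M) + (\<integral>x. (d n x)\<^sup>2 \<partial>M) / K"
        using i1 d2 by simp
      also have "(\<integral>x. (d n x)\<^sup>2 \<partial>M) / K \<le> 4 * C / K" using dC K by (simp add: divide_right_mono)
      finally have "(\<integral>x. \<bar>d n x * h x\<bar> \<partial>M) < e" using N[OF that] K by linarith
      then show ?thesis by simp
    qed
    then show "\<exists>N. \<forall>n\<ge>N. norm ((\<integral>x. \<bar>d n x * h x\<bar> \<partial>M) - 0) < e" by auto
  qed
  moreover have "norm ((\<integral>x. u n x * h x \<partial>M) - (\<integral>x. v x * h x \<partial>M)) \<le> (\<integral>x. \<bar>d n x * h x\<bar> \<partial>M)" for n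
  proof -
    have "(\<integral>x. u n x * h x \<partial>M) - (\<integral>x. v x * h x \<partial>M) = (\<integral>x. d n x * h x \<partial>M)"
      unfolding d_def using prod_int[OF u(1) h(1) u(2) h(2)] prod_int[OF v h(1) v2 h(2)]
      by (simp add: left_diff_distrib)
    then show ?thesis by simp
  qed
  ultimately have "(\<lambda>n. (\<integral>x. u n x * h x \<partial>M) - (\<integral>x. v x * h x \<partial>M)) \<longlonglongrightarrow> 0"
    by - (rule Lim_null_comparison[where g="\<lambda>n. \<integral>x. \<bar>d n x * h x\<bar> \<partial>M"], auto)
  then show "(\<lambda>n. \<integral>x. u n x * h x \<partial>M) \<longlonglongrightarrow> (\<integral>x. v x * h x \<partial>M)"
    by (rule LIM_zero_cancel)
qed

section \<open>Lebesgue measure on the half-line\<close>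

abbreviation hl :: "real measure" where "hl \<equiv> restrict_space lborel {0<..}"

lemma space_hl [simp]: "space hl = {0<..}"
  by (simp add: space_restrict_space)

lemma measurable_hl [measurable (raw)]: "f \<in> borel_measurable borel \<Longrightarrow> f \<in> borel_measurable hl"
  by (rule measurable_restrict_space1) simp

lemma continuous_on_measurable_hl:
  fixes f :: "real \<Rightarrow> real"
  assumes "continuous_on {0<..} f"
  shows "f \<in> borel_measurable hl"
proof -
  have "f \<in> borel_measurable (restrict_space borel {0<..})"
    using assms by (rule borel_measurable_continuous_on_restrict)
  then show ?thesis by (simp cong: measurable_cong_sets add: sets_restrict_space)
qed

text \<open>\<open>hl\<close> carries the trace of the Borel sigma-algebra, so a jointly Borel
  function has to be composed with the inclusion of the half-line into the line.\<close>

lemma measurable_pair_hl: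
  assumes [measurable]: "g \<in> measurable (borel \<Otimes>\<^sub>M N) L"
  shows "g \<in> measurable (hl \<Otimes>\<^sub>M N) L"
proof -
  have [measurable]: "fst \<in> borel_measurable (hl \<Otimes>\<^sub>M N)"
    by (rule measurable_compose[OF measurable_fst measurable_hl[OF measurable_ident_sets[OF refl]]])
  have "(\<lambda>x. g (fst x, snd x)) \<in> measurable (hl \<Otimes>\<^sub>M N) L" by measurable
  then show ?thesis by simp
qed

lemma set_integrable_hl:
  fixes f :: "real \<Rightarrow> 'b::{banach, second_countable_topology}"
  shows "set_integrable lborel {0<..} f \<longleftrightarrow> integrable hl f"
  unfolding set_integrable_def by (subst integrable_restrict_space) auto

lemma set_integral_hl:
  fixes f :: "real \<Rightarrow> 'b::{banach, second_countable_topology}"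
  shows "(LBINT x:{0<..}. f x) = (\<integral>x. f x \<partial>hl)"
  unfolding set_lebesgue_integral_def by (subst integral_restrict_space) auto

lemma sigma_finite_hl: "sigma_finite_measure hl"
  by (rule sigma_finite_measure_restrict_space) (auto intro: lborel.sigma_finite_measure_axioms)

lemma hl_exp:
  fixes z :: complex
  assumes "0 < Re z"
  shows "integrable hl (\<lambda>x. exp (- z * of_real x))" "(\<integral>x. exp (- z * of_real x) \<partial>hl) = 1 / z"
proof -
  have n: "cmod (exp (- z * of_real x)) = exp (- (x * Re z))" for x by (simp add: mult.commute)
  show i: "integrable hl (\<lambda>x. exp (- z * of_real x))"
    by (rule Bochner_Integration.integrable_bound[OF integrable_I0i_exp_mscale[OF assms, unfolded set_integrable_hl]])
       (auto simp: n intro!: measurable_hl)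
  define G where "G = (\<lambda>x::real. - exp (- z * of_real x) / z)"
  have z: "z \<noteq> 0" using assms by auto
  have "(LBINT x=0..\<infinity>. exp (- z * of_real x)) = 0 - (- 1 / z)"
  proof (rule interval_integral_FTC_integrable)
    show "(G has_vector_derivative exp (- z * of_real x)) (at x)" for x
    proof -
      have "((\<lambda>w. - exp (- z * w) / z) has_field_derivative exp (- z * of_real x)) (at (of_real x))"
        using z by (auto intro!: derivative_eq_intros)
      then show ?thesis unfolding G_def by (rule has_vector_derivative_real_field)
    qed
    show "set_integrable lborel (einterval 0 \<infinity>) (\<lambda>x. exp (- z * of_real x))"
      using i by (simp add: set_integrable_hl[symmetric] zero_ereal_def)
    have "((\<lambda>x. - exp (- z * of_real x) / z) \<longlongrightarrow> - exp (- z * of_real 0) / z) (at_right 0)"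
      using z by (intro tendsto_intros) auto
    then show "((G \<circ> real_of_ereal) \<longlongrightarrow> - 1 / z) (at_right 0)"
      by (simp add: G_def zero_ereal_def ereal_tendsto_simps)
    have "((\<lambda>x. exp (- (x * Re z))) \<longlongrightarrow> 0) at_top" using assms by real_asymp
    then have "((\<lambda>x. exp (- z * of_real x)) \<longlongrightarrow> 0) at_top"
      by (subst tendsto_norm_zero_iff[symmetric]) (simp add: mult.commute)
    then have "((\<lambda>x. - exp (- z * of_real x) / z) \<longlongrightarrow> - 0 / z) at_top"
      using z by (intro tendsto_intros) auto
    then show "((G \<circ> real_of_ereal) \<longlongrightarrow> 0) (at_left \<infinity>)"
      by (simp add: G_def ereal_tendsto_simps)
  qed (auto intro!: continuous_intros)
  then show "(\<integral>x. exp (- z * of_real x) \<partial>hl) = 1 / z"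
    by (simp add: interval_lebesgue_integral_0_infty set_integral_hl)
qed

lemma hl_exp_real:
  fixes a :: real
  assumes "0 < a"
  shows "integrable hl (\<lambda>x. exp (- a * x))" "(\<integral>x. exp (- a * x) \<partial>hl) = 1 / a"
proof -
  have e: "exp (- of_real a * of_real x) = complex_of_real (exp (- a * x))" for x
    by (simp add: exp_of_real[symmetric])
  show "integrable hl (\<lambda>x. exp (- a * x))"
    using integrable_I0i_exp_mscale[OF assms] by (simp add: set_integrable_hl mult.commute)
  have "complex_of_real (\<integral>x. exp (- a * x) \<partial>hl) = of_real (1 / a)"
    using hl_exp(2)[of "of_real a"] assms unfolding e integral_complex_of_real by simp
  then show "(\<integral>x. exp (- a * x) \<partial>hl) = 1 / a" by (simp only: of_real_eq_iff)
qed

section \<open>Exponential sums and uniqueness of Laplace transforms\<close>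

definition expsum :: "(nat \<Rightarrow> real) \<Rightarrow> nat \<Rightarrow> real \<Rightarrow> real" where
  "expsum c n y = (\<Sum>i\<le>n. c i * exp (- real (Suc i) * y))"

lemma integrable_hl_bounded_mult:
  fixes f h :: "real \<Rightarrow> real"
  assumes "integrable hl f" "h \<in> borel_measurable hl" "\<And>y. 0 < y \<Longrightarrow> \<bar>h y\<bar> \<le> B"
  shows "integrable hl (\<lambda>y. f y * h y)"
proof (rule Bochner_Integration.integrable_bound)
  show "integrable hl (\<lambda>y. B * \<bar>f y\<bar>)" using assms by auto
  show "AE y in hl. norm (f y * h y) \<le> norm (B * \<bar>f y\<bar>)"
  proof (rule AE_I2)
    fix y assume "y \<in> space hl"
    then have hB: "\<bar>h y\<bar> \<le> \<bar>B\<bar>" using assms(3)[of y] by simp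
    show "norm (f y * h y) \<le> norm (B * \<bar>f y\<bar>)"
      using mult_left_mono[OF hB abs_ge_zero[of "f y"]] by (simp add: abs_mult mult.commute)
  qed
qed (use assms in measurable)

lemma expsum_integrable: "integrable hl (expsum c n)"
  unfolding expsum_def[abs_def]
  by (intro Bochner_Integration.integrable_sum integrable_mult_right hl_exp_real(1)) simp

text \<open>Approximate identities at \<open>x\<close> made of the exponentials \<open>exp (- k y)\<close>, \<open>k \<ge> 1\<close>:
  integrating against them uses a function only through its Laplace transform.\<close>

definition expsum_delta :: "real \<Rightarrow> (nat \<Rightarrow> nat \<Rightarrow> real) \<Rightarrow> (nat \<Rightarrow> nat) \<Rightarrow> bool" where
  "expsum_delta x c N \<longleftrightarrow> (\<forall>j. \<forall>y>0. 0 \<le> expsum (c j) (N j) y) \<and>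
    (\<forall>h B. h \<in> borel_measurable hl \<longrightarrow> (\<forall>y>0. \<bar>h y\<bar> \<le> B) \<longrightarrow> isCont h x \<longrightarrow>
      (\<lambda>j. \<integral>y. expsum (c j) (N j) y * h y \<partial>hl) \<longlonglongrightarrow> h x)"

lemma expsum_deltaD:
  assumes "expsum_delta x c N"
  shows "0 < y \<Longrightarrow> 0 \<le> expsum (c j) (N j) y"
    and "h \<in> borel_measurable hl \<Longrightarrow> (\<And>y. 0 < y \<Longrightarrow> \<bar>h y\<bar> \<le> B) \<Longrightarrow> isCont h x \<Longrightarrow>
      (\<lambda>j. \<integral>y. expsum (c j) (N j) y * h y \<partial>hl) \<longlonglongrightarrow> h x"
  using assms unfolding expsum_delta_def by blast+

text \<open>In the variable \<open>u = exp (- y)\<close> an \<open>expsum\<close> is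
  \<open>u\<close> times a polynomial in \<open>u\<close> on the unit interval. Stone-Weierstrass
  approximation of narrow tent functions around \<open>exp (- x)\<close> therefore yields
  approximate identities at \<open>x\<close>.\<close>

lemma expsum_approx:
  fixes x :: real
  assumes x: "0 < x"
  obtains c N where "expsum_delta x c N"
proof -
  \<comment> \<open>A tent of height 1 and half-width \<open>1 / (m + 1)\<close> centred at
    \<open>exp (- x)\<close>. Its pullback \<open>r m\<close> to the variable \<open>y\<close>
    carries the factor \<open>exp (- y)\<close>, the Jacobian, which also makes it
    integrable.\<close>
  define q :: "nat \<Rightarrow> real \<Rightarrow> real" where "q m u = max 0 (1 - (real m + 1) * \<bar>u - exp (- x)\<bar>)" for m u
  have q: "0 \<le> q m u" "q m u \<le> 1" for m u by (auto simp: q_def)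
  have qcont: "continuous_on A (q m)" for A m unfolding q_def[abs_def] by (intro continuous_intros)
  have qmeas: "q m \<in> borel_measurable borel" for m by (rule borel_measurable_continuous_onI[OF qcont])
  define r where "r m y = exp (- y) * q m (exp (- y))" for m y
  have rmeas: "r m \<in> borel_measurable borel" for m
    unfolding r_def[abs_def] using qmeas by measurable
  have e1: "integrable hl (\<lambda>y. exp (- y))" "(\<integral>y. exp (- y) \<partial>hl) = 1" using hl_exp_real[of 1] by simp_all
  have rint: "integrable hl (r m)" for m
    by (rule Bochner_Integration.integrable_bound[OF e1(1)])
       (use rmeas q in \<open>auto simp: r_def intro!: measurable_hl\<close>)
  define k where "k m = (\<integral>y. r m y \<partial>hl)" for m
  have kpos: "0 < k m" for m
  proof -
    have "isCont (r m) x"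
      unfolding r_def[abs_def] q_def[abs_def] by (intro continuous_intros)
    moreover have rx: "r m x = exp (- x)" by (simp add: r_def q_def)
    ultimately have "((r m) \<longlongrightarrow> exp (- x)) (at x)" by (simp add: isCont_def)
    then have "eventually (\<lambda>y. r m y > exp (- x) / 2) (at x)"
      by (rule order_tendstoD) simp
    then obtain d where d: "d > 0" "\<And>y. y \<noteq> x \<Longrightarrow> dist y x < d \<Longrightarrow> r m y > exp (- x) / 2"
      by (auto simp: eventually_at)
    have "(\<integral>y. indicator {x<..<x+d} y * (exp (- x) / 2) \<partial>hl) \<le> (\<integral>y. r m y \<partial>hl)"
    proof (rule integral_mono[OF _ rint])
      show "integrable hl (\<lambda>y. indicator {x<..<x+d} y * (exp (- x) / 2))"
      proof (intro integrable_mult_left)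
        have sub: "{x<..<x+d} \<subseteq> {0<..}" using x by auto
        have "emeasure hl {x<..<x+d} = emeasure lborel {x<..<x+d}" by (rule emeasure_restrict_space) (use sub in auto)
        then show "integrable hl (indicator {x<..<x+d} :: real \<Rightarrow> real)"
          using sub d by (intro integrable_real_indicator) (auto simp: sets_restrict_space_iff)
      qed
      show "indicator {x<..<x+d} y * (exp (- x) / 2) \<le> r m y" for y
        using d(2)[of y] q[of m "exp (- y)"] by (auto simp: indicator_def dist_real_def r_def intro: less_imp_le)
    qed
    moreover have "(\<integral>y. indicator {x<..<x+d} y * (exp (- x) / 2) \<partial>hl) = d * (exp (- x) / 2)"
    proof -
      have "(\<integral>y. indicator {x<..<x+d} y * (exp (- x) / 2) \<partial>hl) = (\<integral>y. indicator {x<..<x+d} y * (exp (- x) / 2) \<partial>lborel)"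
      proof -
        have "(\<lambda>y. indicator {0<..} y *\<^sub>R (indicator {x<..<x+d} y * (exp (- x) / 2))) = (\<lambda>y. indicator {x<..<x+d} y * (exp (- x) / 2))"
          using x by (auto simp: fun_eq_iff indicator_def)
        then show ?thesis by (subst integral_restrict_space) simp_all
      qed
      then show ?thesis using d by simp
    qed
    ultimately show ?thesis using d by (simp add: k_def) (smt (verit) exp_gt_zero mult_pos_pos)
  qed
  have "\<exists>a n. \<forall>u\<in>{0..1}. \<bar>q m u / k m - (\<Sum>i\<le>n. a i * u ^ i)\<bar> < 1 / (real m + 1)" for m
  proof -
    have "continuous_on {0..1::real} (\<lambda>u. q m u / k m)"
      using kpos[of m] by (intro continuous_intros qcont) auto
    from Stone_Weierstrass_real_polynomial_function[OF _ this, of "1 / (real m + 1)"]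
    obtain g where g: "real_polynomial_function g" "\<And>u. u \<in> {0..1} \<Longrightarrow> \<bar>q m u / k m - g u\<bar> < 1 / (real m + 1)"
      by (auto simp: add_nonneg_pos)
    then show ?thesis unfolding real_polynomial_function_iff_sum by blast
  qed
  then obtain a n where an: "\<And>m u. u \<in> {0..1} \<Longrightarrow> \<bar>q m u / k m - (\<Sum>i\<le>n m. a m i * u ^ i)\<bar> < 1 / (real m + 1)"
    by metis
  \<comment> \<open>Raising the polynomial by its error bound \<open>1 / (m + 1)\<close> puts it
    above \<open>q m / k m\<close>. The resulting sum is nonnegative, at the price of an error of at
    most \<open>2 / (m + 1)\<close>.\<close>
  define c where "c m i = a m i + (if i = 0 then 1 / (real m + 1) else 0)" for m i
  have es: "expsum (c m) (n m) y = exp (- y) * ((\<Sum>i\<le>n m. a m i * exp (- y) ^ i) + 1 / (real m + 1))" for m y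
  proof -
    have "expsum (c m) (n m) y = (\<Sum>i\<le>n m. exp (- y) * (a m i * exp (- y) ^ i) + (if i = 0 then exp (- y) / (real m + 1) else 0))"
      unfolding expsum_def c_def
      by (intro sum.cong refl) (auto simp: exp_of_nat_mult[symmetric] exp_add[symmetric] algebra_simps)
    also have "\<dots> = exp (- y) * (\<Sum>i\<le>n m. a m i * exp (- y) ^ i) + exp (- y) / (real m + 1)"
      by (simp add: sum.distrib sum_distrib_left sum.delta)
    finally show ?thesis by (simp add: algebra_simps)
  qed
  have diff: "0 \<le> expsum (c m) (n m) y - r m y / k m" "expsum (c m) (n m) y - r m y / k m \<le> 2 / (real m + 1) * exp (- y)"
    if "0 < y" for m y
  proof -
    have u: "exp (- y) \<in> {0..1}" using that by simp
    have eq: "expsum (c m) (n m) y - r m y / k m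
        = exp (- y) * ((\<Sum>i\<le>n m. a m i * exp (- y) ^ i) - q m (exp (- y)) / k m + 1 / (real m + 1))"
      unfolding es r_def by (simp add: algebra_simps)
    have b: "0 \<le> (\<Sum>i\<le>n m. a m i * exp (- y) ^ i) - q m (exp (- y)) / k m + 1 / (real m + 1)"
      "(\<Sum>i\<le>n m. a m i * exp (- y) ^ i) - q m (exp (- y)) / k m + 1 / (real m + 1) \<le> 2 / (real m + 1)"
      using an[OF u, of m] by (auto simp: abs_less_iff)
    show "0 \<le> expsum (c m) (n m) y - r m y / k m" unfolding eq using b(1) by simp
    show "expsum (c m) (n m) y - r m y / k m \<le> 2 / (real m + 1) * exp (- y)" unfolding eq
      using mult_left_mono[OF b(2), of "exp (- y)"] by (simp add: mult.commute)
  qed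
  have r0: "0 \<le> r m y / k m" for m y using kpos[of m] q[of m] by (simp add: r_def)
  show thesis
  proof (rule that[of c n], unfold expsum_delta_def, intro conjI allI impI)
    show "0 \<le> expsum (c j) (n j) y" if "0 < y" for j y using diff(1)[OF that, of j] r0[of j y] by linarith
    fix h :: "real \<Rightarrow> real" and B
    assume "h \<in> borel_measurable hl" "\<forall>y>0. \<bar>h y\<bar> \<le> B" "isCont h x"
    then have h: "h \<in> borel_measurable hl" "\<And>y. 0 < y \<Longrightarrow> \<bar>h y\<bar> \<le> B" "isCont h x" by auto
    have B: "0 \<le> B" using h(2)[OF x] by linarith
    have ri: "integrable hl (\<lambda>y. r m y / k m)" "(\<integral>y. r m y / k m \<partial>hl) = 1" for m
      using rint kpos[of m] by (auto simp: k_def)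
    have rih: "integrable hl (\<lambda>y. r m y / k m * h y)" for m
      by (rule integrable_hl_bounded_mult[OF ri(1) h(1,2)])
    have fih: "integrable hl (\<lambda>y. expsum (c m) (n m) y * h y)" for m
      by (rule integrable_hl_bounded_mult[OF expsum_integrable h(1,2)])
    have lim1: "(\<lambda>m. (\<integral>y. expsum (c m) (n m) y * h y \<partial>hl) - (\<integral>y. r m y / k m * h y \<partial>hl)) \<longlonglongrightarrow> 0"
    proof (rule Lim_null_comparison)
      show "(\<lambda>m. B * (2 / (real m + 1))) \<longlonglongrightarrow> 0" by real_asymp
      have "norm ((\<integral>y. expsum (c m) (n m) y * h y \<partial>hl) - (\<integral>y. r m y / k m * h y \<partial>hl)) \<le> B * (2 / (real m + 1))" for m
      proof -
        have "norm (\<integral>y. expsum (c m) (n m) y * h y - r m y / k m * h y \<partial>hl) \<le> (\<integral>y. B * (2 / (real m + 1)) * exp (- y) \<partial>hl)"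
        proof (rule norm_integral_le, goal_cases)
          case 3
          show ?case
          proof (rule AE_I2)
          fix y assume "y \<in> space hl"
          then have y: "0 < y" by simp
          have "norm (expsum (c m) (n m) y * h y - r m y / k m * h y) = \<bar>expsum (c m) (n m) y - r m y / k m\<bar> * \<bar>h y\<bar>"
            by (simp add: abs_mult[symmetric] left_diff_distrib)
          also have "\<dots> \<le> (2 / (real m + 1) * exp (- y)) * B"
            using diff[OF y, of m] h(2)[OF y] by (intro mult_mono) auto
          finally show "norm (expsum (c m) (n m) y * h y - r m y / k m * h y) \<le> B * (2 / (real m + 1)) * exp (- y)"
            by (simp add: mult_ac)
          qed
        qed (use fih rih e1 in auto)
        then show ?thesis using fih rih e1 by simp
      qed
      then show "\<forall>\<^sub>F m in sequentially. norm ((\<integral>y. expsum (c m) (n m) y * h y \<partial>hl) - (\<integral>y. r m y / k m * h y \<partial>hl)) \<le> B * (2 / (real m + 1))"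
        by simp
    qed
    have lim2: "(\<lambda>m. (\<integral>y. r m y / k m * h y \<partial>hl)) \<longlonglongrightarrow> h x"
    proof (rule LIMSEQ_I)
      fix e :: real assume e: "0 < e"
      have "\<forall>e>0. \<exists>d>0. \<forall>y. dist y x < d \<longrightarrow> dist (h y) (h x) < e"
        using h(3) by (simp add: continuous_at_eps_delta)
      from this[rule_format, of "e / 2"] e
      obtain d where d: "d > 0" "\<And>y. dist y x < d \<Longrightarrow> dist (h y) (h x) < e / 2" by auto
      \<comment> \<open>The neighbourhood of \<open>exp (- x)\<close> of radius \<open>b\<close>
        pulls back into the \<open>d\<close>-neighbourhood of \<open>x\<close>, so tents narrower
        than \<open>b\<close> see only values of \<open>h\<close> close to
        \<open>h x\<close>.\<close>
      define b where "b = min (exp (- x) - exp (- (x + d))) (exp (- (x - d)) - exp (- x))"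
      have "0 < b" using d by (simp add: b_def)
      then obtain M where M: "1 / (real M + 1) < b" by (metis nat_approx_posE of_nat_Suc add.commute)
      have "norm ((\<integral>y. r m y / k m * h y \<partial>hl) - h x) < e" if "M \<le> m" for m
      proof -
        have A: "norm (\<integral>y. r m y / k m * h y - r m y / k m * h x \<partial>hl) \<le> (\<integral>y. r m y / k m * (e / 2) \<partial>hl)"
        proof (rule norm_integral_le, goal_cases)
          case 3
          show ?case
          proof (rule AE_I2)
          fix y
          show "norm (r m y / k m * h y - r m y / k m * h x) \<le> r m y / k m * (e / 2)"
          proof (cases "r m y = 0")
            case False
            then have "(real m + 1) * \<bar>exp (- y) - exp (- x)\<bar> < 1" by (auto simp: r_def q_def)
            then have "\<bar>exp (- y) - exp (- x)\<bar> < 1 / (real m + 1)" by (simp add: field_simps)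
            also have "\<dots> \<le> 1 / (real M + 1)" using that by (simp add: field_simps)
            finally have lt: "\<bar>exp (- y) - exp (- x)\<bar> < b" using M by linarith
            have "exp (- (x + d)) < exp (- y)" "exp (- y) < exp (- (x - d))"
              using lt by (auto simp: b_def abs_less_iff)
            then have "dist y x < d" by (auto simp: dist_real_def)
            then have "\<bar>h y - h x\<bar> \<le> e / 2" using d(2) by (simp add: dist_real_def less_imp_le)
            then have "r m y / k m * \<bar>h y - h x\<bar> \<le> r m y / k m * (e / 2)" using r0 by (intro mult_left_mono)
            moreover have "norm (r m y / k m * h y - r m y / k m * h x) = r m y / k m * \<bar>h y - h x\<bar>"
              using r0[of m y] by (metis abs_mult abs_of_nonneg real_norm_def right_diff_distrib)
            ultimately show ?thesis by simp
          qed simp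
          qed
        qed (rule Bochner_Integration.integrable_diff[OF rih integrable_mult_left[OF ri(1)]], rule integrable_mult_left[OF ri(1)])
        have B: "(\<integral>y. r m y / k m * h y - r m y / k m * h x \<partial>hl) = (\<integral>y. r m y / k m * h y \<partial>hl) - h x"
          using ri rih by (simp only: Bochner_Integration.integral_diff integrable_mult_left integral_mult_left_zero)
        have C: "(\<integral>y. r m y / k m * (e / 2) \<partial>hl) = e / 2"
          unfolding integral_mult_left_zero ri(2) by simp
        have "norm ((\<integral>y. r m y / k m * h y \<partial>hl) - h x) \<le> e / 2"
          using A unfolding B C .
        then show ?thesis using e by linarith
      qed
      then show "\<exists>M. \<forall>m\<ge>M. norm ((\<integral>y. r m y / k m * h y \<partial>hl) - h x) < e" by blast
    qed
    show "(\<lambda>j. \<integral>y. expsum (c j) (n j) y * h y \<partial>hl) \<longlonglongrightarrow> h x"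
      using tendsto_add[OF lim1 lim2] by simp
  qed
qed

lemma expsum_integral_mult:
  assumes "h \<in> borel_measurable hl" "\<And>y. 0 < y \<Longrightarrow> \<bar>h y\<bar> \<le> B"
  shows "(\<integral>y. expsum c n y * h y \<partial>hl) = (\<Sum>i\<le>n. c i * (\<integral>y. exp (- real (Suc i) * y) * h y \<partial>hl))"
proof -
  have "integrable hl (\<lambda>y. exp (- real (Suc i) * y) * h y)" for i
    by (rule integrable_hl_bounded_mult[OF hl_exp_real(1) assms]) auto
  then have "(\<integral>y. (\<Sum>i\<le>n. c i * (exp (- real (Suc i) * y) * h y)) \<partial>hl) = (\<Sum>i\<le>n. c i * (\<integral>y. exp (- real (Suc i) * y) * h y \<partial>hl))"
    by simp
  then show ?thesis by (simp add: expsum_def sum_distrib_right mult.assoc)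
qed

text \<open>Equal transforms at the positive integers mean equal integrals against every
  \<open>expsum\<close>, in particular against an approximate identity at \<open>x\<close>, whose
  limits are the two values at \<open>x\<close>.\<close>

lemma laplace_unique_at:
  assumes "h1 \<in> borel_measurable hl" "\<And>y. 0 < y \<Longrightarrow> \<bar>h1 y\<bar> \<le> B1" "isCont h1 x"
    and "h2 \<in> borel_measurable hl" "\<And>y. 0 < y \<Longrightarrow> \<bar>h2 y\<bar> \<le> B2" "isCont h2 x"
    and "0 < x"
    and "\<And>i. (\<integral>y. exp (- real (Suc i) * y) * h1 y \<partial>hl) = (\<integral>y. exp (- real (Suc i) * y) * h2 y \<partial>hl)"
  shows "h1 x = h2 x"
proof -
  obtain c N where cN: "expsum_delta x c N" by (rule expsum_approx[OF \<open>0 < x\<close>])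
  have eq: "(\<lambda>j. \<integral>y. expsum (c j) (N j) y * h1 y \<partial>hl) = (\<lambda>j. \<integral>y. expsum (c j) (N j) y * h2 y \<partial>hl)"
    using assms(8) by (intro ext) (simp only: expsum_integral_mult[OF assms(1,2)] expsum_integral_mult[OF assms(4,5)])
  have "(\<lambda>j. \<integral>y. expsum (c j) (N j) y * h1 y \<partial>hl) \<longlonglongrightarrow> h1 x"
    by (rule expsum_deltaD(2)[OF cN assms(1-3)])
  moreover have "(\<lambda>j. \<integral>y. expsum (c j) (N j) y * h1 y \<partial>hl) \<longlonglongrightarrow> h2 x"
    unfolding eq by (rule expsum_deltaD(2)[OF cN assms(4-6)])
  ultimately show ?thesis by (rule LIMSEQ_unique)
qed

text \<open>Weighting by \<open>exp (- y)\<close> and mapping by \<open>u = exp (- y)\<close> gives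
  finite measures \<open>N M1\<close>, \<open>N M2\<close> on the unit interval whose
  \<open>k\<close>-th moments are the Laplace transforms at \<open>k + 1\<close>. What remains is
  uniqueness in the Hausdorff moment problem: Weierstrass approximation yields equal integrals of
  continuous functions, hence equal characteristic functions.\<close>

lemma measure_eq_laplace:
  fixes M1 M2 :: "real measure"
  assumes sets [measurable_cong]: "sets M1 = sets borel" "sets M2 = sets borel"
    and pos: "AE y in M1. 0 < y" "AE y in M2. 0 < y"
    and fin: "(\<integral>\<^sup>+y. exp (- y) \<partial>M1) < \<infinity>"
    and eq: "\<And>i. (\<integral>\<^sup>+y. exp (- real (Suc i) * y) \<partial>M1) = (\<integral>\<^sup>+y. exp (- real (Suc i) * y) \<partial>M2)"
  shows "M1 = M2"
proof -
  define N where "N M = distr (density M (\<lambda>y. ennreal (exp (- y)))) borel (\<lambda>y. exp (- y))" for M :: "real measure"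
  have setsN [simp]: "sets (N M) = sets borel" "space (N M) = UNIV" for M by (simp_all add: N_def)
  have sp: "space M1 = UNIV" "space M2 = UNIV" using sets by (auto dest: sets_eq_imp_space_eq)
  have nnN: "(\<integral>\<^sup>+u. g u \<partial>N M) = (\<integral>\<^sup>+y. ennreal (exp (- y)) * g (exp (- y)) \<partial>M)"
    if gm [measurable]: "g \<in> borel_measurable borel" and sM [measurable_cong]: "sets M = sets borel" for g and M
    unfolding N_def by (subst nn_integral_distr) (auto intro!: nn_integral_density)
  have recover: "M = density (distr (N M) borel (\<lambda>u. - ln u)) (\<lambda>y. ennreal (exp y))"
    if sM [measurable_cong]: "sets M = sets borel" for M
  proof -
    have "distr (N M) borel (\<lambda>u. - ln u) = distr (density M (\<lambda>y. ennreal (exp (- y)))) borel (\<lambda>y. y)"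
      unfolding N_def by (subst distr_distr) (auto simp: comp_def)
    also have "\<dots> = density M (\<lambda>y. ennreal (exp (- y)))"
      by (rule distr_id2) (simp add: sM)
    finally have "density (distr (N M) borel (\<lambda>u. - ln u)) (\<lambda>y. ennreal (exp y))
        = density M (\<lambda>y. ennreal (exp (- y)) * ennreal (exp y))"
      by (simp add: density_density_eq)
    also have "(\<lambda>y. ennreal (exp (- y)) * ennreal (exp y)) = (\<lambda>_. 1)"
      by (auto simp: ennreal_mult[symmetric] exp_minus fun_eq_iff)
    finally show ?thesis by (simp add: density_1)
  qed
  have range: "AE u in N M. u \<in> {0..1}" if sM [measurable_cong]: "sets M = sets borel" and "AE y in M. 0 < y" for M
    unfolding N_def by (subst AE_distr_iff) (use that in \<open>auto simp: AE_density\<close>)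
  define m0 where "m0 = (\<integral>\<^sup>+y. exp (- y) \<partial>M1)"
  have m0: "emeasure (N M1) UNIV = m0" "emeasure (N M2) UNIV = m0"
    using nnN[of "\<lambda>_. 1" M1] nnN[of "\<lambda>_. 1" M2] sets eq[of 0] by (auto simp: m0_def)
  interpret N1: finite_measure "N M1" using m0 fin by (intro finite_measureI) (simp add: m0_def)
  interpret N2: finite_measure "N M2" using m0 fin by (intro finite_measureI) (simp add: m0_def)
  have int: "integrable (N M) g" if fm: "finite_measure (N M)" "sets M = sets borel" "AE y in M. 0 < y" "continuous_on {0..1} g"
      "g \<in> borel_measurable borel" for g :: "real \<Rightarrow> real" and M
  proof -
    interpret finite_measure "N M" by fact
    obtain B where "\<forall>u\<in>{0..1}. norm (g u) \<le> B"
      using compact_imp_bounded[OF compact_continuous_image[OF fm(4)]] by (auto simp: bounded_iff)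
    then show ?thesis using range[OF fm(2,3)] fm(5)
      by (intro integrable_const_bound[where B=B]) (auto simp: measurable_cong_sets[OF setsN(1) refl])
  qed
  have pow: "(\<integral>u. u ^ k \<partial>N M1) = (\<integral>u. u ^ k \<partial>N M2)" for k
  proof -
    have nn: "(\<integral>\<^sup>+u. ennreal (u ^ k) \<partial>N M) = (\<integral>\<^sup>+y. exp (- real (Suc k) * y) \<partial>M)" if "sets M = sets borel" for M
      by (subst nnN) (auto simp: that ennreal_mult[symmetric] exp_of_nat_mult[symmetric] exp_add[symmetric] algebra_simps
          intro!: nn_integral_cong)
    have "(\<integral>u. u ^ k \<partial>N M) = enn2real (\<integral>\<^sup>+y. exp (- real (Suc k) * y) \<partial>M)"
      if "finite_measure (N M)" "sets M = sets borel" "AE y in M. 0 < y" for M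
      unfolding nn[OF that(2), symmetric]
      by (rule integral_eq_nn_integral) (use range[OF that(2,3)] in \<open>auto simp: measurable_cong_sets[OF setsN(1) refl]\<close>)
    then show ?thesis using N1.finite_measure_axioms N2.finite_measure_axioms sets pos eq by simp
  qed
  have cont_eq: "(\<integral>u. g u \<partial>N M1) = (\<integral>u. g u \<partial>N M2)" if g: "continuous_on UNIV g" for g :: "real \<Rightarrow> real"
  proof (rule ccontr)
    assume ne: "(\<integral>u. g u \<partial>N M1) \<noteq> (\<integral>u. g u \<partial>N M2)"
    define m where "m = measure (N M1) UNIV"
    have m: "measure (N M2) UNIV = m" "0 \<le> m" using m0 by (simp_all add: m_def measure_def)
    define e where "e = \<bar>(\<integral>u. g u \<partial>N M1) - (\<integral>u. g u \<partial>N M2)\<bar> / (2 * m + 1)"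
    have e: "e > 0" "2 * m * e < \<bar>(\<integral>u. g u \<partial>N M1) - (\<integral>u. g u \<partial>N M2)\<bar>"
      using ne m by (auto simp: e_def field_simps)
    obtain p where p: "real_polynomial_function p" "\<And>u. u \<in> {0..1} \<Longrightarrow> \<bar>g u - p u\<bar> < e"
      using Stone_Weierstrass_real_polynomial_function[of "{0..1::real}" g e] e continuous_on_subset[OF g] by auto
    from p(1) obtain a n where pe: "p = (\<lambda>x. \<Sum>i\<le>n. a i * x ^ i)" unfolding real_polynomial_function_iff_sum by blast
    have intp: "integrable (N M) (\<lambda>u. u ^ i)" if "finite_measure (N M)" "sets M = sets borel" "AE y in M. 0 < y" for i M
      by (rule int[OF that]) (auto intro!: continuous_intros)
    have peq: "(\<integral>u. p u \<partial>N M1) = (\<integral>u. p u \<partial>N M2)"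
      unfolding pe using pow intp N1.finite_measure_axioms N2.finite_measure_axioms sets pos
      by (subst (1 2) Bochner_Integration.integral_sum) auto
    have close: "\<bar>(\<integral>u. g u \<partial>N M) - (\<integral>u. p u \<partial>N M)\<bar> \<le> m * e"
      if fm: "finite_measure (N M)" "sets M = sets borel" "AE y in M. 0 < y" and mM: "measure (N M) UNIV = m" for M
    proof -
      interpret finite_measure "N M" by fact
      have ig: "integrable (N M) g" by (rule int[OF fm]) (use g in \<open>auto intro: continuous_on_subset borel_measurable_continuous_onI\<close>)
      have ip: "integrable (N M) p" unfolding pe using intp[OF fm] by auto
      have "norm (\<integral>u. g u - p u \<partial>N M) \<le> (\<integral>u. e \<partial>N M)"
        using range[OF fm(2,3)] ig ip p(2) by (intro norm_integral_le) (auto intro: less_imp_le)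
      then show ?thesis using ig ip mM by (simp add: mult.commute)
    qed
    have "\<bar>(\<integral>u. g u \<partial>N M1) - (\<integral>u. g u \<partial>N M2)\<bar> \<le> m * e + m * e"
      using close[OF N1.finite_measure_axioms sets(1) pos(1)] close[OF N2.finite_measure_axioms sets(2) pos(2)] peq m m_def
      by linarith
    with e(2) show False by simp
  qed
  have "N M1 = N M2"
  \<comment> \<open>A zero measure cannot be normalised to a probability measure, the form in which
    Levy's uniqueness theorem applies.\<close>
  proof (cases "m0 = 0")
    case True
    show ?thesis
    proof (rule measure_eqI)
      fix A assume "A \<in> sets (N M1)"
      have "emeasure (N M1) A \<le> 0" "emeasure (N M2) A \<le> 0"
        using emeasure_space[of "N M1" A] emeasure_space[of "N M2" A] m0 True by auto
      then show "emeasure (N M1) A = emeasure (N M2) A" by simp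
    qed simp
  next
    case False
    define r where "r = enn2real m0"
    have "m0 < top" "0 < m0" using False fin by (simp_all add: m0_def zero_less_iff_neq_zero)
    then have r: "0 < r" "ennreal r = m0" by (simp_all add: r_def enn2real_positive_iff)
    define R where "R M = density (N M) (\<lambda>_. ennreal (1 / r))" for M
    have setsR [simp]: "sets (R M) = sets borel" "space (R M) = UNIV" for M by (simp_all add: R_def)
    have rd: "real_distribution (R M)" if "emeasure (N M) UNIV = m0" for M
    proof (intro real_distribution.intro prob_spaceI real_distribution_axioms.intro)
      show "emeasure (R M) (space (R M)) = 1"
      proof -
        have "emeasure (R M) (space (R M)) = (\<integral>\<^sup>+_. ennreal (1 / r) \<partial>N M)"
          unfolding setsR(2) unfolding R_def by (subst emeasure_density) auto
        also have "\<dots> = ennreal (1 / r) * ennreal r" using that by (simp add: r(2))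
        also have "\<dots> = 1" using r(1) by (simp flip: ennreal_mult)
        finally show ?thesis .
      qed
    qed simp_all
    have "char (R M1) = char (R M2)"
    proof
      fix t :: real
      have ch: "char (R M) t = of_real ((\<integral>u. cos (t * u) \<partial>N M) / r) + \<i> * of_real ((\<integral>u. sin (t * u) \<partial>N M) / r)"
        if "finite_measure (N M)" for M
      proof -
        interpret finite_measure "N M" by fact
        have i: "integrable (N M) (\<lambda>u. cos (t * u))" "integrable (N M) (\<lambda>u. sin (t * u))"
          by (intro integrable_const_bound[where B=1]; auto simp: measurable_cong_sets[OF setsN(1) refl])+
        have "char (R M) t = (\<integral>u. (1 / r) *\<^sub>R iexp (t * u) \<partial>N M)"
          unfolding char_def R_def
          by (subst integral_density) (use r in \<open>auto simp: measurable_cong_sets[OF setsN(1) refl]\<close>)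
        also have "\<dots> = (1 / r) *\<^sub>R (\<integral>u. of_real (cos (t * u)) + \<i> * of_real (sin (t * u)) \<partial>N M)"
          by (simp only: integral_scaleR_right exp_Euler cos_of_real sin_of_real)
        also have "(\<integral>u. of_real (cos (t * u)) + \<i> * of_real (sin (t * u)) \<partial>N M) = of_real (\<integral>u. cos (t * u) \<partial>N M) + \<i> * of_real (\<integral>u. sin (t * u) \<partial>N M)"
          using i by (subst Bochner_Integration.integral_add) auto
        finally show ?thesis by (simp add: scaleR_conv_of_real algebra_simps)
      qed
      show "char (R M1) t = char (R M2) t"
        unfolding ch[OF N1.finite_measure_axioms] ch[OF N2.finite_measure_axioms]
        by (subst (1 2) cont_eq) (auto intro!: continuous_intros)
    qed
    then have RR: "R M1 = R M2" using Levy_uniqueness rd m0 by blast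
    have "N M = density (R M) (\<lambda>_. ennreal r)" for M
      unfolding R_def using r by (subst density_density_eq) (auto simp: ennreal_mult[symmetric] density_1)
    then show ?thesis using RR by metis
  qed
  then show ?thesis using recover[OF sets(1)] recover[OF sets(2)] by simp
qed

section \<open>The half-Cauchy law\<close>

text \<open>The law of \<open>\<bar>Z\<bar>\<close> for a Cauchy variable \<open>Z\<close> of scale \<open>a\<close>.  Its density is twice the
  Poisson kernel of the half-plane at the point \<open>a\<close>, so that the exponent in
  \<open>eigenfunction_laplace\<close> is half of an integral with respect to \<open>hc a\<close>.\<close>

definition hc :: "real \<Rightarrow> real measure" where
  "hc a = density lborel (\<lambda>z. ennreal (indicator {0<..} z * (2 * a / (pi * (a\<^sup>2 + z\<^sup>2)))))"

lemma hc_sets [simp, measurable_cong]: "sets (hc a) = sets borel" "space (hc a) = UNIV"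
  by (simp_all add: hc_def)

text \<open>The closed half-line replaces the open one, at the cost of a null set, to match the
  fundamental theorem of calculus on \<open>{0..}\<close>.\<close>

lemma hc_nn_integral:
  assumes [measurable]: "f \<in> borel_measurable borel"
  shows "(\<integral>\<^sup>+z. f z \<partial>hc a) = (\<integral>\<^sup>+z. ennreal (2 * a / (pi * (a\<^sup>2 + z\<^sup>2))) * f z * indicator {0..} z \<partial>lborel)"
  unfolding hc_def using AE_lborel_singleton[of "0::real"]
  by (subst nn_integral_density) (auto intro!: nn_integral_cong_AE simp: indicator_def elim!: eventually_mono)

lemma arctan_scaled_deriv:
  assumes "0 < a"
  shows "((\<lambda>z. arctan (z / a)) has_real_derivative a / (a\<^sup>2 + z\<^sup>2)) (at z)"
proof -
  have "((\<lambda>z. arctan (z / a)) has_real_derivative inverse (1 + (z / a)\<^sup>2) * (1 / a)) (at z)"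
    using assms by (intro DERIV_chain2[OF DERIV_arctan] DERIV_cdivide DERIV_ident)
  moreover have "a\<^sup>2 + z\<^sup>2 > 0" using assms by (simp add: add_pos_nonneg)
  then have "inverse (1 + (z / a)\<^sup>2) * (1 / a) = a / (a\<^sup>2 + z\<^sup>2)"
    using assms by (simp add: divide_simps power2_eq_square)
  ultimately show ?thesis by simp
qed

lemma hc_deriv:
  assumes "0 < a"
  shows "((\<lambda>z. 2 / pi * arctan (z / a)) has_real_derivative 2 * a / (pi * (a\<^sup>2 + z\<^sup>2))) (at z)"
  using DERIV_cmult[OF arctan_scaled_deriv[OF assms], of "2 / pi"] by simp

lemma hc_prob:
  assumes a: "0 < a"
  shows "prob_space (hc a)" "real_distribution (hc a)"
proof -
  have "(\<integral>\<^sup>+z. ennreal (2 * a / (pi * (a\<^sup>2 + z\<^sup>2))) * indicator {0..} z \<partial>lborel) = ennreal (1 - 2 / pi * arctan (0 / a))"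
  proof (rule nn_integral_FTC_atLeast)
    show "((\<lambda>z. 2 / pi * arctan (z / a)) \<longlongrightarrow> 1) at_top"
    proof -
      have "filterlim (\<lambda>z. z / a) at_top at_top" using a by real_asymp
      then have "((\<lambda>z. 2 / pi * arctan (z / a)) \<longlongrightarrow> 2 / pi * (pi / 2)) at_top"
        by (intro tendsto_intros filterlim_compose[OF tendsto_arctan_at_top])
      then show ?thesis by simp
    qed
  qed (use hc_deriv[OF a] a in auto)
  then have "emeasure (hc a) UNIV = 1"
    using hc_nn_integral[of "\<lambda>_. 1" a] by simp
  then show *: "prob_space (hc a)" by (intro prob_spaceI) simp
  then show "real_distribution (hc a)"
    by (intro real_distribution.intro real_distribution_axioms.intro) auto
qed

lemma hc_AE_pos: "AE z in hc a. 0 < z"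
  unfolding hc_def by (subst AE_density) (auto simp: indicator_def intro!: AE_I2)

lemma hc_integral:
  fixes f :: "real \<Rightarrow> 'b::{banach, second_countable_topology}"
  assumes a: "0 < a" and f[measurable]: "f \<in> borel_measurable borel"
  shows "integrable (hc a) f \<longleftrightarrow> integrable hl (\<lambda>z. (2 * a / (pi * (a\<^sup>2 + z\<^sup>2))) *\<^sub>R f z)"
    and "(\<integral>z. f z \<partial>hc a) = (\<integral>z. (2 * a / (pi * (a\<^sup>2 + z\<^sup>2))) *\<^sub>R f z \<partial>hl)"
proof -
  have nn: "AE z in lborel. 0 \<le> indicator {0<..} z * (2 * a / (pi * (a\<^sup>2 + z\<^sup>2)))" using a by auto
  show "integrable (hc a) f \<longleftrightarrow> integrable hl (\<lambda>z. (2 * a / (pi * (a\<^sup>2 + z\<^sup>2))) *\<^sub>R f z)"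
    unfolding hc_def by (subst integrable_density[OF _ _ nn]) (auto simp: integrable_restrict_space)
  show "(\<integral>z. f z \<partial>hc a) = (\<integral>z. (2 * a / (pi * (a\<^sup>2 + z\<^sup>2))) *\<^sub>R f z \<partial>hl)"
    unfolding hc_def by (subst integral_density[OF _ _ nn]) (auto simp: integral_restrict_space)
qed

text \<open>Poisson kernels form a convolution semigroup in the scale; up to a factor
  \<open>pi\<close> this is its value at the origin. Partial fractions give the primitive for
  \<open>a \<noteq> p\<close>; they degenerate for \<open>a = p\<close>, which has its own
  primitive.\<close>

lemma hc_poisson:
  assumes a: "0 < a" and p: "0 < p"
  shows "(\<integral>z. p / (p\<^sup>2 + z\<^sup>2) \<partial>hc a) = 1 / (a + p)"
proof -
  have pos: "a\<^sup>2 + z\<^sup>2 > 0" "p\<^sup>2 + z\<^sup>2 > 0" for z using a p by (simp_all add: add_pos_nonneg)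
  have lim: "filterlim (\<lambda>z. z / c) at_top at_top" if "0 < c" for c :: real using that by real_asymp
  have at: "((\<lambda>z. arctan (z / c)) \<longlongrightarrow> pi / 2) at_top" if "0 < c" for c :: real
    by (intro filterlim_compose[OF tendsto_arctan_at_top] lim that)
  obtain G where G: "\<And>z. (G has_real_derivative 2 * a / (pi * (a\<^sup>2 + z\<^sup>2)) * (p / (p\<^sup>2 + z\<^sup>2))) (at z)"
      and G0: "G 0 = 0" and Glim: "(G \<longlongrightarrow> 1 / (a + p)) at_top"
  proof (cases "a = p")
    case True
    define G where "G = (\<lambda>z. 2 * a\<^sup>2 / pi * (z / (2 * a\<^sup>2 * (a\<^sup>2 + z\<^sup>2)) + arctan (z / a) / (2 * a ^ 3)))"
    show ?thesis
    proof (rule that[of G])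
      fix z
      have "(G has_real_derivative 2 * a\<^sup>2 / pi * ((2 * a\<^sup>2 * (a\<^sup>2 + z\<^sup>2) - z * (2 * a\<^sup>2 * (2 * z))) / (2 * a\<^sup>2 * (a\<^sup>2 + z\<^sup>2))\<^sup>2
          + a / (a\<^sup>2 + z\<^sup>2) / (2 * a ^ 3))) (at z)"
        unfolding G_def
      proof (intro DERIV_cmult DERIV_add DERIV_cdivide arctan_scaled_deriv a)
        show "((\<lambda>z. z / (2 * a\<^sup>2 * (a\<^sup>2 + z\<^sup>2))) has_real_derivative
            (2 * a\<^sup>2 * (a\<^sup>2 + z\<^sup>2) - z * (2 * a\<^sup>2 * (2 * z))) / (2 * a\<^sup>2 * (a\<^sup>2 + z\<^sup>2))\<^sup>2) (at z)"
          using a pos[of z] by (auto intro!: derivative_eq_intros simp: power2_eq_square)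
      qed
      moreover have "2 * a\<^sup>2 / pi * ((2 * a\<^sup>2 * (a\<^sup>2 + z\<^sup>2) - z * (2 * a\<^sup>2 * (2 * z))) / (2 * a\<^sup>2 * (a\<^sup>2 + z\<^sup>2))\<^sup>2
          + a / (a\<^sup>2 + z\<^sup>2) / (2 * a ^ 3)) = 2 * a / (pi * (a\<^sup>2 + z\<^sup>2)) * (p / (p\<^sup>2 + z\<^sup>2))"
      proof -
        define w where "w = a\<^sup>2 + z\<^sup>2"
        have w: "w > 0" "z * z = w - a\<^sup>2" using pos[of z] by (auto simp: w_def power2_eq_square)
        have "(2 * a\<^sup>2 * w - z * (2 * a\<^sup>2 * (2 * z))) = 2 * a\<^sup>2 * (2 * a\<^sup>2 - w)"
          using w(2) by algebra
        then show ?thesis unfolding w_def[symmetric] True[symmetric] using w(1) a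
          by (simp add: field_simps power2_eq_square power3_eq_cube)
      qed
      ultimately show "(G has_real_derivative 2 * a / (pi * (a\<^sup>2 + z\<^sup>2)) * (p / (p\<^sup>2 + z\<^sup>2))) (at z)" by simp
    next
      have "((\<lambda>z. z / (2 * a\<^sup>2 * (a\<^sup>2 + z\<^sup>2))) \<longlongrightarrow> 0) at_top" using a by real_asymp
      then have "(G \<longlongrightarrow> 2 * a\<^sup>2 / pi * (0 + (pi / 2) / (2 * a ^ 3))) at_top"
        unfolding G_def using a by (intro tendsto_intros at) auto
      then show "(G \<longlongrightarrow> 1 / (a + p)) at_top" using a True by (simp add: field_simps power2_eq_square power3_eq_cube)
    qed (simp add: G_def)
  next
    case False
    then have ne: "p\<^sup>2 - a\<^sup>2 \<noteq> 0" using a p by (simp add: power2_eq_iff)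
    define G where "G = (\<lambda>z. 2 * a * p / (pi * (p\<^sup>2 - a\<^sup>2)) * (arctan (z / a) / a - arctan (z / p) / p))"
    show ?thesis
    proof (rule that[of G])
      fix z
      have "(G has_real_derivative 2 * a * p / (pi * (p\<^sup>2 - a\<^sup>2)) * (a / (a\<^sup>2 + z\<^sup>2) / a - p / (p\<^sup>2 + z\<^sup>2) / p)) (at z)"
        unfolding G_def
        by (intro DERIV_cmult DERIV_diff DERIV_cdivide arctan_scaled_deriv a p)
      moreover have "2 * a * p / (pi * (p\<^sup>2 - a\<^sup>2)) * (1 / (a\<^sup>2 + z\<^sup>2) - 1 / (p\<^sup>2 + z\<^sup>2)) = 2 * a / (pi * (a\<^sup>2 + z\<^sup>2)) * (p / (p\<^sup>2 + z\<^sup>2))"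
      proof -
        have "1 / (a\<^sup>2 + z\<^sup>2) - 1 / (p\<^sup>2 + z\<^sup>2) = (p\<^sup>2 - a\<^sup>2) / ((a\<^sup>2 + z\<^sup>2) * (p\<^sup>2 + z\<^sup>2))"
          using a p pos[of z] by (simp add: diff_divide_eq_iff divide_diff_eq_iff divide_simps)
        then show ?thesis using ne by simp
      qed
      ultimately show "(G has_real_derivative 2 * a / (pi * (a\<^sup>2 + z\<^sup>2)) * (p / (p\<^sup>2 + z\<^sup>2))) (at z)"
        using a p by simp
    next
      have "(G \<longlongrightarrow> 2 * a * p / (pi * (p\<^sup>2 - a\<^sup>2)) * ((pi / 2) / a - (pi / 2) / p)) at_top"
        unfolding G_def using a p by (intro tendsto_intros at) auto
      moreover have "2 * a * p / (pi * (p\<^sup>2 - a\<^sup>2)) * ((pi / 2) / a - (pi / 2) / p) = 1 / (a + p)"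
      proof -
        have "p\<^sup>2 - a\<^sup>2 = (p - a) * (a + p)" by (simp add: power2_eq_square algebra_simps)
        moreover have "(pi / 2) / a - (pi / 2) / p = pi / 2 * ((p - a) / (a * p))" using a p by (simp add: field_simps)
        ultimately show ?thesis using a p False by simp
      qed
      ultimately show "(G \<longlongrightarrow> 1 / (a + p)) at_top" by simp
    qed (simp add: G_def)
  qed
  have nn: "(\<integral>\<^sup>+z. ennreal (p / (p\<^sup>2 + z\<^sup>2)) \<partial>hc a) = ennreal (1 / (a + p))"
  proof -
    have "(\<integral>\<^sup>+z. ennreal (p / (p\<^sup>2 + z\<^sup>2)) \<partial>hc a) = (\<integral>\<^sup>+z. ennreal (2 * a / (pi * (a\<^sup>2 + z\<^sup>2)) * (p / (p\<^sup>2 + z\<^sup>2))) * indicator {0..} z \<partial>lborel)"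
      using a p by (subst hc_nn_integral) (auto simp: ennreal_mult[symmetric] intro!: nn_integral_cong)
    also have "\<dots> = ennreal (1 / (a + p) - G 0)"
      by (rule nn_integral_FTC_atLeast[OF _ G _ Glim]) (use a p in auto)
    finally show ?thesis using G0 by simp
  qed
  show ?thesis
    using a p by (subst integral_eq_nn_integral) (auto simp: nn)
qed

text \<open>By Fubini and \<open>hc_poisson\<close> the Laplace transform in \<open>s\<close> of the
  left-hand side is \<open>1 / (a + p)\<close>, which is that of \<open>exp (- a * s)\<close>.
  Uniqueness for continuous functions and evenness in \<open>s\<close> replace a residue
  computation.\<close>

lemma hc_cos:
  assumes a: "0 < a"
  shows "(\<integral>z. cos (z * s) \<partial>hc a) = exp (- a * \<bar>s\<bar>)"
proof -
  interpret real_distribution "hc a" by (rule hc_prob[OF a])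
  define h where "h s = (\<integral>z. cos (z * s) \<partial>hc a)" for s
  have ci: "integrable (hc a) (\<lambda>z. cos (z * s))" for s by (intro integrable_const_bound[where B=1]) auto
  have hc1: "h s = Re (char (hc a) s)" for s
  proof -
    have "integrable (hc a) (\<lambda>z. iexp (s * z))" by (intro integrable_const_bound[where B=1]) auto
    then have "Re (char (hc a) s) = (\<integral>z. Re (iexp (s * z)) \<partial>hc a)" unfolding char_def by simp
    then show ?thesis by (simp add: h_def Re_exp mult.commute)
  qed
  have hcont: "isCont h s" for s
    unfolding hc1[abs_def] using isCont_char[of s] by (auto simp: isCont_def intro: tendsto_Re)
  have hmeas: "h \<in> borel_measurable borel"
    using hcont by (intro borel_measurable_continuous_onI continuous_at_imp_continuous_on) auto
  have hb: "\<bar>h s\<bar> \<le> 1" for s unfolding hc1 using cmod_char_le_1[of s] abs_Re_le_cmod order_trans by blast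
  have lap: "(\<integral>s. exp (- p * s) * h s \<partial>hl) = 1 / (a + p)" if p: "0 < p" for p
  proof -
    interpret H: sigma_finite_measure hl by (rule sigma_finite_hl)
    interpret P: pair_sigma_finite hl "hc a" by standard
    have cosint: "(\<integral>s. exp (- p * s) * cos (z * s) \<partial>hl) = p / (p\<^sup>2 + z\<^sup>2)" for z
    proof -
      have "(\<integral>s. Re (exp (- Complex p z * of_real s)) \<partial>hl) = Re (1 / Complex p z)"
        using hl_exp[of "Complex p z"] p by simp
      moreover have "Re (exp (- Complex p z * of_real s)) = exp (- p * s) * cos (z * s)" for s
        by (simp add: Re_exp)
      ultimately show ?thesis by (simp add: Re_divide complex_eq_iff)
    qed
    have "integrable (hl \<Otimes>\<^sub>M hc a) (\<lambda>(s, z). exp (- p * s) * cos (z * s))"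
      using hl_exp_real(1)[OF p] prob_space_imp_sigma_finite[OF hc_prob(1)[OF a]] H.sigma_finite_measure_axioms
      by (intro integrable_pair_dominated[where g="\<lambda>s. exp (- p * s)" and h="\<lambda>_. 1"])
         (auto simp: abs_mult intro!: mult_left_le measurable_pair_hl)
    then have "(\<integral>s. (\<integral>z. exp (- p * s) * cos (z * s) \<partial>hc a) \<partial>hl) = (\<integral>z. (\<integral>s. exp (- p * s) * cos (z * s) \<partial>hl) \<partial>hc a)"
      by (rule P.Fubini_integral[symmetric])
    also have "\<dots> = 1 / (a + p)" unfolding cosint by (rule hc_poisson[OF a p])
    finally show ?thesis by (simp add: h_def)
  qed
  have hpos: "h s = exp (- a * s)" if "0 < s" for s
  proof (rule laplace_unique_at[where ?h1.0=h and ?h2.0="\<lambda>y. exp (- a * y)" and ?B1.0=1 and ?B2.0=1])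
    show "(\<integral>y. exp (- real (Suc i) * y) * h y \<partial>hl) = (\<integral>y. exp (- real (Suc i) * y) * exp (- a * y) \<partial>hl)" for i
    proof -
      have "exp (- real (Suc i) * y) * exp (- a * y) = exp (- (a + real (Suc i)) * y)" for y
        by (simp add: exp_add[symmetric] algebra_simps)
      then show ?thesis using lap[of "real (Suc i)"] hl_exp_real[of "a + real (Suc i)"] a by simp
    qed
  qed (use hcont hmeas hb that a in \<open>auto intro!: measurable_hl\<close>)
  have h0: "h 0 = 1" by (simp add: h_def prob_space[unfolded hc_sets])
  have hneg: "h s = h (- s)" for s by (simp add: h_def)
  have "h s = exp (- a * \<bar>s\<bar>)"
  proof (cases s "0::real" rule: linorder_cases)
    case less
    then show ?thesis using hneg[of s] hpos[of "- s"] by simp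
  next
    case equal
    then show ?thesis using h0 by simp
  next
    case greater
    then show ?thesis using hpos[of s] by simp
  qed
  then show ?thesis by (simp add: h_def)
qed

lemma hc_tail:
  assumes a: "0 < a" and x: "0 \<le> x"
  shows "measure (hc a) {x<..} = 1 - 2 / pi * arctan (x / a)"
proof -
  have "emeasure (hc a) {x<..} = (\<integral>\<^sup>+z. ennreal (2 * a / (pi * (a\<^sup>2 + z\<^sup>2))) * indicator {x..} z \<partial>lborel)"
  proof -
    have "emeasure (hc a) {x<..} = (\<integral>\<^sup>+z. indicator {x<..} z \<partial>hc a)" by simp
    also have "\<dots> = (\<integral>\<^sup>+z. ennreal (2 * a / (pi * (a\<^sup>2 + z\<^sup>2))) * indicator {x<..} z * indicator {0..} z \<partial>lborel)"
      by (subst hc_nn_integral) auto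
    also have "\<dots> = (\<integral>\<^sup>+z. ennreal (2 * a / (pi * (a\<^sup>2 + z\<^sup>2))) * indicator {x..} z \<partial>lborel)"
      using AE_lborel_singleton[of x] x by (intro nn_integral_cong_AE) (auto simp: indicator_def elim!: eventually_mono)
    finally show ?thesis .
  qed
  also have "\<dots> = ennreal (1 - 2 / pi * arctan (x / a))"
  proof (rule nn_integral_FTC_atLeast)
    have "filterlim (\<lambda>z. z / a) at_top at_top" using a by real_asymp
    then have "((\<lambda>z. 2 / pi * arctan (z / a)) \<longlongrightarrow> 2 / pi * (pi / 2)) at_top"
      by (intro tendsto_intros filterlim_compose[OF tendsto_arctan_at_top])
    then show "((\<lambda>z. 2 / pi * arctan (z / a)) \<longlongrightarrow> 1) at_top" by simp
  qed (use hc_deriv[OF a] a in auto)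
  also have "0 \<le> 1 - 2 / pi * arctan (x / a)"
    using arctan_ubound[of "x / a"] by (simp add: field_simps)
  then have "enn2real (ennreal (1 - 2 / pi * arctan (x / a))) = 1 - 2 / pi * arctan (x / a)" by simp
  finally show ?thesis by (metis measure_def)
qed

lemma hc_cdf: "0 < a \<Longrightarrow> cdf (hc a) x = (if x \<le> 0 then 0 else 2 / pi * arctan (x / a))"
proof -
  assume a: "0 < a"
  interpret real_distribution "hc a" by (rule hc_prob[OF a])
  have c: "cdf (hc a) x = 1 - measure (hc a) {x<..}" for x
  proof -
    have "measure (hc a) (UNIV - {x<..}) = measure (hc a) UNIV - measure (hc a) {x<..}"
      by (rule finite_measure_Diff) auto
    moreover have "UNIV - {x<..} = {..x}" by auto
    ultimately show ?thesis using prob_space by (simp add: cdf_def)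
  qed
  show ?thesis
  proof (cases "x \<le> 0")
    case True
    have "cdf (hc a) x \<le> cdf (hc a) 0" using True by (rule cdf_nondecreasing)
    moreover have "cdf (hc a) 0 = 0" using c[of 0] hc_tail[OF a, of 0] by simp
    moreover have "0 \<le> cdf (hc a) x" by (rule cdf_nonneg)
    ultimately show ?thesis using True by simp
  next
    case False
    then show ?thesis using c[of x] hc_tail[OF a, of x] by simp
  qed
qed

lemma hc_eq_distr:
  assumes a: "0 < a"
  shows "hc a = distr (uniform_measure lborel {0<..<pi/2}) borel (\<lambda>\<theta>. a * tan \<theta>)"
proof (rule cdf_unique)
  have em: "emeasure lborel {0<..<pi/2} = ennreal (pi / 2)" by simp
  interpret U: prob_space "uniform_measure lborel {0<..<pi/2}"
    by (rule prob_space_uniform_measure) (auto simp: em)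
  have [measurable]: "(\<lambda>\<theta>::real. a * tan \<theta>) \<in> borel_measurable borel" unfolding tan_def by measurable
  show "real_distribution (hc a)" by (rule hc_prob[OF a])
  show rd: "real_distribution (distr (uniform_measure lborel {0<..<pi/2}) borel (\<lambda>\<theta>. a * tan \<theta>))"
    by (rule U.real_distribution_distr) simp
  show "cdf (hc a) = cdf (distr (uniform_measure lborel {0<..<pi/2}) borel (\<lambda>\<theta>. a * tan \<theta>))"
  proof
    fix x
    have "cdf (distr (uniform_measure lborel {0<..<pi/2}) borel (\<lambda>\<theta>. a * tan \<theta>)) x
      = measure (uniform_measure lborel {0<..<pi/2}) {\<theta>. a * tan \<theta> \<le> x}"
      unfolding cdf_def by (subst measure_distr) (auto simp: vimage_def)
    also have "\<dots> = measure lborel ({0<..<pi/2} \<inter> {\<theta>. a * tan \<theta> \<le> x}) / (pi / 2)"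
      by (subst measure_uniform_measure) (auto simp: em)
    also have "{0<..<pi/2} \<inter> {\<theta>. a * tan \<theta> \<le> x} = (if x \<le> 0 then {} else {0<..arctan (x / a)})"
    proof (cases "x \<le> 0")
      case True
      have "a * tan \<theta> > 0" if "0 < \<theta>" "\<theta> < pi / 2" for \<theta> using that a tan_gt_zero by simp
      then show ?thesis using True by fastforce
    next
      case False
      have "a * tan \<theta> \<le> x \<longleftrightarrow> \<theta> \<le> arctan (x / a)" if "0 < \<theta>" "\<theta> < pi / 2" for \<theta>
      proof -
        have "a * tan \<theta> \<le> x \<longleftrightarrow> tan \<theta> \<le> x / a" using a by (simp add: pos_le_divide_eq mult.commute)
        also have "\<dots> \<longleftrightarrow> arctan (tan \<theta>) \<le> arctan (x / a)" by (simp add: arctan_le_iff)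
        finally show ?thesis using that by (simp add: arctan_tan)
      qed
      moreover have "arctan (x / a) < pi / 2" by (rule arctan_ubound)
      ultimately show ?thesis using False by (auto intro: le_less_trans)
    qed
    also have "measure lborel \<dots> / (pi / 2) = cdf (hc a) x"
      using a by (auto simp: hc_cdf zero_le_arctan_iff)
    finally show "cdf (hc a) x = cdf (distr (uniform_measure lborel {0<..<pi/2}) borel (\<lambda>\<theta>. a * tan \<theta>)) x" by simp
  qed
qed

text \<open>In the angle variable logarithms become log-sines on a bounded interval, and the measure
  no longer depends on the scale \<open>a\<close>.\<close>

lemma hc_integral_tan:
  fixes g :: "real \<Rightarrow> real"
  assumes a: "0 < a" and g [measurable]: "g \<in> borel_measurable borel"
  shows "integrable (hc a) g \<longleftrightarrow> set_integrable lborel {0<..<pi/2} (\<lambda>\<theta>. g (a * tan \<theta>))"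
    and "(\<integral>z. g z \<partial>hc a) = 2 / pi * (LBINT \<theta>:{0<..<pi/2}. g (a * tan \<theta>))"
proof -
  have [measurable]: "(\<lambda>\<theta>::real. a * tan \<theta>) \<in> borel_measurable borel" unfolding tan_def by measurable
  have U: "uniform_measure lborel {0<..<pi/2} = density lborel (\<lambda>\<theta>. ennreal (2 / pi * indicator {0<..<pi/2} \<theta>))"
  proof -
    have em: "emeasure lborel {0<..<pi/2} = ennreal (pi / 2)" by simp
    have "(1::ennreal) / ennreal (pi / 2) = ennreal (2 / pi)" using divide_ennreal[of 1 "pi/2"] by simp
    have "indicator {0<..<pi/2} \<theta> / ennreal (pi / 2) = ennreal (2 / pi * indicator {0<..<pi/2} \<theta>)" for \<theta>
    proof (cases "\<theta> \<in> {0<..<pi/2}")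
      case True
      then show ?thesis using \<open>1 / ennreal (pi / 2) = ennreal (2 / pi)\<close> by (simp only: indicator_simps mult_1_right)
    next
      case False
      have "indicator {0<..<pi/2} \<theta> = (0::ennreal)" using False by (rule indicator_simps(2))
      moreover have "indicator {0<..<pi/2} \<theta> = (0::real)" using False by (rule indicator_simps(2))
      ultimately show ?thesis by (simp only: mult_zero_right ennreal_0 ennreal_zero_divide)
    qed
    then show ?thesis unfolding uniform_measure_def em by simp
  qed
  have "integrable (hc a) g \<longleftrightarrow> integrable (uniform_measure lborel {0<..<pi/2}) (\<lambda>\<theta>. g (a * tan \<theta>))"
    unfolding hc_eq_distr[OF a] by (subst integrable_distr_eq) auto
  also have "\<dots> \<longleftrightarrow> integrable lborel (\<lambda>\<theta>. (2 / pi) *\<^sub>R (indicator {0<..<pi/2} \<theta> *\<^sub>R g (a * tan \<theta>)))"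
    unfolding U by (subst integrable_density) (auto simp: mult.assoc)
  also have "\<dots> \<longleftrightarrow> set_integrable lborel {0<..<pi/2} (\<lambda>\<theta>. g (a * tan \<theta>))"
    unfolding set_integrable_def
  proof
    assume "integrable lborel (\<lambda>\<theta>. (2 / pi) *\<^sub>R (indicator {0<..<pi/2} \<theta> *\<^sub>R g (a * tan \<theta>)))"
    then have "integrable lborel (\<lambda>\<theta>. (pi / 2) *\<^sub>R ((2 / pi) *\<^sub>R (indicator {0<..<pi/2} \<theta> *\<^sub>R g (a * tan \<theta>))))"
      by (rule integrable_scaleR_right)
    then show "integrable lborel (\<lambda>\<theta>. indicator {0<..<pi/2} \<theta> *\<^sub>R g (a * tan \<theta>))"
      unfolding scaleR_scaleR by simp
  qed (rule integrable_scaleR_right)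
  finally show "integrable (hc a) g \<longleftrightarrow> set_integrable lborel {0<..<pi/2} (\<lambda>\<theta>. g (a * tan \<theta>))" .
  have "(\<integral>z. g z \<partial>hc a) = (\<integral>\<theta>. g (a * tan \<theta>) \<partial>uniform_measure lborel {0<..<pi/2})"
    unfolding hc_eq_distr[OF a] by (subst integral_distr) auto
  also have "\<dots> = (\<integral>\<theta>. (2 / pi) * (indicator {0<..<pi/2} \<theta> *\<^sub>R g (a * tan \<theta>)) \<partial>lborel)"
    unfolding U by (subst integral_density) (auto simp: mult.assoc)
  also have "\<dots> = 2 / pi * (LBINT \<theta>:{0<..<pi/2}. g (a * tan \<theta>))"
    unfolding set_lebesgue_integral_def by (rule integral_mult_right_zero)
  finally show "(\<integral>z. g z \<partial>hc a) = 2 / pi * (LBINT \<theta>:{0<..<pi/2}. g (a * tan \<theta>))" .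
qed

section \<open>Log-sine integrals\<close>

definition ln_sin :: "real \<Rightarrow> real" where "ln_sin \<theta> = ln \<bar>sin \<theta>\<bar>"

lemma ln_sin_measurable [measurable]: "ln_sin \<in> borel_measurable borel"
  unfolding ln_sin_def[abs_def] by measurable

lemma ln_sin_sym: "ln_sin (- \<theta>) = ln_sin \<theta>" "ln_sin (pi - \<theta>) = ln_sin \<theta>" "ln_sin (\<theta> + pi) = ln_sin \<theta>" "ln_sin (pi / 2 - \<theta>) = ln \<bar>cos \<theta>\<bar>"
  by (simp_all add: ln_sin_def sin_diff)

text \<open>Any linear lower bound serves to dominate \<open>ln_sin\<close> by a logarithm. The
  slope 1/4 comes from splitting at \<open>pi / 3\<close>: below, the cosine is at least 1/2; above,
  the sine is at least 1/2, while \<open>\<theta> / 4\<close> is not, because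
  \<open>pi < 4\<close>.\<close>

lemma sin_ge_quarter:
  assumes "0 \<le> \<theta>" "\<theta> \<le> pi / 2"
  shows "\<theta> / 4 \<le> sin \<theta>"
proof (cases "\<theta> \<le> pi / 3")
  case True
  have "sin 0 - 0 / 4 \<le> sin \<theta> - \<theta> / 4"
  proof (rule DERIV_nonneg_imp_nondecreasing[OF assms(1)])
    fix x assume x: "0 \<le> x" "x \<le> \<theta>"
    have "cos (pi / 3) \<le> cos x" using x True by (intro cos_monotone_0_pi_le) auto
    then have "0 \<le> cos x - 1 / 4" by (simp add: cos_60)
    moreover have "((\<lambda>x. sin x - x / 4) has_real_derivative (cos x - 1 / 4)) (at x)"
      by (auto intro!: derivative_eq_intros)
    ultimately show "\<exists>y. ((\<lambda>x. sin x - x / 4) has_real_derivative y) (at x) \<and> 0 \<le> y" by blast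
  qed
  then show ?thesis by simp
next
  case False
  have "sin (pi / 6) \<le> sin \<theta>" using False assms by (intro sin_monotone_2pi_le) auto
  then have "1 / 2 \<le> sin \<theta>" by (simp add: sin_30)
  moreover have "\<theta> / 4 \<le> 1 / 2" using assms pi_less_4 by simp
  ultimately show ?thesis by linarith
qed

lemma ln_integrable_0: "set_integrable lborel {0<..<c} (\<lambda>x. ln x)" if "0 < c" "c \<le> 1" for c :: real
proof -
  have "set_integrable lborel (einterval 0 (ereal c)) (\<lambda>x. - ln x)"
  proof (rule interval_integral_FTC_nonneg)
    show "(0::ereal) < ereal c" using that by simp
    show "((\<lambda>x. x - x * ln x) has_real_derivative - ln x) (at x)" if "(0::ereal) < ereal x" for x
      using that by (auto intro!: derivative_eq_intros)
    show "isCont (\<lambda>x. - ln x) x" if "(0::ereal) < ereal x" for x :: real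
      using that by (auto intro!: continuous_intros)
    show "AE x in lborel. 0 < ereal x \<longrightarrow> ereal x < ereal c \<longrightarrow> 0 \<le> - ln x"
      using \<open>c \<le> 1\<close> by (auto intro!: AE_I2)
    have "((\<lambda>x::real. x - x * ln x) \<longlongrightarrow> 0) (at_right 0)" by real_asymp
    then show "(((\<lambda>x. x - x * ln x) \<circ> real_of_ereal) \<longlongrightarrow> 0) (at_right 0)"
      by (simp add: zero_ereal_def ereal_tendsto_simps)
    have "isCont (\<lambda>x. x - x * ln x) c" using that by (auto intro!: continuous_intros)
    then have "((\<lambda>x. x - x * ln x) \<longlongrightarrow> c - c * ln c) (at_left c)"
      by (simp add: isCont_def filterlim_at_split)
    then show "(((\<lambda>x. x - x * ln x) \<circ> real_of_ereal) \<longlongrightarrow> c - c * ln c) (at_left (ereal c))"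
      by (simp add: ereal_tendsto_simps)
  qed
  moreover have "einterval 0 (ereal c) = {0<..<c}" by (auto simp: einterval_iff)
  ultimately show ?thesis by (simp add: set_integrable_def)
qed

lemma ln_sin_integrable_quarter: "set_integrable lborel {0..pi/2} ln_sin"
proof -
  have "set_integrable lborel {0<..<1} (\<lambda>x::real. ln x)" by (rule ln_integrable_0) auto
  then have i: "integrable lborel (\<lambda>x::real. indicator {0<..<1} x *\<^sub>R ln x)" by (simp add: set_integrable_def)
  have "integrable lborel (\<lambda>\<theta>::real. indicator {0<..<1} (0 + (1/4) * \<theta>) *\<^sub>R ln (0 + (1/4) * \<theta>))"
    by (rule lborel_integrable_real_affine[OF i]) simp
  then show ?thesis unfolding set_integrable_def
  proof (rule Bochner_Integration.integrable_bound)
    show "AE \<theta> in lborel. norm (indicator {0..pi/2} \<theta> *\<^sub>R ln_sin \<theta>) \<le> norm (indicator {0<..<1} (0 + (1/4) * \<theta>) *\<^sub>R ln (0 + (1/4) * \<theta>))"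
      using AE_lborel_singleton[of "0::real"]
    proof eventually_elim
      case (elim \<theta>)
      show ?case
      proof (cases "\<theta> \<in> {0..pi/2}")
        case True
        with elim have t: "0 < \<theta>" "\<theta> \<le> pi / 2" "\<theta> < 4" using pi_less_4 by auto
        have "0 < \<theta> / 4" "\<theta> / 4 \<le> sin \<theta>" "sin \<theta> \<le> 1" using sin_ge_quarter[of \<theta>] t by auto
        then have "ln (\<theta> / 4) \<le> ln (sin \<theta>)" "ln (sin \<theta>) \<le> 0" by (auto simp: ln_le_cancel_iff)
        then have "\<bar>ln_sin \<theta>\<bar> \<le> \<bar>ln (\<theta> / 4)\<bar>" unfolding ln_sin_def using \<open>0 < \<theta> / 4\<close> \<open>\<theta> / 4 \<le> sin \<theta>\<close> by linarith
        then show ?thesis using t by (simp add: indicator_def)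
      qed simp
    qed
  qed measurable
qed

text \<open>Translations and reflections preserve Lebesgue measure; this moves log-sine integrals
  between intervals along the symmetries of the sine.\<close>

lemma ln_sin_integrable_affine:
  assumes i: "set_integrable lborel A ln_sin" and c: "c = 1 \<or> c = - 1"
    and eq: "\<And>\<theta>. ln_sin (t + c * \<theta>) = f \<theta>" and B: "\<And>\<theta>. t + c * \<theta> \<in> A \<longleftrightarrow> \<theta> \<in> B"
  shows "set_integrable lborel B f" "(LBINT \<theta>:B. f \<theta>) = (LBINT \<theta>:A. ln_sin \<theta>)"
proof -
  have ind: "indicator A (t + c * \<theta>) = (indicator B \<theta> :: real)" for \<theta> using B by (auto simp: indicator_def)
  have "integrable lborel (\<lambda>\<theta>. indicator A (t + c * \<theta>) *\<^sub>R ln_sin (t + c * \<theta>))"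
    using i c unfolding set_integrable_def by (intro lborel_integrable_real_affine) auto
  then show "set_integrable lborel B f" by (simp only: ind eq set_integrable_def)
  show "(LBINT \<theta>:B. f \<theta>) = (LBINT \<theta>:A. ln_sin \<theta>)"
    unfolding set_lebesgue_integral_def
    by (subst (2) lborel_integral_real_affine[where c=c and t=t]) (use c in \<open>auto simp only: ind eq abs_minus abs_one scaleR_one one_neq_zero\<close>)
qed

lemma ln_sin_integrable: "set_integrable lborel {- pi..pi} ln_sin"
proof -
  have q1: "set_integrable lborel {pi/2..pi} ln_sin"
    by (rule ln_sin_integrable_affine(1)[OF ln_sin_integrable_quarter, of "- 1" pi]) (auto simp: ln_sin_sym)
  have "set_integrable lborel ({0..pi/2} \<union> {pi/2..pi}) ln_sin"
    by (rule set_integrable_Un[OF ln_sin_integrable_quarter q1]) auto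
  moreover have "{0..pi/2} \<union> {pi/2..pi} = {0..pi}" by auto
  ultimately have h: "set_integrable lborel {0..pi} ln_sin" by simp
  have "set_integrable lborel {- pi..0} ln_sin"
    by (rule ln_sin_integrable_affine(1)[OF h, of "- 1" 0]) (auto simp: ln_sin_sym)
  then have "set_integrable lborel ({- pi..0} \<union> {0..pi}) ln_sin"
    using h by (rule set_integrable_Un) auto
  moreover have "{- pi..0} \<union> {0..pi} = {- pi..pi}" by auto
  ultimately show ?thesis by simp
qed

lemma ln_sin_int:
  assumes "- pi \<le> c" "c \<le> d" "d \<le> pi"
  shows "set_integrable lborel {c..d} ln_sin" "ln_sin integrable_on {c..d}" "(LBINT \<theta>:{c..d}. ln_sin \<theta>) = integral {c..d} ln_sin"
proof -
  show i: "set_integrable lborel {c..d} ln_sin"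
    by (rule set_integrable_subset[OF ln_sin_integrable]) (use assms in auto)
  show "ln_sin integrable_on {c..d}" "(LBINT \<theta>:{c..d}. ln_sin \<theta>) = integral {c..d} ln_sin"
    using set_borel_integral_eq_integral[OF i] by auto
qed

text \<open>With \<open>z = a * tan \<theta>\<close> and \<open>l = a * tan \<alpha>\<close> the
  difference \<open>z\<^sup>2 - l\<^sup>2\<close> factors into
  \<open>sin (\<theta> + \<alpha>)\<close> and \<open>sin (\<theta> - \<alpha>)\<close> over squared
  cosines, so only log-sine integrals occur. The value is that of the harmonic function
  \<open>ln \<bar>w\<^sup>2 + l\<^sup>2\<bar>\<close> at \<open>w = a\<close>, recovered by
  Poisson's formula from its values on the imaginary axis.\<close>

lemma hc_ln_abs_diff:
  assumes a: "0 < a" and l: "0 < l"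
  shows "integrable (hc a) (\<lambda>z. ln \<bar>z\<^sup>2 - l\<^sup>2\<bar>)" "(\<integral>z. ln \<bar>z\<^sup>2 - l\<^sup>2\<bar> \<partial>hc a) = ln (a\<^sup>2 + l\<^sup>2)"
proof -
  define \<alpha> where "\<alpha> = arctan (l / a)"
  have al: "0 < \<alpha>" "\<alpha> < pi / 2" using a l arctan_ubound by (auto simp: \<alpha>_def)
  have l_eq: "l = a * tan \<alpha>" using a by (simp add: \<alpha>_def tan_arctan)
  have ca: "0 < cos \<alpha>" using al by (intro cos_gt_zero) auto
  let ?I = "{0..pi/2}"
  have p: "set_integrable lborel ?I (\<lambda>\<theta>. ln_sin (\<theta> + \<alpha>))" "(LBINT \<theta>:?I. ln_sin (\<theta> + \<alpha>)) = (LBINT \<theta>:{\<alpha>..\<alpha>+pi/2}. ln_sin \<theta>)"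
    by (rule ln_sin_integrable_affine[OF ln_sin_int(1), of \<alpha> "\<alpha> + pi/2" 1 \<alpha>]; use al in \<open>auto simp: add.commute\<close>)+
  have m: "set_integrable lborel ?I (\<lambda>\<theta>. ln_sin (\<theta> - \<alpha>))" "(LBINT \<theta>:?I. ln_sin (\<theta> - \<alpha>)) = (LBINT \<theta>:{\<alpha>-pi/2..\<alpha>}. ln_sin \<theta>)"
  proof -
    have e: "ln_sin (\<alpha> + - 1 * \<theta>) = ln_sin (\<theta> - \<alpha>)" for \<theta> using ln_sin_sym(1)[of "\<theta> - \<alpha>"] by simp
    show "set_integrable lborel ?I (\<lambda>\<theta>. ln_sin (\<theta> - \<alpha>))" "(LBINT \<theta>:?I. ln_sin (\<theta> - \<alpha>)) = (LBINT \<theta>:{\<alpha>-pi/2..\<alpha>}. ln_sin \<theta>)"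
      by (rule ln_sin_integrable_affine[OF ln_sin_int(1), of "\<alpha> - pi/2" \<alpha> "- 1" \<alpha>]; (rule e)?; use al in \<open>auto\<close>)+
  qed
  have c: "set_integrable lborel ?I (\<lambda>\<theta>. ln \<bar>cos \<theta>\<bar>)" "(LBINT \<theta>:?I. ln \<bar>cos \<theta>\<bar>) = (LBINT \<theta>:?I. ln_sin \<theta>)"
    by (rule ln_sin_integrable_affine[OF ln_sin_integrable_quarter, of "- 1" "pi/2"]; use ln_sin_sym(4) in auto)+
  have k: "set_integrable lborel ?I (\<lambda>\<theta>. 2 * ln a - 2 * ln (cos \<alpha>))" "(LBINT \<theta>:?I. 2 * ln a - 2 * ln (cos \<alpha>)) = pi / 2 * (2 * ln a - 2 * ln (cos \<alpha>))"
    by (auto simp: set_integrable_def set_lebesgue_integral_def)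
  define G where "G \<theta> = ln_sin (\<theta> + \<alpha>) + ln_sin (\<theta> - \<alpha>) + (2 * ln a - 2 * ln (cos \<alpha>)) - 2 * ln \<bar>cos \<theta>\<bar>" for \<theta>
  have Gi: "set_integrable lborel ?I G"
    unfolding G_def[abs_def]
    by (rule set_integral_diff(1)[OF set_integral_add(1)[OF set_integral_add(1)[OF p(1) m(1)] k(1)] set_integrable_mult_right[OF c(1)]])
  have "(LBINT \<theta>:?I. G \<theta>) = (LBINT \<theta>:{\<alpha>..\<alpha>+pi/2}. ln_sin \<theta>) + (LBINT \<theta>:{\<alpha>-pi/2..\<alpha>}. ln_sin \<theta>) + pi / 2 * (2 * ln a - 2 * ln (cos \<alpha>)) - 2 * (LBINT \<theta>:?I. ln_sin \<theta>)"
    unfolding G_def using p m c k by (simp add: set_integral_add set_integral_diff set_integrable_mult_right)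
  \<comment> \<open>The two intervals together have length \<open>pi\<close>, a full period of
    \<open>ln_sin\<close>, and contribute twice the integral over a quarter turn; this cancels the
    log-cosine term.\<close>
  also have "(LBINT \<theta>:{\<alpha>..\<alpha>+pi/2}. ln_sin \<theta>) + (LBINT \<theta>:{\<alpha>-pi/2..\<alpha>}. ln_sin \<theta>) = 2 * (LBINT \<theta>:?I. ln_sin \<theta>)"
  proof -
    have s1: "integral {\<alpha>-pi/2..\<alpha>} ln_sin + integral {\<alpha>..\<alpha>+pi/2} ln_sin = integral {\<alpha>-pi/2..\<alpha>+pi/2} ln_sin"
      using al by (intro Henstock_Kurzweil_Integration.integral_combine ln_sin_int) auto
    have s2: "integral {\<alpha>-pi/2..0} ln_sin + integral {0..\<alpha>+pi/2} ln_sin = integral {\<alpha>-pi/2..\<alpha>+pi/2} ln_sin"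
      using al by (intro Henstock_Kurzweil_Integration.integral_combine ln_sin_int) auto
    have s3: "integral {\<alpha>-pi/2..0} ln_sin = integral {\<alpha>+pi/2..pi} ln_sin"
    proof -
      have "(LBINT \<theta>:{\<alpha>-pi/2..0}. ln_sin \<theta>) = (LBINT \<theta>:{\<alpha>+pi/2..pi}. ln_sin \<theta>)"
        by (rule ln_sin_integrable_affine(2)[OF ln_sin_int(1), of _ _ 1 pi]) (use al ln_sin_sym(3) in \<open>auto simp: add.commute\<close>)
      then show ?thesis using al by (simp add: ln_sin_int)
    qed
    have s4: "integral {0..\<alpha>+pi/2} ln_sin + integral {\<alpha>+pi/2..pi} ln_sin = integral {0..pi} ln_sin"
      using al by (intro Henstock_Kurzweil_Integration.integral_combine ln_sin_int) auto
    have s5: "integral {0..pi/2} ln_sin + integral {pi/2..pi} ln_sin = integral {0..pi} ln_sin"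
      by (intro Henstock_Kurzweil_Integration.integral_combine ln_sin_int) auto
    have s6: "integral {pi/2..pi} ln_sin = integral {0..pi/2} ln_sin"
    proof -
      have "(LBINT \<theta>:{pi/2..pi}. ln_sin \<theta>) = (LBINT \<theta>:{0..pi/2}. ln_sin \<theta>)"
        by (rule ln_sin_integrable_affine(2)[OF ln_sin_int(1), of _ _ "- 1" pi]) (auto simp: ln_sin_sym)
      then show ?thesis by (simp add: ln_sin_int)
    qed
    show ?thesis using s1 s2 s3 s4 s5 s6 al by (simp add: ln_sin_int)
  qed
  finally have GI: "(LBINT \<theta>:?I. G \<theta>) = pi / 2 * (2 * ln a - 2 * ln (cos \<alpha>))" by simp
  have GAE: "AE \<theta> in lborel. indicator {0<..<pi/2} \<theta> *\<^sub>R ln \<bar>(a * tan \<theta>)\<^sup>2 - l\<^sup>2\<bar> = indicator ?I \<theta> *\<^sub>R G \<theta>"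
    using AE_lborel_singleton[of "0::real"] AE_lborel_singleton[of "pi/2"] AE_lborel_singleton[of \<alpha>]
  proof eventually_elim
    case (elim \<theta>)
    show ?case
    proof (cases "\<theta> \<in> {0<..<pi/2}")
      case True
      then have ct: "0 < cos \<theta>" by (intro cos_gt_zero) auto
      have "sin (\<theta> + \<alpha>) > 0" using True al by (intro sin_gt_zero) auto
      moreover have "sin (\<theta> - \<alpha>) \<noteq> 0"
      proof -
        have "sin (\<theta> - \<alpha>) = - sin (\<alpha> - \<theta>)" by (metis minus_diff_eq sin_minus)
        then show ?thesis
          using True al elim sin_gt_zero[of "\<theta> - \<alpha>"] sin_gt_zero[of "\<alpha> - \<theta>"] by (cases "\<theta> < \<alpha>") auto
      qed
      moreover have "(a * tan \<theta>)\<^sup>2 - l\<^sup>2 = a\<^sup>2 * (sin (\<theta> + \<alpha>) * sin (\<theta> - \<alpha>)) / ((cos \<theta>)\<^sup>2 * (cos \<alpha>)\<^sup>2)"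
        unfolding l_eq sin_add sin_diff tan_def using ct ca by (simp add: field_simps power2_eq_square)
      ultimately have "ln \<bar>(a * tan \<theta>)\<^sup>2 - l\<^sup>2\<bar> = 2 * ln a + (ln_sin (\<theta> + \<alpha>) + ln_sin (\<theta> - \<alpha>)) - (2 * ln (cos \<theta>) + 2 * ln (cos \<alpha>))"
        using a ct ca by (simp add: ln_sin_def abs_mult ln_mult ln_div ln_realpow)
      then show ?thesis using True ct by (simp add: G_def)
    qed (use elim in \<open>auto simp: indicator_def\<close>)
  qed
  have mG: "(\<lambda>\<theta>. indicator ?I \<theta> *\<^sub>R G \<theta>) \<in> borel_measurable lborel" using Gi by (auto simp: set_integrable_def)
  have mt: "(\<lambda>\<theta>::real. indicator {0<..<pi/2} \<theta> *\<^sub>R ln \<bar>(a * tan \<theta>)\<^sup>2 - l\<^sup>2\<bar>) \<in> borel_measurable lborel"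
    unfolding tan_def by measurable
  show "integrable (hc a) (\<lambda>z. ln \<bar>z\<^sup>2 - l\<^sup>2\<bar>)"
  proof -
    have "integrable lborel (\<lambda>\<theta>. indicator ?I \<theta> *\<^sub>R G \<theta>)" using Gi by (simp only: set_integrable_def)
    then have "integrable lborel (\<lambda>\<theta>. indicator {0<..<pi/2} \<theta> *\<^sub>R ln \<bar>(a * tan \<theta>)\<^sup>2 - l\<^sup>2\<bar>)"
      by (rule iffD2[OF integrable_cong_AE[OF mt mG GAE]])
    then show ?thesis by (subst hc_integral_tan[OF a]) (simp_all only: set_integrable_def, measurable)
  qed
  have "(LBINT \<theta>:{0<..<pi/2}. ln \<bar>(a * tan \<theta>)\<^sup>2 - l\<^sup>2\<bar>) = (LBINT \<theta>:?I. G \<theta>)"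
    unfolding set_lebesgue_integral_def by (rule integral_cong_AE[OF mt mG GAE])
  then have "2 / pi * (LBINT \<theta>:{0<..<pi/2}. ln \<bar>(a * tan \<theta>)\<^sup>2 - l\<^sup>2\<bar>) = 2 / pi * (pi / 2 * (2 * ln a - 2 * ln (cos \<alpha>)))"
    by (simp only: GI)
  moreover have "(\<integral>z. ln \<bar>z\<^sup>2 - l\<^sup>2\<bar> \<partial>hc a) = 2 / pi * (LBINT \<theta>:{0<..<pi/2}. ln \<bar>(a * tan \<theta>)\<^sup>2 - l\<^sup>2\<bar>)"
    by (rule hc_integral_tan(2)[OF a]) measurable
  ultimately have "(\<integral>z. ln \<bar>z\<^sup>2 - l\<^sup>2\<bar> \<partial>hc a) = 2 / pi * (pi / 2 * (2 * ln a - 2 * ln (cos \<alpha>)))"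
    by (simp only:)
  also have "\<dots> = 2 * ln a - 2 * ln (cos \<alpha>)" by simp
  also have "\<dots> = ln (a\<^sup>2 / (cos \<alpha>)\<^sup>2)" using a ca by (simp add: ln_div ln_realpow)
  also have "a\<^sup>2 / (cos \<alpha>)\<^sup>2 = a\<^sup>2 + l\<^sup>2"
  proof -
    have "a\<^sup>2 + l\<^sup>2 = a\<^sup>2 * ((sin \<alpha>)\<^sup>2 + (cos \<alpha>)\<^sup>2) / (cos \<alpha>)\<^sup>2"
      unfolding l_eq tan_def using ca
      by (simp add: power_divide power_mult_distrib add_divide_distrib distrib_left del: sin_cos_squared_add sin_cos_squared_add2)
    then show ?thesis by simp
  qed
  finally show "(\<integral>z. ln \<bar>z\<^sup>2 - l\<^sup>2\<bar> \<partial>hc a) = ln (a\<^sup>2 + l\<^sup>2)" .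
qed

lemma hc_ln_integrable:
  assumes a: "0 < a"
  shows "integrable (hc a) (\<lambda>z. ln z)"
proof -
  have c: "set_integrable lborel {0..pi/2} (\<lambda>\<theta>. ln \<bar>cos \<theta>\<bar>)"
    by (rule ln_sin_integrable_affine(1)[OF ln_sin_integrable_quarter, of "- 1" "pi/2"]; use ln_sin_sym(4) in auto)
  have k: "set_integrable lborel {0..pi/2} (\<lambda>\<theta>. ln a)" by (auto simp: set_integrable_def)
  have "set_integrable lborel {0..pi/2} (\<lambda>\<theta>. ln a + ln_sin \<theta> - ln \<bar>cos \<theta>\<bar>)"
    using c k ln_sin_integrable_quarter by (intro set_integral_add set_integral_diff) auto
  then have "set_integrable lborel {0<..<pi/2} (\<lambda>\<theta>. ln a + ln_sin \<theta> - ln \<bar>cos \<theta>\<bar>)"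
    by (rule set_integrable_subset) auto
  moreover have e: "indicator {0<..<pi/2} \<theta> *\<^sub>R (ln a + ln_sin \<theta> - ln \<bar>cos \<theta>\<bar>) = indicator {0<..<pi/2} \<theta> *\<^sub>R ln (a * tan \<theta>)" for \<theta>
  proof (cases "\<theta> \<in> {0<..<pi/2}")
    case True
    then have "0 < cos \<theta>" "0 < sin \<theta>" by (auto intro!: cos_gt_zero sin_gt_zero)
    then show ?thesis using a True by (simp add: ln_sin_def tan_def ln_mult ln_div)
  qed simp
  ultimately have "set_integrable lborel {0<..<pi/2} (\<lambda>\<theta>. ln (a * tan \<theta>))"
    unfolding set_integrable_def by (simp only: e)
  then show ?thesis
    by (subst hc_integral_tan[OF a]) auto
qed

section \<open>Wiener-Hopf identity for killed symmetric random walks\<close>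

definition halfplane_bounded :: "(complex \<Rightarrow> complex) \<Rightarrow> real \<Rightarrow> bool" where
  "halfplane_bounded f B \<longleftrightarrow> f holomorphic_on {z. 0 < Re z} \<and> continuous_on {z. 0 \<le> Re z} f \<and>
     (\<forall>z. 0 \<le> Re z \<longrightarrow> cmod (f z) \<le> B)"

text \<open>With \<open>Y\<close> the positive part, the negative part or the modulus of a
  coordinate, and \<open>f\<close> a weight, this covers the transforms \<open>vh\<close>,
  \<open>wh\<close> and \<open>lh\<close> at once.\<close>

lemma halfplane_bounded_laplace:
  fixes Y :: "'b \<Rightarrow> real" and f :: "'b \<Rightarrow> real"
  assumes Y [measurable]: "Y \<in> borel_measurable M" and Y0: "\<And>x. x \<in> space M \<Longrightarrow> 0 \<le> Y x"
    and f: "integrable M f"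
  shows "halfplane_bounded (\<lambda>z. \<integral>x. exp (- z * of_real (Y x)) * of_real (f x) \<partial>M) (\<integral>x. \<bar>f x\<bar> \<partial>M)"
    and "0 \<le> Re z \<Longrightarrow> integrable M (\<lambda>x. exp (- z * of_real (Y x)) * of_real (f x))"
proof -
  have [measurable]: "f \<in> borel_measurable M" using f by simp
  have n: "cmod (exp (- z * of_real (Y x)) * of_real (f x)) \<le> \<bar>f x\<bar>" if "0 \<le> Re z" "x \<in> space M" for z x
    using that Y0 by (auto simp: norm_mult intro!: mult_left_le_one_le)
  have int: "integrable M (\<lambda>x. exp (- z * of_real (Y x)) * of_real (f x))" if "0 \<le> Re z" for z
    by (rule Bochner_Integration.integrable_bound[OF f]) (use n that in \<open>auto intro!: AE_I2\<close>)
  show "0 \<le> Re z \<Longrightarrow> integrable M (\<lambda>x. exp (- z * of_real (Y x)) * of_real (f x))" by (rule int)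
  show "halfplane_bounded (\<lambda>z. \<integral>x. exp (- z * of_real (Y x)) * of_real (f x) \<partial>M) (\<integral>x. \<bar>f x\<bar> \<partial>M)"
    unfolding halfplane_bounded_def
  proof (intro conjI allI impI)
    show "cmod (\<integral>x. exp (- z * of_real (Y x)) * of_real (f x) \<partial>M) \<le> (\<integral>x. \<bar>f x\<bar> \<partial>M)" if "0 \<le> Re z" for z
      by (rule norm_integral_le[OF int[OF that]]) (use f n that in \<open>auto intro!: AE_I2\<close>)
    show "continuous_on {z. 0 \<le> Re z} (\<lambda>z. \<integral>x. exp (- z * of_real (Y x)) * of_real (f x) \<partial>M)"
      unfolding continuous_on_sequentially comp_def
    proof (intro allI ballI impI)
      fix s z assume z: "z \<in> {z. 0 \<le> Re z}" and s: "(\<forall>n. s n \<in> {z. 0 \<le> Re z}) \<and> s \<longlonglongrightarrow> z"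
      show "(\<lambda>n. \<integral>x. exp (- s n * of_real (Y x)) * of_real (f x) \<partial>M) \<longlonglongrightarrow> (\<integral>x. exp (- z * of_real (Y x)) * of_real (f x) \<partial>M)"
      proof (rule integral_dominated_convergence[where w="\<lambda>x. \<bar>f x\<bar>"])
        show "AE x in M. (\<lambda>n. exp (- s n * of_real (Y x)) * of_real (f x)) \<longlonglongrightarrow> exp (- z * of_real (Y x)) * of_real (f x)"
          using s by (auto intro!: tendsto_intros)
      qed (use f n s in \<open>auto intro!: AE_I2\<close>)
    qed
    show "(\<lambda>z. \<integral>x. exp (- z * of_real (Y x)) * of_real (f x) \<partial>M) holomorphic_on {z. 0 < Re z}"
    proof (rule holomorphic_onI)
      fix z assume "z \<in> {z. 0 < Re z}"
      then have z: "0 < Re z" by simp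
      have ball: "Re w \<ge> Re z / 2" if "w \<in> ball z (Re z / 2)" for w
        using that abs_Re_le_cmod[of "z - w"] by (auto simp: dist_norm)
      have "((\<lambda>z. \<integral>x. exp (- z * of_real (Y x)) * of_real (f x) \<partial>M) has_field_derivative
          (\<integral>x. - of_real (Y x) * exp (- z * of_real (Y x)) * of_real (f x) \<partial>M)) (at z)"
      proof (rule has_field_derivative_integral(1)[where r="Re z / 2" and g="\<lambda>x. 2 / Re z * \<bar>f x\<bar>"])
        fix w x assume w: "w \<in> ball z (Re z / 2)" and x: "x \<in> space M"
        show "((\<lambda>w. exp (- w * of_real (Y x)) * of_real (f x)) has_field_derivative
          - of_real (Y x) * exp (- w * of_real (Y x)) * of_real (f x)) (at w)"
          by (auto intro!: derivative_eq_intros)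
        \<comment> \<open>On the ball \<open>Re w\<close> is at least \<open>Re z / 2\<close>, and
          \<open>y * exp (- c * y) \<le> 1 / c\<close> then bounds the derivative uniformly in the
          size of \<open>Y x\<close>.\<close>
        have "Y x * (Re z / 2) \<le> Y x * Re w" using ball[OF w] Y0[OF x] by (rule mult_left_mono)
        then have "Y x * exp (- (Y x * Re w)) \<le> Y x * exp (- (Y x * (Re z / 2)))"
          using Y0[OF x] by (intro mult_left_mono) auto
        also have "\<dots> \<le> 2 / Re z"
        proof -
          have "Y x * (Re z / 2) \<le> exp (Y x * (Re z / 2))" using exp_ge_add_one_self[of "Y x * (Re z / 2)"] by linarith
          then have "Y x * (Re z / 2) * exp (- (Y x * (Re z / 2))) \<le> 1"
            by (simp add: exp_minus field_simps)
          then show ?thesis using z by (simp add: field_simps)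
        qed
        finally have "Y x * exp (- (Y x * Re w)) \<le> 2 / Re z" .
        then show "cmod (- of_real (Y x) * exp (- w * of_real (Y x)) * of_real (f x)) \<le> 2 / Re z * \<bar>f x\<bar>"
        proof -
          assume le: "Y x * exp (- (Y x * Re w)) \<le> 2 / Re z"
          have "cmod (- of_real (Y x) * exp (- w * of_real (Y x)) * of_real (f x)) = Y x * exp (- (Y x * Re w)) * \<bar>f x\<bar>"
            using Y0[OF x] by (simp add: norm_mult mult.commute)
          then show ?thesis using mult_right_mono[OF le, of "\<bar>f x\<bar>"] by simp
        qed
      next
        fix w assume "w \<in> ball z (Re z / 2)"
        then show "integrable M (\<lambda>x. exp (- w * of_real (Y x)) * of_real (f x))" using ball[of w] z by (intro int) linarith
      qed (use z f in auto)
      then show "(\<lambda>z. \<integral>x. exp (- z * of_real (Y x)) * of_real (f x) \<partial>M) field_differentiable at z within {z. 0 < Re z}"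
        using field_differentiable_at_within field_differentiable_def by blast
    qed
  qed
qed

text \<open>The geometric factor gives uniform convergence on the closed half-plane, so generating
  functions in \<open>k\<close> inherit holomorphy, continuity up to the axis and a bound.\<close>

lemma halfplane_bounded_series:
  assumes f: "\<And>k. halfplane_bounded (f k) B" and r: "cmod r < 1"
  shows "halfplane_bounded (\<lambda>z. \<Sum>k. r ^ k * f k z) (B / (1 - cmod r))"
    and "0 \<le> Re z \<Longrightarrow> summable (\<lambda>k. r ^ k * f k z)"
proof -
  have b: "cmod (f k z) \<le> B" if "0 \<le> Re z" for k z using f[of k] that by (simp add: halfplane_bounded_def)
  have B0: "0 \<le> B" using order_trans[OF norm_ge_zero b[of 0 0]] by simp
  have le: "cmod (r ^ k * f k z) \<le> B * cmod r ^ k" if "0 \<le> Re z" for k z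
    using mult_left_mono[OF b[OF that, of k], of "cmod r ^ k"] by (simp add: norm_mult norm_power mult.commute)
  have sg: "summable (\<lambda>k. B * cmod r ^ k)" using r by (intro summable_mult summable_geometric) simp
  show sum: "summable (\<lambda>k. r ^ k * f k z)" if "0 \<le> Re z" for z
    by (rule summable_comparison_test'[OF sg]) (use le[OF that] in auto)
  have ul: "uniform_limit {z. 0 \<le> Re z} (\<lambda>n z. \<Sum>k<n. r ^ k * f k z) (\<lambda>z. \<Sum>k. r ^ k * f k z) sequentially"
    by (rule Weierstrass_m_test[OF _ sg]) (use le in auto)
  show "halfplane_bounded (\<lambda>z. \<Sum>k. r ^ k * f k z) (B / (1 - cmod r))"
    unfolding halfplane_bounded_def
  proof (intro conjI allI impI)
    show "cmod (\<Sum>k. r ^ k * f k z) \<le> B / (1 - cmod r)" if "0 \<le> Re z" for z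
    proof -
      have "cmod (\<Sum>k. r ^ k * f k z) \<le> (\<Sum>k. B * cmod r ^ k)"
        by (rule norm_suminf_le[OF le[OF that] sg])
      then show ?thesis using r by (simp add: suminf_mult suminf_geometric)
    qed
    show "continuous_on {z. 0 \<le> Re z} (\<lambda>z. \<Sum>k. r ^ k * f k z)"
      by (rule uniform_limit_theorem[OF _ ul])
         (use f in \<open>auto simp: halfplane_bounded_def intro!: always_eventually continuous_intros\<close>)
    show "(\<lambda>z. \<Sum>k. r ^ k * f k z) holomorphic_on {z. 0 < Re z}"
    proof (rule holomorphic_uniform_sequence)
      show "open {z. 0 < Re z}" by (simp add: open_halfspace_Re_gt)
      show "(\<lambda>z. \<Sum>k<n. r ^ k * f k z) holomorphic_on {z. 0 < Re z}" for n
        using f by (auto simp: halfplane_bounded_def intro!: holomorphic_intros)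
      fix z assume "z \<in> {z. 0 < Re z}"
      then have z: "0 < Re z" by simp
      have "cball z (Re z / 2) \<subseteq> {z. 0 < Re z}"
      proof
        fix w assume "w \<in> cball z (Re z / 2)"
        then show "w \<in> {z. 0 < Re z}" using z abs_Re_le_cmod[of "z - w"] by (auto simp: dist_norm)
      qed
      moreover from this have "uniform_limit (cball z (Re z / 2)) (\<lambda>n z. \<Sum>k<n. r ^ k * f k z) (\<lambda>z. \<Sum>k. r ^ k * f k z) sequentially"
        by (intro uniform_limit_on_subset[OF ul]) auto
      ultimately show "\<exists>d>0. cball z d \<subseteq> {z. 0 < Re z} \<and> uniform_limit (cball z d) (\<lambda>n z. \<Sum>k<n. r ^ k * f k z) (\<lambda>z. \<Sum>k. r ^ k * f k z) sequentially"
        using z by (intro exI[of _ "Re z / 2"]) auto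
    qed
  qed
qed

text \<open>Continuity across the imaginary axis makes the pasted function entire, linear growth
  makes it affine, and boundedness along the positive axis forces slope 0.\<close>

lemma liouville_glue:
  assumes fh: "f holomorphic_on {z. 0 < Re z}" and fc: "continuous_on {z. 0 \<le> Re z} f"
    and gh: "g holomorphic_on {z. Re z < 0}" and gc: "continuous_on {z. Re z \<le> 0} g"
    and eq: "\<And>z. Re z = 0 \<Longrightarrow> f z = g z"
    and growth: "\<And>z. 0 \<le> Re z \<Longrightarrow> 1 \<le> cmod z \<Longrightarrow> cmod (f z) \<le> K * cmod z"
       "\<And>z. Re z \<le> 0 \<Longrightarrow> 1 \<le> cmod z \<Longrightarrow> cmod (g z) \<le> K * cmod z"
    and bdd: "\<And>x::real. 1 \<le> x \<Longrightarrow> cmod (f (of_real x)) \<le> C"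
    and "0 \<le> Re z" "Re w \<le> 0"
  shows "f z = g w"
proof -
  define F where "F z = (if Re z \<le> 0 then g z else f z)" for z
  have "continuous_on ({z. Re z \<le> 0} \<union> {z. 0 \<le> Re z}) F"
    unfolding F_def
    by (rule continuous_on_cases[OF _ _ gc fc]) (use eq in \<open>auto simp: closed_halfspace_Re_le closed_halfspace_Re_ge\<close>)
  moreover have "{z. Re z \<le> 0} \<union> {z. 0 \<le> Re z} = UNIV" by auto
  ultimately have Fc: "continuous_on UNIV F" by simp
  have F1: "F holomorphic_on {z. Re z < 0}" using gh by (rule holomorphic_transform) (auto simp: F_def)
  have F2: "F holomorphic_on {z. 0 < Re z}" using fh by (rule holomorphic_transform) (auto simp: F_def)
  have F: "F holomorphic_on UNIV"
    using holomorphic_on_paste_across_line[of UNIV 1 F 0] F1 F2 Fc by simp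
  have Fg: "cmod (F z) \<le> K * cmod z ^ 1" if "1 \<le> cmod z" for z
    using growth[of z] that by (auto simp: F_def)
  have lin: "F z = F 0 + deriv F 0 * z" for z
    using Liouville_polynomial[OF F Fg, where \<xi>=z] by (simp add: numeral_2_eq_2)
  have "deriv F 0 = 0"
  proof (rule ccontr)
    assume d: "deriv F 0 \<noteq> 0"
    \<comment> \<open>So far out, an affine function with nonzero slope \<open>deriv F 0\<close>
      exceeds \<open>C\<close> in modulus.\<close>
    define x where "x = max 1 ((\<bar>C\<bar> + cmod (F 0) + 1) / cmod (deriv F 0))"
    have x1: "1 \<le> x" by (simp add: x_def)
    have "\<bar>C\<bar> + cmod (F 0) + 1 \<le> cmod (deriv F 0) * x"
      using d by (simp add: x_def max_def field_simps split: if_splits)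
    moreover have "cmod (deriv F 0) * x = cmod (deriv F 0 * of_real x)" using x1 by (simp add: norm_mult)
    moreover have "deriv F 0 * of_real x = F (of_real x) - F 0" using lin[of "of_real x"] by simp
    moreover have "cmod (F (of_real x) - F 0) \<le> cmod (F (of_real x)) + cmod (F 0)" by (rule norm_triangle_ineq4)
    moreover have "F (of_real x) = f (of_real x)" using x1 by (simp add: F_def)
    ultimately show False using bdd[OF x1] by simp
  qed
  then have const: "F z = F w" using lin[of z] lin[of w] by simp
  moreover have "F w = g w" using assms by (simp add: F_def)
  moreover have "F z = f z" using eq[of z] assms by (auto simp: F_def)
  ultimately show ?thesis by simp
qed


text \<open>The expectation of \<open>g\<close> at the \<open>k\<close>-th position of a walk with
  step law \<mu> started at \<open>x\<close>, restricted to the event that all positions from the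
  0th to the \<open>k\<close>-th are positive. The recursion conditions on the first step.\<close>

primrec killed_walk :: "real measure \<Rightarrow> (real \<Rightarrow> real) \<Rightarrow> nat \<Rightarrow> real \<Rightarrow> real" where
  "killed_walk \<mu> g 0 = (\<lambda>x. indicator {0<..} x * g x)"
| "killed_walk \<mu> g (Suc k) = (\<lambda>x. indicator {0<..} x * (\<integral>s. killed_walk \<mu> g k (x + s) \<partial>\<mu>))"

text \<open>\<open>\<nu> k\<close> stands for the law of the walk after \<open>k\<close> steps and
  enters through its characteristic function, which avoids convolution powers. Real values of \<phi>
  express the symmetry of the steps.\<close>

locale walk_chars =
  fixes \<mu> :: "real measure" and \<nu> :: "nat \<Rightarrow> real measure" and \<phi> :: "real \<Rightarrow> real"
  assumes dist: "\<And>k. real_distribution (\<nu> k)"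
    and step_dist: "real_distribution \<mu>"
    and step_char: "\<And>\<xi>. char \<mu> \<xi> = of_real (\<phi> \<xi>)"
    and char: "\<And>k \<xi>. char (\<nu> k) \<xi> = of_real (\<phi> \<xi> ^ k)"
begin

sublocale step: real_distribution \<mu> by (rule step_dist)

lemma sets_step [measurable_cong]: "sets \<mu> = sets borel" by simp

lemma phi_le_1: "\<bar>\<phi> \<xi>\<bar> \<le> 1"
  using step.cmod_char_le_1[of \<xi>] step_char[of \<xi>] by simp

lemma phi_measurable [measurable]: "\<phi> \<in> borel_measurable borel"
proof -
  have "\<phi> = (\<lambda>\<xi>. Re (char (\<mu>) \<xi>))" using step_char by (auto simp: fun_eq_iff)
  moreover have "isCont (\<lambda>\<xi>. Re (char (\<mu>) \<xi>)) \<xi>" for \<xi>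
    using step.isCont_char[of \<xi>] by (auto simp: isCont_def intro: tendsto_Re)
  ultimately show ?thesis
    by (intro borel_measurable_continuous_onI continuous_at_imp_continuous_on) auto
qed

text \<open>By \<open>hc_cos\<close>, \<open>exp (- a * \<bar>y\<bar>)\<close> is a mixture of
  cosines with mixing law \<open>hc a\<close>, so Fubini turns the expectation into an integral of
  the characteristic function.\<close>

lemma exp_abs_expectation:
  assumes a: "0 < a"
  shows "(\<integral>s. exp (- a * \<bar>s + y\<bar>) \<partial>\<nu> k) = (\<integral>z. cos (z * y) * \<phi> z ^ k \<partial>hc a)"
proof -
  interpret N: real_distribution "\<nu> k" by (rule dist)
  interpret H: real_distribution "hc a" by (rule hc_prob[OF a])
  interpret P: pair_sigma_finite "\<nu> k" "hc a" by standard
  have [measurable_cong]: "sets (\<nu> k) = sets borel" by simp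
  have i: "integrable (\<nu> k \<Otimes>\<^sub>M hc a) (\<lambda>(s, z). cos (z * (s + y)))"
    by (rule integrable_pair_dominated[where g="\<lambda>_. 1" and h="\<lambda>_. 1"])
       (auto intro: N.sigma_finite_measure_axioms H.sigma_finite_measure_axioms)
  have inner: "(\<integral>s. cos (z * (s + y)) \<partial>\<nu> k) = cos (z * y) * \<phi> z ^ k" for z
  proof -
    have int: "integrable (\<nu> k) (\<lambda>s. iexp (z * s))" by (intro N.integrable_const_bound[where B=1]) auto
    have "(\<integral>s. cos (z * (s + y)) \<partial>\<nu> k) = (\<integral>s. Re (iexp (z * y) * iexp (z * s)) \<partial>\<nu> k)"
      by (intro Bochner_Integration.integral_cong refl) (simp add: Re_exp Im_exp cos_add algebra_simps)
    also have "\<dots> = Re (iexp (z * y) * char (\<nu> k) z)"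
      unfolding char_def using int by (subst integral_Re) auto
    also have "\<dots> = cos (z * y) * \<phi> z ^ k" unfolding char by (simp add: Re_exp)
    finally show ?thesis .
  qed
  have "(\<integral>s. exp (- a * \<bar>s + y\<bar>) \<partial>\<nu> k) = (\<integral>s. (\<integral>z. cos (z * (s + y)) \<partial>hc a) \<partial>\<nu> k)"
    by (simp add: hc_cos[OF a])
  also have "\<dots> = (\<integral>z. (\<integral>s. cos (z * (s + y)) \<partial>\<nu> k) \<partial>hc a)"
    by (rule P.Fubini_integral[OF i, symmetric])
  finally show ?thesis by (simp only: inner)
qed

text \<open>\<open>w\<close> extends the one-step recursion of \<open>v\<close> to the whole line; its part on the negative half-line
  is what the killing removes.  \<open>vh\<close> and \<open>wh\<close> are the Laplace transforms of the two parts, and \<open>lh\<close>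
  gives the Wiener-Hopf factors.\<close>

definition v where "v b k = killed_walk \<mu> (\<lambda>x. exp (- b * x)) k" for b :: real
definition w where "w b k x = (\<integral>s. v b k (x + s) \<partial>\<mu>)" for b x :: real
definition vh where "vh b k z = (\<integral>x. exp (- z * of_real (max x 0)) * of_real (v b k x) \<partial>lborel)" for z :: complex
definition wh where "wh b k z = (\<integral>x. exp (- z * of_real (max (- x) 0)) * of_real (w b k x * indicator {..0} x) \<partial>lborel)" for z :: complex
definition lh where "lh k z = (\<integral>s. exp (- z * of_real \<bar>s\<bar>) * of_real (1 / (2 * real k)) \<partial>\<nu> k)" for z :: complex

section \<open>Mass bounds and transforms of the killed walk\<close>

lemma v_0: "v b 0 x = indicator {0<..} x * exp (- b * x)"
  and v_Suc: "v b (Suc k) x = indicator {0<..} x * w b k x"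
  by (simp_all add: v_def w_def)

lemma v_measurable [measurable]: "v b k \<in> borel_measurable borel"
proof (induction k)
  case 0
  show ?case unfolding v_0[abs_def] by measurable
next
  case (Suc k)
  note [measurable] = Suc
  show ?case unfolding v_Suc[abs_def] w_def[abs_def] by measurable
qed

context
  fixes b :: real
  assumes b: "0 < b"
begin

lemma v_bounds: "0 \<le> v b k x" "v b k x \<le> 1" "x \<le> 0 \<Longrightarrow> v b k x = 0"
proof -
  have "0 \<le> v b k x \<and> v b k x \<le> 1 \<and> (x \<le> 0 \<longrightarrow> v b k x = 0)"
  proof (induction k arbitrary: x)
    case 0
    show ?case using b by (auto simp: v_0 indicator_def)
  next
    case (Suc k)
    have "(\<integral>s. v b k (x + s) \<partial>\<mu>) \<le> (\<integral>s. 1 \<partial>\<mu>)"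
      by (intro integral_mono step.integrable_const_bound[where B=1]) (use Suc in auto)
    then have "(\<integral>s. v b k (x + s) \<partial>\<mu>) \<le> 1" using step.prob_space by simp
    moreover have "0 \<le> (\<integral>s. v b k (x + s) \<partial>\<mu>)" using Suc by (intro Bochner_Integration.integral_nonneg) auto
    ultimately show ?case by (auto simp: v_Suc w_def indicator_def)
  qed
  then show "0 \<le> v b k x" "v b k x \<le> 1" "x \<le> 0 \<Longrightarrow> v b k x = 0" by auto
qed

lemma w_measurable [measurable]: "w b k \<in> borel_measurable borel"
  unfolding w_def[abs_def] by measurable

lemma w_nonneg: "0 \<le> w b k x"
  unfolding w_def using v_bounds by (intro Bochner_Integration.integral_nonneg) auto

lemma nn_v_shift: "(\<integral>\<^sup>+x. ennreal (v b k (x + s)) \<partial>lborel) = (\<integral>\<^sup>+x. ennreal (v b k x) \<partial>lborel)"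
  using nn_integral_real_affine[of "\<lambda>x. ennreal (v b k x)" 1 s] by (simp add: add.commute)

lemma nn_w: "(\<integral>\<^sup>+x. w b k x \<partial>lborel) = (\<integral>\<^sup>+x. v b k x \<partial>lborel)"
proof -
  interpret P: pair_sigma_finite lborel "\<mu>" by standard
  have "(\<integral>\<^sup>+x. w b k x \<partial>lborel) = (\<integral>\<^sup>+x. \<integral>\<^sup>+s. ennreal (v b k (x + s)) \<partial>\<mu> \<partial>lborel)"
    unfolding w_def
    by (intro nn_integral_cong nn_integral_eq_integral[symmetric] step.integrable_const_bound[where B=1])
       (use v_bounds in auto)
  also have "\<dots> = (\<integral>\<^sup>+s. \<integral>\<^sup>+x. ennreal (v b k (x + s)) \<partial>lborel \<partial>\<mu>)"
    by (rule P.Fubini'[symmetric]) measurable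
  also have "\<dots> = (\<integral>\<^sup>+s. \<integral>\<^sup>+x. ennreal (v b k x) \<partial>lborel \<partial>\<mu>)"
    by (simp only: nn_v_shift)
  also have "\<dots> = (\<integral>\<^sup>+x. ennreal (v b k x) \<partial>lborel)" using step.emeasure_space_1 by simp
  finally show ?thesis .
qed

text \<open>Averaging over a step preserves the Lebesgue integral and killing can only lower it, so
  the total mass never exceeds its initial value.\<close>

lemma nn_v: "(\<integral>\<^sup>+x. v b k x \<partial>lborel) \<le> ennreal (1 / b)"
proof (induction k)
  case 0
  have "(\<integral>\<^sup>+x. v b 0 x \<partial>lborel) = (\<integral>\<^sup>+x. ennreal (exp (- b * x)) \<partial>hl)"
    by (subst nn_integral_restrict_space) (auto intro!: nn_integral_cong simp: v_0 indicator_def)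
  also have "\<dots> = ennreal (1 / b)" using hl_exp_real[OF b] by (subst nn_integral_eq_integral) auto
  finally show ?case by simp
next
  case (Suc k)
  have "(\<integral>\<^sup>+x. v b (Suc k) x \<partial>lborel) \<le> (\<integral>\<^sup>+x. w b k x \<partial>lborel)"
    unfolding v_Suc using w_nonneg by (intro nn_integral_mono) (auto simp: indicator_def)
  then show ?case using Suc nn_w by simp
qed

lemma v_integrable: "integrable lborel (v b k)" "(\<integral>x. \<bar>v b k x\<bar> \<partial>lborel) \<le> 1 / b"
proof -
  show i: "integrable lborel (v b k)"
    using nn_v[of k] v_bounds by (intro integrableI_bounded) (auto simp: le_less_trans[OF _ ennreal_less_top])
  have "ennreal (\<integral>x. \<bar>v b k x\<bar> \<partial>lborel) \<le> ennreal (1 / b)"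
    using i nn_v[of k] v_bounds by (subst nn_integral_eq_integral[symmetric]) auto
  then show "(\<integral>x. \<bar>v b k x\<bar> \<partial>lborel) \<le> 1 / b" using b by simp
qed

lemma w_integrable: "integrable lborel (w b k)" "(\<integral>x. \<bar>w b k x * indicator {..0} x\<bar> \<partial>lborel) \<le> 1 / b"
   "integrable lborel (\<lambda>x. w b k x * indicator {..0} x)"
proof -
  have nn: "(\<integral>\<^sup>+x. ennreal (w b k x) \<partial>lborel) \<le> ennreal (1 / b)" using nn_v[of k] nn_w[of k] by simp
  show i: "integrable lborel (w b k)"
    using nn w_nonneg by (intro integrableI_bounded) (auto simp: le_less_trans[OF _ ennreal_less_top])
  show i2: "integrable lborel (\<lambda>x. w b k x * indicator {..0} x)"
    by (rule integrable_real_mult_indicator[OF _ i]) simp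
  have "(\<integral>x. \<bar>w b k x * indicator {..0} x\<bar> \<partial>lborel) \<le> (\<integral>x. w b k x \<partial>lborel)"
    using i i2 w_nonneg[of k] by (intro integral_mono) (auto simp: indicator_def)
  moreover have "ennreal (\<integral>x. w b k x \<partial>lborel) \<le> ennreal (1 / b)"
    using i nn w_nonneg by (subst nn_integral_eq_integral[symmetric]) auto
  then have "(\<integral>x. w b k x \<partial>lborel) \<le> 1 / b" using b by simp
  ultimately show "(\<integral>x. \<bar>w b k x * indicator {..0} x\<bar> \<partial>lborel) \<le> 1 / b" by linarith
qed

end

lemma halfplane_bounded_mono: "halfplane_bounded f B \<Longrightarrow> B \<le> C \<Longrightarrow> halfplane_bounded f C"
  unfolding halfplane_bounded_def by fastforce

lemma vh_bounded: "0 < b \<Longrightarrow> halfplane_bounded (vh b k) (1 / b)"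
  unfolding vh_def[abs_def]
  by (rule halfplane_bounded_mono[OF halfplane_bounded_laplace(1)]) (use v_integrable[of b k] in auto)

lemma wh_bounded: "0 < b \<Longrightarrow> halfplane_bounded (wh b k) (1 / b)"
  unfolding wh_def[abs_def]
  by (rule halfplane_bounded_mono[OF halfplane_bounded_laplace(1)]) (use w_integrable[of b k] in auto)

lemma lh_bounded: "halfplane_bounded (lh k) 1"
proof -
  interpret N: real_distribution "\<nu> k" by (rule dist)
  \<comment> \<open>For \<open>k = 0\<close> the weight \<open>1 / (2 * real k)\<close> is 0 by the
    convention for division, so the logarithmic series built from \<open>lh\<close> starts at
    \<open>k = 1\<close>.\<close>
  have "\<bar>1 / (2 * real k)\<bar> \<le> 1" by (cases k) auto
  then have "(\<integral>s. \<bar>1 / (2 * real k)\<bar> \<partial>\<nu> k) \<le> 1" using N.prob_space by simp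
  then show ?thesis unfolding lh_def[abs_def]
    by (intro halfplane_bounded_mono[OF halfplane_bounded_laplace(1)]) auto
qed


lemma vh_0: "0 < b \<Longrightarrow> 0 \<le> Re z \<Longrightarrow> vh b 0 z = 1 / (of_real b + z)"
proof -
  assume b: "0 < b" and z: "0 \<le> Re z"
  have "vh b 0 z = (\<integral>x. exp (- (of_real b + z) * of_real x) \<partial>hl)"
    unfolding vh_def v_0
    by (subst integral_restrict_space)
       (auto intro!: Bochner_Integration.integral_cong arg_cong[where f=exp] simp: indicator_def exp_add[symmetric] exp_of_real[symmetric] algebra_simps)
  also have "\<dots> = 1 / (of_real b + z)" by (rule hl_exp(2)) (use b z in simp)
  finally show ?thesis .
qed

text \<open>This decay is what later keeps \<open>b + z\<close> times the generating function of
  \<open>vh\<close> bounded along the positive axis.\<close>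

lemma vh_real_bound: "0 < b \<Longrightarrow> 0 < x \<Longrightarrow> cmod (vh b k (of_real x)) \<le> 1 / x"
proof -
  assume b: "0 < b" and x: "0 < x"
  have hx: "integrable lborel (\<lambda>y. indicator {0<..} y *\<^sub>R exp (- x * y))" "(\<integral>y. indicator {0<..} y *\<^sub>R exp (- x * y) \<partial>lborel) = 1 / x"
    using hl_exp_real[OF x] by (simp_all add: integrable_restrict_space integral_restrict_space)
  have "cmod (vh b k (of_real x)) \<le> (\<integral>y. indicator {0<..} y *\<^sub>R exp (- x * y) \<partial>lborel)"
    unfolding vh_def
  proof (rule norm_integral_le[OF _ hx(1)])
    show "integrable lborel (\<lambda>y. exp (- of_real x * of_real (max y 0)) * complex_of_real (v b k y))"
      by (rule halfplane_bounded_laplace(2)) (use x v_integrable[OF b] in auto)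
    show "AE y in lborel. cmod (exp (- of_real x * of_real (max y 0)) * complex_of_real (v b k y)) \<le> indicator {0<..} y *\<^sub>R exp (- x * y)"
    proof (rule AE_I2)
      fix y
      show "cmod (exp (- of_real x * of_real (max y 0)) * complex_of_real (v b k y)) \<le> indicator {0<..} y *\<^sub>R exp (- x * y)"
        using v_bounds(1,2)[OF b, where k=k and x=y] v_bounds(3)[OF b, where k=k and x=y] by (cases "0 < y") (auto simp: norm_mult intro: mult_left_le)
    qed
  qed
  then show ?thesis by (simp only: hx(2))
qed

text \<open>On the imaginary axis the two half-line transforms are Fourier integrals and add up to
  the transform of \<open>w\<close>; averaging over a shift multiplies the transform of
  \<open>v\<close> by the characteristic function. The argument of \<open>wh\<close> is reflected
  because \<open>wh\<close> is a transform in \<open>max (- x) 0\<close>.\<close>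

lemma transform_recursion:
  assumes b: "0 < b"
  shows "vh b (Suc k) (\<i> * of_real \<xi>) + wh b k (- (\<i> * of_real \<xi>)) = of_real (\<phi> \<xi>) * vh b k (\<i> * of_real \<xi>)"
proof -
  let ?z = "\<i> * complex_of_real \<xi>"
  note [measurable] = w_measurable[OF b]
  interpret P: pair_sigma_finite lborel \<mu> by standard
  have nz: "cmod (exp (- ?z * of_real x)) = 1" for x by simp
  have iv: "integrable lborel (\<lambda>x. exp (- ?z * of_real x) * of_real (v b k x))"
    by (rule Bochner_Integration.integrable_bound[OF v_integrable(1)[OF b, of k]]) (auto simp: norm_mult)
  have iw: "integrable lborel (\<lambda>x. exp (- ?z * of_real x) * of_real (w b k x * f x))"
    if "f \<in> borel_measurable borel" "\<And>x. \<bar>f x\<bar> \<le> 1" for f :: "real \<Rightarrow> real"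
  proof -
    have [measurable]: "f \<in> borel_measurable borel" by fact
    show ?thesis
      by (rule Bochner_Integration.integrable_bound[OF w_integrable(1)[OF b, of k]])
         (use that(2) in \<open>auto simp: norm_mult abs_mult intro!: mult_left_le\<close>)
  qed
  have vh: "vh b k ?z = (\<integral>x. exp (- ?z * of_real x) * of_real (v b k x) \<partial>lborel)"
    unfolding vh_def
    by (intro Bochner_Integration.integral_cong refl) (use v_bounds(3)[OF b, of _ k] in \<open>auto simp: max_def\<close>)
  have "vh b (Suc k) ?z + wh b k (- ?z)
      = (\<integral>x. exp (- ?z * of_real x) * of_real (w b k x * indicator {0<..} x) \<partial>lborel)
      + (\<integral>x. exp (- ?z * of_real x) * of_real (w b k x * indicator {..0} x) \<partial>lborel)"
    unfolding vh_def wh_def v_Suc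
    by (intro arg_cong2[where f="(+)"] Bochner_Integration.integral_cong refl) (auto simp: indicator_def max_def mult.commute)
  also have "\<dots> = (\<integral>x. exp (- ?z * of_real x) * of_real (w b k x * indicator {0<..} x) + exp (- ?z * of_real x) * of_real (w b k x * indicator {..0} x) \<partial>lborel)"
    by (rule Bochner_Integration.integral_add[symmetric]; rule iw) auto
  also have "\<dots> = (\<integral>x. exp (- ?z * of_real x) * of_real (w b k x) \<partial>lborel)"
    by (intro Bochner_Integration.integral_cong refl) (auto simp: indicator_def)
  also have "\<dots> = (\<integral>x. (\<integral>s. exp (- ?z * of_real x) * of_real (v b k (x + s)) \<partial>\<mu>) \<partial>lborel)"
    by (simp add: w_def)
  also have "\<dots> = (\<integral>s. (\<integral>x. exp (- ?z * of_real x) * of_real (v b k (x + s)) \<partial>lborel) \<partial>\<mu>)"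
  proof (rule P.Fubini_integral[symmetric])
    show "integrable (lborel \<Otimes>\<^sub>M \<mu>) (\<lambda>(x, s). exp (- ?z * of_real x) * complex_of_real (v b k (x + s)))"
    proof (rule integrableI_bounded)
      have "(\<integral>\<^sup>+p. norm (case p of (x, s) \<Rightarrow> exp (- ?z * of_real x) * complex_of_real (v b k (x + s))) \<partial>(lborel \<Otimes>\<^sub>M \<mu>))
        = (\<integral>\<^sup>+s. \<integral>\<^sup>+x. ennreal (v b k (x + s)) \<partial>lborel \<partial>\<mu>)"
        by (subst P.nn_integral_snd[symmetric]) (use v_bounds(1)[OF b] in \<open>auto simp: norm_mult\<close>)
      also have "\<dots> = (\<integral>\<^sup>+s. \<integral>\<^sup>+x. ennreal (v b k x) \<partial>lborel \<partial>\<mu>)"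
        by (simp only: nn_v_shift[OF b])
      also have "\<dots> = (\<integral>\<^sup>+x. ennreal (v b k x) \<partial>lborel)" using step.emeasure_space_1 by simp
      also have "\<dots> < \<infinity>" using nn_v[OF b, of k] by (simp add: le_less_trans[OF _ ennreal_less_top])
      finally show "(\<integral>\<^sup>+p. norm (case p of (x, s) \<Rightarrow> exp (- ?z * of_real x) * complex_of_real (v b k (x + s))) \<partial>(lborel \<Otimes>\<^sub>M \<mu>)) < \<infinity>" .
    qed measurable
  qed
  also have "\<dots> = (\<integral>s. iexp (\<xi> * s) * vh b k ?z \<partial>\<mu>)"
  proof (intro Bochner_Integration.integral_cong refl)
    fix s
    have "(\<integral>x. exp (- ?z * of_real x) * of_real (v b k (x + s)) \<partial>lborel)
       = (\<integral>x. exp (- ?z * of_real (x - s)) * of_real (v b k x) \<partial>lborel)"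
      by (subst (2) lborel_integral_real_affine[where c=1 and t=s]) (auto simp: add.commute)
    also have "\<dots> = (\<integral>x. iexp (\<xi> * s) * (exp (- ?z * of_real x) * of_real (v b k x)) \<partial>lborel)"
    proof (intro Bochner_Integration.integral_cong refl)
      fix x
      have "exp (- ?z * of_real (x - s)) = iexp (\<xi> * s) * exp (- ?z * of_real x)"
        unfolding exp_add[symmetric] by (rule arg_cong[where f=exp]) (simp add: algebra_simps)
      then show "exp (- ?z * of_real (x - s)) * of_real (v b k x) = iexp (\<xi> * s) * (exp (- ?z * of_real x) * of_real (v b k x))"
        by (simp only: mult.assoc)
    qed
    also have "\<dots> = iexp (\<xi> * s) * vh b k ?z" unfolding vh by (rule integral_mult_right_zero)
    finally show "(\<integral>x. exp (- ?z * of_real x) * of_real (v b k (x + s)) \<partial>lborel) = iexp (\<xi> * s) * vh b k ?z" .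
  qed
  also have "\<dots> = char \<mu> \<xi> * vh b k ?z" by (simp add: char_def)
  also have "\<dots> = of_real (\<phi> \<xi>) * vh b k ?z" by (simp add: step_char)
  finally show ?thesis .
qed

text \<open>The two exponentials add up to a cosine. Summed with weights \<open>r ^ k\<close>, the
  right-hand sides give \<open>- Ln (1 - r * \<phi> \<xi>)\<close>, so \<open>lh\<close> splits this
  logarithm between the two half-planes.\<close>

lemma lh_sum: "lh k (\<i> * of_real \<xi>) + lh k (- (\<i> * of_real \<xi>)) = of_real (\<phi> \<xi> ^ k / real k)"
proof -
  interpret N: real_distribution "\<nu> k" by (rule dist)
  let ?z = "\<i> * complex_of_real \<xi>"
  have i: "integrable (\<nu> k) (\<lambda>s. exp (z * of_real \<bar>s\<bar>) * of_real (1 / (2 * real k)))" if "Re z = 0" for z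
    by (rule N.integrable_const_bound[where B="1 / (2 * real k)"]) (use that in \<open>auto simp: norm_mult norm_divide\<close>)
  have ii: "integrable (\<nu> k) (\<lambda>s. iexp (\<xi> * s))" by (rule N.integrable_const_bound[where B=1]) auto
  have "lh k ?z + lh k (- ?z) = (\<integral>s. exp (- ?z * of_real \<bar>s\<bar>) * of_real (1 / (2 * real k)) + exp (- (- ?z) * of_real \<bar>s\<bar>) * of_real (1 / (2 * real k)) \<partial>\<nu> k)"
    unfolding lh_def by (rule Bochner_Integration.integral_add[symmetric]; rule i) auto
  also have "\<dots> = (\<integral>s. of_real (Re (iexp (\<xi> * s)) / real k) \<partial>\<nu> k)"
  proof (intro Bochner_Integration.integral_cong refl)
    fix s
    have "exp (- ?z * of_real \<bar>s\<bar>) + exp (- (- ?z) * of_real \<bar>s\<bar>) = 2 * of_real (cos (\<xi> * s))"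
      by (simp add: complex_eq_iff Re_exp Im_exp abs_if)
    then have A: "(exp (- ?z * of_real \<bar>s\<bar>) + exp (- (- ?z) * of_real \<bar>s\<bar>)) * of_real (1 / (2 * real k)) = of_real (cos (\<xi> * s) / real k)"
      by (simp add: field_simps)
    then show "exp (- ?z * of_real \<bar>s\<bar>) * of_real (1 / (2 * real k)) + exp (- (- ?z) * of_real \<bar>s\<bar>) * of_real (1 / (2 * real k)) = of_real (Re (iexp (\<xi> * s)) / real k)"
      unfolding distrib_right[symmetric] A by (simp add: Re_exp)
  qed
  also have "\<dots> = of_real (Re (char (\<nu> k) \<xi>) / real k)"
    unfolding char_def using ii by (simp add: integral_complex_of_real[symmetric] del: of_real_divide)
  also have "\<dots> = of_real (\<phi> \<xi> ^ k / real k)" by (simp add: char)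
  finally show ?thesis .
qed

lemma lh_real: "0 < a \<Longrightarrow> lh k (of_real a) = of_real ((\<integral>z. \<phi> z ^ k \<partial>hc a) / (2 * real k))"
proof -
  assume a: "0 < a"
  have "lh k (of_real a) = (\<integral>s. of_real (exp (- a * \<bar>s + 0\<bar>) / (2 * real k)) \<partial>\<nu> k)"
    unfolding lh_def by (intro Bochner_Integration.integral_cong refl) (simp add: exp_of_real[symmetric])
  also have "\<dots> = of_real ((\<integral>s. exp (- a * \<bar>s + 0\<bar>) \<partial>\<nu> k) / (2 * real k))"
    by (simp only: integral_complex_of_real integral_divide_zero)
  also have "\<dots> = of_real ((\<integral>z. \<phi> z ^ k \<partial>hc a) / (2 * real k))"
    unfolding exp_abs_expectation[OF a] by simp
  finally show ?thesis .
qed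

text \<open>The logarithm is expanded in powers of \<open>r\<close> and integrated termwise: at a
  real point the half-plane part of the logarithm is half of its Poisson integral.\<close>

lemma log_series_integral:
  assumes a: "0 < a" and r: "cmod r < 1"
  shows "(\<Sum>k. r ^ k * lh k (of_real a)) = - (\<integral>z. Ln (1 - r * of_real (\<phi> z)) \<partial>hc a) / 2"
proof -
  interpret H: real_distribution "hc a" by (rule hc_prob[OF a])
  have rp: "cmod (r * of_real (\<phi> z)) < 1" for z
    using r phi_le_1[of z] by (metis abs_ge_zero le_less_trans mult_left_le norm_ge_zero norm_mult norm_of_real)
  let ?f = "\<lambda>k z. (r * complex_of_real (\<phi> z)) ^ k / of_nat k"
  have sm: "(\<lambda>k. ?f k z) sums - Ln (1 - r * of_real (\<phi> z))" for z
    using sums_minus[OF Ln_series'[of "- (r * of_real (\<phi> z))"]] rp[of z] by simp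
  have le: "cmod (?f k z) \<le> cmod r ^ k" for k z
  proof (cases "k = 0")
    case False
    have "cmod (?f k z) = cmod r ^ k * (\<bar>\<phi> z\<bar> ^ k / real k)" by (simp add: norm_divide norm_mult norm_power power_mult_distrib)
    also have "\<dots> \<le> cmod r ^ k * 1"
    proof (intro mult_left_mono)
      have "\<bar>\<phi> z\<bar> ^ k \<le> 1" by (rule power_le_one) (auto simp: phi_le_1)
      then show "\<bar>\<phi> z\<bar> ^ k / real k \<le> 1" using False by (simp add: divide_le_eq)
    qed simp
    finally show ?thesis by simp
  qed simp
  have fi: "integrable (hc a) (?f k)" for k
    by (rule H.integrable_const_bound[where B="cmod r ^ k"]) (use le in auto)
  have "(\<lambda>k. \<integral>z. ?f k z \<partial>hc a) sums (\<integral>z. (\<Sum>k. ?f k z) \<partial>hc a)"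
  proof (rule sums_integral[OF fi])
    have sc: "summable (\<lambda>k. cmod r ^ k)" using r by (intro summable_geometric) simp
    show "AE z in hc a. summable (\<lambda>k. norm (?f k z))"
      by (intro AE_I2 summable_comparison_test'[OF sc]) (use le in auto)
    show "summable (\<lambda>k. \<integral>z. norm (?f k z) \<partial>hc a)"
    proof (rule summable_comparison_test'[OF sc])
      fix k
      have "(\<integral>z. norm (?f k z) \<partial>hc a) \<le> (\<integral>z. cmod r ^ k \<partial>hc a)"
        using fi[of k] le by (intro integral_mono) auto
      then show "norm (\<integral>z. norm (?f k z) \<partial>hc a) \<le> cmod r ^ k" by (simp add: H.prob_space[unfolded hc_sets])
    qed
  qed
  moreover have "(\<Sum>k. ?f k z) = - Ln (1 - r * of_real (\<phi> z))" for z using sm by (rule sums_unique[symmetric])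
  ultimately have "(\<lambda>k. \<integral>z. ?f k z \<partial>hc a) sums (- (\<integral>z. Ln (1 - r * of_real (\<phi> z)) \<partial>hc a))" by simp
  then have "(\<lambda>k. (\<integral>z. ?f k z \<partial>hc a) / 2) sums (- (\<integral>z. Ln (1 - r * of_real (\<phi> z)) \<partial>hc a) / 2)" by (rule sums_divide)
  moreover have "(\<integral>z. ?f k z \<partial>hc a) / 2 = r ^ k * lh k (of_real a)" for k
  proof -
    have "(\<integral>z. ?f k z \<partial>hc a) = (\<integral>z. r ^ k / of_nat k * of_real (\<phi> z ^ k) \<partial>hc a)"
      by (intro Bochner_Integration.integral_cong refl) (simp add: power_mult_distrib)
    also have "\<dots> = r ^ k / of_nat k * of_real (\<integral>z. \<phi> z ^ k \<partial>hc a)"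
      by (simp only: integral_mult_right_zero integral_complex_of_real)
    finally have X: "(\<integral>z. ?f k z \<partial>hc a) = r ^ k / of_nat k * of_real (\<integral>z. \<phi> z ^ k \<partial>hc a)" .
    show ?thesis unfolding X lh_real[OF a] by simp
  qed
  ultimately have "(\<lambda>k. r ^ k * lh k (of_real a)) sums (- (\<integral>z. Ln (1 - r * of_real (\<phi> z)) \<partial>hc a) / 2)" by simp
  then show ?thesis by (rule sums_unique[symmetric])
qed

text \<open>The functions \<open>f\<close> and \<open>g\<close> below live on the two half-planes and agree on the imaginary axis, hence
  glue to an entire function of linear growth; as it is bounded on the positive axis, it is constant.\<close>

theorem killed_walk_generating_function:
  assumes a: "0 < a" and b: "0 < b" and r: "cmod r < 1"
  shows "(\<lambda>k. r ^ k * of_real (\<integral>x. exp (- a * x) * killed_walk \<mu> (\<lambda>x. exp (- b * x)) k x \<partial>hl)) sums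
    (exp (- (\<integral>z. Ln (1 - r * of_real (\<phi> z)) \<partial>hc a) / 2 - (\<integral>z. Ln (1 - r * of_real (\<phi> z)) \<partial>hc b) / 2) / of_real (a + b))"
proof -
  define V where "V z = (\<Sum>k. r ^ k * vh b k z)" for z
  define W where "W z = (\<Sum>k. r ^ k * wh b k z)" for z
  define L where "L z = (\<Sum>k. r ^ k * lh k z)" for z
  define B where "B = (1 / b) / (1 - cmod r)"
  define E where "E = exp (1 / (1 - cmod r))"
  have hV: "halfplane_bounded V B" and sV: "\<And>z. 0 \<le> Re z \<Longrightarrow> summable (\<lambda>k. r ^ k * vh b k z)"
    unfolding V_def[abs_def] B_def using halfplane_bounded_series[where f="vh b", OF vh_bounded[OF b] r] by blast+
  have hW: "halfplane_bounded W B" and sW: "\<And>z. 0 \<le> Re z \<Longrightarrow> summable (\<lambda>k. r ^ k * wh b k z)"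
    unfolding W_def[abs_def] B_def using halfplane_bounded_series[where f="wh b", OF wh_bounded[OF b] r] by blast+
  have hL: "halfplane_bounded L (1 / (1 - cmod r))" and sL: "\<And>z. 0 \<le> Re z \<Longrightarrow> summable (\<lambda>k. r ^ k * lh k z)"
    unfolding L_def[abs_def] using halfplane_bounded_series[where f=lh, OF lh_bounded r] by blast+
  have B0: "0 \<le> B" using b r by (simp add: B_def)
  have bE: "cmod (exp (L z)) \<le> E" "cmod (exp (- L z)) \<le> E" if "0 \<le> Re z" for z
  proof -
    have "\<bar>Re (L z)\<bar> \<le> 1 / (1 - cmod r)"
      using hL that abs_Re_le_cmod[of "L z"] unfolding halfplane_bounded_def by (meson order_trans)
    then show "cmod (exp (L z)) \<le> E" "cmod (exp (- L z)) \<le> E" unfolding E_def by (auto simp: abs_le_iff)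
  qed
  have E0: "0 \<le> E" "1 \<le> E" using r by (auto simp: E_def)
  have bV: "cmod (V z) \<le> B" and bW: "cmod (W z) \<le> B" if "0 \<le> Re z" for z
    using hV hW that by (auto simp: halfplane_bounded_def)
  \<comment> \<open>The factor \<open>b + z\<close> clears the initial term
    \<open>1 / (b + z)\<close> of \<open>V\<close>; the exponentials distribute the two Wiener-Hopf
    factors of \<open>1 - r * \<phi> \<xi>\<close> over the two half-planes.\<close>
  define f where "f z = (of_real b + z) * V z * exp (- L z)" for z
  define g where "g z = exp (L (- z)) * (1 - (of_real b + z) * r * W (- z))" for z
  have neg: "uminus ` {z. Re z < 0} = {z::complex. 0 < Re z}" "uminus ` {z. Re z \<le> 0} = {z::complex. 0 \<le> Re z}"
  proof safe
    fix z :: complex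
    show "z \<in> uminus ` {z. Re z < 0}" if "0 < Re z" by (rule image_eqI[of z uminus "- z"]) (use that in auto)
    show "z \<in> uminus ` {z. Re z \<le> 0}" if "0 \<le> Re z" by (rule image_eqI[of z uminus "- z"]) (use that in auto)
  qed auto
  have "f (of_real a) = g (- of_real b)"
  proof (rule liouville_glue[where f=f and g=g and z="of_real a" and w="- of_real b" and K="E * (1 + (b + 1) * B)" and C="(b + 1) / (1 - cmod r) * E"])
    show "f holomorphic_on {z. 0 < Re z}" "continuous_on {z. 0 \<le> Re z} f"
      unfolding f_def using hV hL unfolding halfplane_bounded_def
      by (auto intro!: holomorphic_intros continuous_intros)
    have "(\<lambda>z. h (- z)) holomorphic_on {z. Re z < 0}" "continuous_on {z. Re z \<le> 0} (\<lambda>z. h (- z))"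
      if "halfplane_bounded h C" for h C
    proof -
      have "(h \<circ> uminus) holomorphic_on {z. Re z < 0}"
        by (rule holomorphic_on_compose) (use that neg in \<open>auto simp: halfplane_bounded_def intro!: holomorphic_intros\<close>)
      then show "(\<lambda>z. h (- z)) holomorphic_on {z. Re z < 0}" by (simp add: comp_def)
      have "continuous_on {z. Re z \<le> 0} (h \<circ> uminus)"
        by (rule continuous_on_compose) (use that neg in \<open>auto simp: halfplane_bounded_def intro!: continuous_intros\<close>)
      then show "continuous_on {z. Re z \<le> 0} (\<lambda>z. h (- z))" by (simp add: comp_def)
    qed
    from this[OF hW] this[OF hL] show "g holomorphic_on {z. Re z < 0}" "continuous_on {z. Re z \<le> 0} g"
      unfolding g_def by (auto intro!: holomorphic_intros continuous_intros)
    show "f z = g z" if z0: "Re z = 0" for z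
    proof -
      define \<xi> where "\<xi> = Im z"
      have z: "z = \<i> * of_real \<xi>" using z0 by (simp add: complex_eq_iff \<xi>_def)
      let ?p = "complex_of_real (\<phi> \<xi>)"
      have rp: "cmod (r * ?p) < 1"
        using r phi_le_1[of \<xi>] by (metis abs_ge_zero le_less_trans mult_left_le norm_ge_zero norm_mult norm_of_real)
      have bz: "of_real b + z \<noteq> 0" using b z0 by (auto simp: complex_eq_iff)
      have V1: "V z = 1 / (of_real b + z) + r * (?p * V z - W (- z))"
      proof -
        have s1: "summable (\<lambda>k. r ^ k * vh b k z)" "summable (\<lambda>k. r ^ k * wh b k (- z))"
          using sV sW z0 by auto
        have "V z = vh b 0 z + (\<Sum>k. r ^ Suc k * vh b (Suc k) z)"
          unfolding V_def using suminf_split_head[OF s1(1)] by simp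
        also have "(\<lambda>k. r ^ Suc k * vh b (Suc k) z) = (\<lambda>k. r * (?p * (r ^ k * vh b k z) - r ^ k * wh b k (- z)))"
        proof
          fix k
          have key: "vh b (Suc k) z = ?p * vh b k z - wh b k (- z)"
            using transform_recursion[OF b, of k \<xi>] unfolding z[symmetric] by (simp add: eq_diff_eq)
          show "r ^ Suc k * vh b (Suc k) z = r * (?p * (r ^ k * vh b k z) - r ^ k * wh b k (- z))"
            unfolding key by (simp add: algebra_simps)
        qed
        also have "(\<Sum>k. r * (?p * (r ^ k * vh b k z) - r ^ k * wh b k (- z))) = r * (?p * V z - W (- z))"
        proof (rule sums_unique[symmetric])
          have "(\<lambda>k. r ^ k * vh b k z) sums V z" "(\<lambda>k. r ^ k * wh b k (- z)) sums W (- z)"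
            unfolding V_def W_def using s1 by (auto intro: summable_sums)
          then show "(\<lambda>k. r * (?p * (r ^ k * vh b k z) - r ^ k * wh b k (- z))) sums (r * (?p * V z - W (- z)))"
            by (intro sums_mult sums_diff)
        qed
        finally show ?thesis using vh_0[OF b, of z] z0 by simp
      qed
      \<comment> \<open>The Wiener-Hopf equation, with one unknown holomorphic on the right
        half-plane and the other on the left.\<close>
      have V2: "(of_real b + z) * V z * (1 - r * ?p) = 1 - (of_real b + z) * r * W (- z)"
      proof -
        have "(of_real b + z) * V z = (of_real b + z) * (1 / (of_real b + z) + r * (?p * V z - W (- z)))"
          using V1 by (rule arg_cong)
        also have "\<dots> = 1 + (of_real b + z) * (r * (?p * V z - W (- z)))" using bz by (simp add: distrib_left)
        finally show ?thesis by (simp add: algebra_simps)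
      qed
      have L1: "L z + L (- z) = - Ln (1 - r * ?p)"
      proof -
        have "L z + L (- z) = (\<Sum>k. r ^ k * lh k z + r ^ k * lh k (- z))"
          unfolding L_def using sL[of z] sL[of "- z"] z0 by (intro suminf_add) auto
        also have "\<dots> = (\<Sum>k. (r * ?p) ^ k / of_nat k)"
          using lh_sum[of _ \<xi>] unfolding z by (simp add: distrib_left[symmetric] power_mult_distrib)
        also have "\<dots> = - Ln (1 - r * ?p)"
          using sums_unique[OF sums_minus[OF Ln_series'[of "- (r * ?p)"]]] rp by simp
        finally show ?thesis .
      qed
      have "1 - r * ?p \<noteq> 0" using rp by auto
      then have E1: "exp (L z) * exp (L (- z)) * (1 - r * ?p) = 1"
        unfolding exp_add[symmetric] L1 by (simp add: exp_minus)
      have "f z = (of_real b + z) * V z * (exp (L z) * exp (L (- z)) * (1 - r * ?p)) * exp (- L z)" by (simp add: f_def E1)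
      also have "\<dots> = (of_real b + z) * V z * (1 - r * ?p) * exp (L (- z)) * (exp (L z) * exp (- L z))" by (simp only: mult_ac)
      also have "\<dots> = exp (L (- z)) * (1 - (of_real b + z) * r * W (- z))"
        unfolding V2 by (simp add: exp_minus)
      finally show ?thesis by (simp add: g_def)
    qed
    have bz: "cmod (of_real b + z) \<le> (b + 1) * cmod z" if "1 \<le> cmod z" for z
    proof -
      have "cmod (of_real b + z) \<le> b + cmod z" using norm_triangle_ineq[of "of_real b" z] b by simp
      moreover have "b \<le> b * cmod z" using b that by simp
      ultimately show ?thesis by (simp add: distrib_right)
    qed
    show "cmod (f z) \<le> E * (1 + (b + 1) * B) * cmod z" if "0 \<le> Re z" "1 \<le> cmod z" for z
    proof -
      have "cmod (f z) \<le> (b + 1) * cmod z * B * E"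
        unfolding f_def norm_mult using bz[OF that(2)] bV[OF that(1)] bE[OF that(1)] b B0 by (intro mult_mono) auto
      also have "\<dots> \<le> E * (1 + (b + 1) * B) * cmod z"
        using E0 by (simp add: algebra_simps)
      finally show ?thesis .
    qed
    show "cmod (g z) \<le> E * (1 + (b + 1) * B) * cmod z" if "Re z \<le> 0" "1 \<le> cmod z" for z
    proof -
      have "cmod ((of_real b + z) * r * W (- z)) \<le> (b + 1) * cmod z * 1 * B"
        unfolding norm_mult using bz[OF that(2)] bW[of "- z"] that b B0 r by (intro mult_mono) auto
      then have "cmod (1 - (of_real b + z) * r * W (- z)) \<le> 1 + (b + 1) * cmod z * B"
        using norm_triangle_ineq4[of 1 "(of_real b + z) * r * W (- z)"] by simp
      also have "\<dots> \<le> (1 + (b + 1) * B) * cmod z" using that(2) by (simp add: algebra_simps)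
      finally have "cmod (g z) \<le> E * ((1 + (b + 1) * B) * cmod z)"
        unfolding g_def norm_mult using bE(1)[of "- z"] that E0 by (intro mult_mono) auto
      then show ?thesis by simp
    qed
    show "cmod (f (of_real x)) \<le> (b + 1) / (1 - cmod r) * E" if "1 \<le> x" for x
    proof -
      have x: "0 < x" using that by simp
      have "cmod (V (of_real x)) \<le> (\<Sum>k. 1 / x * cmod r ^ k)"
        unfolding V_def
      proof (rule norm_suminf_le)
        show "cmod (r ^ k * vh b k (of_real x)) \<le> 1 / x * cmod r ^ k" for k
          using mult_left_mono[OF vh_real_bound[OF b x, of k], of "cmod r ^ k"] by (simp add: norm_mult norm_power)
        show "summable (\<lambda>k. 1 / x * cmod r ^ k)" using r by (intro summable_mult summable_geometric) simp
      qed
      also have "\<dots> = 1 / x * (\<Sum>k. cmod r ^ k)" by (rule suminf_mult) (use r in simp)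
      also have "\<dots> = 1 / (x * (1 - cmod r))" using r by (simp add: suminf_geometric)
      finally have Vx: "cmod (V (of_real x)) \<le> 1 / (x * (1 - cmod r))" .
      have "cmod (f (of_real x)) \<le> (b + 1) * x * (1 / (x * (1 - cmod r))) * E"
        unfolding f_def norm_mult using bz[of "of_real x"] Vx bE[of "of_real x"] that b r by (intro mult_mono) auto
      then show ?thesis using x by simp
    qed
  qed (use a b in auto)
  \<comment> \<open>At the point \<open>- b\<close> the factor \<open>b + z\<close> removes the
    unknown \<open>W\<close>, so the constant is known there.\<close>
  then have "(of_real b + of_real a) * V (of_real a) * exp (- L (of_real a)) = exp (L (of_real b))"
    by (simp add: f_def g_def)
  then have "V (of_real a) = exp (L (of_real a) + L (of_real b)) / of_real (a + b)"
    using a b by (simp add: exp_minus exp_add field_simps flip: of_real_add)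
  also have "L (of_real a) + L (of_real b) = - (\<integral>z. Ln (1 - r * of_real (\<phi> z)) \<partial>hc a) / 2 - (\<integral>z. Ln (1 - r * of_real (\<phi> z)) \<partial>hc b) / 2"
    unfolding L_def log_series_integral[OF a r] log_series_integral[OF b r] by simp
  finally have Va: "V (of_real a) = exp (- (\<integral>z. Ln (1 - r * of_real (\<phi> z)) \<partial>hc a) / 2 - (\<integral>z. Ln (1 - r * of_real (\<phi> z)) \<partial>hc b) / 2) / of_real (a + b)" .
  have "vh b k (of_real a) = of_real (\<integral>x. exp (- a * x) * killed_walk \<mu> (\<lambda>x. exp (- b * x)) k x \<partial>hl)" for k
  proof -
    have "vh b k (of_real a) = (\<integral>x. of_real (indicator {0<..} x *\<^sub>R (exp (- a * x) * v b k x)) \<partial>lborel)"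
      unfolding vh_def
      by (intro Bochner_Integration.integral_cong refl) (use v_bounds(3)[OF b, of _ k] in \<open>auto simp: indicator_def max_def exp_of_real[symmetric]\<close>)
    also have "\<dots> = of_real (\<integral>x. exp (- a * x) * v b k x \<partial>hl)"
      by (simp only: integral_complex_of_real) (simp add: integral_restrict_space)
    finally show ?thesis by (simp add: v_def)
  qed
  then show ?thesis using summable_sums[OF sV[of "of_real a"]] a Va by (simp add: V_def)
qed

end

section \<open>Complete Bernstein functions\<close>

lemma completely_monotoneD:
  assumes "completely_monotone m" and "0 < x"
  shows "m differentiable at x" "0 \<le> m x" "deriv m x \<le> 0"
proof -
  have "(deriv ^^ 0) m differentiable at x \<and> 0 \<le> (-1) ^ 0 * (deriv ^^ 0) m x" "0 \<le> (-1) ^ 1 * (deriv ^^ 1) m x"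
    using assms unfolding completely_monotone_def by blast+
  then show "m differentiable at x" "0 \<le> m x" "deriv m x \<le> 0" by simp_all
qed

lemma completely_monotone_antimono:
  assumes m: "completely_monotone m" and "0 < x" "x \<le> y"
  shows "m y \<le> m x"
proof (rule DERIV_nonpos_imp_nonincreasing[OF \<open>x \<le> y\<close>])
  fix z assume "x \<le> z" "z \<le> y"
  then have "0 < z" using assms by simp
  then have "(m has_real_derivative deriv m z) (at z)"
    using completely_monotoneD(1)[OF m] by (metis DERIV_deriv_iff_real_differentiable)
  then show "\<exists>y. (m has_real_derivative y) (at z) \<and> y \<le> 0"
    using completely_monotoneD(3)[OF m \<open>0 < z\<close>] by blast
qed

text \<open>Only the monotonicity of the Levy density enters: substituting \<open>u = x s\<close> gives
  \<open>x\<^sup>2 \<integral> s exp (- x s) m s ds = \<integral> u exp (- u) m (u / x) du\<close>, which increases with \<open>x\<close>.\<close>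

lemma complete_Bernstein_deriv:
  assumes "complete_Bernstein \<psi>"
  shows "0 < x \<Longrightarrow> (\<psi> has_real_derivative deriv \<psi> x) (at x)"
    and "0 < x \<Longrightarrow> 0 \<le> deriv \<psi> x"
    and "0 < x \<Longrightarrow> x \<le> y \<Longrightarrow> deriv \<psi> y \<le> deriv \<psi> x"
    and "0 < x \<Longrightarrow> x \<le> y \<Longrightarrow> x\<^sup>2 * deriv \<psi> x \<le> y\<^sup>2 * deriv \<psi> y"
proof -
  from assms obtain c1 c2 m where c: "0 \<le> c1" "0 \<le> c2" and m: "completely_monotone m"
    and mi: "integrable hl (\<lambda>s. min 1 s * m s)"
    and psi: "\<And>x. 0 < x \<Longrightarrow> \<psi> x = c1 + c2 * x + (\<integral>s. (1 - exp (- x * s)) * m s \<partial>hl)"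
    unfolding complete_Bernstein_def set_integrable_hl set_integral_hl by blast
  have "continuous_on {0<..} m"
    using completely_monotoneD(1)[OF m]
    by (auto intro!: continuous_at_imp_continuous_on differentiable_imp_continuous_within)
  then have mm [measurable]: "m \<in> borel_measurable hl" by (rule continuous_on_measurable_hl)
  have m0: "0 \<le> m s" if "0 < s" for s using completely_monotoneD(2)[OF m that] .
  define D where "D x = (\<integral>s. s * exp (- x * s) * m s \<partial>hl)" for x
  \<comment> \<open>Integrability is available against \<open>min 1 s\<close>: small
    \<open>s\<close> are covered by the factor \<open>s\<close>, large \<open>s\<close> by the
    exponential decay, at the cost of \<open>1 / x\<close>.\<close>
  have bnd: "s * exp (- x * s) \<le> (1 + 1 / x) * min 1 s" if "0 < x" "0 < s" for x s :: real
  proof -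
    have "x * s \<le> exp (x * s)" using exp_ge_add_one_self[of "x * s"] by linarith
    then have "x * s * exp (- x * s) \<le> 1" by (simp add: exp_minus field_simps)
    then have 1: "s * exp (- x * s) \<le> 1 / x" using that by (simp add: field_simps)
    have 2: "s * exp (- x * s) \<le> s * 1" using that by (intro mult_left_mono) auto
    have 3: "s * 1 \<le> s * (1 + 1 / x)" using that by (intro mult_left_mono) auto
    show ?thesis
    proof (cases "s \<le> 1")
      case True
      then show ?thesis using 2 3 by (simp add: min_def mult.commute)
    next
      case False
      then show ?thesis using 1 by (simp add: min_def)
    qed
  qed
  have Dint: "integrable hl (\<lambda>s. s * exp (- x * s) * m s)" if x: "0 < x" for x
  proof (rule Bochner_Integration.integrable_bound[OF integrable_mult_right[OF mi, of "1 + 1 / x"]])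
    show "AE s in hl. norm (s * exp (- x * s) * m s) \<le> norm ((1 + 1 / x) * (min 1 s * m s))"
    proof (rule AE_I2)
      fix s assume "s \<in> space hl"
      then have s: "0 < s" by simp
      have "s * exp (- x * s) * m s \<le> (1 + 1 / x) * min 1 s * m s"
        using bnd[OF x s] m0[OF s] by (rule mult_right_mono)
      then show "norm (s * exp (- x * s) * m s) \<le> norm ((1 + 1 / x) * (min 1 s * m s))"
        using x s m0[OF s] by (simp add: abs_mult mult.assoc)
    qed
  qed measurable
  have der: "(\<psi> has_real_derivative c2 + D x) (at x)" if x: "0 < x" for x
  proof -
    have I: "((\<lambda>w. \<integral>s. (1 - exp (- w * s)) * m s \<partial>hl) has_real_derivative D x) (at x)"
      unfolding D_def
    proof (rule has_field_derivative_integral(1)[where r="x / 2" and g="\<lambda>s. (1 + 2 / x) * (min 1 s * m s)"])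
      fix w assume "w \<in> ball x (x / 2)"
      then have w: "x / 2 < w" by (auto simp: dist_real_def abs_if split: if_splits)
      then have w0: "0 < w" using x by linarith
      show "integrable hl (\<lambda>s. (1 - exp (- w * s)) * m s)"
      proof (rule Bochner_Integration.integrable_bound[OF integrable_mult_right[OF mi, of "1 + w"]])
        show "AE s in hl. norm ((1 - exp (- w * s)) * m s) \<le> norm ((1 + w) * (min 1 s * m s))"
        proof (rule AE_I2)
          fix s assume "s \<in> space hl"
          then have s: "0 < s" by simp
          have "1 - exp (- w * s) \<le> w * s" using exp_ge_add_one_self[of "- w * s"] by linarith
          have "1 - exp (- w * s) \<le> (1 + w) * min 1 s"
          proof (cases "s \<le> 1")
            case True
            then show ?thesis using \<open>1 - exp (- w * s) \<le> w * s\<close> s by (simp add: min_def distrib_right)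
          next
            case False
            have "1 - exp (- w * s) \<le> 1 + w" using w0 exp_gt_zero[of "- w * s"] by linarith
            then show ?thesis using False by (simp add: min_def)
          qed
          then have "(1 - exp (- w * s)) * m s \<le> (1 + w) * min 1 s * m s" using m0[OF s] by (rule mult_right_mono)
          moreover have "0 \<le> 1 - exp (- w * s)" using w0 s by simp
          ultimately show "norm ((1 - exp (- w * s)) * m s) \<le> norm ((1 + w) * (min 1 s * m s))"
            using m0[OF s] w0 s by (simp add: abs_mult mult.assoc)
        qed
      qed measurable
      fix s assume "s \<in> space hl"
      then have s: "0 < s" by simp
      show "((\<lambda>w. (1 - exp (- w * s)) * m s) has_real_derivative s * exp (- w * s) * m s) (at w)"
        by (auto intro!: derivative_eq_intros)
      have "exp (- w * s) \<le> exp (- (x / 2) * s)" using w s by simp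
      then have "s * exp (- w * s) \<le> s * exp (- (x / 2) * s)" using s by (intro mult_left_mono) auto
      also have "\<dots> \<le> (1 + 1 / (x / 2)) * min 1 s" using x s by (intro bnd) auto
      finally have "s * exp (- w * s) * m s \<le> (1 + 2 / x) * min 1 s * m s" using m0[OF s] by (intro mult_right_mono) auto
      then show "norm (s * exp (- w * s) * m s) \<le> (1 + 2 / x) * (min 1 s * m s)"
        using s m0[OF s] by (simp add: abs_mult mult.assoc)
    qed (use x mi in auto)
    have "((\<lambda>w. c1 + c2 * w + (\<integral>s. (1 - exp (- w * s)) * m s \<partial>hl)) has_real_derivative c2 + D x) (at x)"
      using I by (auto intro!: derivative_eq_intros)
    then show ?thesis
      by (rule has_field_derivative_transform_within_open[where S="{0<..}"]) (use x psi in auto)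
  qed
  then have dD: "deriv \<psi> x = c2 + D x" if "0 < x" for x using that DERIV_imp_deriv by blast
  show "0 < x \<Longrightarrow> (\<psi> has_real_derivative deriv \<psi> x) (at x)" using der dD by simp
  show "0 < x \<Longrightarrow> 0 \<le> deriv \<psi> x"
    using c m0 by (simp add: dD D_def) (intro add_nonneg_nonneg Bochner_Integration.integral_nonneg_AE AE_I2, auto)
  show "deriv \<psi> y \<le> deriv \<psi> x" if "0 < x" "x \<le> y"
  proof -
    have "D y \<le> D x" unfolding D_def
    proof (rule integral_mono[OF Dint Dint])
      fix s assume "s \<in> space hl"
      then show "s * exp (- y * s) * m s \<le> s * exp (- x * s) * m s"
        using that m0[of s] by (intro mult_right_mono mult_left_mono) auto
    qed (use that in auto)
    then show ?thesis using that dD by simp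
  qed
  show "x\<^sup>2 * deriv \<psi> x \<le> y\<^sup>2 * deriv \<psi> y" if xy: "0 < x" "x \<le> y"
  proof -
    define h where "h x u = indicator {0<..} u *\<^sub>R (u * exp (- u) * m (u / x))" for x u :: real
    have scal: "x\<^sup>2 * D x = (\<integral>u. h x u \<partial>lborel)" "integrable lborel (h x)" if x: "0 < x" for x
    proof -
      let ?g = "\<lambda>s. indicator {0<..} s *\<^sub>R (s * exp (- x * s) * m s)"
      have gi: "integrable lborel ?g" using Dint[OF x] by (simp add: integrable_restrict_space)
      have Dg: "D x = (\<integral>s. ?g s \<partial>lborel)" unfolding D_def by (simp add: integral_restrict_space)
      have gh: "?g (0 + (1 / x) * u) = h x u / x" for u
        using x by (auto simp: h_def indicator_def zero_less_mult_iff zero_less_divide_iff)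
      have "D x = \<bar>1 / x\<bar> *\<^sub>R (\<integral>u. ?g (0 + (1 / x) * u) \<partial>lborel)"
        unfolding Dg by (rule lborel_integral_real_affine) (use x in auto)
      also have "\<dots> = (\<integral>u. h x u \<partial>lborel) / x\<^sup>2" unfolding gh using x by (simp add: power2_eq_square)
      finally show "x\<^sup>2 * D x = (\<integral>u. h x u \<partial>lborel)" using x by simp
      have "integrable lborel (\<lambda>u. ?g (0 + (1 / x) * u))"
        by (rule lborel_integrable_real_affine[OF gi]) (use x in auto)
      then have "integrable lborel (\<lambda>u. h x u / x)" unfolding gh .
      then have "integrable lborel (\<lambda>u. x * (h x u / x))" by (rule integrable_mult_right)
      then show "integrable lborel (h x)" using x by simp
    qed
    have "(\<integral>u. h x u \<partial>lborel) \<le> (\<integral>u. h y u \<partial>lborel)"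
    proof (rule integral_mono)
      show "h x u \<le> h y u" for u
      proof (cases "0 < u")
        case True
        have "m (u / x) \<le> m (u / y)"
          using xy True by (intro completely_monotone_antimono[OF m]) (auto simp: frac_le)
        then show ?thesis using True by (simp add: h_def mult_left_mono)
      qed (simp add: h_def)
    qed (use scal xy in auto)
    then have "x\<^sup>2 * D x \<le> y\<^sup>2 * D y" using scal xy by simp
    moreover have "x\<^sup>2 * c2 \<le> y\<^sup>2 * c2" using xy c by (intro mult_right_mono power_mono) auto
    ultimately show ?thesis using xy dD by (simp add: distrib_left)
  qed
qed

text \<open>\<open>der_anti\<close> is concavity of \<psi> and \<open>der_mono\<close> is convexity
  of \<open>y \<mapsto> \<psi> (1 / y)\<close>; together they enclose difference quotients from both
  sides. \<open>at_0\<close> will come from the characteristic functions, \<open>at_inf\<close> from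
  integrability of the weight, and strict positivity of the derivative from
  \<open>at_inf\<close>.\<close>

locale levy_symbol =
  fixes \<psi> \<psi>' :: "real \<Rightarrow> real"
  assumes der: "0 < x \<Longrightarrow> (\<psi> has_real_derivative \<psi>' x) (at x)"
    and der_pos: "0 < x \<Longrightarrow> 0 < \<psi>' x"
    and der_anti: "0 < x \<Longrightarrow> x \<le> y \<Longrightarrow> \<psi>' y \<le> \<psi>' x"
    and der_mono: "0 < x \<Longrightarrow> x \<le> y \<Longrightarrow> x\<^sup>2 * \<psi>' x \<le> y\<^sup>2 * \<psi>' y"
    and at_0: "\<psi> 0 = 0" "(\<psi> \<longlongrightarrow> 0) (at_right 0)"
    and at_inf: "filterlim \<psi> at_top at_top"
begin

lemma less: "0 < x \<Longrightarrow> x < y \<Longrightarrow> \<psi> x < \<psi> y"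
  by (rule DERIV_pos_imp_increasing) (auto intro!: exI[of _ "\<psi>' _"] der der_pos)

lemma pos: "0 < x \<Longrightarrow> 0 < \<psi> x"
proof -
  assume x: "0 < x"
  have "0 \<le> \<psi> (x / 2)"
  proof (rule tendsto_upperbound[OF at_0(2)])
    show "\<forall>\<^sub>F y in at_right 0. \<psi> y \<le> \<psi> (x / 2)"
      unfolding eventually_at_right_field using x less by (intro exI[of _ "x/2"]) (auto intro: less_imp_le)
  qed simp
  then show "0 < \<psi> x" using less[of "x/2" x] x by linarith
qed

lemma nonneg: "0 \<le> x \<Longrightarrow> 0 \<le> \<psi> x"
  using pos[of x] at_0 by (cases "x = 0") auto

lemma continuous_sq: "isCont (\<lambda>z. \<psi> (z\<^sup>2)) z"
proof (cases "z = 0")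
  case True
  have "filterlim (\<lambda>z::real. z\<^sup>2) (at_right 0) (at 0)"
    unfolding filterlim_at by (auto intro!: tendsto_eq_intros eventually_at_filter[THEN iffD2])
  from filterlim_compose[OF at_0(2) this] show ?thesis using True at_0 by (simp add: isCont_def)
next
  case False
  then have "0 < z\<^sup>2" by simp
  then have "isCont \<psi> (z\<^sup>2)" by (rule DERIV_isCont[OF der])
  moreover have "isCont (\<lambda>z::real. z\<^sup>2) z" by simp
  ultimately show ?thesis by (rule isCont_o2[rotated])
qed

lemma measurable_sq [measurable]: "(\<lambda>z. \<psi> (z\<^sup>2)) \<in> borel_measurable borel"
  using continuous_sq by (intro borel_measurable_continuous_onI continuous_at_imp_continuous_on) auto

section \<open>Two-sided bounds for difference quotients of the symbol\<close>

lemma slope_le: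
  assumes "0 < x" "0 < y"
  shows "\<psi> y - \<psi> x \<le> \<psi>' x * (y - x)"
proof (cases x y rule: linorder_cases)
  case less
  then obtain z where z: "x < z" "z < y" "\<psi> y - \<psi> x = (y - x) * \<psi>' z"
    using MVT2[of x y \<psi> \<psi>'] der assms by fastforce
  then show ?thesis using mult_left_mono[OF der_anti[of x z], of "y - x"] assms by (simp add: mult.commute)
next
  case greater
  then obtain z where z: "y < z" "z < x" "\<psi> x - \<psi> y = (x - y) * \<psi>' z"
    using MVT2[of y x \<psi> \<psi>'] der assms by fastforce
  then show ?thesis using mult_left_mono[OF der_anti[of z x], of "x - y"] assms by (simp add: algebra_simps)
qed simp

text \<open>The function \<open>z \<mapsto> \<psi> z + \<psi>' x * x\<^sup>2 / z\<close> is smallest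
  at \<open>x\<close>, since its derivative has the sign of
  \<open>z\<^sup>2 * \<psi>' z - x\<^sup>2 * \<psi>' x\<close>. In other words, \<psi> lies above
  its tangent hyperbola.\<close>

lemma slope_ge:
  assumes x: "0 < x" and y: "0 < y"
  shows "\<psi>' x * x * (y - x) / y \<le> \<psi> y - \<psi> x"
proof -
  define g where "g z = \<psi> z + \<psi>' x * x\<^sup>2 / z" for z
  have g: "(g has_real_derivative (z\<^sup>2 * \<psi>' z - x\<^sup>2 * \<psi>' x) / z\<^sup>2) (at z)" if "0 < z" for z
  proof -
    have "(g has_real_derivative \<psi>' z + (0 * z - \<psi>' x * x\<^sup>2 * 1) / (z * z)) (at z)"
      unfolding g_def using that by (intro DERIV_add DERIV_divide DERIV_const DERIV_ident der) auto
    then show ?thesis using that by (simp add: diff_divide_distrib power2_eq_square mult.commute)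
  qed
  have "g x \<le> g y"
  proof (cases "x \<le> y")
    case True
    then show ?thesis
    proof (rule DERIV_nonneg_imp_nondecreasing)
      fix z assume z: "x \<le> z" "z \<le> y"
      then show "\<exists>d. (g has_real_derivative d) (at z) \<and> 0 \<le> d"
        using g[of z] der_mono[OF x z(1)] x by (intro exI[of _ "(z\<^sup>2 * \<psi>' z - x\<^sup>2 * \<psi>' x) / z\<^sup>2"]) auto
    qed
  next
    case False
    then have "y \<le> x" by simp
    then show ?thesis
    proof (rule DERIV_nonpos_imp_nonincreasing)
      fix z assume z: "y \<le> z" "z \<le> x"
      then show "\<exists>d. (g has_real_derivative d) (at z) \<and> d \<le> 0"
        using g[of z] der_mono[of z x] y by (intro exI[of _ "(z\<^sup>2 * \<psi>' z - x\<^sup>2 * \<psi>' x) / z\<^sup>2"]) (auto simp: divide_le_0_iff)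
    qed
  qed
  moreover have "\<psi>' x * x * (y - x) / y = \<psi>' x * x\<^sup>2 / x - \<psi>' x * x\<^sup>2 / y"
    using x y by (simp add: field_simps power2_eq_square)
  ultimately show ?thesis by (simp add: g_def)
qed

text \<open>The argument of the logarithm in \<open>eigenfunction_log\<close>; the absolute values
  make it independent of the order of \<open>z\<close> and \<open>l\<close>. At \<open>z = l\<close>
  it is \<open>0 / 0 = 0\<close> instead of 1, which affects a null set only.\<close>

definition ratio :: "real \<Rightarrow> real \<Rightarrow> real" where
  "ratio l z = \<psi>' (l\<^sup>2) * \<bar>z\<^sup>2 - l\<^sup>2\<bar> / \<bar>\<psi> (z\<^sup>2) - \<psi> (l\<^sup>2)\<bar>"

lemma psi_ne: "0 < l \<Longrightarrow> 0 < z \<Longrightarrow> z \<noteq> l \<Longrightarrow> \<psi> (z\<^sup>2) \<noteq> \<psi> (l\<^sup>2)"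
proof -
  assume lz: "0 < l" "0 < z" "z \<noteq> l"
  then have "z\<^sup>2 < l\<^sup>2 \<or> l\<^sup>2 < z\<^sup>2" by (metis linorder_neqE_linordered_idom power_strict_mono less_imp_le pos2)
  then show ?thesis using less[of "z\<^sup>2" "l\<^sup>2"] less[of "l\<^sup>2" "z\<^sup>2"] lz by auto
qed

text \<open>Concavity of \<psi> yields the comparison with 1, convexity of
  \<open>y \<mapsto> \<psi> (1 / y)\<close> the comparison with
  \<open>(z / l)\<^sup>2\<close>.\<close>

lemma ratio_bounds:
  assumes l: "0 < l" and z: "0 < z" "z \<noteq> l"
  shows "min 1 ((z / l)\<^sup>2) \<le> ratio l z" "ratio l z \<le> max 1 ((z / l)\<^sup>2)" "0 < ratio l z"
proof -
  let ?Z = "z\<^sup>2" and ?L = "l\<^sup>2"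
  have Z: "0 < ?Z" and L: "0 < ?L" using l z by auto
  note a = slope_le[OF L Z] slope_ge[OF L Z]
  have dp: "0 < \<psi>' ?L" using der_pos L .
  have "min 1 (?Z / ?L) \<le> ratio l z \<and> ratio l z \<le> max 1 (?Z / ?L)"
  proof (cases "z < l")
    case True
    then have lt: "?Z < ?L" using l z by (intro power_strict_mono) auto
    have d: "\<psi> ?Z < \<psi> ?L" using less Z lt by blast
    have q: "ratio l z = \<psi>' ?L * (?L - ?Z) / (\<psi> ?L - \<psi> ?Z)" using lt d by (simp add: ratio_def)
    have "\<psi>' ?L * (?L - ?Z) \<le> \<psi> ?L - \<psi> ?Z" using a(1) by (simp add: algebra_simps)
    then have 1: "ratio l z \<le> 1" unfolding q using d by (simp add: divide_le_eq)
    have "\<psi> ?L - \<psi> ?Z \<le> \<psi>' ?L * ?L * (?L - ?Z) / ?Z"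
      using a(2) Z by (simp add: field_simps)
    then have "?Z * (\<psi> ?L - \<psi> ?Z) \<le> ?L * (\<psi>' ?L * (?L - ?Z))" using Z by (simp add: field_simps)
    then have "?Z / ?L \<le> ratio l z" unfolding q using d L by (simp add: field_simps)
    then show ?thesis using 1 by auto
  next
    case False
    then have "l < z" using z by simp
    then have lt: "?L < ?Z" using l z by (intro power_strict_mono) auto
    have d: "\<psi> ?L < \<psi> ?Z" using less L lt by blast
    have q: "ratio l z = \<psi>' ?L * (?Z - ?L) / (\<psi> ?Z - \<psi> ?L)" using lt d by (simp add: ratio_def)
    have 1: "1 \<le> ratio l z" unfolding q using d a(1) by (simp add: le_divide_eq)
    have "?L * (\<psi>' ?L * (?Z - ?L)) \<le> ?Z * (\<psi> ?Z - \<psi> ?L)" using a(2) Z by (simp add: field_simps)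
    then have "ratio l z \<le> ?Z / ?L" unfolding q using d L by (simp add: field_simps)
    then show ?thesis using 1 by auto
  qed
  then show "min 1 ((z / l)\<^sup>2) \<le> ratio l z" "ratio l z \<le> max 1 ((z / l)\<^sup>2)" by (simp_all add: power_divide)
  then show "0 < ratio l z" using l z by (auto simp: min_def split: if_splits intro: less_le_trans[rotated])
qed

text \<open>The counterpart of \<open>ratio\<close> for the walk with time step \<delta>: the
  difference \<open>u\<close> of two values of \<psi> is replaced by
  \<open>(1 - exp (- \<delta> * u)) / \<delta>\<close>, which tends to \<open>u\<close> with
  \<delta>.\<close>

definition ratio_step :: "real \<Rightarrow> real \<Rightarrow> real \<Rightarrow> real" where
  "ratio_step \<delta> l z = \<delta> * \<psi>' (l\<^sup>2) * \<bar>z\<^sup>2 - l\<^sup>2\<bar> / \<bar>1 - exp (- \<delta> * (\<psi> (z\<^sup>2) - \<psi> (l\<^sup>2)))\<bar>"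

lemma one_minus_exp_bounds:
  fixes y :: real
  assumes "y \<noteq> 0"
  shows "\<bar>y\<bar> / (1 + max 0 y) \<le> \<bar>1 - exp (- y)\<bar>" "\<bar>1 - exp (- y)\<bar> \<le> \<bar>y\<bar> * exp (max 0 (- y))" "0 < \<bar>1 - exp (- y)\<bar>"
proof -
  have "\<bar>y\<bar> / (1 + max 0 y) \<le> \<bar>1 - exp (- y)\<bar> \<and> \<bar>1 - exp (- y)\<bar> \<le> \<bar>y\<bar> * exp (max 0 (- y))"
  proof (cases "0 < y")
    case True
    have 1: "1 - exp (- y) \<le> y" using exp_ge_add_one_self[of "- y"] by linarith
    have "exp (- y) \<le> 1 / (1 + y)"
      using exp_ge_add_one_self[of y] True by (simp add: exp_minus field_simps)
    then have 2: "y / (1 + y) \<le> 1 - exp (- y)" using True by (simp add: field_simps)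
    have "0 \<le> 1 - exp (- y)" using True by simp
    then show ?thesis using 1 2 True by simp
  next
    case False
    then have y: "y < 0" using assms by simp
    have 1: "- y \<le> exp (- y) - 1" using exp_ge_add_one_self[of "- y"] by linarith
    have "1 - exp y \<le> - y" using exp_ge_add_one_self[of y] by linarith
    then have "(1 - exp y) * exp (- y) \<le> - y * exp (- y)" by (intro mult_right_mono) auto
    then have 2: "exp (- y) - 1 \<le> - y * exp (- y)" by (simp add: left_diff_distrib exp_minus)
    have "0 \<le> exp (- y) - 1" using y by simp
    then show ?thesis using 1 2 y by (simp add: max_def)
  qed
  then show "\<bar>y\<bar> / (1 + max 0 y) \<le> \<bar>1 - exp (- y)\<bar>" "\<bar>1 - exp (- y)\<bar> \<le> \<bar>y\<bar> * exp (max 0 (- y))" by auto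
  show "0 < \<bar>1 - exp (- y)\<bar>" using assms by simp
qed

text \<open>The quotient of \<open>ratio_step\<close> and \<open>ratio\<close> is
  \<open>\<bar>y\<bar> / \<bar>1 - exp (- y)\<bar>\<close>, which lies between
  \<open>exp (- max 0 (- y))\<close> and \<open>1 + max 0 y\<close>. For
  \<open>\<delta> \<le> t\<close> this gives bounds free of \<delta>, as the limit of vanishing step
  requires.\<close>

lemma ratio_step_bounds:
  assumes l: "0 < l" and z: "0 < z" "z \<noteq> l" and d: "0 < \<delta>" "\<delta> \<le> t"
  shows "ln (ratio_step \<delta> l z) \<le> 2 * max 0 (ln z - ln l) + ln (1 + t * \<psi> (z\<^sup>2))"
    and "- (2 * max 0 (ln l - ln z) + t * \<psi> (l\<^sup>2)) \<le> ln (ratio_step \<delta> l z)"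
    and "0 < ratio_step \<delta> l z"
proof -
  define y where "y = \<delta> * (\<psi> (z\<^sup>2) - \<psi> (l\<^sup>2))"
  have y0: "y \<noteq> 0" using psi_ne[OF l z] d by (simp add: y_def)
  note yb = one_minus_exp_bounds[OF y0]
  have eq: "ratio_step \<delta> l z = ratio l z * (\<bar>y\<bar> / \<bar>1 - exp (- y)\<bar>)"
    using psi_ne[OF l z] d by (simp add: ratio_step_def ratio_def y_def abs_mult)
  have yp: "0 < \<bar>y\<bar> / \<bar>1 - exp (- y)\<bar>" using yb(3) y0 by simp
  show pos': "0 < ratio_step \<delta> l z" unfolding eq using ratio_bounds(3)[OF l z] yp by (rule mult_pos_pos)
  have lneq: "ln (ratio_step \<delta> l z) = ln (ratio l z) + ln (\<bar>y\<bar> / \<bar>1 - exp (- y)\<bar>)"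
    unfolding eq by (rule ln_mult_pos[OF ratio_bounds(3)[OF l z] yp])
  have lnq: "ln ((z / l)\<^sup>2) = 2 * (ln z - ln l)" using l z by (simp add: ln_realpow ln_div)
  have zl: "0 < (z / l)\<^sup>2" using l z by simp
  have "ln (ratio l z) \<le> ln (max 1 ((z / l)\<^sup>2))" using ratio_bounds[OF l z] zl by (simp add: ln_le_cancel_iff less_max_iff_disj)
  also have "\<dots> \<le> 2 * max 0 (ln z - ln l)" using lnq by (auto simp: max_def)
  finally have r1: "ln (ratio l z) \<le> 2 * max 0 (ln z - ln l)" .
  have "- (2 * max 0 (ln l - ln z)) \<le> ln (min 1 ((z / l)\<^sup>2))" using lnq by (auto simp: min_def max_def)
  also have "\<dots> \<le> ln (ratio l z)" using ratio_bounds[OF l z] zl by (subst ln_le_cancel_iff) auto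
  finally have r2: "- (2 * max 0 (ln l - ln z)) \<le> ln (ratio l z)" .
  have pz: "0 \<le> \<psi> (z\<^sup>2)" and pl: "0 \<le> \<psi> (l\<^sup>2)" by (auto intro: nonneg)
  have my: "max 0 y \<le> t * \<psi> (z\<^sup>2)"
  proof -
    have "y \<le> \<delta> * \<psi> (z\<^sup>2)" unfolding y_def using pl d by (intro mult_left_mono) auto
    also have "\<dots> \<le> t * \<psi> (z\<^sup>2)" using d pz by (intro mult_right_mono) auto
    finally show ?thesis using pz d by simp
  qed
  have my': "max 0 (- y) \<le> t * \<psi> (l\<^sup>2)"
  proof -
    have "- y \<le> \<delta> * \<psi> (l\<^sup>2)" unfolding y_def using pz d by (simp add: right_diff_distrib)
    also have "\<dots> \<le> t * \<psi> (l\<^sup>2)" using d pl by (intro mult_right_mono) auto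
    finally show ?thesis using pl d by simp
  qed
  have "\<bar>y\<bar> / \<bar>1 - exp (- y)\<bar> \<le> 1 + max 0 y"
    using yb(1,3) by (simp add: field_simps)
  also have "\<dots> \<le> 1 + t * \<psi> (z\<^sup>2)" using my by simp
  finally have "ln (\<bar>y\<bar> / \<bar>1 - exp (- y)\<bar>) \<le> ln (1 + t * \<psi> (z\<^sup>2))"
    using yp by (subst ln_le_cancel_iff) auto
  then show "ln (ratio_step \<delta> l z) \<le> 2 * max 0 (ln z - ln l) + ln (1 + t * \<psi> (z\<^sup>2))"
    unfolding lneq using r1 by linarith
  have "exp (- max 0 (- y)) \<le> \<bar>y\<bar> / \<bar>1 - exp (- y)\<bar>"
    using yb(2,3) by (simp add: field_simps exp_minus)
  then have "- max 0 (- y) \<le> ln (\<bar>y\<bar> / \<bar>1 - exp (- y)\<bar>)"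
    using yp by (subst (asm) ln_ge_iff[symmetric]) auto
  then show "- (2 * max 0 (ln l - ln z) + t * \<psi> (l\<^sup>2)) \<le> ln (ratio_step \<delta> l z)"
    unfolding lneq using r2 my' by linarith
qed

section \<open>Logarithmic integrability under the half-Cauchy law\<close>

lemma psi_upper: "0 < x \<Longrightarrow> \<psi> x \<le> (\<psi> 1 + \<psi>' 1) * (1 + x)"
proof -
  assume x: "0 < x"
  have "\<psi> x \<le> \<psi> 1 + \<psi>' 1 * (x - 1)" using slope_le[of 1 x] x by simp
  also have "\<dots> \<le> (\<psi> 1 + \<psi>' 1) * (1 + x)"
    using pos[of 1] der_pos[of 1] x by (simp add: algebra_simps)
  finally show ?thesis .
qed

lemma ln_psi_integrable:
  assumes a: "0 < a" and t: "0 < t"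
  shows "integrable (hc a) (\<lambda>z. ln (1 + t * \<psi> (z\<^sup>2)))"
proof -
  define C where "C = 1 + t * (\<psi> 1 + \<psi>' 1)"
  interpret H: prob_space "hc a" by (rule hc_prob[OF a])
  have C: "1 \<le> C" using t pos[of 1] der_pos[of 1] by (simp add: C_def)
  show ?thesis
  proof (rule Bochner_Integration.integrable_bound)
    show "integrable (hc a) (\<lambda>z. ln C + ln 2 + 2 * \<bar>ln z\<bar>)"
      using hc_ln_integrable[OF a] by auto
    show "AE z in hc a. norm (ln (1 + t * \<psi> (z\<^sup>2))) \<le> norm (ln C + ln 2 + 2 * \<bar>ln z\<bar>)"
      using hc_AE_pos
    proof eventually_elim
      case (elim z)
      have t0: "0 \<le> t * \<psi> (z\<^sup>2)" using t nonneg by simp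
      have "t * \<psi> (z\<^sup>2) \<le> t * ((\<psi> 1 + \<psi>' 1) * (1 + z\<^sup>2))"
        using psi_upper[of "z\<^sup>2"] t elim by (intro mult_left_mono) auto
      moreover have "C * (1 + z\<^sup>2) = (1 + z\<^sup>2) + t * ((\<psi> 1 + \<psi>' 1) * (1 + z\<^sup>2))" by (simp add: C_def algebra_simps)
      moreover have "0 \<le> z\<^sup>2" by simp
      ultimately have "1 + t * \<psi> (z\<^sup>2) \<le> C * (1 + z\<^sup>2)" by linarith
      also have "\<dots> \<le> C * (2 * max 1 (z\<^sup>2))" using C by (intro mult_left_mono) (auto simp: max_def)
      finally have "ln (1 + t * \<psi> (z\<^sup>2)) \<le> ln (C * (2 * max 1 (z\<^sup>2)))"
        using t0 C by (subst ln_le_cancel_iff) (auto simp: less_max_iff_disj)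
      also have "\<dots> = ln C + ln 2 + ln (max 1 (z\<^sup>2))" using C by (simp add: ln_mult less_max_iff_disj)
      also have "ln (max 1 (z\<^sup>2)) \<le> 2 * \<bar>ln z\<bar>" using elim by (auto simp: max_def ln_realpow)
      finally show ?case using t0 C by simp
    qed
  qed measurable
qed

text \<open>Concavity lets \<psi> grow at most linearly, so the dominating function is logarithmic
  in \<open>z\<close> and integrable against the heavy tail of \<open>hc a\<close>. It does not
  depend on \<delta>.\<close>

lemma ln_ratio_step_dominated:
  assumes a: "0 < a" and t: "0 < t"
  shows "integrable (hc a) (\<lambda>z. 2 * \<bar>ln z\<bar> + 2 * \<bar>ln l\<bar> + t * \<psi> (l\<^sup>2) + ln (1 + t * \<psi> (z\<^sup>2)))"
    and "0 < l \<Longrightarrow> 0 < z \<Longrightarrow> z \<noteq> l \<Longrightarrow> 0 < \<delta> \<Longrightarrow> \<delta> \<le> t \<Longrightarrow>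
      \<bar>ln (ratio_step \<delta> l z)\<bar> \<le> 2 * \<bar>ln z\<bar> + 2 * \<bar>ln l\<bar> + t * \<psi> (l\<^sup>2) + ln (1 + t * \<psi> (z\<^sup>2))"
proof -
  interpret H: prob_space "hc a" by (rule hc_prob[OF a])
  show "integrable (hc a) (\<lambda>z. 2 * \<bar>ln z\<bar> + 2 * \<bar>ln l\<bar> + t * \<psi> (l\<^sup>2) + ln (1 + t * \<psi> (z\<^sup>2)))"
    using hc_ln_integrable[OF a] ln_psi_integrable[OF a t] by auto
  assume A: "0 < l" "0 < z" "z \<noteq> l" "0 < \<delta>" "\<delta> \<le> t"
  have "0 \<le> ln (1 + t * \<psi> (z\<^sup>2))" "0 \<le> t * \<psi> (l\<^sup>2)" using t nonneg by (auto intro!: ln_ge_zero)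
  then show "\<bar>ln (ratio_step \<delta> l z)\<bar> \<le> 2 * \<bar>ln z\<bar> + 2 * \<bar>ln l\<bar> + t * \<psi> (l\<^sup>2) + ln (1 + t * \<psi> (z\<^sup>2))"
    using ratio_step_bounds[OF A] by (auto simp: max_def split: if_splits)
qed

lemma ratio_step_measurable [measurable]: "ratio_step \<delta> l \<in> borel_measurable borel"
  unfolding ratio_step_def[abs_def] by measurable

lemma ratio_measurable [measurable]: "ratio l \<in> borel_measurable borel"
  unfolding ratio_def[abs_def] by measurable

lemma hc_AE_ne: "AE z in hc a. z \<noteq> l"
  unfolding hc_def using AE_lborel_singleton[of l] by (subst AE_density) (auto elim: eventually_mono)

lemma ln_ratio_step_integrable:
  assumes a: "0 < a" and l: "0 < l" and d: "0 < \<delta>"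
  shows "integrable (hc a) (\<lambda>z. ln (ratio_step \<delta> l z))"
proof (rule Bochner_Integration.integrable_bound[OF ln_ratio_step_dominated(1)[OF a d]])
  show "AE z in hc a. norm (ln (ratio_step \<delta> l z)) \<le> norm (2 * \<bar>ln z\<bar> + 2 * \<bar>ln l\<bar> + \<delta> * \<psi> (l\<^sup>2) + ln (1 + \<delta> * \<psi> (z\<^sup>2)))"
    using hc_AE_pos hc_AE_ne[where a=a and l=l]
    by eventually_elim (use ln_ratio_step_dominated(2)[OF a d l] d in \<open>auto intro: order_trans[OF _ abs_ge_self]\<close>)
qed measurable

end

section \<open>Contour deformation\<close>

text \<open>The substitution \<open>r = exp (- v)\<close> unfolds the plane slit along \<open>(0, \<infinity>)\<close> to a strip; the
  generating function of the walk extends to it, with singularities only on the real axis.\<close>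

definition strip :: "complex set" where "strip = {v. 0 < Im v \<and> Im v < 2 * pi}"

lemma open_strip: "open strip" and convex_strip: "convex strip"
proof -
  have eq: "strip = {v. 0 < Im v} \<inter> {v. Im v < 2 * pi}" by (auto simp: strip_def)
  show "open strip" unfolding eq by (intro open_Int open_halfspace_Im_gt open_halfspace_Im_lt)
  show "convex strip" unfolding eq by (intro convex_Int convex_halfspace_Im_gt convex_halfspace_Im_lt)
qed

text \<open>For \<open>y \<ge> 0\<close> the number \<open>y * exp (- v)\<close> can be real and at
  least 1 only if \<open>Im v\<close> is a multiple of \<open>2 * pi\<close>, and the strip lies
  between two such lines. So the principal logarithm is holomorphic along the whole family.\<close>

lemma strip_nonpos:
  assumes y: "0 \<le> y" and v: "v \<in> strip"
  shows "1 - of_real y * exp (- v) \<notin> \<real>\<^sub>\<le>\<^sub>0"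
proof
  assume "1 - of_real y * exp (- v) \<in> \<real>\<^sub>\<le>\<^sub>0"
  then have re: "1 \<le> y * (exp (- Re v) * cos (Im v))" and im: "y * (exp (- Re v) * sin (Im v)) = 0"
    by (auto simp: complex_nonpos_Reals_iff Re_exp Im_exp)
  have "y \<noteq> 0" using re by auto
  then have "sin (Im v) = 0" using im by simp
  then have "Im v = pi"
    using v sin_gt_zero[of "Im v"] sin_lt_zero[of "Im v"] unfolding strip_def
    by (cases "Im v" pi rule: linorder_cases) auto
  then have "y * exp (- Re v) \<le> - 1" using re by simp
  moreover have "0 \<le> y * exp (- Re v)" using y by simp
  ultimately show False by linarith
qed

text \<open>The values of \<phi> lie in the unit interval, so compactness of \<open>{0..1}\<close>
  times a closed disc bounds the logarithm and its derivative uniformly and permits differentiation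
  under the integral.\<close>

lemma Ln_integral_strip:
  fixes \<phi> :: "real \<Rightarrow> real"
  assumes M: "prob_space M" and \<phi> [measurable]: "\<phi> \<in> borel_measurable M" and range: "\<And>z. 0 \<le> \<phi> z" "\<And>z. \<phi> z \<le> 1"
  shows "(\<lambda>v. \<integral>z. Ln (1 - of_real (\<phi> z) * exp (- v)) \<partial>M) holomorphic_on strip"
    and "v \<in> strip \<Longrightarrow> integrable M (\<lambda>z. Ln (1 - of_real (\<phi> z) * exp (- v)))"
proof -
  interpret M: prob_space M by (rule M)
  have main: "(\<exists>D. ((\<lambda>v. \<integral>z. Ln (1 - of_real (\<phi> z) * exp (- v)) \<partial>M) has_field_derivative D) (at v)) \<and>
     integrable M (\<lambda>z. Ln (1 - of_real (\<phi> z) * exp (- v)))" if v: "v \<in> strip" for v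
  proof -
    obtain r where r: "0 < r" "cball v r \<subseteq> strip" using open_strip v open_contains_cball by blast
    let ?A = "{0..1::real} \<times> cball v r"
    have A: "compact ?A" by (intro compact_Times compact_Icc compact_cball)
    have nz: "1 - of_real (fst p) * exp (- snd p) \<notin> \<real>\<^sub>\<le>\<^sub>0" if "p \<in> ?A" for p
      using that r by (intro strip_nonpos) auto
    have "continuous_on ?A (\<lambda>p. Ln (1 - of_real (fst p) * exp (- snd p)))"
      using nz by (intro continuous_intros) auto
    from compact_imp_bounded[OF compact_continuous_image[OF this A]]
    obtain B1 where B1: "\<And>p. p \<in> ?A \<Longrightarrow> cmod (Ln (1 - of_real (fst p) * exp (- snd p))) \<le> B1"
      unfolding bounded_iff by blast
    have nz': "1 - of_real (fst p) * exp (- snd p) \<noteq> 0" if "p \<in> ?A" for p using nz[OF that] by auto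
    have "continuous_on ?A (\<lambda>p. of_real (fst p) * exp (- snd p) / (1 - of_real (fst p) * exp (- snd p)))"
      using nz' by (intro continuous_intros) auto
    from compact_imp_bounded[OF compact_continuous_image[OF this A]]
    obtain B2 where B2: "\<And>p. p \<in> ?A \<Longrightarrow> cmod (of_real (fst p) * exp (- snd p) / (1 - of_real (fst p) * exp (- snd p))) \<le> B2"
      unfolding bounded_iff by blast
    have int: "integrable M (\<lambda>z. Ln (1 - of_real (\<phi> z) * exp (- w)))" if "w \<in> cball v r" for w
    proof (rule M.integrable_const_bound[where B=B1])
      show "AE z in M. cmod (Ln (1 - of_real (\<phi> z) * exp (- w))) \<le> B1"
        using B1[of "(\<phi> z, w)" for z] that range by (intro AE_I2) auto
    qed measurable
    have "((\<lambda>v. \<integral>z. Ln (1 - of_real (\<phi> z) * exp (- v)) \<partial>M) has_field_derivative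
        (\<integral>z. of_real (\<phi> z) * exp (- v) / (1 - of_real (\<phi> z) * exp (- v)) \<partial>M)) (at v)"
    proof (rule has_field_derivative_integral(1)[where r=r and g="\<lambda>_. B2"])
      fix w z assume w: "w \<in> ball v r" and z: "z \<in> space M"
      then have p: "(\<phi> z, w) \<in> ?A" using range by auto
      show "((\<lambda>w. Ln (1 - of_real (\<phi> z) * exp (- w))) has_field_derivative
          of_real (\<phi> z) * exp (- w) / (1 - of_real (\<phi> z) * exp (- w))) (at w)"
        using nz[OF p] by (auto intro!: derivative_eq_intros simp: divide_inverse mult_ac)
      show "cmod (of_real (\<phi> z) * exp (- w) / (1 - of_real (\<phi> z) * exp (- w))) \<le> B2"
        using B2[OF p] by simp
    qed (use r int in auto)
    then show ?thesis using int[of v] r by auto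
  qed
  show "v \<in> strip \<Longrightarrow> integrable M (\<lambda>z. Ln (1 - of_real (\<phi> z) * exp (- v)))" using main by blast
  show "(\<lambda>v. \<integral>z. Ln (1 - of_real (\<phi> z) * exp (- v)) \<partial>M) holomorphic_on strip"
    using main by (intro holomorphic_onI) (meson field_differentiable_at_within field_differentiable_def)
qed

text \<open>A primitive on the convex strip gives Cauchy's theorem for the rectangle between the
  heights \<open>e\<close> and \<open>pi\<close>. Its upper side contributes nothing to the
  imaginary part because \<open>f\<close> is real there.\<close>

lemma strip_contour:
  assumes f: "f holomorphic_on strip" and real: "\<And>x. Im (f (Complex x pi)) = 0"
    and e: "0 < e" "e \<le> pi" and TR: "T \<le> R"
  shows "Im (integral {T..R} (\<lambda>x. f (Complex x e))) =
    Re (integral {e..pi} (\<lambda>\<theta>. f (Complex T \<theta>))) - Re (integral {e..pi} (\<lambda>\<theta>. f (Complex R \<theta>)))"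
proof -
  from holomorphic_convex_primitive'[OF convex_strip open_strip f] obtain F where
    F: "\<And>v. v \<in> strip \<Longrightarrow> (F has_field_derivative f v) (at v within strip)" by blast
  then have F: "\<And>v. v \<in> strip \<Longrightarrow> (F has_field_derivative f v) (at v)"
    using open_strip by (metis at_within_open)
  have hor: "((\<lambda>x. f (Complex x y)) has_integral (F (Complex R y) - F (Complex T y))) {T..R}" if "0 < y" "y < 2 * pi" for y
  proof (rule fundamental_theorem_of_calculus[OF TR])
    fix x assume "x \<in> {T..R}"
    have "((\<lambda>x. F (of_real x + \<i> * of_real y)) has_vector_derivative f (of_real x + \<i> * of_real y)) (at x)"
    proof (rule has_vector_derivative_real_field)
      have "((\<lambda>w. F (w + \<i> * of_real y)) has_field_derivative f (of_real x + \<i> * of_real y) * (1 + 0)) (at (of_real x))"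
        by (rule DERIV_chain2[of F]) (auto intro!: derivative_eq_intros F simp: strip_def that)
      then show "((\<lambda>w. F (w + \<i> * of_real y)) has_field_derivative f (of_real x + \<i> * of_real y)) (at (of_real x))" by simp
    qed
    then show "((\<lambda>x. F (Complex x y)) has_vector_derivative f (Complex x y)) (at x within {T..R})"
      by (simp add: Complex_eq has_vector_derivative_at_within)
  qed
  have ver: "((\<lambda>\<theta>. \<i> * f (Complex x \<theta>)) has_integral (F (Complex x pi) - F (Complex x e))) {e..pi}" for x
  proof (rule fundamental_theorem_of_calculus[OF e(2)])
    fix \<theta> assume t: "\<theta> \<in> {e..pi}"
    have "((\<lambda>\<theta>. F (of_real x + \<i> * of_real \<theta>)) has_vector_derivative \<i> * f (of_real x + \<i> * of_real \<theta>)) (at \<theta>)"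
    proof (rule has_vector_derivative_real_field)
      have "((\<lambda>w. F (of_real x + \<i> * w)) has_field_derivative f (of_real x + \<i> * of_real \<theta>) * (0 + \<i> * 1)) (at (of_real \<theta>))"
        by (rule DERIV_chain2[of F]) (use t e in \<open>auto intro!: derivative_eq_intros F simp: strip_def\<close>)
      then show "((\<lambda>w. F (of_real x + \<i> * w)) has_field_derivative \<i> * f (of_real x + \<i> * of_real \<theta>)) (at (of_real \<theta>))"
        by (simp add: mult.commute)
    qed
    then show "((\<lambda>\<theta>. F (Complex x \<theta>)) has_vector_derivative \<i> * f (Complex x \<theta>)) (at \<theta> within {e..pi})"
      by (simp add: Complex_eq has_vector_derivative_at_within)
  qed
  have Im0: "Im (F (Complex R pi)) = Im (F (Complex T pi))"
  proof -
    have "((\<lambda>x. Im (f (Complex x pi))) has_integral Im (F (Complex R pi) - F (Complex T pi))) {T..R}"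
      by (rule has_integral_Im[OF hor]) auto
    then have "((\<lambda>x. 0) has_integral Im (F (Complex R pi) - F (Complex T pi))) {T..R}" by (simp only: real)
    then have "Im (F (Complex R pi) - F (Complex T pi)) = 0" using has_integral_0_eq by blast
    then show ?thesis by simp
  qed
  have Re_ver: "Re (integral {e..pi} (\<lambda>\<theta>. f (Complex x \<theta>))) = Im (F (Complex x pi)) - Im (F (Complex x e))" for x
  proof -
    have "((\<lambda>\<theta>. (- \<i>) * (\<i> * f (Complex x \<theta>))) has_integral (- \<i>) * (F (Complex x pi) - F (Complex x e))) {e..pi}"
      by (rule has_integral_mult_right[OF ver])
    then have "integral {e..pi} (\<lambda>\<theta>. f (Complex x \<theta>)) = (- \<i>) * (F (Complex x pi) - F (Complex x e))"
      by (simp add: integral_unique)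
    then show ?thesis by simp
  qed
  have "integral {T..R} (\<lambda>x. f (Complex x e)) = F (Complex R e) - F (Complex T e)"
    by (rule integral_unique[OF hor]) (use e pi_gt_zero in linarith)+
  then show ?thesis unfolding Re_ver using Im0 by simp
qed

section \<open>Power series coefficients from a half circle\<close>

lemma cos_integral_0_pi:
  fixes m :: int
  shows "integral {0..pi} (\<lambda>\<theta>. cos (of_int m * \<theta>)) = (if m = 0 then pi else 0)"
proof (cases "m = 0")
  case False
  have "((\<lambda>\<theta>. cos (of_int m * \<theta>)) has_integral (sin (of_int m * pi) / of_int m - sin (of_int m * 0) / of_int m)) {0..pi}"
  proof (rule fundamental_theorem_of_calculus)
    fix x :: real
    have "((\<lambda>\<theta>. sin (of_int m * \<theta>) / of_int m) has_real_derivative cos (of_int m * x)) (at x within {0..pi})"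
      using False by (auto intro!: derivative_eq_intros)
    then show "((\<lambda>\<theta>. sin (of_int m * \<theta>) / of_int m) has_vector_derivative cos (of_int m * x)) (at x within {0..pi})"
      by (simp add: has_real_derivative_iff_has_vector_derivative)
  qed simp
  moreover have "sin (of_int m * pi) = 0" by (simp add: sin_zero_iff_int2)
  ultimately show ?thesis using False by (simp add: integral_unique)
qed simp

text \<open>Orthogonality of cosines on the circle of radius \<open>exp (- 1)\<close>, parametrised
  by \<open>r = exp (- Complex 1 \<theta>)\<close>. As the \<open>c k\<close> are real, the real
  part over the half circle carries the full information. The sum is available for
  \<open>\<theta> > 0\<close>; the endpoint 0, where the cut starts, is a null set.\<close>

lemma circle_coefficient:
  fixes c :: "nat \<Rightarrow> real"
  assumes B: "\<And>k. \<bar>c k\<bar> \<le> B"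
    and g: "\<And>\<theta>. 0 < \<theta> \<Longrightarrow> \<theta> \<le> pi \<Longrightarrow> (\<lambda>k. exp (- Complex 1 \<theta>) ^ k * of_real (c k)) sums g \<theta>"
  shows "integral {0..pi} (\<lambda>\<theta>. Re (exp (of_nat N * Complex 1 \<theta>) * g \<theta>)) = pi * c N"
    and "(\<lambda>\<theta>. Re (exp (of_nat N * Complex 1 \<theta>) * g \<theta>)) integrable_on {0..pi}"
proof -
  define h where "h k \<theta> = c k * exp (real N - real k) * cos (of_int (int N - int k) * \<theta>)" for k \<theta>
  have term_eq: "Re (exp (of_nat N * Complex 1 \<theta>) * (exp (- Complex 1 \<theta>) ^ k * of_real (c k))) = h k \<theta>" for k \<theta>
  proof -
    have "exp (of_nat N * Complex 1 \<theta>) * exp (- Complex 1 \<theta>) ^ k = exp (Complex (real N - real k) ((real N - real k) * \<theta>))"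
      unfolding exp_of_nat_mult[symmetric] exp_add[symmetric]
      by (rule arg_cong[where f=exp]) (simp add: complex_eq_iff algebra_simps)
    note E = this
    have E2: "exp (of_nat N * Complex 1 \<theta>) * (exp (- Complex 1 \<theta>) ^ k * of_real (c k)) = of_real (c k) * exp (Complex (real N - real k) ((real N - real k) * \<theta>))"
      unfolding mult.assoc[symmetric] E by (rule mult.commute)
    show ?thesis unfolding E2 h_def by (simp add: Re_exp)
  qed
  have B0: "0 \<le> B" using B[of 0] by linarith
  have hb: "\<bar>h k \<theta>\<bar> \<le> B * exp (real N) * exp (- 1) ^ k" for k \<theta>
  proof -
    have "\<bar>h k \<theta>\<bar> \<le> B * exp (real N - real k) * 1"
      unfolding h_def abs_mult using B[of k] B0 by (intro mult_mono) auto
    also have "exp (real N - real k) = exp (real N) * exp (- 1) ^ k"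
      by (simp add: exp_of_nat_mult[symmetric] exp_add[symmetric])
    finally show ?thesis by simp
  qed
  have sg: "summable (\<lambda>k. B * exp (real N) * exp (- 1 :: real) ^ k)"
    by (intro summable_mult summable_geometric) simp
  have ul: "uniform_limit {0..pi} (\<lambda>n \<theta>. \<Sum>k<n. h k \<theta>) (\<lambda>\<theta>. \<Sum>k. h k \<theta>) sequentially"
    by (rule Weierstrass_m_test[OF _ sg]) (use hb in auto)
  have hc: "continuous_on {0..pi} (\<lambda>\<theta>. \<Sum>k<n. h k \<theta>)" for n
    unfolding h_def by (intro continuous_intros)
  have sc: "continuous_on {0..pi} (\<lambda>\<theta>. \<Sum>k. h k \<theta>)"
    by (rule uniform_limit_theorem[OF _ ul]) (use hc in auto)
  have lim: "(\<lambda>n. integral {0..pi} (\<lambda>\<theta>. \<Sum>k<n. h k \<theta>)) \<longlonglongrightarrow> integral {0..pi} (\<lambda>\<theta>. \<Sum>k. h k \<theta>)"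
  proof -
    have "norm ((\<Sum>k<n. h k \<theta>)) \<le> (\<Sum>k. B * exp (real N) * exp (- 1 :: real) ^ k)" for n \<theta>
    proof -
      have "norm ((\<Sum>k<n. h k \<theta>)) \<le> (\<Sum>k<n. B * exp (real N) * exp (- 1 :: real) ^ k)"
        by (rule sum_norm_le) (use hb in auto)
      also have "\<dots> \<le> (\<Sum>k. B * exp (real N) * exp (- 1 :: real) ^ k)"
        using B0 by (intro sum_le_suminf sg) auto
      finally show ?thesis .
    qed
    moreover have "(\<lambda>n. \<Sum>k<n. h k \<theta>) \<longlonglongrightarrow> (\<Sum>k. h k \<theta>)" for \<theta>
      by (rule summable_LIMSEQ, rule summable_comparison_test'[OF sg]) (use hb in auto)
    ultimately show ?thesis
      by (intro dominated_convergence(2)[where h="\<lambda>_. \<Sum>k. B * exp (real N) * exp (- 1 :: real) ^ k"])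
         (use hc in \<open>auto intro: integrable_continuous_real\<close>)
  qed
  have hk: "integral {0..pi} (h k) = (if k = N then pi * c N else 0)" for k
    unfolding h_def[abs_def] integral_mult_right cos_integral_0_pi by auto
  have "integral {0..pi} (\<lambda>\<theta>. \<Sum>k<n. h k \<theta>) = (\<Sum>k<n. if k = N then pi * c N else 0)" for n
    unfolding hk[symmetric]
    by (rule integral_sum) (auto simp: h_def[abs_def] intro!: integrable_continuous_real continuous_intros)
  moreover have "(\<lambda>n. \<Sum>k<n. if k = N then pi * c N else 0) \<longlonglongrightarrow> pi * c N"
    using sums_single[of N "\<lambda>_. pi * c N"] unfolding sums_def by simp
  ultimately have val: "integral {0..pi} (\<lambda>\<theta>. \<Sum>k. h k \<theta>) = pi * c N"
    using lim by (simp add: LIMSEQ_unique)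
  have eq: "(\<Sum>k. h k \<theta>) = Re (exp (of_nat N * Complex 1 \<theta>) * g \<theta>)" if "\<theta> \<in> {0..pi} - {0}" for \<theta>
  proof -
    have "(\<lambda>k. Re (exp (of_nat N * Complex 1 \<theta>) * (exp (- Complex 1 \<theta>) ^ k * of_real (c k)))) sums Re (exp (of_nat N * Complex 1 \<theta>) * g \<theta>)"
      using that by (intro sums_Re sums_mult g) auto
    then show ?thesis unfolding term_eq by (rule sums_unique[symmetric])
  qed
  show "integral {0..pi} (\<lambda>\<theta>. Re (exp (of_nat N * Complex 1 \<theta>) * g \<theta>)) = pi * c N"
    unfolding val[symmetric] by (rule integral_spike[of "{0}"]) (use eq in auto)
  show "(\<lambda>\<theta>. Re (exp (of_nat N * Complex 1 \<theta>) * g \<theta>)) integrable_on {0..pi}"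
    by (rule integrable_spike[OF integrable_continuous_real[OF sc], of "{0}"]) (use eq in auto)
qed

section \<open>Boundary values of the logarithm\<close>

lemma cmod_Ln_le: "w \<noteq> 0 \<Longrightarrow> cmod (Ln w) \<le> \<bar>ln (cmod w)\<bar> + pi"
  using cmod_le[of "Ln w"] mpi_less_Im_Ln[of w] Im_Ln_le_pi[of w] by (simp add: Re_Ln)

text \<open>The approach is from \<open>Im v > 0\<close>, where \<open>1 - y * exp (- v)\<close> has
  positive imaginary part near the axis; where the limit is negative, the principal logarithm
  therefore picks up \<open>+ \<i> * pi\<close>.\<close>

lemma Ln_approach_real:
  assumes e: "e \<longlonglongrightarrow> 0" "\<And>n. 0 < e n" "\<And>n. e n < pi" and y: "0 \<le> y" "y \<noteq> 1"
  shows "(\<lambda>n. Ln (1 - of_real y * exp (- Complex 0 (e n)))) \<longlonglongrightarrow> of_real (ln \<bar>1 - y\<bar>) + (if 1 < y then \<i> * of_real pi else 0)"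
proof -
  let ?w = "\<lambda>n. 1 - of_real y * exp (- Complex 0 (e n))"
  have "(\<lambda>n. - Complex 0 (e n)) \<longlonglongrightarrow> - Complex 0 0" using e(1) by (intro tendsto_intros)
  then have "(\<lambda>n. exp (- Complex 0 (e n))) \<longlonglongrightarrow> exp (- Complex 0 0)" by (rule tendsto_exp)
  then have "?w \<longlonglongrightarrow> 1 - of_real y * exp (- Complex 0 0)"
    by (rule tendsto_diff[OF tendsto_const tendsto_mult[OF tendsto_const]])
  then have w: "?w \<longlonglongrightarrow> of_real (1 - y)" by (simp add: Complex_eq)
  show ?thesis
  proof (cases "1 < y")
    case False
    then have y1: "0 < 1 - y" using y by simp
    then have "(\<lambda>n. Ln (?w n)) \<longlonglongrightarrow> Ln (of_real (1 - y))"
      by (intro tendsto_Ln w) (simp add: complex_nonpos_Reals_iff)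
    also have "Ln (of_real (1 - y)) = of_real (ln \<bar>1 - y\<bar>)" unfolding abs_of_pos[OF y1] by (rule Ln_of_real[OF y1])
    finally show ?thesis using False by simp
  next
    case True
    then have y1: "0 < y - 1" by simp
    have im: "0 < Im (?w n)" for n
    proof -
      have "Im (?w n) = y * sin (e n)" by (simp add: Im_exp)
      then show ?thesis using True sin_gt_zero[OF e(2,3)[of n]] by simp
    qed
    have "(\<lambda>n. Ln (- ?w n)) \<longlonglongrightarrow> Ln (of_real (y - 1))"
      using tendsto_minus[OF w] y1 by (intro tendsto_Ln) (simp_all add: complex_nonpos_Reals_iff)
    then have "(\<lambda>n. Ln (- ?w n) + \<i> * of_real pi) \<longlonglongrightarrow> of_real (ln (y - 1)) + \<i> * of_real pi"
      unfolding Ln_of_real[OF y1] by (rule tendsto_add[OF _ tendsto_const])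
    moreover have "Ln (- ?w n) + \<i> * of_real pi = Ln (?w n)" for n
      using im[of n] by (subst Ln_minus) (auto simp: complex_eq_iff)
    ultimately show ?thesis using True by simp
  qed
qed

context levy_symbol
begin

definition phi :: "real \<Rightarrow> real \<Rightarrow> real" where "phi \<delta> z = exp (- \<delta> * \<psi> (z\<^sup>2))"

lemma phi_measurable [measurable]: "phi \<delta> \<in> borel_measurable borel"
  unfolding phi_def[abs_def] by measurable

lemma phi_range: "0 < \<delta> \<Longrightarrow> 0 \<le> phi \<delta> z" "0 < \<delta> \<Longrightarrow> phi \<delta> z \<le> 1" "0 < phi \<delta> z"
   "0 < \<delta> \<Longrightarrow> z \<noteq> 0 \<Longrightarrow> phi \<delta> z < 1"
  using nonneg[of "z\<^sup>2"] pos[of "z\<^sup>2"] by (auto simp: phi_def)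

text \<open>Up to the factor \<open>- 1 / 2\<close>, the contribution of \<open>a\<close> to the
  exponent of the generating function of the walk at \<open>r = exp (- v)\<close>.\<close>

definition log_mean :: "real \<Rightarrow> real \<Rightarrow> complex \<Rightarrow> complex" where
  "log_mean \<delta> a v = (\<integral>z. Ln (1 - of_real (phi \<delta> z) * exp (- v)) \<partial>hc a)"

definition bdry_log :: "real \<Rightarrow> real \<Rightarrow> real \<Rightarrow> real" where
  "bdry_log \<delta> x z = ln \<bar>1 - phi \<delta> z * exp (- x)\<bar>"

lemma bdry_log_measurable [measurable]: "(\<lambda>(x, z). bdry_log \<delta> x z) \<in> borel_measurable (borel \<Otimes>\<^sub>M borel)"
  unfolding bdry_log_def[abs_def] by measurable

lemma log_mean_holomorphic: "0 < a \<Longrightarrow> 0 < \<delta> \<Longrightarrow> log_mean \<delta> a holomorphic_on strip"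
  unfolding log_mean_def[abs_def] by (rule Ln_integral_strip(1)[OF hc_prob(1)]) (use phi_range in auto)

lemma log_mean_integrable: "0 < a \<Longrightarrow> 0 < \<delta> \<Longrightarrow> v \<in> strip \<Longrightarrow> integrable (hc a) (\<lambda>z. Ln (1 - of_real (phi \<delta> z) * exp (- v)))"
  by (rule Ln_integral_strip(2)[OF hc_prob(1)]) (use phi_range in auto)

lemma log_mean_Re_ge:
  assumes a: "0 < a" and d: "0 < \<delta>" and v: "v \<in> strip" and g: "integrable (hc a) g"
    and le: "AE z in hc a. g z \<le> ln (cmod (1 - of_real (phi \<delta> z) * exp (- v)))"
  shows "(\<integral>z. g z \<partial>hc a) \<le> Re (log_mean \<delta> a v)"
proof -
  have nz: "1 - of_real (phi \<delta> z) * exp (- v) \<noteq> 0" for z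
    using strip_nonpos[OF phi_range(1)[OF d] v, of z] by auto
  have "Re (log_mean \<delta> a v) = (\<integral>z. Re (Ln (1 - of_real (phi \<delta> z) * exp (- v))) \<partial>hc a)"
    unfolding log_mean_def by (rule integral_Re[symmetric]) (rule log_mean_integrable[OF a d v])
  moreover have "(\<integral>z. g z \<partial>hc a) \<le> (\<integral>z. Re (Ln (1 - of_real (phi \<delta> z) * exp (- v))) \<partial>hc a)"
    by (rule integral_mono_AE[OF g integrable_Re[OF log_mean_integrable[OF a d v]]]) (use le nz in \<open>simp add: Re_Ln\<close>)
  ultimately show ?thesis by simp
qed

text \<open>For a fixed real part the distance of \<open>phi \<delta> z * exp (- v)\<close> from 1
  is smallest on the real axis. Hence boundary values control the logarithm from below throughout
  the strip.\<close>

lemma bdry_log_le: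
  assumes "\<bar>1 - phi \<delta> z * exp (- x)\<bar> \<noteq> 0"
  shows "bdry_log \<delta> x z \<le> ln (cmod (1 - of_real (phi \<delta> z) * exp (- Complex x e)))"
proof -
  have "cmod (of_real (phi \<delta> z) * exp (- Complex x e)) = phi \<delta> z * exp (- x)"
    using phi_range(3)[of \<delta> z] by (simp add: norm_mult)
  then have "\<bar>1 - phi \<delta> z * exp (- x)\<bar> \<le> cmod (1 - of_real (phi \<delta> z) * exp (- Complex x e))"
    using norm_triangle_ineq3[of 1 "of_real (phi \<delta> z) * exp (- Complex x e)"] by simp
  then show ?thesis unfolding bdry_log_def using assms by (subst ln_le_cancel_iff) auto
qed

text \<open>By concavity \<open>\<psi> (z\<^sup>2)\<close> is at least
  \<open>\<psi>' 1 * min 1 (z\<^sup>2) / 2\<close>, so \<open>1 - phi \<delta> z\<close> vanishes at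
  most quadratically at 0 and its logarithm has an integrable lower bound. This controls the
  approach to the branch point \<open>x = 0\<close> from the right.\<close>

lemma one_minus_phi_ge:
  assumes d: "0 < \<delta>"
  obtains g where "\<And>z. 0 < z \<Longrightarrow> g z \<le> ln (1 - phi \<delta> z)" "\<And>a. 0 < a \<Longrightarrow> integrable (hc a) g"
proof -
  define C where "C = 1 + 2 / (\<delta> * \<psi>' 1)"
  have C: "1 \<le> C" using d der_pos[of 1] by (simp add: C_def)
  define g where "g z = - (ln C + 2 * \<bar>ln z\<bar>)" for z :: real
  show thesis
  proof (rule that[of g])
    show "integrable (hc a) g" if "0 < a" for a
    proof -
      interpret H: prob_space "hc a" by (rule hc_prob[OF that])
      show ?thesis unfolding g_def using hc_ln_integrable[OF that] by auto
    qed
    fix z :: real assume z: "0 < z"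
    define p where "p = \<psi> (z\<^sup>2)"
    have p: "0 < p" using pos z by (simp add: p_def)
    have pl: "\<psi>' 1 * min 1 (z\<^sup>2) / 2 \<le> p"
    proof -
      define m where "m = min 1 (z\<^sup>2)"
      have m: "0 < m" "m \<le> 1" "m \<le> z\<^sup>2" using z by (auto simp: m_def)
      \<comment> \<open>The chord runs from \<open>m / 2\<close> to \<open>m\<close>, because the
        slope bound concerns positive arguments.\<close>
      have "\<psi>' 1 * (m / 2) \<le> \<psi>' m * (m / 2)"
        using der_anti[of m 1] m by (intro mult_right_mono) auto
      also have "\<dots> \<le> \<psi> m - \<psi> (m / 2)" using slope_le[of m "m / 2"] m by simp
      also have "\<dots> \<le> \<psi> m" using nonneg[of "m / 2"] m by simp
      also have "\<dots> \<le> p" unfolding p_def using less[of m "z\<^sup>2"] m by (cases "m = z\<^sup>2") auto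
      finally show ?thesis by (simp add: m_def)
    qed
    have "1 + 1 / (\<delta> * p) \<le> C * max 1 (1 / z\<^sup>2)"
    proof -
      have mm: "0 < \<psi>' 1 * min 1 (z\<^sup>2)" using z der_pos[of 1] by simp
      have "1 / (\<delta> * p) \<le> 1 / (\<delta> * (\<psi>' 1 * min 1 (z\<^sup>2) / 2))" using pl d mm p by (intro divide_left_mono mult_left_mono) auto
      also have "\<dots> = 2 / (\<delta> * \<psi>' 1) * max 1 (1 / z\<^sup>2)" using z by (auto simp: min_def max_def field_simps)
      finally have "1 / (\<delta> * p) \<le> 2 / (\<delta> * \<psi>' 1) * max 1 (1 / z\<^sup>2)" .
      then show ?thesis unfolding C_def distrib_right by (intro add_mono) auto
    qed
    moreover have "ln (C * max 1 (1 / z\<^sup>2)) \<le> ln C + 2 * \<bar>ln z\<bar>"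
      using C z by (subst ln_mult_pos) (auto simp: max_def ln_div ln_realpow less_max_iff_disj)
    moreover have "0 < 1 + 1 / (\<delta> * p)" using d p by (simp add: add_pos_pos)
    ultimately have "ln (1 + 1 / (\<delta> * p)) \<le> ln C + 2 * \<bar>ln z\<bar>"
      by (meson ln_mono order_trans)
    moreover have "1 / (1 + 1 / (\<delta> * p)) \<le> 1 - phi \<delta> z"
      using one_minus_exp_bounds(1)[of "\<delta> * p"] d p phi_range(4)[OF d, of z] z by (simp add: phi_def p_def[symmetric] field_simps)
    then have "ln (1 / (1 + 1 / (\<delta> * p))) \<le> ln (1 - phi \<delta> z)"
      using d p by (intro ln_mono) (auto intro!: divide_pos_pos add_pos_pos)
    moreover have "ln (1 / (1 + 1 / (\<delta> * p))) = - ln (1 + 1 / (\<delta> * p))"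
      using \<open>0 < 1 + 1 / (\<delta> * p)\<close> ln_divide_pos[of 1 "1 + 1 / (\<delta> * p)"] by simp
    ultimately show "g z \<le> ln (1 - phi \<delta> z)" unfolding g_def by linarith
  qed
qed

lemma bdry_log_integrable_pos:
  assumes a: "0 < a" and d: "0 < \<delta>" and x: "0 < x"
  shows "integrable (hc a) (bdry_log \<delta> x)"
proof -
  interpret H: prob_space "hc a" by (rule hc_prob[OF a])
  show ?thesis
  proof (rule H.integrable_const_bound[where B="- ln (1 - exp (- x))"])
    have "\<bar>bdry_log \<delta> x z\<bar> \<le> - ln (1 - exp (- x))" for z
    proof -
      have "phi \<delta> z * exp (- x) \<le> 1 * exp (- x)" using phi_range(2)[OF d] by (intro mult_right_mono) auto
      then have lo: "1 - exp (- x) \<le> 1 - phi \<delta> z * exp (- x)" by simp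
      have p: "0 < 1 - exp (- x)" using x by simp
      have hi: "1 - phi \<delta> z * exp (- x) \<le> 1" using phi_range(3)[of \<delta> z] by simp
      have "ln (1 - exp (- x)) \<le> ln (1 - phi \<delta> z * exp (- x))" using lo p by (intro ln_mono) auto
      moreover have "ln (1 - phi \<delta> z * exp (- x)) \<le> ln 1" by (rule ln_mono) (use lo p hi in linarith)+
      moreover have "bdry_log \<delta> x z = ln (1 - phi \<delta> z * exp (- x))"
      proof -
        have "0 < 1 - phi \<delta> z * exp (- x)" using lo p by linarith
        then show ?thesis unfolding bdry_log_def by (simp only: abs_of_pos)
      qed
      moreover have "\<bar>u\<bar> \<le> - w" if "w \<le> u" "u \<le> 0" for u w :: real using that by linarith
      ultimately show ?thesis by simp
    qed
    then show "AE z in hc a. norm (bdry_log \<delta> x z) \<le> - ln (1 - exp (- x))" by simp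
  qed (unfold bdry_log_def[abs_def], measurable)
qed

text \<open>On the cut the logarithm is singular at \<open>z = l\<close>. The singularity is
  isolated in \<open>ln \<bar>z\<^sup>2 - l\<^sup>2\<bar>\<close>, whose mean is explicit; the rest
  is the dominated term \<open>ln (ratio_step \<delta> l z)\<close>.\<close>

lemma bdry_log_eq_ratio:
  assumes l: "0 < l" and z: "0 < z" "z \<noteq> l" and d: "0 < \<delta>"
  shows "bdry_log \<delta> (- \<delta> * \<psi> (l\<^sup>2)) z = ln (\<delta> * \<psi>' (l\<^sup>2)) + ln \<bar>z\<^sup>2 - l\<^sup>2\<bar> - ln (ratio_step \<delta> l z)"
proof -
  define y where "y = \<delta> * (\<psi> (z\<^sup>2) - \<psi> (l\<^sup>2))"
  have y0: "y \<noteq> 0" using psi_ne[OF l z] d by (simp add: y_def)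
  have b: "bdry_log \<delta> (- \<delta> * \<psi> (l\<^sup>2)) z = ln \<bar>1 - exp (- y)\<bar>"
    by (simp add: bdry_log_def phi_def y_def exp_add[symmetric] algebra_simps)
  have pd: "0 < \<delta> * \<psi>' (l\<^sup>2)" using d der_pos l by simp
  have zl: "0 < \<bar>z\<^sup>2 - l\<^sup>2\<bar>" using l z by (auto simp: power2_eq_iff)
  have p1: "0 < \<bar>1 - exp (- y)\<bar>" using y0 by simp
  have "ratio_step \<delta> l z = \<delta> * \<psi>' (l\<^sup>2) * \<bar>z\<^sup>2 - l\<^sup>2\<bar> / \<bar>1 - exp (- y)\<bar>" by (simp add: ratio_step_def y_def)
  then have "ln (ratio_step \<delta> l z) = ln (\<delta> * \<psi>' (l\<^sup>2)) + ln \<bar>z\<^sup>2 - l\<^sup>2\<bar> - ln \<bar>1 - exp (- y)\<bar>"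
    using ln_divide_pos[OF mult_pos_pos[OF pd zl] p1] ln_mult_pos[OF pd zl] by simp
  then show ?thesis using b by simp
qed

lemma bdry_log_integral_neg:
  assumes a: "0 < a" and l: "0 < l" and d: "0 < \<delta>"
  shows "integrable (hc a) (bdry_log \<delta> (- \<delta> * \<psi> (l\<^sup>2)))"
    and "(\<integral>z. bdry_log \<delta> (- \<delta> * \<psi> (l\<^sup>2)) z \<partial>hc a) = ln (\<delta> * \<psi>' (l\<^sup>2)) + ln (a\<^sup>2 + l\<^sup>2) - (\<integral>z. ln (ratio_step \<delta> l z) \<partial>hc a)"
proof -
  interpret H: prob_space "hc a" by (rule hc_prob[OF a])
  let ?g = "\<lambda>z. ln (\<delta> * \<psi>' (l\<^sup>2)) + ln \<bar>z\<^sup>2 - l\<^sup>2\<bar> - ln (ratio_step \<delta> l z)"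
  have ae: "AE z in hc a. bdry_log \<delta> (- \<delta> * \<psi> (l\<^sup>2)) z = ?g z"
    using hc_AE_pos hc_AE_ne[where a=a and l=l] by eventually_elim (use bdry_log_eq_ratio[OF l _ _ d] in auto)
  have m: "bdry_log \<delta> (- \<delta> * \<psi> (l\<^sup>2)) \<in> borel_measurable (hc a)" unfolding bdry_log_def[abs_def] by measurable
  have gi: "integrable (hc a) ?g"
    using hc_ln_abs_diff(1)[OF a l] ln_ratio_step_integrable[OF a l d] by auto
  show "integrable (hc a) (bdry_log \<delta> (- \<delta> * \<psi> (l\<^sup>2)))"
    by (rule iffD2[OF integrable_cong_AE[OF m _ ae] gi]) measurable
  have "(\<integral>z. bdry_log \<delta> (- \<delta> * \<psi> (l\<^sup>2)) z \<partial>hc a) = (\<integral>z. ?g z \<partial>hc a)"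
    by (rule integral_cong_AE[OF m _ ae]) measurable
  also have "\<dots> = ln (\<delta> * \<psi>' (l\<^sup>2)) + ln (a\<^sup>2 + l\<^sup>2) - (\<integral>z. ln (ratio_step \<delta> l z) \<partial>hc a)"
    using hc_ln_abs_diff[OF a l] ln_ratio_step_integrable[OF a l d] H.prob_space by simp
  finally show "(\<integral>z. bdry_log \<delta> (- \<delta> * \<psi> (l\<^sup>2)) z \<partial>hc a) = ln (\<delta> * \<psi>' (l\<^sup>2)) + ln (a\<^sup>2 + l\<^sup>2) - (\<integral>z. ln (ratio_step \<delta> l z) \<partial>hc a)" .
qed

text \<open>The intermediate value theorem for \<open>l \<mapsto> \<psi> (l\<^sup>2)\<close> between
  0 and infinity. The spectral variable \<open>l\<close> thereby parametrises the whole cut.\<close>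

lemma neg_reparam:
  assumes d: "0 < \<delta>" and x: "x < 0"
  obtains l where "0 < l" "x = - \<delta> * \<psi> (l\<^sup>2)"
proof -
  have "filterlim (\<lambda>l::real. \<psi> (l\<^sup>2)) at_top at_top"
    by (rule filterlim_compose[OF at_inf]) real_asymp
  then have "eventually (\<lambda>l. - x / \<delta> \<le> \<psi> (l\<^sup>2)) at_top" by (simp add: filterlim_at_top)
  then obtain R where R: "\<And>l. l \<ge> R \<Longrightarrow> - x / \<delta> \<le> \<psi> (l\<^sup>2)" by (auto simp: eventually_at_top_linorder)
  have "\<exists>l\<ge>0. l \<le> max R 0 \<and> \<psi> (l\<^sup>2) = - x / \<delta>"
    by (rule IVT) (use R[of "max R 0"] d x at_0 continuous_sq in \<open>auto simp: divide_le_0_iff\<close>)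
  then obtain l where l: "0 \<le> l" "\<psi> (l\<^sup>2) = - x / \<delta>" by blast
  have "l \<noteq> 0" using l x d at_0 by auto
  then show thesis using l d by (intro that[of l]) auto
qed

lemma bdry_log_integrable:
  assumes "0 < a" "0 < \<delta>" "x \<noteq> 0"
  shows "integrable (hc a) (bdry_log \<delta> x)"
proof (cases "0 < x")
  case False
  then have "x < 0" using assms by simp
  from neg_reparam[OF assms(2) this] obtain l where "0 < l" "x = - \<delta> * \<psi> (l\<^sup>2)" .
  then show ?thesis using bdry_log_integral_neg(1)[OF assms(1) _ assms(2)] by simp
qed (use bdry_log_integrable_pos assms in auto)

text \<open>The mass of those \<open>z\<close> at which the boundary value of the logarithm has
  imaginary part \<open>pi\<close>.\<close>

definition above :: "real \<Rightarrow> real \<Rightarrow> real \<Rightarrow> real" where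
  "above \<delta> a x = measure (hc a) {z. 1 < phi \<delta> z * exp (- x)}"

text \<open>The logarithm of the modulus is bounded below by \<open>bdry_log\<close> and above by
  \<open>ln (1 + exp (- x))\<close>, independently of the distance to the axis, so the pointwise
  limits may be integrated. The exceptional \<open>z\<close> with
  \<open>phi \<delta> z * exp (- x) = 1\<close> form a null set.\<close>

lemma log_mean_limit:
  assumes a: "0 < a" and d: "0 < \<delta>" and x: "x \<noteq> 0"
    and e: "e \<longlonglongrightarrow> 0" "\<And>n. 0 < e n" "\<And>n. e n < pi"
  shows "(\<lambda>n. log_mean \<delta> a (Complex x (e n))) \<longlonglongrightarrow> of_real (\<integral>z. bdry_log \<delta> x z \<partial>hc a) + \<i> * of_real (pi * above \<delta> a x)"
proof -
  interpret H: prob_space "hc a" by (rule hc_prob[OF a])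
  let ?y = "\<lambda>z. phi \<delta> z * exp (- x)"
  let ?A = "{z. 1 < ?y z}"
  have A: "?A \<in> sets (hc a)" by simp
  have ne: "AE z in hc a. ?y z \<noteq> 1"
  proof (cases "0 < x")
    case True
    have "?y z < 1" for z
    proof -
      have "?y z \<le> 1 * exp (- x)" using phi_range(2)[OF d] by (intro mult_right_mono) auto
      also have "\<dots> < 1" using True by simp
      finally show ?thesis .
    qed
    then show ?thesis by (intro AE_I2) (metis less_irrefl)
  next
    case False
    then have "x < 0" using x by simp
    from neg_reparam[OF d this] obtain l where l: "0 < l" "x = - \<delta> * \<psi> (l\<^sup>2)" .
    show ?thesis using hc_AE_pos hc_AE_ne[where a=a and l=l]
    proof eventually_elim
      case (elim z)
      then have "\<psi> (z\<^sup>2) \<noteq> \<psi> (l\<^sup>2)" using psi_ne[OF l(1)] by blast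
      moreover have "?y z = exp (\<delta> * (\<psi> (l\<^sup>2) - \<psi> (z\<^sup>2)))" by (simp add: phi_def l exp_add[symmetric] algebra_simps)
      ultimately show ?case using d by simp
    qed
  qed
  have inS: "Complex x (e n) \<in> strip" for n using e(2,3)[of n] pi_gt_zero by (simp add: strip_def)
  have split: "exp (- Complex x t) = of_real (exp (- x)) * exp (- Complex 0 t)" for t
    by (simp add: complex_eq_iff Re_exp Im_exp)
  have bi: "integrable (hc a) (bdry_log \<delta> x)" by (rule bdry_log_integrable[OF a d x])
  have "(\<lambda>n. \<integral>z. Ln (1 - of_real (phi \<delta> z) * exp (- Complex x (e n))) \<partial>hc a)
      \<longlonglongrightarrow> (\<integral>z. of_real (bdry_log \<delta> x z) + \<i> * of_real (pi * indicator ?A z) \<partial>hc a)"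
  proof (rule integral_dominated_convergence[where w="\<lambda>z. \<bar>bdry_log \<delta> x z\<bar> + ln (1 + exp (- x)) + pi"])
    show "(\<lambda>z. complex_of_real (bdry_log \<delta> x z) + \<i> * of_real (pi * indicator ?A z)) \<in> borel_measurable (hc a)"
      using bi A by measurable
    show "(\<lambda>z. Ln (1 - of_real (phi \<delta> z) * exp (- Complex x (e n)))) \<in> borel_measurable (hc a)" for n by measurable
    show "integrable (hc a) (\<lambda>z. \<bar>bdry_log \<delta> x z\<bar> + ln (1 + exp (- x)) + pi)" using bi by auto
    show "AE z in hc a. (\<lambda>n. Ln (1 - of_real (phi \<delta> z) * exp (- Complex x (e n)))) \<longlonglongrightarrow> of_real (bdry_log \<delta> x z) + \<i> * of_real (pi * indicator ?A z)"
      using ne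
    proof eventually_elim
      case (elim z)
      have "(\<lambda>n. Ln (1 - of_real (?y z) * exp (- Complex 0 (e n)))) \<longlonglongrightarrow> of_real (ln \<bar>1 - ?y z\<bar>) + (if 1 < ?y z then \<i> * of_real pi else 0)"
        by (rule Ln_approach_real[OF e]) (use elim phi_range(3)[of \<delta> z] in auto)
      note A = this
      have eq: "complex_of_real (phi \<delta> z) * exp (- Complex x t) = of_real (?y z) * exp (- Complex 0 t)" for t
        unfolding split by simp
      have rhs: "(if 1 < ?y z then \<i> * complex_of_real pi else 0) = \<i> * of_real (pi * indicator ?A z)"
        by (simp add: indicator_def)
      show ?case using A unfolding eq rhs bdry_log_def .
    qed
    show "AE z in hc a. cmod (Ln (1 - of_real (phi \<delta> z) * exp (- Complex x (e n)))) \<le> \<bar>bdry_log \<delta> x z\<bar> + ln (1 + exp (- x)) + pi" for n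
      using ne
    proof eventually_elim
      case (elim z)
      let ?w = "1 - of_real (phi \<delta> z) * exp (- Complex x (e n))"
      have nz: "?w \<noteq> 0" using strip_nonpos[OF phi_range(1)[OF d] inS, of z n] by auto
      have lo: "bdry_log \<delta> x z \<le> ln (cmod ?w)" by (rule bdry_log_le) (use elim in auto)
      have "cmod ?w \<le> 1 + phi \<delta> z * exp (- x)"
        using norm_triangle_ineq4[of 1 "of_real (phi \<delta> z) * exp (- Complex x (e n))"] phi_range(3)[of \<delta> z] by (simp add: norm_mult)
      also have "\<dots> \<le> 1 + exp (- x)" using mult_right_mono[OF phi_range(2)[OF d, of z], of "exp (- x)"] by simp
      finally have "ln (cmod ?w) \<le> ln (1 + exp (- x))" using nz by (intro ln_mono) auto
      moreover have "0 \<le> ln (1 + exp (- x))" by simp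
      ultimately have "\<bar>ln (cmod ?w)\<bar> \<le> \<bar>bdry_log \<delta> x z\<bar> + ln (1 + exp (- x))" using lo by linarith
      then show ?case using cmod_Ln_le[OF nz] by linarith
    qed
  qed
  moreover have "(\<integral>z. complex_of_real (bdry_log \<delta> x z) + \<i> * of_real (pi * indicator ?A z) \<partial>hc a)
     = of_real (\<integral>z. bdry_log \<delta> x z \<partial>hc a) + \<i> * of_real (pi * above \<delta> a x)"
  proof -
    have "integrable (hc a) (\<lambda>z. pi * indicator ?A z :: real)" by (intro integrable_mult_right integrable_real_indicator) (auto simp: H.emeasure_eq_measure)
    then have "(\<integral>z. complex_of_real (bdry_log \<delta> x z) + \<i> * of_real (pi * indicator ?A z) \<partial>hc a)
     = of_real (\<integral>z. bdry_log \<delta> x z \<partial>hc a) + \<i> * of_real (\<integral>z. pi * indicator ?A z \<partial>hc a)"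
      using bi by (subst Bochner_Integration.integral_add) (auto simp del: of_real_mult)
    then show ?thesis by (simp add: above_def)
  qed
  ultimately show ?thesis by (simp add: log_mean_def)
qed

lemma above_pos: "0 < \<delta> \<Longrightarrow> 0 < x \<Longrightarrow> above \<delta> a x = 0"
proof -
  assume d: "0 < \<delta>" and x: "0 < x"
  have "phi \<delta> z * exp (- x) < 1" for z
  proof -
    have "phi \<delta> z * exp (- x) \<le> 1 * exp (- x)" using phi_range(2)[OF d] by (intro mult_right_mono) auto
    also have "\<dots> < 1" using x by simp
    finally show ?thesis .
  qed
  then have "{z. 1 < phi \<delta> z * exp (- x)} = {}" by (auto simp: not_less intro: less_imp_le)
  then show ?thesis by (simp add: above_def)
qed

text \<open>As \<psi> is increasing, the set measured by \<open>above\<close> is the interval below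
  \<open>l\<close> up to a null set; its half-Cauchy mass turns the argument on the cut into an
  angle.\<close>

lemma above_neg: "0 < \<delta> \<Longrightarrow> 0 < a \<Longrightarrow> 0 < l \<Longrightarrow> above \<delta> a (- \<delta> * \<psi> (l\<^sup>2)) = 2 / pi * arctan (l / a)"
proof -
  assume d: "0 < \<delta>" and a: "0 < a" and l: "0 < l"
  interpret H: real_distribution "hc a" by (rule hc_prob[OF a])
  have "measure (hc a) {z. 1 < phi \<delta> z * exp (- (- \<delta> * \<psi> (l\<^sup>2)))} = measure (hc a) {..l}"
  proof (rule H.finite_measure_eq_AE)
    show "AE z in hc a. z \<in> {z. 1 < phi \<delta> z * exp (- (- \<delta> * \<psi> (l\<^sup>2)))} \<longleftrightarrow> z \<in> {..l}"
      using hc_AE_pos hc_AE_ne[where a=a and l=l]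
    proof eventually_elim
      case (elim z)
      have "1 < phi \<delta> z * exp (- (- \<delta> * \<psi> (l\<^sup>2))) \<longleftrightarrow> \<psi> (z\<^sup>2) < \<psi> (l\<^sup>2)"
        using d by (simp add: phi_def exp_add[symmetric])
      also have "\<dots> \<longleftrightarrow> z < l"
      proof (cases "z < l")
        case True
        then show ?thesis using less[of "z\<^sup>2" "l\<^sup>2"] elim l by (simp add: power_strict_mono)
      next
        case False
        then have "l\<^sup>2 < z\<^sup>2" using elim l by (intro power_strict_mono) auto
        then show ?thesis using less[of "l\<^sup>2" "z\<^sup>2"] False l by simp
      qed
      finally show ?case using elim by auto
    qed
  qed auto
  then show ?thesis using hc_cdf[OF a, of l] l by (simp add: above_def cdf_def)
qed

end

section \<open>Substitution along the branch cut\<close>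

lemma absolutely_integrable_borel:
  fixes f :: "real \<Rightarrow> real"
  assumes "(\<lambda>x. indicator S x *\<^sub>R f x) \<in> borel_measurable borel"
  shows "f absolutely_integrable_on S \<longleftrightarrow> set_integrable lborel S f"
    and "set_integrable lborel S f \<Longrightarrow> integral S f = (LBINT x:S. f x)"
proof -
  show "f absolutely_integrable_on S \<longleftrightarrow> set_integrable lborel S f"
    unfolding set_integrable_def using assms by (intro integrable_completion) simp
  show "set_integrable lborel S f \<Longrightarrow> integral S f = (LBINT x:S. f x)"
    by (rule set_borel_integral_eq_integral(2)[symmetric])
qed

context levy_symbol
begin

text \<open>Monotone functions are measurable; the indicator restricts to the half-line on which
  \<open>l \<mapsto> \<psi>' (l\<^sup>2)\<close> is known to be monotone.\<close>

lemma der_measurable: "(\<lambda>l. indicator {0<..} l * \<psi>' (l\<^sup>2)) \<in> borel_measurable borel"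
proof -
  have "mono_on {0<..} (\<lambda>l. - \<psi>' (l\<^sup>2))"
    by (intro mono_onI) (auto intro!: der_anti power_mono)
  then have "(\<lambda>l. - \<psi>' (l\<^sup>2)) \<in> borel_measurable (restrict_space borel {0<..})"
    by (rule borel_measurable_mono_on_fnc)
  then have "(\<lambda>l. - (- \<psi>' (l\<^sup>2))) \<in> borel_measurable (restrict_space borel {0<..})"
    by (rule borel_measurable_uminus)
  then show ?thesis
    by (subst (asm) borel_measurable_restrict_space_iff) auto
qed

text \<open>The map \<open>l \<mapsto> - \<delta> * \<psi> (l\<^sup>2)\<close> takes the half-line
  beyond \<open>c\<close> onto a left half-line, bijectively because \<psi> is strictly increasing
  and unbounded. The case \<open>c = 1\<close> serves integrability far out, the case
  \<open>c = 0\<close> covers the whole cut.\<close>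

lemma change_of_variables:
  fixes h :: "real \<Rightarrow> real"
  assumes h [measurable]: "h \<in> borel_measurable borel" and d: "0 < \<delta>" and c: "0 \<le> c"
  shows "set_integrable lborel {..< - \<delta> * \<psi> (c\<^sup>2)} h \<longleftrightarrow>
      set_integrable lborel {c<..} (\<lambda>l. \<delta> * \<psi>' (l\<^sup>2) * (2 * l) * h (- \<delta> * \<psi> (l\<^sup>2)))" (is "?A \<longleftrightarrow> ?B")
    and "set_integrable lborel {..< - \<delta> * \<psi> (c\<^sup>2)} h \<Longrightarrow>
      (LBINT x:{..< - \<delta> * \<psi> (c\<^sup>2)}. h x) = (LBINT l:{c<..}. \<delta> * \<psi>' (l\<^sup>2) * (2 * l) * h (- \<delta> * \<psi> (l\<^sup>2)))"
proof -
  let ?g = "\<lambda>l. - \<delta> * \<psi> (l\<^sup>2)" and ?g' = "\<lambda>l. - \<delta> * (\<psi>' (l\<^sup>2) * (2 * l))"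
  have lt: "?g y < ?g x" if "c \<le> x" "x < y" for x y
  proof -
    have xy: "x\<^sup>2 < y\<^sup>2" using that c by (intro power_strict_mono) auto
    have "\<psi> (x\<^sup>2) < \<psi> (y\<^sup>2)"
    proof (cases "x = 0")
      case True
      then show ?thesis using pos[of "y\<^sup>2"] xy at_0 by simp
    qed (use less[of "x\<^sup>2" "y\<^sup>2"] xy in auto)
    then show ?thesis using d by simp
  qed
  have inj: "inj_on ?g {c<..}"
    by (rule linorder_inj_onI') (metis lt greaterThan_iff less_imp_le less_irrefl)
  have img: "?g ` {c<..} = {..< ?g c}"
  proof (intro equalityI subsetI)
    fix x assume "x \<in> ?g ` {c<..}"
    then show "x \<in> {..< ?g c}" using lt[of c] by auto
  next
    fix x assume "x \<in> {..< ?g c}"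
    then have x: "x < ?g c" by simp
    have "?g c \<le> 0" using d nonneg[of "c\<^sup>2"] by simp
    then have "x < 0" using x by simp
    from neg_reparam[OF d this] obtain l where l: "0 < l" "x = ?g l" .
    have "c < l"
    proof (rule ccontr)
      assume "\<not> c < l"
      then have "l\<^sup>2 \<le> c\<^sup>2" using l by (intro power_mono) auto
      then have "\<psi> (l\<^sup>2) \<le> \<psi> (c\<^sup>2)" using less[of "l\<^sup>2" "c\<^sup>2"] l by (cases "l\<^sup>2 = c\<^sup>2") (auto intro: less_imp_le)
      then show False using x l d by simp
    qed
    then show "x \<in> ?g ` {c<..}" using l by auto
  qed
  have der': "(?g has_field_derivative ?g' x) (at x within {c<..})" if "x \<in> {c<..}" for x
  proof -
    have "((\<lambda>l. \<psi> (l\<^sup>2)) has_real_derivative \<psi>' (x\<^sup>2) * (2 * x)) (at x)"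
      by (rule DERIV_chain2[of \<psi>]) (use that c in \<open>auto intro!: der derivative_eq_intros\<close>)
    then show ?thesis by (intro DERIV_cmult) (rule has_field_derivative_at_within)
  qed
  note cov = has_absolute_integral_change_of_variables_1'[of "{c<..}" ?g ?g' h, OF _ der' inj, unfolded img]
  have abs_eq: "\<bar>?g' l\<bar> * h (?g l) = \<delta> * \<psi>' (l\<^sup>2) * (2 * l) * h (?g l)" if "l \<in> {c<..}" for l
    using that c d der_pos[of "l\<^sup>2"] by (simp add: abs_mult)
  have m1: "(\<lambda>x. indicator {..< ?g c} x *\<^sub>R h x) \<in> borel_measurable borel" by measurable
  have m2: "(\<lambda>l. indicator {c<..} l *\<^sub>R (\<delta> * \<psi>' (l\<^sup>2) * (2 * l) * h (?g l))) \<in> borel_measurable borel"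
  proof -
    note [measurable] = der_measurable
    have "(\<lambda>l. indicator {c<..} l * (\<delta> * (indicator {0<..} l * \<psi>' (l\<^sup>2)) * (2 * l) * h (?g l))) \<in> borel_measurable borel"
      by measurable
    moreover have "(\<lambda>l. indicator {c<..} l * (\<delta> * (indicator {0<..} l * \<psi>' (l\<^sup>2)) * (2 * l) * h (?g l))) = (\<lambda>l. indicator {c<..} l *\<^sub>R (\<delta> * \<psi>' (l\<^sup>2) * (2 * l) * h (?g l)))"
      using c by (auto simp: indicator_def fun_eq_iff)
    ultimately show ?thesis by (simp only:)
  qed
  have ai: "(\<lambda>l. \<bar>?g' l\<bar> * h (?g l)) absolutely_integrable_on {c<..} \<longleftrightarrow> ?B"
    unfolding absolutely_integrable_borel(1)[OF m2, symmetric]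
    by (rule set_integrable_cong[OF refl refl abs_eq])
  have int_eq: "integral {c<..} (\<lambda>l. \<bar>?g' l\<bar> * h (?g l)) = integral {c<..} (\<lambda>l. \<delta> * \<psi>' (l\<^sup>2) * (2 * l) * h (?g l))"
    by (rule integral_cong) (rule abs_eq)
  show AB: "?A \<longleftrightarrow> ?B"
    using cov[of "integral {..< ?g c} h"] cov[of "integral {c<..} (\<lambda>l. \<bar>?g' l\<bar> * h (?g l))"] ai absolutely_integrable_borel(1)[OF m1] by auto
  assume A: ?A
  then have "integral {c<..} (\<lambda>l. \<bar>?g' l\<bar> * h (?g l)) = integral {..< ?g c} h"
    using cov[of "integral {..< ?g c} h"] absolutely_integrable_borel(1)[OF m1] by auto
  then show "(LBINT x:{..< ?g c}. h x) = (LBINT l:{c<..}. \<delta> * \<psi>' (l\<^sup>2) * (2 * l) * h (?g l))"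
    unfolding int_eq using A AB absolutely_integrable_borel(2)[OF m1] absolutely_integrable_borel(2)[OF m2] by simp
qed

text \<open>For the walk with step \<delta> this takes the place of the Laplace transform at
  \<open>a\<close> of the eigenfunction with parameter \<open>l\<close>; \<open>eig\<close> is its
  limit as \<delta> tends to 0.\<close>

definition eig_step :: "real \<Rightarrow> real \<Rightarrow> real \<Rightarrow> real" where
  "eig_step \<delta> a l = l / (l\<^sup>2 + a\<^sup>2) * exp ((\<integral>z. ln (ratio_step \<delta> l z) \<partial>hc a) / 2)"

text \<open>Integrated form of the upper bound in \<open>ratio_step_bounds\<close>. It is free of
  \<delta>, and its dependence on \<open>l\<close> is confined to \<open>l < 1\<close>.\<close>

lemma eig_step_upper:
  assumes a: "0 < a" and l: "0 < l" and d: "0 < \<delta>" "\<delta> \<le> t"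
  shows "(\<integral>z. ln (ratio_step \<delta> l z) \<partial>hc a) \<le> 2 * max 0 (- ln l) + (\<integral>z. 2 * \<bar>ln z\<bar> + ln (1 + t * \<psi> (z\<^sup>2)) \<partial>hc a)"
proof -
  interpret H: prob_space "hc a" by (rule hc_prob[OF a])
  have t: "0 < t" using d by simp
  have i: "integrable (hc a) (\<lambda>z. 2 * \<bar>ln z\<bar> + ln (1 + t * \<psi> (z\<^sup>2)))"
    using hc_ln_integrable[OF a] ln_psi_integrable[OF a t] by auto
  have "(\<integral>z. ln (ratio_step \<delta> l z) \<partial>hc a) \<le> (\<integral>z. 2 * max 0 (- ln l) + (2 * \<bar>ln z\<bar> + ln (1 + t * \<psi> (z\<^sup>2))) \<partial>hc a)"
  proof (rule integral_mono_AE[OF ln_ratio_step_integrable[OF a l d(1)]])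
    show "AE z in hc a. ln (ratio_step \<delta> l z) \<le> 2 * max 0 (- ln l) + (2 * \<bar>ln z\<bar> + ln (1 + t * \<psi> (z\<^sup>2)))"
      using hc_AE_pos hc_AE_ne[where a=a and l=l]
    proof eventually_elim
      case (elim z)
      have "max 0 (ln z - ln l) \<le> max 0 (- ln l) + \<bar>ln z\<bar>" by linarith
      moreover have "x \<le> 2 * m + (2 * q + p)" if "x \<le> 2 * m' + p" "m' \<le> m + q" for x m m' p q :: real
        using that by linarith
      ultimately show ?case using ratio_step_bounds(1)[OF l elim d] by blast
    qed
  qed (use i in auto)
  also have "\<dots> = 2 * max 0 (- ln l) + (\<integral>z. 2 * \<bar>ln z\<bar> + ln (1 + t * \<psi> (z\<^sup>2)) \<partial>hc a)"
    using Bochner_Integration.integral_add[OF _ i, of "\<lambda>_. 2 * max 0 (- ln l)"] H.prob_space by simp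
  finally show ?thesis .
qed

text \<open>Modulus and argument of the integrand at the boundary point \<open>x\<close> of the strip.  They become a
  product of two \<open>eig_step\<close> terms after the substitution \<open>x = - \<delta> * \<psi> (l\<^sup>2)\<close>.\<close>

definition bdry_modulus :: "nat \<Rightarrow> real \<Rightarrow> real \<Rightarrow> real \<Rightarrow> real \<Rightarrow> real" where
  "bdry_modulus N \<delta> a b x = exp (real N * x) * exp (- (\<integral>z. bdry_log \<delta> x z \<partial>hc a) / 2 - (\<integral>z. bdry_log \<delta> x z \<partial>hc b) / 2)"

definition bdry_angle :: "real \<Rightarrow> real \<Rightarrow> real \<Rightarrow> real \<Rightarrow> real" where
  "bdry_angle \<delta> a b x = pi / 2 * (above \<delta> a x + above \<delta> b x)"

section \<open>Product form and integrability of the boundary integrand\<close>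

lemma bdry_modulus_measurable [measurable]:
  assumes "0 < a" "0 < b"
  shows "bdry_modulus N \<delta> a b \<in> borel_measurable borel" "bdry_angle \<delta> a b \<in> borel_measurable borel"
proof -
  interpret A: real_distribution "hc a" by (rule hc_prob) fact
  interpret B: real_distribution "hc b" by (rule hc_prob) fact
  show "bdry_modulus N \<delta> a b \<in> borel_measurable borel"
    unfolding bdry_modulus_def[abs_def] by measurable
  have "above \<delta> c x = (\<integral>z. indicator {p. 1 < phi \<delta> (snd p) * exp (- fst p)} (x, z) \<partial>hc c)" for c x
  proof -
    have "(\<integral>z. indicator {p. 1 < phi \<delta> (snd p) * exp (- fst p)} (x, z) \<partial>hc c) = (\<integral>z. indicator {z. 1 < phi \<delta> z * exp (- x)} z \<partial>hc c)"
      by (intro Bochner_Integration.integral_cong) (auto simp: indicator_def)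
    also have "\<dots> = above \<delta> c x" by (simp add: above_def)
    finally show ?thesis by (rule sym)
  qed
  then show "bdry_angle \<delta> a b \<in> borel_measurable borel"
    unfolding bdry_angle_def[abs_def] by simp measurable
qed

lemma exp_half_ln: "0 < x \<Longrightarrow> exp (- ln x / 2) = 1 / sqrt x" for x :: real
  using exp_ln[of x] by (simp add: exp_minus ln_sqrt[symmetric] inverse_eq_divide)

text \<open>Each of the two means of \<open>bdry_log\<close> contains
  \<open>ln (\<delta> * \<psi>' (l\<^sup>2))\<close> and enters with weight 1/2, so together they
  cancel the Jacobian. The halves of \<open>ln (a\<^sup>2 + l\<^sup>2)\<close> and
  \<open>ln (b\<^sup>2 + l\<^sup>2)\<close> give square roots, and the sine of
  \<open>arctan (l / a) + arctan (l / b)\<close> supplies the same square roots again; hence the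
  separation into \<open>eig_step\<close> factors.\<close>

lemma bdry_modulus_neg:
  assumes a: "0 < a" and b: "0 < b" and l: "0 < l" and d: "0 < \<delta>"
  shows "\<delta> * \<psi>' (l\<^sup>2) * (2 * l) * bdry_modulus N \<delta> a b (- \<delta> * \<psi> (l\<^sup>2)) =
      exp (- (real N * \<delta>) * \<psi> (l\<^sup>2)) * (2 * l) / (sqrt (a\<^sup>2 + l\<^sup>2) * sqrt (b\<^sup>2 + l\<^sup>2)) *
      (exp ((\<integral>z. ln (ratio_step \<delta> l z) \<partial>hc a) / 2) * exp ((\<integral>z. ln (ratio_step \<delta> l z) \<partial>hc b) / 2))" (is "_ = ?R")
    and "sin (bdry_angle \<delta> a b (- \<delta> * \<psi> (l\<^sup>2))) = l * (a + b) / (sqrt (a\<^sup>2 + l\<^sup>2) * sqrt (b\<^sup>2 + l\<^sup>2))"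
    and "\<delta> * \<psi>' (l\<^sup>2) * (2 * l) * (bdry_modulus N \<delta> a b (- \<delta> * \<psi> (l\<^sup>2)) * sin (bdry_angle \<delta> a b (- \<delta> * \<psi> (l\<^sup>2)))) =
      2 * (a + b) * (exp (- (real N * \<delta>) * \<psi> (l\<^sup>2)) * eig_step \<delta> a l * eig_step \<delta> b l)"
proof -
  define Ra where "Ra = (\<integral>z. ln (ratio_step \<delta> l z) \<partial>hc a)"
  define Rb where "Rb = (\<integral>z. ln (ratio_step \<delta> l z) \<partial>hc b)"
  define w where "w = \<delta> * \<psi>' (l\<^sup>2)"
  define sa where "sa = sqrt (a\<^sup>2 + l\<^sup>2)"
  define sb where "sb = sqrt (b\<^sup>2 + l\<^sup>2)"
  have w: "0 < w" using d der_pos l by (simp add: w_def)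
  have pa: "0 < a\<^sup>2 + l\<^sup>2" and pb: "0 < b\<^sup>2 + l\<^sup>2" using a b l by (auto intro: add_pos_pos)
  have s: "0 < sa" "0 < sb" "sa * sa = l\<^sup>2 + a\<^sup>2" "sb * sb = l\<^sup>2 + b\<^sup>2" using pa pb by (auto simp: sa_def sb_def)
  have "exp (- (\<integral>z. bdry_log \<delta> (- \<delta> * \<psi> (l\<^sup>2)) z \<partial>hc a) / 2 - (\<integral>z. bdry_log \<delta> (- \<delta> * \<psi> (l\<^sup>2)) z \<partial>hc b) / 2)
     = exp (- ln w + (- ln (a\<^sup>2 + l\<^sup>2) / 2 + (- ln (b\<^sup>2 + l\<^sup>2) / 2 + (Ra / 2 + Rb / 2))))"
    unfolding bdry_log_integral_neg(2)[OF a l d] bdry_log_integral_neg(2)[OF b l d] Ra_def[symmetric] Rb_def[symmetric] w_def[symmetric]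
    by (rule arg_cong[where f=exp]) (simp add: field_simps)
  also have "\<dots> = 1 / w * (1 / sa * (1 / sb * (exp (Ra / 2) * exp (Rb / 2))))"
    unfolding exp_add exp_half_ln[OF pa] exp_half_ln[OF pb] sa_def[symmetric] sb_def[symmetric]
    using w by (simp add: exp_minus inverse_eq_divide)
  finally have e: "exp (- (\<integral>z. bdry_log \<delta> (- \<delta> * \<psi> (l\<^sup>2)) z \<partial>hc a) / 2 - (\<integral>z. bdry_log \<delta> (- \<delta> * \<psi> (l\<^sup>2)) z \<partial>hc b) / 2)
     = 1 / w * (1 / sa * (1 / sb * (exp (Ra / 2) * exp (Rb / 2))))" .
  show 1: "\<delta> * \<psi>' (l\<^sup>2) * (2 * l) * bdry_modulus N \<delta> a b (- \<delta> * \<psi> (l\<^sup>2)) = ?R"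
    unfolding bdry_modulus_def e w_def[symmetric] Ra_def[symmetric] Rb_def[symmetric] sa_def[symmetric] sb_def[symmetric]
    using w by (simp add: mult.assoc)
  have sc: "sin (arctan (l / c)) = l / sqrt (c\<^sup>2 + l\<^sup>2)" "cos (arctan (l / c)) = c / sqrt (c\<^sup>2 + l\<^sup>2)" if c: "0 < c" for c
  proof -
    have "sqrt (1 + (l / c)\<^sup>2) = sqrt ((c\<^sup>2 + l\<^sup>2) / c\<^sup>2)" using c by (simp add: power_divide add_divide_distrib)
    also have "\<dots> = sqrt (c\<^sup>2 + l\<^sup>2) / c" using c by (simp add: real_sqrt_divide)
    finally have e: "sqrt (1 + (l / c)\<^sup>2) = sqrt (c\<^sup>2 + l\<^sup>2) / c" .
    show "sin (arctan (l / c)) = l / sqrt (c\<^sup>2 + l\<^sup>2)" "cos (arctan (l / c)) = c / sqrt (c\<^sup>2 + l\<^sup>2)"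
      unfolding sin_arctan cos_arctan e using c by auto
  qed
  have ang: "bdry_angle \<delta> a b (- \<delta> * \<psi> (l\<^sup>2)) = arctan (l / a) + arctan (l / b)"
    unfolding bdry_angle_def above_neg[OF d a l] above_neg[OF d b l] by (simp add: field_simps)
  show 2: "sin (bdry_angle \<delta> a b (- \<delta> * \<psi> (l\<^sup>2))) = l * (a + b) / (sqrt (a\<^sup>2 + l\<^sup>2) * sqrt (b\<^sup>2 + l\<^sup>2))"
    unfolding ang sin_add sc[OF a] sc[OF b] by (simp add: add_divide_distrib distrib_left mult.commute)
  have "\<delta> * \<psi>' (l\<^sup>2) * (2 * l) * (bdry_modulus N \<delta> a b (- \<delta> * \<psi> (l\<^sup>2)) * sin (bdry_angle \<delta> a b (- \<delta> * \<psi> (l\<^sup>2))))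
     = ?R * (l * (a + b) / (sa * sb))"
    unfolding 1[symmetric] 2 sa_def sb_def by (simp only: mult.assoc)
  also have "\<dots> = 2 * (a + b) * (exp (- (real N * \<delta>) * \<psi> (l\<^sup>2)) * (l / (sa * sa) * exp (Ra / 2)) * (l / (sb * sb) * exp (Rb / 2)))"
    unfolding sa_def[symmetric] sb_def[symmetric] Ra_def[symmetric] Rb_def[symmetric] by (simp add: mult_ac)
  finally show "\<delta> * \<psi>' (l\<^sup>2) * (2 * l) * (bdry_modulus N \<delta> a b (- \<delta> * \<psi> (l\<^sup>2)) * sin (bdry_angle \<delta> a b (- \<delta> * \<psi> (l\<^sup>2)))) =
      2 * (a + b) * (exp (- (real N * \<delta>) * \<psi> (l\<^sup>2)) * eig_step \<delta> a l * eig_step \<delta> b l)"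
    unfolding eig_step_def s(3,4) Ra_def Rb_def .
qed

text \<open>The region corresponds to \<open>l > 1\<close>, where everything beside the weight is
  bounded after the substitution, so integrability is that of the weight itself.\<close>

lemma bdry_modulus_integrable_far:
  assumes a: "0 < a" and b: "0 < b" and d: "0 < \<delta>"
    and i: "integrable hl (\<lambda>l. exp (- (real N * \<delta>) * \<psi> (l\<^sup>2)))"
  shows "set_integrable lborel {..< - \<delta> * \<psi> 1} (bdry_modulus N \<delta> a b)"
proof -
  note [measurable] = bdry_modulus_measurable[OF a b]
  define M where "M c = (\<integral>z. 2 * \<bar>ln z\<bar> + ln (1 + \<delta> * \<psi> (z\<^sup>2)) \<partial>hc c)" for c
  have "set_integrable lborel {1<..} (\<lambda>l. \<delta> * \<psi>' (l\<^sup>2) * (2 * l) * bdry_modulus N \<delta> a b (- \<delta> * \<psi> (l\<^sup>2)))"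
    unfolding set_integrable_def
  proof (rule Bochner_Integration.integrable_bound)
    show "integrable lborel (\<lambda>l. (2 * (exp (M a / 2) * exp (M b / 2))) *\<^sub>R (indicator {0<..} l *\<^sub>R exp (- (real N * \<delta>) * \<psi> (l\<^sup>2))))"
      using i by (intro integrable_scaleR_right) (simp add: integrable_restrict_space)
    show "(\<lambda>l. indicator {1<..} l *\<^sub>R (\<delta> * \<psi>' (l\<^sup>2) * (2 * l) * bdry_modulus N \<delta> a b (- \<delta> * \<psi> (l\<^sup>2)))) \<in> borel_measurable lborel"
    proof -
      note [measurable] = der_measurable
      have "(\<lambda>l. indicator {1<..} l * (\<delta> * (indicator {0<..} l * \<psi>' (l\<^sup>2)) * (2 * l) * bdry_modulus N \<delta> a b (- \<delta> * \<psi> (l\<^sup>2)))) \<in> borel_measurable lborel"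
        by measurable
      moreover have "(\<lambda>l. indicator {1<..} l * (\<delta> * (indicator {0<..} l * \<psi>' (l\<^sup>2)) * (2 * l) * bdry_modulus N \<delta> a b (- \<delta> * \<psi> (l\<^sup>2))))
         = (\<lambda>l. indicator {1<..} l *\<^sub>R (\<delta> * \<psi>' (l\<^sup>2) * (2 * l) * bdry_modulus N \<delta> a b (- \<delta> * \<psi> (l\<^sup>2))))"
        by (auto simp: indicator_def fun_eq_iff)
      ultimately show ?thesis by (simp only:)
    qed
    show "AE l in lborel. norm (indicator {1<..} l *\<^sub>R (\<delta> * \<psi>' (l\<^sup>2) * (2 * l) * bdry_modulus N \<delta> a b (- \<delta> * \<psi> (l\<^sup>2))))
      \<le> norm ((2 * (exp (M a / 2) * exp (M b / 2))) *\<^sub>R (indicator {0<..} l *\<^sub>R exp (- (real N * \<delta>) * \<psi> (l\<^sup>2))))"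
    proof (rule AE_I2)
      fix l :: real
      show "norm (indicator {1<..} l *\<^sub>R (\<delta> * \<psi>' (l\<^sup>2) * (2 * l) * bdry_modulus N \<delta> a b (- \<delta> * \<psi> (l\<^sup>2))))
        \<le> norm ((2 * (exp (M a / 2) * exp (M b / 2))) *\<^sub>R (indicator {0<..} l *\<^sub>R exp (- (real N * \<delta>) * \<psi> (l\<^sup>2))))"
      proof (cases "1 < l")
        case True
        then have l: "0 < l" by simp
        have up: "exp ((\<integral>z. ln (ratio_step \<delta> l z) \<partial>hc c) / 2) \<le> exp (M c / 2)" if "0 < c" for c
          using eig_step_upper[OF that l d order_refl] True by (simp add: M_def)
        have sq: "l \<le> sqrt (c\<^sup>2 + l\<^sup>2)" for c using l by (intro real_le_rsqrt) simp
        have frac: "2 * l / (sqrt (a\<^sup>2 + l\<^sup>2) * sqrt (b\<^sup>2 + l\<^sup>2)) \<le> 2"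
        proof -
          have "l * 1 \<le> sqrt (a\<^sup>2 + l\<^sup>2) * sqrt (b\<^sup>2 + l\<^sup>2)"
          proof (rule mult_mono)
            show "1 \<le> sqrt (b\<^sup>2 + l\<^sup>2)" using sq[of b] True by linarith
          qed (use sq[of a] in auto)
          then show ?thesis using l by (subst divide_le_eq) (auto intro!: mult_pos_pos add_nonneg_pos)
        qed
        define A B e q where "A = exp ((\<integral>z. ln (ratio_step \<delta> l z) \<partial>hc a) / 2)" and "B = exp ((\<integral>z. ln (ratio_step \<delta> l z) \<partial>hc b) / 2)"
          and "e = exp (- (real N * \<delta>) * \<psi> (l\<^sup>2))" and "q = 2 * l / (sqrt (a\<^sup>2 + l\<^sup>2) * sqrt (b\<^sup>2 + l\<^sup>2))"
        have pos: "0 \<le> A" "0 \<le> B" "0 \<le> e" "0 \<le> q" using l by (auto simp: A_def B_def e_def q_def)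
        have F: "\<delta> * \<psi>' (l\<^sup>2) * (2 * l) * bdry_modulus N \<delta> a b (- \<delta> * \<psi> (l\<^sup>2)) = e * q * (A * B)"
          unfolding bdry_modulus_neg(1)[OF a b l d] by (simp add: A_def B_def e_def q_def)
        have "norm (indicator {1<..} l *\<^sub>R (\<delta> * \<psi>' (l\<^sup>2) * (2 * l) * bdry_modulus N \<delta> a b (- \<delta> * \<psi> (l\<^sup>2)))) = e * q * (A * B)"
          unfolding F using True pos by (simp add: abs_mult)
        also have "\<dots> \<le> e * 2 * (exp (M a / 2) * exp (M b / 2))"
          using pos frac up[OF a] up[OF b] unfolding A_def[symmetric] B_def[symmetric] q_def[symmetric] by (intro mult_mono mult_nonneg_nonneg) auto
        also have "\<dots> = norm ((2 * (exp (M a / 2) * exp (M b / 2))) *\<^sub>R (indicator {0<..} l *\<^sub>R exp (- (real N * \<delta>) * \<psi> (l\<^sup>2))))"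
          unfolding e_def[symmetric] using l pos by (simp add: abs_mult)
        finally show ?thesis .
      qed simp
    qed
  qed
  then show ?thesis using change_of_variables(1)[of "bdry_modulus N \<delta> a b" \<delta> 1] d by simp
qed

text \<open>The bound has to be uniform in \<open>l \<le> 1\<close>: as \<open>x\<close> approaches
  0, \<open>l\<close> tends to 0 and the singularity at \<open>z = l\<close> moves towards the
  endpoint. All terms of the bound have finite half-Cauchy means.\<close>

lemma bdry_log_lower_near:
  assumes d: "0 < \<delta>"
  obtains c where "0 < c" "\<And>l z. 0 < l \<Longrightarrow> l \<le> 1 \<Longrightarrow> 0 < z \<Longrightarrow> z \<noteq> l \<Longrightarrow>
     ln c + ln \<bar>z\<^sup>2 - l\<^sup>2\<bar> - ln (2 + z\<^sup>2) \<le> bdry_log \<delta> (- \<delta> * \<psi> (l\<^sup>2)) z"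
proof -
  \<comment> \<open>The threshold \<open>z\<^sup>2 = 4\<close> is safely above
    \<open>l\<^sup>2 \<le> 1\<close>. Below it the slopes of \<psi> are at least
    \<open>\<psi>' 4\<close>; above it \<psi> exceeds its value at \<open>l\<^sup>2\<close> by at
    least \<open>\<psi> 4 - \<psi> 1\<close>.\<close>
  define c1 where "c1 = \<delta> * \<psi>' 4 / (1 + \<delta> * \<psi> 4)"
  define c2 where "c2 = 1 - exp (- \<delta> * (\<psi> 4 - \<psi> 1))"
  have c1: "0 < c1" using d der_pos[of 4] pos[of 4] by (auto simp: c1_def intro!: divide_pos_pos add_pos_pos)
  have c2: "0 < c2" using d less[of 1 4] by (simp add: c2_def)
  show thesis
  proof (rule that[of "min c1 c2"])
    show c: "0 < min c1 c2" using c1 c2 by simp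
    fix l z :: real assume l: "0 < l" "l \<le> 1" and z: "0 < z" "z \<noteq> l"
    let ?Z = "z\<^sup>2" and ?L = "l\<^sup>2"
    define y where "y = \<delta> * (\<psi> ?Z - \<psi> ?L)"
    have Z: "0 < ?Z" and L: "0 < ?L" "?L \<le> 1" using l z by (auto simp: power_le_one)
    have y0: "y \<noteq> 0" using psi_ne[OF l(1) z] d by (simp add: y_def)
    have zl: "0 < \<bar>?Z - ?L\<bar>" using l z by (auto simp: power2_eq_iff)
    have m: "min c1 c2 * \<bar>?Z - ?L\<bar> / (2 + ?Z) \<le> \<bar>1 - exp (- y)\<bar>"
    proof (cases "?Z \<le> 4")
      case True
      have ad: "\<psi>' 4 * \<bar>?Z - ?L\<bar> \<le> \<bar>\<psi> ?Z - \<psi> ?L\<bar>"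
      proof (cases "?L \<le> ?Z")
        case le: True
        have "\<psi>' 4 * (?Z - ?L) \<le> \<psi>' ?Z * (?Z - ?L)" using der_anti[of ?Z 4] Z True le by (intro mult_right_mono) auto
        also have "\<dots> \<le> \<psi> ?Z - \<psi> ?L" using slope_le[OF Z L(1)] by (simp add: algebra_simps)
        finally show ?thesis using le by simp
      next
        case False
        have "\<psi>' 4 * (?L - ?Z) \<le> \<psi>' ?L * (?L - ?Z)" using der_anti[of ?L 4] L False by (intro mult_right_mono) auto
        also have "\<dots> \<le> \<psi> ?L - \<psi> ?Z" using slope_le[OF L(1) Z] by (simp add: algebra_simps)
        finally show ?thesis using False by simp
      qed
      have yd: "max 0 y \<le> \<delta> * \<psi> 4"
      proof -
        have "\<psi> ?Z \<le> \<psi> 4" using less[of ?Z 4] Z True by (cases "?Z = 4") auto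
        then have "y \<le> \<delta> * \<psi> 4" unfolding y_def using d nonneg[of ?L] by (intro mult_left_mono) auto
        then show ?thesis using d nonneg[of 4] by simp
      qed
      have "c1 * \<bar>?Z - ?L\<bar> = \<delta> * (\<psi>' 4 * \<bar>?Z - ?L\<bar>) / (1 + \<delta> * \<psi> 4)" by (simp add: c1_def)
      also have "\<dots> \<le> \<delta> * \<bar>\<psi> ?Z - \<psi> ?L\<bar> / (1 + \<delta> * \<psi> 4)"
        using ad d nonneg[of 4] by (intro divide_right_mono mult_left_mono) auto
      also have "\<dots> = \<bar>y\<bar> / (1 + \<delta> * \<psi> 4)" using d by (simp add: y_def abs_mult)
      also have "\<dots> \<le> \<bar>y\<bar> / (1 + max 0 y)" using yd by (intro divide_left_mono) auto
      also have "\<dots> \<le> \<bar>1 - exp (- y)\<bar>" by (rule one_minus_exp_bounds(1)[OF y0])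
      finally have 1: "c1 * \<bar>?Z - ?L\<bar> \<le> \<bar>1 - exp (- y)\<bar>" .
      have "min c1 c2 * \<bar>?Z - ?L\<bar> / (2 + ?Z) \<le> min c1 c2 * \<bar>?Z - ?L\<bar> / 1"
        using c Z by (intro divide_left_mono) (auto intro: add_pos_pos)
      also have "\<dots> \<le> c1 * \<bar>?Z - ?L\<bar>" by (simp add: mult_right_mono)
      finally show ?thesis using 1 by linarith
    next
      case False
      have "\<psi> ?L \<le> \<psi> 1" using less[of ?L 1] L by (cases "?L = 1") auto
      moreover have "\<psi> 4 < \<psi> ?Z" using less[of 4 ?Z] False by simp
      ultimately have "\<delta> * (\<psi> 4 - \<psi> 1) \<le> y" unfolding y_def using d by (intro mult_left_mono) auto
      then have "c2 \<le> 1 - exp (- y)" by (simp add: c2_def)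
      then have 2: "c2 \<le> \<bar>1 - exp (- y)\<bar>" by linarith
      have "min c1 c2 * \<bar>?Z - ?L\<bar> / (2 + ?Z) = min c1 c2 * (\<bar>?Z - ?L\<bar> / (2 + ?Z))" by simp
      also have "\<dots> \<le> min c1 c2 * 1"
      proof (intro mult_left_mono)
        have "\<bar>?Z - ?L\<bar> \<le> 2 + ?Z" "0 < 2 + ?Z" using Z L by linarith+
        then show "\<bar>?Z - ?L\<bar> / (2 + ?Z) \<le> 1" by (simp only: divide_le_eq_1_pos)
      qed (use c in simp)
      finally show ?thesis using 2 by simp
    qed
    have p: "0 < min c1 c2 * \<bar>?Z - ?L\<bar> / (2 + ?Z)" 
    proof -
      have "0 < 2 + ?Z" using Z by linarith
      then show ?thesis using c zl by (intro divide_pos_pos mult_pos_pos)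
    qed
    have "ln (min c1 c2 * \<bar>?Z - ?L\<bar> / (2 + ?Z)) = ln (min c1 c2) + ln \<bar>?Z - ?L\<bar> - ln (2 + ?Z)"
      using ln_divide_pos[of "min c1 c2 * \<bar>?Z - ?L\<bar>" "2 + ?Z"] ln_mult_pos[OF c zl] mult_pos_pos[OF c zl] Z by (simp add: add_pos_pos)
    moreover have "ln (min c1 c2 * \<bar>?Z - ?L\<bar> / (2 + ?Z)) \<le> ln \<bar>1 - exp (- y)\<bar>" using p m by (intro ln_mono)
    moreover have "bdry_log \<delta> (- \<delta> * \<psi> ?L) z = ln \<bar>1 - exp (- y)\<bar>"
      by (simp add: bdry_log_def phi_def y_def exp_add[symmetric] algebra_simps)
    ultimately show "ln (min c1 c2) + ln \<bar>?Z - ?L\<bar> - ln (2 + ?Z) \<le> bdry_log \<delta> (- \<delta> * \<psi> ?L) z" by simp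
  qed
qed

lemma ln_2_sq_integrable: "0 < a \<Longrightarrow> integrable (hc a) (\<lambda>z. ln (2 + z\<^sup>2))"
proof -
  assume a: "0 < a"
  interpret H: prob_space "hc a" by (rule hc_prob[OF a])
  show ?thesis
  proof (rule Bochner_Integration.integrable_bound)
    show "integrable (hc a) (\<lambda>z. ln 3 + 2 * \<bar>ln z\<bar>)" using hc_ln_integrable[OF a] by auto
    show "AE z in hc a. norm (ln (2 + z\<^sup>2)) \<le> norm (ln 3 + 2 * \<bar>ln z\<bar>)"
      using hc_AE_pos
    proof eventually_elim
      case (elim z)
      have "ln (2 + z\<^sup>2) \<le> ln (3 * max 1 (z\<^sup>2))" by (rule ln_mono) (auto simp: max_def add_pos_nonneg)
      also have "\<dots> = ln 3 + ln (max 1 (z\<^sup>2))" by (rule ln_mult_pos) (auto simp: max_def)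
      also have "ln (max 1 (z\<^sup>2)) \<le> 2 * \<bar>ln z\<bar>" using elim by (auto simp: max_def ln_realpow)
      finally have "ln (2 + z\<^sup>2) \<le> ln 3 + 2 * \<bar>ln z\<bar>" by simp
      moreover have "0 \<le> ln (2 + z\<^sup>2)" by (simp add: add_increasing2)
      ultimately show ?case by simp
    qed
  qed measurable
qed

text \<open>The two sides of the branch point need different lower bounds for the logarithm:
  \<open>one_minus_phi_ge\<close> on the right and \<open>bdry_log_lower_near\<close> on the
  left.\<close>

lemma bdry_modulus_bounded_near:
  assumes a: "0 < a" and b: "0 < b" and d: "0 < \<delta>"
  obtains C where "\<And>x. - \<delta> * \<psi> 1 \<le> x \<Longrightarrow> x \<le> 1 \<Longrightarrow> x \<noteq> 0 \<Longrightarrow> bdry_modulus N \<delta> a b x \<le> C"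
proof -
  obtain c where c: "0 < c" "\<And>l z. 0 < l \<Longrightarrow> l \<le> 1 \<Longrightarrow> 0 < z \<Longrightarrow> z \<noteq> l \<Longrightarrow>
     ln c + ln \<bar>z\<^sup>2 - l\<^sup>2\<bar> - ln (2 + z\<^sup>2) \<le> bdry_log \<delta> (- \<delta> * \<psi> (l\<^sup>2)) z"
    using bdry_log_lower_near[OF d] by metis
  obtain g where g: "\<And>z. 0 < z \<Longrightarrow> g z \<le> ln (1 - phi \<delta> z)" "\<And>a. 0 < a \<Longrightarrow> integrable (hc a) g"
    using one_minus_phi_ge[OF d] by metis
  define J where "J q = ln c + ln (q\<^sup>2) - (\<integral>z. ln (2 + z\<^sup>2) \<partial>hc q)" for q
  define G where "G q = (\<integral>z. g z \<partial>hc q)" for q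
  have lower: "min (J q) (G q) \<le> (\<integral>z. bdry_log \<delta> x z \<partial>hc q)" if q: "0 < q" and x: "- \<delta> * \<psi> 1 \<le> x" "x \<noteq> 0" for q x
  proof (cases "0 < x")
    case True
    have "G q \<le> (\<integral>z. bdry_log \<delta> x z \<partial>hc q)" unfolding G_def
    proof (rule integral_mono_AE[OF g(2)[OF q] bdry_log_integrable[OF q d x(2)]])
      show "AE z in hc q. g z \<le> bdry_log \<delta> x z" using hc_AE_pos
      proof eventually_elim
        case (elim z)
        have "phi \<delta> z * exp (- x) \<le> phi \<delta> z * 1" using True phi_range(3)[of \<delta> z] by (intro mult_left_mono) auto
        then have le: "1 - phi \<delta> z \<le> 1 - phi \<delta> z * exp (- x)" by simp
        have "0 < 1 - phi \<delta> z" using phi_range(4)[OF d, of z] elim by simp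
        then have "ln (1 - phi \<delta> z) \<le> ln \<bar>1 - phi \<delta> z * exp (- x)\<bar>" using le by (intro ln_mono) auto
        then show ?case using g(1)[OF elim] by (simp add: bdry_log_def)
      qed
    qed
    then show ?thesis by simp
  next
    case False
    then have "x < 0" using x by simp
    from neg_reparam[OF d this] obtain l where l: "0 < l" "x = - \<delta> * \<psi> (l\<^sup>2)" .
    have l1: "l \<le> 1"
    proof (rule ccontr)
      assume "\<not> l \<le> 1"
      then have "1 < l\<^sup>2" by simp
      then have "\<psi> 1 < \<psi> (l\<^sup>2)" by (intro less) auto
      then show False using x(1) l(2) d by simp
    qed
    have i: "integrable (hc q) (\<lambda>z. ln c + ln \<bar>z\<^sup>2 - l\<^sup>2\<bar> - ln (2 + z\<^sup>2))"
    proof -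
      interpret H: prob_space "hc q" by (rule hc_prob[OF q])
      show ?thesis using hc_ln_abs_diff(1)[OF q l(1)] ln_2_sq_integrable[OF q] by auto
    qed
    have "(\<integral>z. ln c + ln \<bar>z\<^sup>2 - l\<^sup>2\<bar> - ln (2 + z\<^sup>2) \<partial>hc q) \<le> (\<integral>z. bdry_log \<delta> x z \<partial>hc q)"
    proof (rule integral_mono_AE[OF i bdry_log_integrable[OF q d x(2)]])
      show "AE z in hc q. ln c + ln \<bar>z\<^sup>2 - l\<^sup>2\<bar> - ln (2 + z\<^sup>2) \<le> bdry_log \<delta> x z"
        using hc_AE_pos hc_AE_ne[where a=q and l=l] by eventually_elim (use c(2) l l1 in auto)
    qed
    moreover have "(\<integral>z. ln c + ln \<bar>z\<^sup>2 - l\<^sup>2\<bar> - ln (2 + z\<^sup>2) \<partial>hc q) = ln c + ln (q\<^sup>2 + l\<^sup>2) - (\<integral>z. ln (2 + z\<^sup>2) \<partial>hc q)"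
    proof -
      interpret H: prob_space "hc q" by (rule hc_prob[OF q])
      show ?thesis using hc_ln_abs_diff[OF q l(1)] ln_2_sq_integrable[OF q] H.prob_space by simp
    qed
    moreover have "ln (q\<^sup>2) \<le> ln (q\<^sup>2 + l\<^sup>2)" using q by (intro ln_mono) auto
    ultimately have "J q \<le> (\<integral>z. bdry_log \<delta> x z \<partial>hc q)" by (simp add: J_def)
    then show ?thesis by simp
  qed
  show thesis
  proof (rule that)
    fix x assume x: "- \<delta> * \<psi> 1 \<le> x" "x \<le> 1" "x \<noteq> 0"
    have "exp (real N * x) \<le> exp (real N * 1)" using x by (simp add: mult_left_le)
    moreover have "exp (- (\<integral>z. bdry_log \<delta> x z \<partial>hc a) / 2 - (\<integral>z. bdry_log \<delta> x z \<partial>hc b) / 2) \<le> exp (- min (J a) (G a) / 2 - min (J b) (G b) / 2)"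
      using lower[OF a x(1,3)] lower[OF b x(1,3)] by simp
    ultimately show "bdry_modulus N \<delta> a b x \<le> exp (real N * 1) * exp (- min (J a) (G a) / 2 - min (J b) (G b) / 2)"
      unfolding bdry_modulus_def by (rule mult_mono) auto
  qed
qed

lemma bdry_modulus_integrable:
  assumes a: "0 < a" and b: "0 < b" and d: "0 < \<delta>"
    and i: "integrable hl (\<lambda>l. exp (- (real N * \<delta>) * \<psi> (l\<^sup>2)))"
  shows "set_integrable lborel {..1} (bdry_modulus N \<delta> a b)"
proof -
  note [measurable] = bdry_modulus_measurable[OF a b]
  obtain C where C: "\<And>x. - \<delta> * \<psi> 1 \<le> x \<Longrightarrow> x \<le> 1 \<Longrightarrow> x \<noteq> 0 \<Longrightarrow> bdry_modulus N \<delta> a b x \<le> C"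
    using bdry_modulus_bounded_near[OF a b d] by metis
  have "set_integrable lborel {- \<delta> * \<psi> 1..1} (bdry_modulus N \<delta> a b)"
    unfolding set_integrable_def
  proof (rule Bochner_Integration.integrable_bound)
    show "integrable lborel (\<lambda>x. indicator {- \<delta> * \<psi> 1..1} x *\<^sub>R C)"
      by (intro integrable_scaleR_left impI integrable_real_indicator) (auto simp: emeasure_lborel_Icc_eq)
    show "AE x in lborel. norm (indicator {- \<delta> * \<psi> 1..1} x *\<^sub>R bdry_modulus N \<delta> a b x) \<le> norm (indicator {- \<delta> * \<psi> 1..1} x *\<^sub>R C)"
      using AE_lborel_singleton[of "0::real"]
    proof eventually_elim
      case (elim x)
      have "0 \<le> bdry_modulus N \<delta> a b x" by (simp add: bdry_modulus_def)
      then show ?case using C[of x] elim by (auto simp: indicator_def)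
    qed
  qed measurable
  then have "set_integrable lborel ({..< - \<delta> * \<psi> 1} \<union> {- \<delta> * \<psi> 1..1}) (bdry_modulus N \<delta> a b)"
    by (intro set_integrable_Un bdry_modulus_integrable_far[OF a b d i]) auto
  moreover have "{..< - \<delta> * \<psi> 1} \<union> {- \<delta> * \<psi> 1..1} = {..1}"
  proof -
    have "0 \<le> \<delta> * \<psi> 1" using d nonneg[of 1] by simp
    then show ?thesis by auto
  qed
  ultimately show ?thesis by simp
qed

text \<open>Cauchy's formula on a circle is the integral of \<open>f\<close> over a vertical segment of the strip.  As \<open>f\<close> is
  real on the middle line, this reduces to the integral of the imaginary part of its boundary values on
  the real axis.\<close>

theorem coefficient_formula:
  fixes c :: "nat \<Rightarrow> real"
  assumes a: "0 < a" and b: "0 < b" and d: "0 < \<delta>" and N: "1 \<le> N"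
    and i: "integrable hl (\<lambda>l. exp (- (real N * \<delta>) * \<psi> (l\<^sup>2)))"
    and B: "\<And>k. \<bar>c k\<bar> \<le> B"
    and gen: "\<And>r. cmod r < 1 \<Longrightarrow> (\<lambda>k. r ^ k * of_real (c k)) sums
      (exp (- (\<integral>z. Ln (1 - r * of_real (phi \<delta> z)) \<partial>hc a) / 2 - (\<integral>z. Ln (1 - r * of_real (phi \<delta> z)) \<partial>hc b) / 2) / of_real (a + b))"
  shows "c N = 2 / pi * (\<integral>l. exp (- (real N * \<delta>) * \<psi> (l\<^sup>2)) * eig_step \<delta> a l * eig_step \<delta> b l \<partial>hl)"
proof -
  note [measurable] = bdry_modulus_measurable[OF a b]
  \<comment> \<open>For \<open>Re v > 0\<close>, \<open>H v\<close> is \<open>a + b\<close> times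
    the generating function at \<open>r = exp (- v)\<close>; the factor
    \<open>exp (of_nat N * v)\<close> in \<open>f\<close> singles out the coefficient of index
    \<open>N\<close>.\<close>
  define H where "H v = exp (- log_mean \<delta> a v / 2 - log_mean \<delta> b v / 2)" for v
  define f where "f v = exp (of_nat N * v) * H v" for v
  have Hh: "H holomorphic_on strip" unfolding H_def
    by (intro holomorphic_intros log_mean_holomorphic a b d) auto
  have fh: "f holomorphic_on strip" unfolding f_def by (intro holomorphic_intros Hh)
  have fc: "continuous_on strip f" using fh by (rule holomorphic_on_imp_continuous_on)
  have chor: "continuous_on A (\<lambda>x. f (Complex x e))" if "0 < e" "e < 2 * pi" for A e
  proof -
    have "continuous_on A (\<lambda>x. f (of_real x + \<i> * of_real e))"
      by (rule continuous_on_compose2[OF fc]) (auto intro!: continuous_intros simp: strip_def that)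
    then show ?thesis by (simp add: Complex_eq)
  qed
  have cver: "continuous_on {e..pi} (\<lambda>\<theta>. f (Complex x \<theta>))" if "0 < e" for x e
  proof -
    have "continuous_on {e..pi} (\<lambda>\<theta>. f (of_real x + \<i> * of_real \<theta>))"
      by (rule continuous_on_compose2[OF fc]) (use that pi_gt_zero in \<open>auto intro!: continuous_intros simp: strip_def\<close>)
    then show ?thesis by (simp add: Complex_eq)
  qed
  \<comment> \<open>On the line \<open>Im v = pi\<close> the number \<open>exp (- v)\<close> is
    negative, so all the logarithms are real.\<close>
  have real: "Im (f (Complex x pi)) = 0" for x
  proof -
    have K: "\<exists>r. log_mean \<delta> q (Complex x pi) = of_real r" for q
    proof -
      have "exp (- Complex x pi) = of_real (- exp (- x))" by (simp add: complex_eq_iff Re_exp Im_exp)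
      then have "log_mean \<delta> q (Complex x pi) = (\<integral>z. of_real (ln (1 + phi \<delta> z * exp (- x))) \<partial>hc q)"
        unfolding log_mean_def
      proof (intro Bochner_Integration.integral_cong refl)
        fix z
        assume E: "exp (- Complex x pi) = of_real (- exp (- x))"
        have "0 < 1 + phi \<delta> z * exp (- x)" using phi_range(3)[of \<delta> z] by (simp add: add_pos_pos)
        then have "Ln (of_real (1 + phi \<delta> z * exp (- x))) = of_real (ln (1 + phi \<delta> z * exp (- x)))" by (rule Ln_of_real)
        then show "Ln (1 - of_real (phi \<delta> z) * exp (- Complex x pi)) = of_real (ln (1 + phi \<delta> z * exp (- x)))"
          unfolding E by simp
      qed
      then show ?thesis by (auto simp: integral_complex_of_real)
    qed
    obtain ra rb where "log_mean \<delta> a (Complex x pi) = of_real ra" "log_mean \<delta> b (Complex x pi) = of_real rb" using K by metis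
    then have "f (Complex x pi) = exp (of_nat N * Complex x pi) * of_real (exp (- ra / 2 - rb / 2))"
      by (simp add: f_def H_def exp_of_real[symmetric])
    moreover have "Im (exp (of_nat N * Complex x pi)) = 0" by (simp add: Im_exp sin_npi)
    ultimately show ?thesis by simp
  qed
  have fabs: "cmod (f (Complex x e)) = exp (real N * x) * exp (- Re (log_mean \<delta> a (Complex x e)) / 2 - Re (log_mean \<delta> b (Complex x e)) / 2)" for x e
    by (simp add: f_def H_def norm_mult)
  have fbd: "cmod (f (Complex x e)) \<le> bdry_modulus N \<delta> a b x" if x: "x \<noteq> 0" and e: "0 < e" "e < 2 * pi" for x e
  proof -
    have v: "Complex x e \<in> strip" using e by (simp add: strip_def)
    have ne: "AE z in hc q. \<bar>1 - phi \<delta> z * exp (- x)\<bar> \<noteq> 0" if q: "0 < q" for q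
    proof (cases "0 < x")
      case True
      have "phi \<delta> z * exp (- x) < 1" for z
      proof -
        have "phi \<delta> z * exp (- x) \<le> 1 * exp (- x)" using phi_range(2)[OF d] by (intro mult_right_mono) auto
        also have "\<dots> < 1" using True by simp
        finally show ?thesis .
      qed
      then show ?thesis by (intro AE_I2) (metis abs_eq_0 diff_gt_0_iff_gt less_irrefl)
    next
      case False
      then have "x < 0" using x by simp
      from neg_reparam[OF d this] obtain l where l: "0 < l" "x = - \<delta> * \<psi> (l\<^sup>2)" .
      show ?thesis using hc_AE_pos hc_AE_ne[where a=q and l=l]
      proof eventually_elim
        case (elim z)
        then have "\<psi> (z\<^sup>2) \<noteq> \<psi> (l\<^sup>2)" using psi_ne[OF l(1)] by blast
        moreover have "phi \<delta> z * exp (- x) = exp (\<delta> * (\<psi> (l\<^sup>2) - \<psi> (z\<^sup>2)))" by (simp add: phi_def l exp_add[symmetric] algebra_simps)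
        ultimately show ?case using d by simp
      qed
    qed
    have ge: "(\<integral>z. bdry_log \<delta> x z \<partial>hc q) \<le> Re (log_mean \<delta> q (Complex x e))" if q: "0 < q" for q
    proof (rule log_mean_Re_ge[OF q d v bdry_log_integrable[OF q d x]])
      show "AE z in hc q. bdry_log \<delta> x z \<le> ln (cmod (1 - of_real (phi \<delta> z) * exp (- Complex x e)))"
        using ne[OF q] by eventually_elim (rule bdry_log_le)
    qed
    show ?thesis unfolding fabs bdry_modulus_def using ge[OF a] ge[OF b] by (intro mult_left_mono) auto
  qed
  \<comment> \<open>The rectangle extends to \<open>- n\<close> on the left while its lower side
    descends like \<open>1 / n\<close>; at this slow rate \<open>exp (- n)\<close> beats the bound
    \<open>1 / sin (e n)\<close> on the left side.\<close>
  define e where "e n = 1 / (real n + 1)" for n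
  have e: "e \<longlonglongrightarrow> 0" "0 < e n" "e n \<le> 1" "e n < pi" "e n < 2 * pi" "e n \<le> pi" for n
  proof -
    show "e \<longlonglongrightarrow> 0" unfolding e_def by real_asymp
    show e1: "0 < e n" "e n \<le> 1" by (auto simp: e_def)
    show "e n < pi" "e n < 2 * pi" "e n \<le> pi" using e1 pi_gt3 by auto
  qed
  have contour: "Im (integral {- real n..1} (\<lambda>x. f (Complex x (e n)))) =
    Re (integral {e n..pi} (\<lambda>\<theta>. f (Complex (- real n) \<theta>))) - Re (integral {e n..pi} (\<lambda>\<theta>. f (Complex 1 \<theta>)))" for n
    by (rule strip_contour[OF fh real]) (use e in auto)
  have left: "(\<lambda>n. Re (integral {e n..pi} (\<lambda>\<theta>. f (Complex (- real n) \<theta>)))) \<longlonglongrightarrow> 0"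
  proof (rule Lim_null_comparison)
    show "(\<lambda>n. exp (- real n) / sin (1 / (real n + 1)) * pi) \<longlonglongrightarrow> 0" by real_asymp
    have "norm (Re (integral {e n..pi} (\<lambda>\<theta>. f (Complex (- real n) \<theta>)))) \<le> exp (- real n) / sin (e n) * pi" for n
    proof -
      have se: "0 < sin (e n)" using e by (intro sin_gt_zero) auto
      have "cmod (f (Complex (- real n) \<theta>)) \<le> exp (- real n) / sin (e n)" if t: "\<theta> \<in> {e n..pi}" for \<theta>
      proof -
        have v: "Complex (- real n) \<theta> \<in> strip" using t e(2)[of n] pi_gt_zero by (auto simp: strip_def)
        \<comment> \<open>The distance of 1 from the ray through \<open>exp (- v)\<close> is
          \<open>sin \<theta>\<close> for acute \<theta> and at least 1 otherwise.\<close>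
        have ge: "sin (e n) \<le> cmod (1 - of_real (phi \<delta> z) * exp (- Complex (- real n) \<theta>))" for z
        proof (cases "\<theta> \<le> pi / 2")
          case True
          define s where "s = phi \<delta> z * exp (real n)"
          have "sin (e n) \<le> sin \<theta>" using t True e(2)[of n] by (intro sin_monotone_2pi_le) auto
          also have "sin \<theta> \<le> \<bar>Im (cis \<theta> - of_real s)\<bar>" by simp
          also have "\<dots> \<le> cmod (cis \<theta> - of_real s)" by (rule abs_Im_le_cmod)
          also have "cis \<theta> - of_real s = cis \<theta> * (1 - of_real (phi \<delta> z) * exp (- Complex (- real n) \<theta>))"
          proof -
            have "exp (- Complex (- real n) \<theta>) = of_real (exp (real n)) * cis (- \<theta>)"
              by (simp add: complex_eq_iff Re_exp Im_exp)
            then show ?thesis by (simp add: s_def right_diff_distrib mult.left_commute[of "cis \<theta>"] cis_mult)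
          qed
          finally show ?thesis by (simp add: norm_mult)
        next
          case False
          have "cos \<theta> \<le> 0" using cos_monotone_0_pi_le[of "pi / 2" \<theta>] False t by simp
          then have "1 \<le> Re (1 - of_real (phi \<delta> z) * exp (- Complex (- real n) \<theta>))"
            using phi_range(3)[of \<delta> z] by (simp add: Re_exp mult_nonneg_nonpos)
          also have "\<dots> \<le> cmod (1 - of_real (phi \<delta> z) * exp (- Complex (- real n) \<theta>))" by (rule complex_Re_le_cmod)
          finally show ?thesis using sin_le_one[of "e n"] by linarith
        qed
        have K: "ln (sin (e n)) \<le> Re (log_mean \<delta> q (Complex (- real n) \<theta>))" if q: "0 < q" for q
        proof -
          interpret Q: prob_space "hc q" by (rule hc_prob[OF q])
          have "(\<integral>z. ln (sin (e n)) \<partial>hc q) \<le> Re (log_mean \<delta> q (Complex (- real n) \<theta>))"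
          proof (rule log_mean_Re_ge[OF q d v])
            show "AE z in hc q. ln (sin (e n)) \<le> ln (cmod (1 - of_real (phi \<delta> z) * exp (- Complex (- real n) \<theta>)))"
              by (intro AE_I2 ln_mono se ge)
          qed simp
          then show ?thesis using Q.prob_space by simp
        qed
        have "cmod (f (Complex (- real n) \<theta>)) \<le> exp (- real n) * exp (- ln (sin (e n)))"
          unfolding fabs
        proof (rule mult_mono)
          show "exp (real N * - real n) \<le> exp (- real n)" using N mult_right_mono[of 1 "real N" "real n"] by simp
          show "exp (- Re (log_mean \<delta> a (Complex (- real n) \<theta>)) / 2 - Re (log_mean \<delta> b (Complex (- real n) \<theta>)) / 2) \<le> exp (- ln (sin (e n)))"
            using K[OF a] K[OF b] by simp
        qed auto
        then show ?thesis using se by (simp add: exp_minus inverse_eq_divide)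
      qed
      then have "norm (integral {e n..pi} (\<lambda>\<theta>. f (Complex (- real n) \<theta>))) \<le> exp (- real n) / sin (e n) * (pi - e n)"
        using e by (intro integral_bound cver) auto
      also have "\<dots> \<le> exp (- real n) / sin (e n) * pi" using se e(2)[of n] by (intro mult_left_mono) auto
      finally show ?thesis using abs_Re_le_cmod order_trans by (metis real_norm_def)
    qed
    then show "\<forall>\<^sub>F n in sequentially. norm (Re (integral {e n..pi} (\<lambda>\<theta>. f (Complex (- real n) \<theta>)))) \<le> exp (- real n) / sin (1 / (real n + 1)) * pi"
      unfolding e_def by simp
  qed
  have right: "(\<lambda>n. Re (integral {e n..pi} (\<lambda>\<theta>. f (Complex 1 \<theta>)))) \<longlonglongrightarrow> pi * ((a + b) * c N)"
  proof -
    have sums: "(\<lambda>k. exp (- Complex 1 \<theta>) ^ k * of_real ((a + b) * c k)) sums H (Complex 1 \<theta>)" for \<theta>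
    proof -
      have "cmod (exp (- Complex 1 \<theta>)) < 1" by simp
      from gen[OF this, unfolded mult.commute[of "exp (- Complex 1 \<theta>)"]]
      have "(\<lambda>k. of_real (c k) * exp (- Complex 1 \<theta>) ^ k) sums (H (Complex 1 \<theta>) / of_real (a + b))"
        unfolding H_def log_mean_def by (simp only: mult.commute)
      then have S: "(\<lambda>k. of_real (a + b) * (of_real (c k) * exp (- Complex 1 \<theta>) ^ k)) sums (of_real (a + b) * (H (Complex 1 \<theta>) / of_real (a + b)))"
        by (rule sums_mult)
      have "a + b \<noteq> 0" using a b by linarith
      then have "of_real (a + b) \<noteq> (0::complex)" by (simp only: of_real_eq_0_iff not_False_eq_True)
      then have H: "of_real (a + b) * (H (Complex 1 \<theta>) / of_real (a + b)) = H (Complex 1 \<theta>)" by (simp del: of_real_add)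
      have "of_real (a + b) * (of_real (c k) * exp (- Complex 1 \<theta>) ^ k) = exp (- Complex 1 \<theta>) ^ k * of_real ((a + b) * c k)" for k
        by (simp only: of_real_mult mult_ac)
      then show ?thesis using S unfolding H by (simp only:)
    qed
    have bb: "\<bar>(a + b) * c k\<bar> \<le> (a + b) * B" for k using B[of k] a b by (simp add: abs_mult)
    note cc = circle_coefficient[of "\<lambda>k. (a + b) * c k", OF bb sums]
    have feq: "f v = exp (of_nat N * v) * H v" for v by (simp add: f_def)
    have "continuous_on {0..pi} (\<lambda>x. integral {x..pi} (\<lambda>\<theta>. Re (f (Complex 1 \<theta>))))"
      unfolding feq by (rule indefinite_integral_continuous_1'[OF cc(2)])
    moreover have "0 \<in> {0..pi}" "(\<forall>n. e n \<in> {0..pi}) \<and> e \<longlonglongrightarrow> 0"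
      using e(1,2,6) by (auto intro: less_imp_le)
    ultimately have "(\<lambda>n. integral {e n..pi} (\<lambda>\<theta>. Re (f (Complex 1 \<theta>)))) \<longlonglongrightarrow> integral {0..pi} (\<lambda>\<theta>. Re (f (Complex 1 \<theta>)))"
      unfolding continuous_on_sequentially comp_def by blast
    moreover have "integral {e n..pi} (\<lambda>\<theta>. Re (f (Complex 1 \<theta>))) = Re (integral {e n..pi} (\<lambda>\<theta>. f (Complex 1 \<theta>)))" for n
      using integral_unique[OF has_integral_Re[OF integrable_integral[OF integrable_continuous_real[OF cver[OF e(2)]]]]] by simp
    moreover have "integral {0..pi} (\<lambda>\<theta>. Re (f (Complex 1 \<theta>))) = pi * ((a + b) * c N)"
      unfolding feq by (rule cc(1))
    ultimately show ?thesis by simp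
  qed
  have "(\<lambda>n. Im (integral {- real n..1} (\<lambda>x. f (Complex x (e n))))) \<longlonglongrightarrow> 0 - pi * ((a + b) * c N)"
    unfolding contour by (intro tendsto_diff left right)
  moreover have "(\<lambda>n. Im (integral {- real n..1} (\<lambda>x. f (Complex x (e n))))) \<longlonglongrightarrow>
      (LBINT x. indicator {..1} x * - (bdry_modulus N \<delta> a b x * sin (bdry_angle \<delta> a b x)))"
  proof -
    have seti: "set_integrable lborel {- real n..1} (\<lambda>x. Im (f (Complex x (e n))))" for n
      by (intro borel_integrable_atLeastAtMost' continuous_intros chor e)
    have conv: "Im (integral {- real n..1} (\<lambda>x. f (Complex x (e n)))) = (LBINT x. indicator {- real n..1} x * Im (f (Complex x (e n))))" for n
    proof -
      have "Im (integral {- real n..1} (\<lambda>x. f (Complex x (e n)))) = integral {- real n..1} (\<lambda>x. Im (f (Complex x (e n))))"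
        using integral_unique[OF has_integral_Im[OF integrable_integral[OF integrable_continuous_real[OF chor[OF e(2,5)]]]]] by simp
      also have "\<dots> = (LBINT x:{- real n..1}. Im (f (Complex x (e n))))"
        using set_borel_integral_eq_integral(2)[OF seti] by simp
      finally show ?thesis by (simp add: set_lebesgue_integral_def)
    qed
    show ?thesis unfolding conv
    proof (rule integral_dominated_convergence[where w="\<lambda>x. indicator {..1} x * bdry_modulus N \<delta> a b x"])
      show "(\<lambda>x. indicator {..1} x * - (bdry_modulus N \<delta> a b x * sin (bdry_angle \<delta> a b x))) \<in> borel_measurable lborel" by measurable
      show "(\<lambda>x. indicator {- real n..1} x * Im (f (Complex x (e n)))) \<in> borel_measurable lborel" for n
        using seti[of n] by (auto simp: set_integrable_def)
      show "integrable lborel (\<lambda>x. indicator {..1} x * bdry_modulus N \<delta> a b x)"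
        using bdry_modulus_integrable[OF a b d i] by (simp add: set_integrable_def)
      show "AE x in lborel. norm (indicator {- real n..1} x * Im (f (Complex x (e n)))) \<le> indicator {..1} x * bdry_modulus N \<delta> a b x" for n
        using AE_lborel_singleton[of "0::real"]
      proof eventually_elim
        case (elim x)
        have "\<bar>Im (f (Complex x (e n)))\<bar> \<le> bdry_modulus N \<delta> a b x"
          using fbd[OF elim e(2,5)[of n]] abs_Im_le_cmod order_trans by blast
        moreover have "0 \<le> bdry_modulus N \<delta> a b x" by (simp add: bdry_modulus_def)
        ultimately show ?case by (auto simp: indicator_def)
      qed
      show "AE x in lborel. (\<lambda>n. indicator {- real n..1} x * Im (f (Complex x (e n)))) \<longlonglongrightarrow> indicator {..1} x * - (bdry_modulus N \<delta> a b x * sin (bdry_angle \<delta> a b x))"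
        using AE_lborel_singleton[of "0::real"]
      proof eventually_elim
        case (elim x)
        let ?A = "\<integral>z. bdry_log \<delta> x z \<partial>hc a" and ?B = "\<integral>z. bdry_log \<delta> x z \<partial>hc b"
        let ?P = "of_real ?A + \<i> * of_real (pi * above \<delta> a x)" and ?Q = "of_real ?B + \<i> * of_real (pi * above \<delta> b x)"
        have ex: "(\<lambda>n. of_nat N * Complex x (e n)) \<longlonglongrightarrow> of_nat N * Complex x 0"
          by (intro tendsto_mult tendsto_const tendsto_Complex e(1))
        have "(\<lambda>n. f (Complex x (e n))) \<longlonglongrightarrow> exp (of_nat N * Complex x 0) * exp (- ?P / 2 - ?Q / 2)"
          unfolding f_def H_def
          by (rule tendsto_mult[OF tendsto_exp[OF ex] tendsto_exp[OF tendsto_diff[OF tendsto_divide[OF tendsto_minus[OF log_mean_limit[OF a d elim e(1,2,4)]] tendsto_const] tendsto_divide[OF log_mean_limit[OF b d elim e(1,2,4)] tendsto_const]]]]) simp_all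
        then have "(\<lambda>n. Im (f (Complex x (e n)))) \<longlonglongrightarrow> Im (exp (of_nat N * Complex x 0) * exp (- ?P / 2 - ?Q / 2))"
          by (rule tendsto_Im)
        also have "exp (of_nat N * Complex x 0) * exp (- ?P / 2 - ?Q / 2) = exp (Complex (real N * x + (- ?A / 2 - ?B / 2)) (- bdry_angle \<delta> a b x))"
          unfolding exp_add[symmetric] by (rule arg_cong[where f=exp]) (simp add: complex_eq_iff bdry_angle_def field_simps)
        also have "Im \<dots> = - (bdry_modulus N \<delta> a b x * sin (bdry_angle \<delta> a b x))"
          by (simp add: Im_exp bdry_modulus_def exp_add)
        finally have lim: "(\<lambda>n. Im (f (Complex x (e n)))) \<longlonglongrightarrow> - (bdry_modulus N \<delta> a b x * sin (bdry_angle \<delta> a b x))" .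
        have "eventually (\<lambda>n. indicator {- real n..1} x = (indicator {..1} x :: real)) sequentially"
        proof -
          obtain m :: nat where m: "- x \<le> real m" using real_arch_simple by blast
          have "indicator {- real n..1} x = (indicator {..1} x :: real)" if "m \<le> n" for n
            using m that by (auto simp: indicator_def)
          then show ?thesis by (auto simp: eventually_sequentially)
        qed
        then have "(\<lambda>n. indicator {- real n..1} x :: real) \<longlonglongrightarrow> indicator {..1} x" by (rule tendsto_eventually)
        then show ?case using lim by (rule tendsto_mult)
      qed
    qed
  qed
  ultimately have eq: "(LBINT x. indicator {..1} x * - (bdry_modulus N \<delta> a b x * sin (bdry_angle \<delta> a b x))) = - (pi * ((a + b) * c N))"
    using LIMSEQ_unique by fastforce
  let ?h = "\<lambda>x. bdry_modulus N \<delta> a b x * sin (bdry_angle \<delta> a b x)"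
  \<comment> \<open>There is no cut to the right of 0, so the boundary angle vanishes and the piece
    of the contour between 0 and 1 drops out.\<close>
  have hz: "?h x = 0" if "0 < x" for x using that above_pos[OF d that] by (simp add: bdry_angle_def)
  have hi: "set_integrable lborel {..<0} ?h"
    unfolding set_integrable_def
  proof (rule Bochner_Integration.integrable_bound)
    show "integrable lborel (\<lambda>x. indicator {..1} x *\<^sub>R bdry_modulus N \<delta> a b x)"
      using bdry_modulus_integrable[OF a b d i] by (simp add: set_integrable_def)
    show "AE x in lborel. norm (indicator {..<0} x *\<^sub>R ?h x) \<le> norm (indicator {..1} x *\<^sub>R bdry_modulus N \<delta> a b x)"
      by (rule AE_I2) (auto simp: indicator_def abs_mult intro!: mult_left_le)
  qed measurable
  have c0: "- \<delta> * \<psi> (0\<^sup>2) = 0" using at_0 by simp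
  have "(LBINT x:{..<0}. ?h x) = (LBINT l:{0<..}. \<delta> * \<psi>' (l\<^sup>2) * (2 * l) * ?h (- \<delta> * \<psi> (l\<^sup>2)))"
    using change_of_variables(2)[of ?h \<delta> 0, unfolded c0, OF _ d _ hi] by simp
  also have "\<dots> = (LBINT l:{0<..}. 2 * (a + b) * (exp (- (real N * \<delta>) * \<psi> (l\<^sup>2)) * eig_step \<delta> a l * eig_step \<delta> b l))"
    by (rule set_lebesgue_integral_cong) (use bdry_modulus_neg(3)[OF a b _ d] in auto)
  also have "\<dots> = 2 * (a + b) * (\<integral>l. exp (- (real N * \<delta>) * \<psi> (l\<^sup>2)) * eig_step \<delta> a l * eig_step \<delta> b l \<partial>hl)"
    unfolding set_integral_hl by (rule integral_mult_right_zero)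
  finally have I1: "(LBINT x:{..<0}. ?h x) = 2 * (a + b) * (\<integral>l. exp (- (real N * \<delta>) * \<psi> (l\<^sup>2)) * eig_step \<delta> a l * eig_step \<delta> b l \<partial>hl)" .
  have "(LBINT x. indicator {..1} x * - ?h x) = (LBINT x. - (indicator {..<0} x *\<^sub>R ?h x))"
  proof (rule integral_cong_AE)
    show "AE x in lborel. indicator {..1} x * - ?h x = - (indicator {..<0} x *\<^sub>R ?h x)"
      using AE_lborel_singleton[of "0::real"]
    proof eventually_elim
      case (elim x)
      then show ?case using hz[of x] by (cases "0 < x") (auto simp: indicator_def)
    qed
  qed measurable
  also have "\<dots> = - (LBINT x:{..<0}. ?h x)" by (simp add: set_lebesgue_integral_def)
  finally have "pi * ((a + b) * c N) = (LBINT x:{..<0}. ?h x)" using eq by simp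
  then have E: "(a + b) * (pi * c N) = (a + b) * (2 * (\<integral>l. exp (- (real N * \<delta>) * \<psi> (l\<^sup>2)) * eig_step \<delta> a l * eig_step \<delta> b l \<partial>hl))"
    unfolding I1 by (simp only: mult_ac)
  have "a + b \<noteq> 0" using a b by linarith
  then have "pi * c N = 2 * (\<integral>l. exp (- (real N * \<delta>) * \<psi> (l\<^sup>2)) * eig_step \<delta> a l * eig_step \<delta> b l \<partial>hl)"
    by (rule mult_left_cancel[THEN iffD1, OF _ E])
  then show ?thesis by (simp add: field_simps)
qed

text \<open>The Laplace transform of the eigenfunction with parameter \<open>l\<close> at the point \<open>a\<close>.\<close>

definition eig :: "real \<Rightarrow> real \<Rightarrow> real" where
  "eig a l = l / (l\<^sup>2 + a\<^sup>2) * exp ((\<integral>z. ln (ratio l z) \<partial>hc a) / 2)"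

section \<open>The limit of vanishing time step\<close>

lemma eig_step_nonneg: "0 < l \<Longrightarrow> 0 \<le> eig_step \<delta> a l"
  by (simp add: eig_step_def)

lemma eig_step_measurable: "0 < a \<Longrightarrow> eig_step \<delta> a \<in> borel_measurable hl"
proof -
  assume a: "0 < a"
  interpret H: real_distribution "hc a" by (rule hc_prob[OF a])
  note [measurable] = der_measurable
  define R where "R l z = \<delta> * (indicator {0<..} l * \<psi>' (l\<^sup>2)) * \<bar>z\<^sup>2 - l\<^sup>2\<bar> / \<bar>1 - exp (- \<delta> * (\<psi> (z\<^sup>2) - \<psi> (l\<^sup>2)))\<bar>" for l z
  have "(\<lambda>l. l / (l\<^sup>2 + a\<^sup>2) * exp ((\<integral>z. ln (R l z) \<partial>hc a) / 2)) \<in> borel_measurable borel"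
    unfolding R_def by measurable
  then have "(\<lambda>l. l / (l\<^sup>2 + a\<^sup>2) * exp ((\<integral>z. ln (R l z) \<partial>hc a) / 2)) \<in> borel_measurable hl" by (rule measurable_hl)
  moreover have "eig_step \<delta> a l = l / (l\<^sup>2 + a\<^sup>2) * exp ((\<integral>z. ln (R l z) \<partial>hc a) / 2)" if "l \<in> space hl" for l
    using that by (simp add: eig_step_def R_def ratio_step_def)
  ultimately show ?thesis by (rule iffD2[OF measurable_cong, rotated])
qed

text \<open>The difference quotient of \<open>exp\<close> at 0 gives pointwise convergence of
  \<open>ratio_step\<close> to \<open>ratio\<close>; the dominating function for \<open>t\<close>
  serves all steps up to \<open>t\<close>.\<close>

lemma eig_step_tendsto:
  assumes a: "0 < a" and l: "0 < l" and d: "\<delta> \<longlonglongrightarrow> 0" "\<And>n. 0 < \<delta> n" "\<And>n. \<delta> n \<le> t"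
  shows "(\<lambda>n. eig_step (\<delta> n) a l) \<longlonglongrightarrow> eig a l"
proof -
  have t: "0 < t" using d(2,3)[of 0] by linarith
  have ptw: "(\<lambda>n. ln (ratio_step (\<delta> n) l z)) \<longlonglongrightarrow> ln (ratio l z)" if z: "0 < z" "z \<noteq> l" for z
  proof -
    define u where "u = \<psi> (z\<^sup>2) - \<psi> (l\<^sup>2)"
    have u: "u \<noteq> 0" using psi_ne[OF l z] by (simp add: u_def)
    have "((\<lambda>y. exp (- y * u)) has_real_derivative - u) (at 0)"
      by (auto intro!: derivative_eq_intros)
    then have "((\<lambda>y. (exp (- y * u) - 1) / y) \<longlongrightarrow> - u) (at 0)" by (simp add: has_field_derivative_iff)
    moreover have "filterlim \<delta> (at 0) sequentially"
      using d by (auto simp: filterlim_at eventually_sequentially) (metis less_irrefl)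
    ultimately have "(\<lambda>n. (exp (- \<delta> n * u) - 1) / \<delta> n) \<longlonglongrightarrow> - u" by (rule filterlim_compose)
    then have "(\<lambda>n. \<psi>' (l\<^sup>2) * \<bar>z\<^sup>2 - l\<^sup>2\<bar> / \<bar>(exp (- \<delta> n * u) - 1) / \<delta> n\<bar>) \<longlonglongrightarrow> \<psi>' (l\<^sup>2) * \<bar>z\<^sup>2 - l\<^sup>2\<bar> / \<bar>- u\<bar>"
      using u by (intro tendsto_intros) auto
    moreover have "\<psi>' (l\<^sup>2) * \<bar>z\<^sup>2 - l\<^sup>2\<bar> / \<bar>(exp (- \<delta> n * u) - 1) / \<delta> n\<bar> = ratio_step (\<delta> n) l z" for n
      using d(2)[of n] by (simp add: ratio_step_def u_def abs_minus_commute[of 1])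
    ultimately have "(\<lambda>n. ratio_step (\<delta> n) l z) \<longlonglongrightarrow> ratio l z" by (simp add: ratio_def u_def abs_minus_commute[of "\<psi> (l\<^sup>2)"])
    then show ?thesis using ratio_bounds(3)[OF l z] by (intro tendsto_ln) auto
  qed
  have "(\<lambda>n. \<integral>z. ln (ratio_step (\<delta> n) l z) \<partial>hc a) \<longlonglongrightarrow> (\<integral>z. ln (ratio l z) \<partial>hc a)"
  proof (rule integral_dominated_convergence[OF _ _ ln_ratio_step_dominated(1)[OF a t]])
    show "AE z in hc a. (\<lambda>n. ln (ratio_step (\<delta> n) l z)) \<longlonglongrightarrow> ln (ratio l z)"
      using hc_AE_pos hc_AE_ne[where a=a and l=l] by eventually_elim (rule ptw)
    show "AE z in hc a. norm (ln (ratio_step (\<delta> n) l z)) \<le> 2 * \<bar>ln z\<bar> + 2 * \<bar>ln l\<bar> + t * \<psi> (l\<^sup>2) + ln (1 + t * \<psi> (z\<^sup>2))" for n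
      using hc_AE_pos hc_AE_ne[where a=a and l=l]
      by eventually_elim (use ln_ratio_step_dominated(2)[OF a t l _ _ d(2,3)] in simp)
  qed measurable
  then show ?thesis unfolding eig_step_def eig_def by (intro tendsto_intros) auto
qed

text \<open>As \<open>l\<close> tends to 0 the two exponentials together may grow like
  \<open>1 / l\<^sup>2\<close>, which the numerator \<open>l\<^sup>2\<close> of the product
  compensates. For large \<open>l\<close> they stay bounded.\<close>

lemma eig_step_product_bound:
  assumes a: "0 < a" and b: "0 < b" and t: "0 < t"
  obtains C where "\<And>\<delta> l. 0 < \<delta> \<Longrightarrow> \<delta> \<le> t \<Longrightarrow> 0 < l \<Longrightarrow> eig_step \<delta> a l * eig_step \<delta> b l \<le> C"
proof -
  define M where "M c = (\<integral>z. 2 * \<bar>ln z\<bar> + ln (1 + t * \<psi> (z\<^sup>2)) \<partial>hc c)" for c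
  show thesis
  proof (rule that)
    fix \<delta> l :: real assume d: "0 < \<delta>" "\<delta> \<le> t" and l: "0 < l"
    define Ra where "Ra = (\<integral>z. ln (ratio_step \<delta> l z) \<partial>hc a)"
    define Rb where "Rb = (\<integral>z. ln (ratio_step \<delta> l z) \<partial>hc b)"
    have R: "Ra \<le> 2 * max 0 (- ln l) + M a" "Rb \<le> 2 * max 0 (- ln l) + M b"
      unfolding Ra_def Rb_def M_def by (rule eig_step_upper[OF a l d], rule eig_step_upper[OF b l d])
    have "exp (Ra / 2) * exp (Rb / 2) \<le> exp (2 * max 0 (- ln l) + (M a / 2 + M b / 2))"
      unfolding exp_add[symmetric] using R by simp
    also have "\<dots> = max 1 (1 / l\<^sup>2) * exp (M a / 2 + M b / 2)"
    proof -
      have "exp (2 * max 0 (- ln l)) = max 1 (1 / l\<^sup>2)"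
      proof (cases "l \<le> 1")
        case True
        have "exp (2 * (- ln l)) = 1 / l\<^sup>2" using l by (simp add: exp_minus exp_of_nat_mult[of 2, simplified] inverse_eq_divide)
        moreover have "1 \<le> 1 / l\<^sup>2" using True l by (simp add: power_le_one)
        moreover have "max 0 (- ln l) = - ln l" using True l by simp
        ultimately show ?thesis by simp
      next
        case False
        then have "1 / l\<^sup>2 \<le> 1" by (simp add: divide_le_eq)
        moreover have "max 0 (- ln l) = 0" using False by simp
        ultimately show ?thesis by simp
      qed
      then show ?thesis by (simp add: exp_add)
    qed
    finally have E: "exp (Ra / 2) * exp (Rb / 2) \<le> max 1 (1 / l\<^sup>2) * exp (M a / 2 + M b / 2)" .
    have la: "0 < l\<^sup>2 + a\<^sup>2" "0 < l\<^sup>2 + b\<^sup>2" using l by (auto intro: add_pos_nonneg)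
    have q: "l\<^sup>2 / ((l\<^sup>2 + a\<^sup>2) * (l\<^sup>2 + b\<^sup>2)) * max 1 (1 / l\<^sup>2) \<le> (1 + 1 / a\<^sup>2) / b\<^sup>2"
    proof -
      have "l\<^sup>2 * max 1 (1 / l\<^sup>2) \<le> l\<^sup>2 + 1" using l by (auto simp: max_def)
      then have "l\<^sup>2 / ((l\<^sup>2 + a\<^sup>2) * (l\<^sup>2 + b\<^sup>2)) * max 1 (1 / l\<^sup>2) \<le> (l\<^sup>2 + 1) / ((l\<^sup>2 + a\<^sup>2) * (l\<^sup>2 + b\<^sup>2))"
        using la by (simp add: divide_right_mono)
      also have "\<dots> = (l\<^sup>2 + 1) / (l\<^sup>2 + a\<^sup>2) * (1 / (l\<^sup>2 + b\<^sup>2))" by simp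
      also have "\<dots> \<le> (1 + 1 / a\<^sup>2) * (1 / b\<^sup>2)"
      proof (rule mult_mono)
        have "l\<^sup>2 + 1 \<le> (1 + 1 / a\<^sup>2) * (l\<^sup>2 + a\<^sup>2)" using a by (simp add: field_simps)
        then show "(l\<^sup>2 + 1) / (l\<^sup>2 + a\<^sup>2) \<le> 1 + 1 / a\<^sup>2" using la by (simp add: divide_le_eq)
        show "1 / (l\<^sup>2 + b\<^sup>2) \<le> 1 / b\<^sup>2" using b by (intro divide_left_mono) (auto intro!: mult_pos_pos add_nonneg_pos)
      qed (use la in auto)
      finally show ?thesis by simp
    qed
    have "eig_step \<delta> a l * eig_step \<delta> b l = l\<^sup>2 / ((l\<^sup>2 + a\<^sup>2) * (l\<^sup>2 + b\<^sup>2)) * (exp (Ra / 2) * exp (Rb / 2))"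
      by (simp add: eig_step_def Ra_def Rb_def power2_eq_square)
    also have "\<dots> \<le> l\<^sup>2 / ((l\<^sup>2 + a\<^sup>2) * (l\<^sup>2 + b\<^sup>2)) * (max 1 (1 / l\<^sup>2) * exp (M a / 2 + M b / 2))"
      using E la by (intro mult_left_mono) auto
    also have "\<dots> = l\<^sup>2 / ((l\<^sup>2 + a\<^sup>2) * (l\<^sup>2 + b\<^sup>2)) * max 1 (1 / l\<^sup>2) * exp (M a / 2 + M b / 2)" by simp
    also have "\<dots> \<le> (1 + 1 / a\<^sup>2) / b\<^sup>2 * exp (M a / 2 + M b / 2)" using q by (intro mult_right_mono) auto
    finally show "eig_step \<delta> a l * eig_step \<delta> b l \<le> (1 + 1 / a\<^sup>2) / b\<^sup>2 * exp (M a / 2 + M b / 2)" .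
  qed
qed

lemma eig_integral_limit:
  assumes a: "0 < a" and b: "0 < b" and t: "0 < t"
    and i: "integrable hl (\<lambda>l. exp (- t * \<psi> (l\<^sup>2)))"
  shows "eig a \<in> borel_measurable hl"
    and "integrable hl (\<lambda>l. exp (- t * \<psi> (l\<^sup>2)) * eig a l * eig b l)"
    and "(\<lambda>n. \<integral>l. exp (- t * \<psi> (l\<^sup>2)) * eig_step (t / 2 ^ n) a l * eig_step (t / 2 ^ n) b l \<partial>hl)
      \<longlonglongrightarrow> (\<integral>l. exp (- t * \<psi> (l\<^sup>2)) * eig a l * eig b l \<partial>hl)"
proof -
  have d: "(\<lambda>n. t / 2 ^ n) \<longlonglongrightarrow> 0" "0 < t / 2 ^ n" "t / 2 ^ n \<le> t" for n :: nat
  proof -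
    show "(\<lambda>n. t / 2 ^ n) \<longlonglongrightarrow> 0" by real_asymp
    show "0 < t / 2 ^ n" "t / 2 ^ n \<le> t" using t by (auto simp: divide_le_eq)
  qed
  have lim: "(\<lambda>n. eig_step (t / 2 ^ n) c l) \<longlonglongrightarrow> eig c l" if "0 < c" "l \<in> space hl" for c l
    by (rule eig_step_tendsto[OF that(1) _ d]) (use that in auto)
  show m: "eig a \<in> borel_measurable hl"
    by (rule borel_measurable_LIMSEQ_real[OF lim[OF a] eig_step_measurable[OF a]])
  have mb: "eig b \<in> borel_measurable hl"
    by (rule borel_measurable_LIMSEQ_real[OF lim[OF b] eig_step_measurable[OF b]])
  obtain C where C: "\<And>\<delta> l. 0 < \<delta> \<Longrightarrow> \<delta> \<le> t \<Longrightarrow> 0 < l \<Longrightarrow> eig_step \<delta> a l * eig_step \<delta> b l \<le> C"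
    using eig_step_product_bound[OF a b t] by metis
  have em: "(\<lambda>l. exp (- t * \<psi> (l\<^sup>2))) \<in> borel_measurable hl" by (intro measurable_hl) measurable
  have ci: "integrable hl (\<lambda>l. exp (- t * \<psi> (l\<^sup>2)) * C)" using i by simp
  have le: "AE l in hl. norm (exp (- t * \<psi> (l\<^sup>2)) * eig_step (t / 2 ^ n) a l * eig_step (t / 2 ^ n) b l) \<le> exp (- t * \<psi> (l\<^sup>2)) * C" for n
  proof (rule AE_I2)
    fix l assume "l \<in> space hl"
    then have l: "0 < l" by simp
    show "norm (exp (- t * \<psi> (l\<^sup>2)) * eig_step (t / 2 ^ n) a l * eig_step (t / 2 ^ n) b l) \<le> exp (- t * \<psi> (l\<^sup>2)) * C"
      using C[OF d(2,3)[of n] l] eig_step_nonneg[OF l] by (simp add: abs_mult mult.assoc)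
  qed
  have tl: "AE l in hl. (\<lambda>n. exp (- t * \<psi> (l\<^sup>2)) * eig_step (t / 2 ^ n) a l * eig_step (t / 2 ^ n) b l) \<longlonglongrightarrow> exp (- t * \<psi> (l\<^sup>2)) * eig a l * eig b l"
    by (rule AE_I2) (intro tendsto_mult tendsto_const lim a b)
  have m1: "(\<lambda>l. exp (- t * \<psi> (l\<^sup>2)) * eig a l * eig b l) \<in> borel_measurable hl" using m mb em by measurable
  have m2: "(\<lambda>l. exp (- t * \<psi> (l\<^sup>2)) * eig_step (t / 2 ^ n) a l * eig_step (t / 2 ^ n) b l) \<in> borel_measurable hl" for n
    using eig_step_measurable[OF a] eig_step_measurable[OF b] em by measurable
  show "integrable hl (\<lambda>l. exp (- t * \<psi> (l\<^sup>2)) * eig a l * eig b l)"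
    by (rule integrable_dominated_convergence[OF m1 m2 ci tl le])
  show "(\<lambda>n. \<integral>l. exp (- t * \<psi> (l\<^sup>2)) * eig_step (t / 2 ^ n) a l * eig_step (t / 2 ^ n) b l \<partial>hl)
      \<longlonglongrightarrow> (\<integral>l. exp (- t * \<psi> (l\<^sup>2)) * eig a l * eig b l \<partial>hl)"
    by (rule integral_dominated_convergence[OF m1 m2 ci tl le])
qed

end

section \<open>From random walks to the killed process\<close>

lemma killed_walk_cong:
  assumes "\<And>y. 0 < y \<Longrightarrow> g y = h y"
  shows "killed_walk \<mu> g k = killed_walk \<mu> h k"
proof (induction k)
  case 0
  then show ?case using assms by (auto simp: fun_eq_iff indicator_def)
qed simp

text \<open>The recursion opens at the first step; here the averaging is moved to the last step,
  whose increment is independent of the earlier ones and can be peeled off by induction.\<close>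

lemma killed_walk_last_step:
  "killed_walk \<mu> g (Suc k) = killed_walk \<mu> (\<lambda>y. \<integral>s. indicator {0<..} (y + s) * g (y + s) \<partial>\<mu>) k"
proof (induction k)
  case (Suc k)
  show ?case
    unfolding killed_walk.simps(2)[of _ _ "Suc k"] Suc
      killed_walk.simps(2)[of _ "\<lambda>y. \<integral>s. indicator {0<..} (y + s) * g (y + s) \<partial>\<mu>" k] ..
qed simp

text \<open>Fubini for the product law. Both orders are recorded: one averages out the last step of
  a walk, the other the initial piece of a path.\<close>

lemma (in prob_space) indep_var_expectation:
  fixes h :: "'b \<times> 'b \<Rightarrow> real"
  assumes ind: "indep_var S A T B" and h [measurable]: "h \<in> borel_measurable (S \<Otimes>\<^sub>M T)"
    and bdd: "\<And>z. \<bar>h z\<bar> \<le> C"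
  shows "expectation (\<lambda>\<omega>. h (A \<omega>, B \<omega>)) = expectation (\<lambda>\<omega>. expectation (\<lambda>\<omega>'. h (A \<omega>, B \<omega>')))"
    and "expectation (\<lambda>\<omega>. h (A \<omega>, B \<omega>)) = expectation (\<lambda>\<omega>. expectation (\<lambda>\<omega>'. h (A \<omega>', B \<omega>)))"
proof -
  have A [measurable]: "random_variable S A" and B [measurable]: "random_variable T B"
    and d: "distr M S A \<Otimes>\<^sub>M distr M T B = distr M (S \<Otimes>\<^sub>M T) (\<lambda>x. (A x, B x))"
    using ind unfolding indep_var_distribution_eq by auto
  interpret a: prob_space "distr M S A" by (rule prob_space_distr) fact
  interpret b: prob_space "distr M T B" by (rule prob_space_distr) fact
  interpret P: pair_prob_space "distr M S A" "distr M T B" ..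
  have i: "integrable (distr M S A \<Otimes>\<^sub>M distr M T B) h"
    by (rule P.integrable_const_bound[where B=C]) (use bdd in auto)
  have "expectation (\<lambda>\<omega>. h (A \<omega>, B \<omega>)) = integral\<^sup>L (distr M S A \<Otimes>\<^sub>M distr M T B) h"
    unfolding d by (subst integral_distr) auto
  moreover have "integral\<^sup>L (distr M S A \<Otimes>\<^sub>M distr M T B) h = (\<integral>a. \<integral>b. h (a, b) \<partial>distr M T B \<partial>distr M S A)"
    by (rule P.integral_fst'[OF i, symmetric])
  moreover have "integral\<^sup>L (distr M S A \<Otimes>\<^sub>M distr M T B) h = (\<integral>b. \<integral>a. h (a, b) \<partial>distr M S A \<partial>distr M T B)"
    using P.integral_snd[of "\<lambda>a b. h (a, b)"] i by simp
  moreover have "(\<integral>a. \<integral>b. h (a, b) \<partial>distr M T B \<partial>distr M S A) = expectation (\<lambda>\<omega>. expectation (\<lambda>\<omega>'. h (A \<omega>, B \<omega>')))"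
    by (subst integral_distr)
       (auto intro!: b.borel_measurable_lebesgue_integral Bochner_Integration.integral_cong integral_distr)
  moreover have "(\<integral>b. \<integral>a. h (a, b) \<partial>distr M S A \<partial>distr M T B) = expectation (\<lambda>\<omega>. expectation (\<lambda>\<omega>'. h (A \<omega>', B \<omega>)))"
    by (subst integral_distr)
       (auto intro!: a.borel_measurable_lebesgue_integral Bochner_Integration.integral_cong integral_distr)
  ultimately show "expectation (\<lambda>\<omega>. h (A \<omega>, B \<omega>)) = expectation (\<lambda>\<omega>. expectation (\<lambda>\<omega>'. h (A \<omega>, B \<omega>')))"
    "expectation (\<lambda>\<omega>. h (A \<omega>, B \<omega>)) = expectation (\<lambda>\<omega>. expectation (\<lambda>\<omega>'. h (A \<omega>', B \<omega>)))" by simp_all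
qed

text \<open>Survival up to step \<open>k\<close> and the position at \<open>k\<close> are functions
  of the increments with index below \<open>k\<close>, so averaging over the independent
  \<open>Y k\<close> reproduces the function \<open>G\<close> of the last-step recursion.\<close>

lemma (in prob_space) killed_walk_expectation:
  fixes Y :: "nat \<Rightarrow> 'a \<Rightarrow> real" and g :: "real \<Rightarrow> real"
  assumes ind: "\<And>n. indep_vars (\<lambda>_. borel) Y {..<n}"
    and dist: "\<And>k. distr M borel (Y k) = \<mu>"
    and g: "g \<in> borel_measurable borel" "\<And>y. \<bar>g y\<bar> \<le> C"
  shows "killed_walk \<mu> g k x =
    expectation (\<lambda>\<omega>. g (x + (\<Sum>i<k. Y i \<omega>)) * (\<Prod>j\<le>k. indicator {0<..} (x + (\<Sum>i<j. Y i \<omega>))))"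
  using g
proof (induction k arbitrary: g)
  case 0
  show ?case by (simp add: prob_space)
next
  case (Suc k)
  note [measurable] = Suc.prems(1)
  have Y [measurable]: "Y i \<in> borel_measurable M" for i
    using ind[of "Suc i"] unfolding indep_vars_def by auto
  interpret m: prob_space \<mu> unfolding dist[of 0, symmetric] by (rule prob_space_distr) measurable
  have sm [measurable_cong]: "sets \<mu> = sets borel" unfolding dist[of 0, symmetric] by simp
  define G where "G y = (\<integral>s. indicator {0<..} (y + s) * g (y + s) \<partial>\<mu>)" for y
  have C: "0 \<le> C" using Suc.prems(2)[of 0] by linarith
  have Gm: "G \<in> borel_measurable borel" unfolding G_def[abs_def] by measurable
  have Gb: "\<bar>G y\<bar> \<le> C" for y
  proof -
    have "norm (G y) \<le> (\<integral>s. C \<partial>\<mu>)" unfolding G_def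
      by (rule norm_integral_le[OF m.integrable_const_bound[where B=C]])
         (use Suc.prems(2) C in \<open>auto simp: indicator_def intro!: AE_I2\<close>)
    then show ?thesis by (simp add: m.prob_space)
  qed
  define P where "P u = (\<Prod>j\<le>k. indicator {0<..} (x + (\<Sum>i<j. u i)) :: real)" for u :: "nat \<Rightarrow> real"
  have P01: "0 \<le> P u" "P u \<le> 1" for u
    unfolding P_def by (auto intro!: prod_nonneg prod_le_1 simp: indicator_def)
  let ?S = "PiM {..<k} (\<lambda>_. borel :: real measure)"
  let ?R = "\<lambda>\<omega>. restrict (\<lambda>i. Y i \<omega>) {..<k}"
  let ?T = "PiM {k} (\<lambda>_. borel :: real measure)"
  let ?Q = "\<lambda>\<omega>. restrict (\<lambda>i. Y i \<omega>) {k}"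
  have iv: "indep_var ?S ?R ?T ?Q"
    by (rule indep_var_restrict[OF ind[of "Suc k"]]) auto
  define h where "h = (\<lambda>(u, s). P u * (indicator {0<..} (x + (\<Sum>i<k. u i) + s k) * g (x + (\<Sum>i<k. u i) + s k)))"
  have sums: "(\<lambda>u. \<Sum>i<j. u i) \<in> borel_measurable ?S" if "j \<le> k" for j
    using that by (intro borel_measurable_sum) (auto intro!: measurable_component_singleton)
  have Pm: "P \<in> borel_measurable ?S" unfolding P_def[abs_def]
  proof (intro borel_measurable_prod)
    fix j assume "j \<in> {..k}"
    then have [measurable]: "(\<lambda>u. \<Sum>i<j. u i) \<in> borel_measurable ?S" using sums by simp
    show "(\<lambda>u. indicator {0<..} (x + (\<Sum>i<j. u i)) :: real) \<in> borel_measurable ?S" by measurable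
  qed
  have hm: "h \<in> borel_measurable (?S \<Otimes>\<^sub>M ?T)"
  proof -
    have "(\<lambda>s. s k) \<in> borel_measurable ?T" by (rule measurable_component_singleton) simp
    note [measurable] = this Pm sums[OF le_refl]
    show ?thesis unfolding h_def by measurable
  qed
  have hb: "\<bar>h z\<bar> \<le> C" for z
  proof -
    have "\<bar>P u * (indicator {0<..} v * g v)\<bar> \<le> 1 * C" for u and v :: real
      unfolding abs_mult using P01[of u] Suc.prems(2)[of v] C by (intro mult_mono) (auto simp: indicator_def)
    then show ?thesis by (cases z) (simp add: h_def)
  qed
  have PR: "P (?R \<omega>) = (\<Prod>j\<le>k. indicator {0<..} (x + (\<Sum>i<j. Y i \<omega>)))" for \<omega>
    unfolding P_def by (intro prod.cong refl arg_cong[where f="indicator {0<..}"] arg_cong2[where f="(+)"] sum.cong) auto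
  have SR: "(\<Sum>i<k. ?R \<omega> i) = (\<Sum>i<k. Y i \<omega>)" for \<omega> by simp
  have "killed_walk \<mu> g (Suc k) x = killed_walk \<mu> G k x" unfolding killed_walk_last_step G_def[abs_def] ..
  also have "\<dots> = expectation (\<lambda>\<omega>. G (x + (\<Sum>i<k. Y i \<omega>)) * (\<Prod>j\<le>k. indicator {0<..} (x + (\<Sum>i<j. Y i \<omega>))))"
    by (rule Suc.IH[OF Gm Gb])
  also have "\<dots> = expectation (\<lambda>\<omega>. expectation (\<lambda>\<omega>'. h (?R \<omega>, ?Q \<omega>')))"
  proof (intro Bochner_Integration.integral_cong refl)
    fix \<omega>
    have "G y = expectation (\<lambda>\<omega>'. indicator {0<..} (y + Y k \<omega>') * g (y + Y k \<omega>'))" for y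
      unfolding G_def dist[of k, symmetric] by (rule integral_distr) auto
    then show "G (x + (\<Sum>i<k. Y i \<omega>)) * (\<Prod>j\<le>k. indicator {0<..} (x + (\<Sum>i<j. Y i \<omega>))) =
        expectation (\<lambda>\<omega>'. h (?R \<omega>, ?Q \<omega>'))"
      unfolding h_def split PR SR by (simp add: mult.commute)
  qed
  also have "\<dots> = expectation (\<lambda>\<omega>. h (?R \<omega>, ?Q \<omega>))"
    by (rule indep_var_expectation(1)[OF iv hm hb, symmetric])
  also have "\<dots> = expectation (\<lambda>\<omega>. g (x + (\<Sum>i<Suc k. Y i \<omega>)) * (\<Prod>j\<le>Suc k. indicator {0<..} (x + (\<Sum>i<j. Y i \<omega>))))"
    unfolding h_def split PR SR
    by (intro Bochner_Integration.integral_cong refl) (simp add: atMost_Suc add.assoc mult_ac)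
  finally show ?case .
qed

section \<open>The process along equidistant times and its minimum\<close>

locale levy_walk = levy_symbol \<psi> \<psi>' for \<psi> \<psi>' :: "real \<Rightarrow> real" +
  fixes M :: "'a measure" and X :: "real \<Rightarrow> 'a \<Rightarrow> real" and t :: real
  assumes process: "levy_process M X"
    and chars: "0 \<le> s \<Longrightarrow> char (distr M borel (X s)) \<xi> = of_real (exp (- s * \<psi> (\<xi>\<^sup>2)))"
    and t: "0 < t"
begin

sublocale prob_space M using process by (simp add: levy_process_def)

lemma X_measurable [measurable]: "0 \<le> s \<Longrightarrow> X s \<in> borel_measurable M"
  using process by (simp add: levy_process_def)

lemma X_0: "AE \<omega> in M. X 0 \<omega> = 0"
  using process by (simp add: levy_process_def)

lemma right_continuous: "AE \<omega> in M. \<forall>s\<ge>0. ((\<lambda>s. X s \<omega>) \<longlongrightarrow> X s \<omega>) (at_right s)"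
proof -
  have "AE \<omega> in M. \<forall>t\<ge>0. ((\<lambda>s. X s \<omega>) \<longlongrightarrow> X t \<omega>) (at_right t) \<and>
        (0 < t \<longrightarrow> (\<exists>l. ((\<lambda>s. X s \<omega>) \<longlongrightarrow> l) (at_left t)))"
    using process unfolding levy_process_def by blast
  then show ?thesis by eventually_elim blast
qed

definition inc :: "real \<Rightarrow> nat \<Rightarrow> 'a \<Rightarrow> real" where
  "inc \<delta> k \<omega> = X (real (Suc k) * \<delta>) \<omega> - X (real k * \<delta>) \<omega>"

lemma inc_indep:
  assumes "0 \<le> \<delta>"
  shows "indep_vars (\<lambda>_. borel) (inc \<delta>) {..<n}"
proof -
  have "mono (\<lambda>k. real k * \<delta>)" using assms by (intro monoI mult_right_mono) auto
  then show ?thesis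
    using process unfolding levy_process_def inc_def[abs_def]
    by (elim conjE allE[of _ n] allE[of _ "\<lambda>k. real k * \<delta>"] impE) auto
qed

lemma inc_dist:
  assumes "0 \<le> \<delta>"
  shows "distr M borel (inc \<delta> k) = distr M borel (X \<delta>)"
proof -
  have "distr M borel (\<lambda>\<omega>. X (real k * \<delta> + \<delta>) \<omega> - X (real k * \<delta>) \<omega>) = distr M borel (X \<delta>)"
    using process assms unfolding levy_process_def by (auto simp del: of_nat_Suc)
  moreover have "real (Suc k) * \<delta> = real k * \<delta> + \<delta>" by (simp add: algebra_simps)
  ultimately show ?thesis unfolding inc_def[abs_def] by simp
qed

lemma inc_sum: "k \<le> j \<Longrightarrow> (\<Sum>i\<in>{k..<j}. inc \<delta> i \<omega>) = X (real j * \<delta>) \<omega> - X (real k * \<delta>) \<omega>"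
  unfolding inc_def by (rule sum_Suc_diff')

lemma walk_chars:
  assumes "0 \<le> \<delta>"
  shows "walk_chars (distr M borel (X \<delta>)) (\<lambda>k. distr M borel (X (real k * \<delta>))) (phi \<delta>)"
  unfolding walk_chars_def
proof (intro conjI allI)
  show "real_distribution (distr M borel (X (real k * \<delta>)))" for k
    using assms by (intro real_distribution_distr) simp
  show "real_distribution (distr M borel (X \<delta>))"
    using assms by (intro real_distribution_distr) simp
  show "char (distr M borel (X \<delta>)) \<xi> = of_real (phi \<delta> \<xi>)" for \<xi>
    using chars[OF assms] by (simp add: phi_def)
  show "char (distr M borel (X (real k * \<delta>))) \<xi> = of_real (phi \<delta> \<xi> ^ k)" for k \<xi>
    using chars[of "real k * \<delta>"] assms by (simp add: phi_def exp_of_nat_mult[symmetric] mult.assoc)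
qed

lemma walk_expectation:
  assumes \<delta>: "0 \<le> \<delta>" and g [measurable]: "g \<in> borel_measurable borel" and b: "\<And>y. \<bar>g y\<bar> \<le> C"
  shows "killed_walk (distr M borel (X \<delta>)) g k x =
    expectation (\<lambda>\<omega>. g (x + X (real k * \<delta>) \<omega>) * (\<Prod>j\<le>k. indicator {0<..} (x + X (real j * \<delta>) \<omega>)))"
proof -
  have [measurable]: "inc \<delta> i \<in> borel_measurable M" for i
    using inc_indep[OF \<delta>, of "Suc i"] unfolding indep_vars_def by auto
  have [measurable]: "X (real j * \<delta>) \<in> borel_measurable M" for j using \<delta> by simp
  show ?thesis
    unfolding killed_walk_expectation[OF inc_indep[OF \<delta>] inc_dist[OF \<delta>] g b]
  proof (rule integral_cong_AE)
    show "AE \<omega> in M. g (x + (\<Sum>i<k. inc \<delta> i \<omega>)) * (\<Prod>j\<le>k. indicator {0<..} (x + (\<Sum>i<j. inc \<delta> i \<omega>))) =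
        g (x + X (real k * \<delta>) \<omega>) * (\<Prod>j\<le>k. indicator {0<..} (x + X (real j * \<delta>) \<omega>))"
      using X_0
    proof eventually_elim
      case (elim \<omega>)
      then have "(\<Sum>i<j. inc \<delta> i \<omega>) = X (real j * \<delta>) \<omega>" for j
        using inc_sum[of 0 j \<delta> \<omega>] by (simp add: lessThan_atLeast0)
      then show ?case by simp
    qed
  qed measurable
qed

text \<open>Splitting off the increment of \<open>X\<close> up to time \<open>t / 2 ^ n\<close>, which is independent of the rest of the
  minimum and has no concentration, shows that the minimum after that time is not 0.\<close>

definition wmin :: "real \<Rightarrow> nat \<Rightarrow> nat \<Rightarrow> 'a \<Rightarrow> real" where
  "wmin x n i \<omega> = Min ((\<lambda>j. x + X (real j * (t / 2 ^ (n + i))) \<omega>) ` {2 ^ i..2 ^ (n + i)})"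

lemma wmin_measurable [measurable]: "wmin x n i \<in> borel_measurable M"
  unfolding wmin_def[abs_def] using t by (intro borel_measurable_Min) auto

text \<open>Given the increments after time \<open>t / 2 ^ n\<close>, the minimum is
  \<open>X (t / 2 ^ n)\<close> shifted by a constant. By \<open>exp_abs_expectation\<close> the
  shift enters only through a cosine, so the bound is uniform in the shift and in the mesh.\<close>

lemma wmin_bound:
  assumes a: "0 < a"
  shows "expectation (\<lambda>\<omega>. exp (- a * \<bar>wmin x n i \<omega>\<bar>)) \<le> (\<integral>z. phi (t / 2 ^ n) z \<partial>hc a)"
proof -
  define \<delta> where "\<delta> = t / 2 ^ (n + i)"
  define k N where "k = (2::nat) ^ i" and "N = (2::nat) ^ (n + i)"
  have \<delta>: "0 \<le> \<delta>" using t by (simp add: \<delta>_def)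
  have kN: "k \<le> N" unfolding k_def N_def by (intro power_increasing) auto
  have kd: "real k * \<delta> = t / 2 ^ n" by (simp add: k_def \<delta>_def power_add)
  interpret H: real_distribution "hc a" by (rule hc_prob[OF a])
  let ?S = "PiM {..<k} (\<lambda>_. borel :: real measure)" and ?T = "PiM {k..<N} (\<lambda>_. borel :: real measure)"
  let ?R = "\<lambda>\<omega>. restrict (\<lambda>i. inc \<delta> i \<omega>) {..<k}" and ?Q = "\<lambda>\<omega>. restrict (\<lambda>i. inc \<delta> i \<omega>) {k..<N}"
  have iv: "indep_var ?S ?R ?T ?Q"
    by (rule indep_var_restrict[OF inc_indep[OF \<delta>, of N]]) (use kN in auto)
  define Z where "Z v = Min ((\<lambda>j. x + (\<Sum>i\<in>{k..<j}. v i)) ` {k..N})" for v :: "nat \<Rightarrow> real"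
  define h where "h = (\<lambda>(u, v). exp (- a * \<bar>(\<Sum>i<k. u i) + Z v\<bar>))"
  have "Z \<in> borel_measurable ?T" unfolding Z_def[abs_def]
    by (intro borel_measurable_Min borel_measurable_add borel_measurable_const borel_measurable_sum)
       (auto intro!: measurable_component_singleton)
  moreover have "(\<lambda>u. \<Sum>i<k. u i) \<in> borel_measurable ?S"
    by (intro borel_measurable_sum) (auto intro!: measurable_component_singleton)
  ultimately have hm: "h \<in> borel_measurable (?S \<Otimes>\<^sub>M ?T)" unfolding h_def by measurable
  have hb: "\<bar>h z\<bar> \<le> 1" for z using a by (cases z) (simp add: h_def)
  have [measurable]: "inc \<delta> i \<in> borel_measurable M" for i
    using inc_indep[OF \<delta>, of "Suc i"] unfolding indep_vars_def by auto
  have [measurable]: "X (real j * \<delta>) \<in> borel_measurable M" for j using \<delta> by simp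
  have R: "(\<Sum>i<k. ?R \<omega> i) = X (real k * \<delta>) \<omega> - X 0 \<omega>" for \<omega>
    using inc_sum[of 0 k \<delta> \<omega>] by (simp add: lessThan_atLeast0)
  have Q: "Z (?Q \<omega>) = wmin x n i \<omega> - X (real k * \<delta>) \<omega>" for \<omega>
  proof -
    have "Z (?Q \<omega>) = Min ((\<lambda>j. (x + X (real j * \<delta>) \<omega>) + (- X (real k * \<delta>) \<omega>)) ` {k..N})"
      unfolding Z_def
    proof (intro arg_cong[where f=Min] image_cong refl)
      fix j assume j: "j \<in> {k..N}"
      then have "(\<Sum>i\<in>{k..<j}. ?Q \<omega> i) = (\<Sum>i\<in>{k..<j}. inc \<delta> i \<omega>)" by (intro sum.cong) auto
      then show "x + (\<Sum>i\<in>{k..<j}. ?Q \<omega> i) = x + X (real j * \<delta>) \<omega> + - X (real k * \<delta>) \<omega>"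
        using j by (simp add: inc_sum)
    qed
    also have "\<dots> = Min ((\<lambda>j. x + X (real j * \<delta>) \<omega>) ` {k..N}) + (- X (real k * \<delta>) \<omega>)"
      using kN by (intro Min_add_commute) auto
    finally show ?thesis by (simp add: wmin_def k_def N_def \<delta>_def)
  qed
  have inner: "expectation (\<lambda>\<omega>'. h (?R \<omega>', ?Q \<omega>)) \<le> (\<integral>z. phi (t / 2 ^ n) z \<partial>hc a)" for \<omega>
  proof -
    let ?y = "Z (?Q \<omega>)"
    interpret W: walk_chars "distr M borel (X (t / 2 ^ n))" "\<lambda>k. distr M borel (X (real k * (t / 2 ^ n)))" "phi (t / 2 ^ n)"
      using t by (intro walk_chars) simp
    have "expectation (\<lambda>\<omega>'. h (?R \<omega>', ?Q \<omega>)) = expectation (\<lambda>\<omega>'. exp (- a * \<bar>X (real k * \<delta>) \<omega>' + ?y\<bar>))"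
      unfolding h_def split R
    proof (rule integral_cong_AE)
      show "AE \<omega>' in M. exp (- a * \<bar>X (real k * \<delta>) \<omega>' - X 0 \<omega>' + ?y\<bar>) = exp (- a * \<bar>X (real k * \<delta>) \<omega>' + ?y\<bar>)"
        using X_0 by eventually_elim simp
    qed auto
    also have "\<dots> = (\<integral>s. exp (- a * \<bar>s + ?y\<bar>) \<partial>distr M borel (X (real k * \<delta>)))"
      by (rule integral_distr[symmetric]) auto
    also have "\<dots> = (\<integral>z. cos (z * ?y) * phi (t / 2 ^ n) z \<partial>hc a)"
      using W.exp_abs_expectation[OF a, of 1 ?y] by (simp add: kd)
    also have "\<dots> \<le> (\<integral>z. phi (t / 2 ^ n) z \<partial>hc a)"
    proof (rule integral_mono)
      have b: "\<bar>cos (z * ?y) * phi (t / 2 ^ n) z\<bar> \<le> 1" "\<bar>phi (t / 2 ^ n) z\<bar> \<le> 1" for z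
        using t phi_range(1,2)[of "t / 2 ^ n" z] abs_cos_le_one[of "z * ?y"]
        by (auto simp: abs_mult intro!: mult_le_one)
      show "integrable (hc a) (\<lambda>z. cos (z * ?y) * phi (t / 2 ^ n) z)" "integrable (hc a) (phi (t / 2 ^ n))"
        using b by (auto intro!: H.integrable_const_bound[where B=1])
      show "cos (z * ?y) * phi (t / 2 ^ n) z \<le> phi (t / 2 ^ n) z" for z
        using t phi_range(1)[of "t / 2 ^ n" z] mult_right_mono[OF cos_le_one] by fastforce
    qed
    finally show ?thesis .
  qed
  have "expectation (\<lambda>\<omega>. exp (- a * \<bar>wmin x n i \<omega>\<bar>)) = expectation (\<lambda>\<omega>. h (?R \<omega>, ?Q \<omega>))"
  proof (rule integral_cong_AE)
    show "AE \<omega> in M. exp (- a * \<bar>wmin x n i \<omega>\<bar>) = h (?R \<omega>, ?Q \<omega>)"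
      using X_0 by eventually_elim (simp only: h_def split R Q, simp)
    show "(\<lambda>\<omega>. h (?R \<omega>, ?Q \<omega>)) \<in> borel_measurable M" unfolding h_def split R Q by measurable
  qed measurable
  also have "\<dots> = expectation (\<lambda>\<omega>. expectation (\<lambda>\<omega>'. h (?R \<omega>', ?Q \<omega>)))"
    by (rule indep_var_expectation(2)[OF iv hm hb])
  also have "\<dots> \<le> (\<integral>z. phi (t / 2 ^ n) z \<partial>hc a)"
  proof (cases "integrable M (\<lambda>\<omega>. expectation (\<lambda>\<omega>'. h (?R \<omega>', ?Q \<omega>)))")
    case True
    show ?thesis by (rule integral_le_const[OF True]) (use inner in auto)
  next
    \<comment> \<open>The integral of a non-integrable function is 0 by convention, which is below
      the nonnegative right-hand side.\<close>
    case False
    have "0 \<le> (\<integral>z. phi (t / 2 ^ n) z \<partial>hc a)"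
      using t by (intro Bochner_Integration.integral_nonneg) (auto intro: phi_range(1))
    then show ?thesis using False by (simp add: not_integrable_integral_eq)
  qed
  finally show ?thesis .
qed

text \<open>As the scale grows, the mass of the half-Cauchy law escapes to where
  \<open>phi \<delta>\<close> vanishes, \<psi> being unbounded. In the angle variable the measure is
  fixed and dominated convergence applies.\<close>

lemma phi_hc_tendsto_0:
  assumes \<delta>: "0 < \<delta>"
  shows "(\<lambda>k. \<integral>z. phi \<delta> z \<partial>hc (real (Suc k))) \<longlonglongrightarrow> 0"
proof -
  have [measurable]: "(\<lambda>\<theta>::real. a * tan \<theta>) \<in> borel_measurable borel" for a unfolding tan_def by measurable
  have "(\<lambda>k. LBINT \<theta>:{0<..<pi/2}. phi \<delta> (real (Suc k) * tan \<theta>)) \<longlonglongrightarrow> (LBINT \<theta>:{0<..<pi/2}. 0)"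
    unfolding set_lebesgue_integral_def
  proof (rule integral_dominated_convergence[where w="\<lambda>\<theta>. indicator {0<..<pi/2} \<theta>"])
    show "AE \<theta> in lborel. (\<lambda>k. indicator {0<..<pi/2} \<theta> *\<^sub>R phi \<delta> (real (Suc k) * tan \<theta>)) \<longlonglongrightarrow>
        indicator {0<..<pi/2} \<theta> *\<^sub>R (0::real)"
    proof (rule AE_I2)
      fix \<theta> :: real
      show "(\<lambda>k. indicator {0<..<pi/2} \<theta> *\<^sub>R phi \<delta> (real (Suc k) * tan \<theta>)) \<longlonglongrightarrow> indicator {0<..<pi/2} \<theta> *\<^sub>R (0::real)"
      proof (cases "\<theta> \<in> {0<..<pi/2}")
        case True
        then have T: "0 < tan \<theta>" by (auto intro: tan_gt_zero)
        have "filterlim (\<lambda>k. (real (Suc k) * c)\<^sup>2) at_top sequentially" if "0 < c" for c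
          using that by real_asymp
        from this[OF T]
        have "filterlim (\<lambda>k. \<psi> ((real (Suc k) * tan \<theta>)\<^sup>2)) at_top sequentially"
          by (rule filterlim_compose[OF at_inf])
        then have "filterlim (\<lambda>k. - \<delta> * \<psi> ((real (Suc k) * tan \<theta>)\<^sup>2)) at_bot sequentially"
          using \<delta> by (subst filterlim_tendsto_neg_mult_at_bot_iff[where c="-\<delta>"]) auto
        then have "(\<lambda>k. phi \<delta> (real (Suc k) * tan \<theta>)) \<longlonglongrightarrow> 0"
          unfolding phi_def by (rule filterlim_compose[OF exp_at_bot])
        then show ?thesis using True by simp
      qed simp
    qed
    show "AE \<theta> in lborel. norm (indicator {0<..<pi/2} \<theta> *\<^sub>R phi \<delta> (real (Suc k) * tan \<theta>)) \<le> indicator {0<..<pi/2} \<theta>" for k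
      using \<delta> phi_range(1,2) by (auto simp: indicator_def)
  qed auto
  then have "(\<lambda>k. 2 / pi * (LBINT \<theta>:{0<..<pi/2}. phi \<delta> (real (Suc k) * tan \<theta>))) \<longlonglongrightarrow> 2 / pi * 0"
    by (intro tendsto_mult tendsto_const) (simp add: set_lebesgue_integral_def)
  then show ?thesis by (subst hc_integral_tan) auto
qed

text \<open>On the event in question \<open>exp (- a * \<bar>wmin x n i \<omega>\<bar>)\<close>
  tends to 1 as the mesh is refined, so its probability is at most the bound of
  \<open>wmin_bound\<close> for every \<open>a\<close>, and that bound tends to 0.\<close>

lemma wmin_not_tendsto_0: "AE \<omega> in M. \<not> (\<lambda>i. wmin x n i \<omega>) \<longlonglongrightarrow> 0"
proof -
  define B where "B = {\<omega> \<in> space M. (\<lambda>i. wmin x n i \<omega>) \<longlonglongrightarrow> 0}"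
  have B [measurable]: "B \<in> sets M" unfolding B_def by measurable
  have "prob B \<le> (\<integral>z. phi (t / 2 ^ n) z \<partial>hc (real (Suc k)))" for k
  proof (rule LIMSEQ_le_const2)
    let ?a = "real (Suc k)"
    have "(\<lambda>i. expectation (\<lambda>\<omega>. indicator B \<omega> * exp (- ?a * \<bar>wmin x n i \<omega>\<bar>))) \<longlonglongrightarrow> expectation (\<lambda>\<omega>. indicator B \<omega>)"
    proof (rule integral_dominated_convergence[where w="\<lambda>_. 1"])
      show "AE \<omega> in M. (\<lambda>i. indicator B \<omega> * exp (- ?a * \<bar>wmin x n i \<omega>\<bar>)) \<longlonglongrightarrow> indicator B \<omega>"
      proof (rule AE_I2)
        fix \<omega> assume "\<omega> \<in> space M"
        show "(\<lambda>i. indicator B \<omega> * exp (- ?a * \<bar>wmin x n i \<omega>\<bar>)) \<longlonglongrightarrow> indicator B \<omega>"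
        proof (cases "\<omega> \<in> B")
          case True
          then have "(\<lambda>i. wmin x n i \<omega>) \<longlonglongrightarrow> 0" by (simp add: B_def)
          then have "(\<lambda>i. exp (- ?a * \<bar>wmin x n i \<omega>\<bar>)) \<longlonglongrightarrow> exp (- ?a * \<bar>0\<bar>)"
            by (intro tendsto_intros)
          then show ?thesis using True by simp
        qed simp
      qed
    qed (auto simp: indicator_def intro!: AE_I2 mult_nonpos_nonneg)
    then show "(\<lambda>i. expectation (\<lambda>\<omega>. indicator B \<omega> * exp (- ?a * \<bar>wmin x n i \<omega>\<bar>))) \<longlonglongrightarrow> prob B" by simp
    show "\<exists>N. \<forall>i\<ge>N. expectation (\<lambda>\<omega>. indicator B \<omega> * exp (- ?a * \<bar>wmin x n i \<omega>\<bar>)) \<le> (\<integral>z. phi (t / 2 ^ n) z \<partial>hc ?a)"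
    proof (intro exI allI impI)
      fix i
      have "expectation (\<lambda>\<omega>. indicator B \<omega> * exp (- ?a * \<bar>wmin x n i \<omega>\<bar>)) \<le> expectation (\<lambda>\<omega>. exp (- ?a * \<bar>wmin x n i \<omega>\<bar>))"
        by (intro integral_mono integrable_const_bound[where B=1]) (auto simp: indicator_def intro!: AE_I2 mult_nonpos_nonneg)
      also have "\<dots> \<le> (\<integral>z. phi (t / 2 ^ n) z \<partial>hc ?a)" by (rule wmin_bound) simp
      finally show "expectation (\<lambda>\<omega>. indicator B \<omega> * exp (- ?a * \<bar>wmin x n i \<omega>\<bar>)) \<le> (\<integral>z. phi (t / 2 ^ n) z \<partial>hc ?a)" .
    qed
  qed
  then have "prob B \<le> 0"
    using t by (intro LIMSEQ_le_const[OF phi_hc_tendsto_0[of "t / 2 ^ n"]]) auto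
  then have "prob B = 0" using measure_nonneg[of M B] by linarith
  then have "AE \<omega> in M. \<omega> \<notin> B" by (subst (asm) prob_eq_0) auto
  then show ?thesis using AE_space by eventually_elim (auto simp: B_def)
qed

section \<open>Survival on dyadic grids and survival of the path\<close>

definition grid :: "nat \<Rightarrow> nat \<Rightarrow> real" where "grid m j = real j * (t / 2 ^ m)"

lemma grid_nonneg: "0 \<le> grid m j"
  using t by (simp add: grid_def)

lemma X_grid_measurable [measurable]: "X (grid m j) \<in> borel_measurable M"
  by (rule X_measurable[OF grid_nonneg])

lemma grid_top: "grid m (2 ^ m) = t"
  by (simp add: grid_def)

lemma grid_refine: "m \<le> m' \<Longrightarrow> grid m' (j * 2 ^ (m' - m)) = grid m j"
  by (auto simp: grid_def power_add le_iff_add)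

text \<open>For right-continuous paths this is almost surely the event that the path started at \<open>x\<close>
  stays positive up to time \<open>t\<close>; in contrast to positivity at the grid points it is an open
  condition on \<open>x\<close>.\<close>

definition alive :: "real \<Rightarrow> 'a \<Rightarrow> bool" where
  "alive x \<omega> \<longleftrightarrow> (\<exists>k. \<forall>m. \<forall>j\<le>2 ^ m. 1 / real (Suc k) \<le> x + X (grid m j) \<omega>)"

lemma alive_measurable [measurable]: "Measurable.pred M (alive x)"
  unfolding alive_def[abs_def] by measurable

lemma alive_indicator_measurable [measurable]: "indicator {\<omega>. alive x \<omega>} \<in> (borel_measurable M :: ('a \<Rightarrow> real) set)"
proof -
  have "(indicator {\<omega> \<in> space M. alive x \<omega>} :: 'a \<Rightarrow> real) \<in> borel_measurable M" by measurable
  then show ?thesis by (subst measurable_cong[where g="indicator {\<omega> \<in> space M. alive x \<omega>}"]) (auto simp: indicator_def)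
qed

lemma alive_pos: "alive x \<omega> \<Longrightarrow> j \<le> 2 ^ m \<Longrightarrow> 0 < x + X (grid m j) \<omega>"
  unfolding alive_def by (meson divide_pos_pos less_le_trans of_nat_0_less_iff zero_less_Suc zero_less_one)

lemma alive_pos_end: "alive x \<omega> \<Longrightarrow> 0 < x + X t \<omega>"
  using alive_pos[of x \<omega> "2 ^ 0" 0, OF _ order_refl] by (simp only: grid_top)

text \<open>A path that is nonnegative on the grids but not bounded away from 0 comes arbitrarily
  close to 0. Right-continuity keeps it above \<open>x / 2\<close> up to some time
  \<open>t / 2 ^ n\<close>, so the small values occur later and make
  \<open>wmin x n i \<omega>\<close> tend to 0, an event of probability 0.\<close>

lemma nonneg_imp_alive:
  assumes x: "0 < x"
  shows "AE \<omega> in M. (\<forall>m. \<forall>j\<le>2 ^ m. 0 \<le> x + X (grid m j) \<omega>) \<longrightarrow> alive x \<omega>"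
proof -
  have "AE \<omega> in M. \<forall>n. \<not> (\<lambda>i. wmin x n i \<omega>) \<longlonglongrightarrow> 0"
    unfolding AE_all_countable by (intro allI wmin_not_tendsto_0)
  with X_0 right_continuous show ?thesis
  proof eventually_elim
   case (elim \<omega>)
   show ?case
   proof (intro impI, rule ccontr)
    have 0: "X 0 \<omega> = 0" and rc: "\<forall>s\<ge>0. ((\<lambda>s. X s \<omega>) \<longlongrightarrow> X s \<omega>) (at_right s)"
      and nt: "\<forall>n. \<not> (\<lambda>i. wmin x n i \<omega>) \<longlonglongrightarrow> 0" using elim by auto
    assume nn: "\<forall>m. \<forall>j\<le>2 ^ m. 0 \<le> x + X (grid m j) \<omega>" and na: "\<not> alive x \<omega>"
    from rc 0 have "((\<lambda>s. X s \<omega>) \<longlongrightarrow> 0) (at_right 0)" by force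
    then have "eventually (\<lambda>s. - (x / 2) < X s \<omega>) (at_right 0)"
      using x by (intro order_tendstoD) auto
    then obtain b where b: "0 < b" "\<And>s. 0 < s \<Longrightarrow> s < b \<Longrightarrow> - (x / 2) < X s \<omega>"
      unfolding eventually_at_right_field by blast
    have "(\<lambda>n. t / 2 ^ n) \<longlonglongrightarrow> 0" by real_asymp
    then have "eventually (\<lambda>n. t / 2 ^ n < b) sequentially" using b(1) by (rule order_tendstoD)
    then obtain n where n: "t / 2 ^ n < b" by (auto simp: eventually_sequentially)
    have small: "x / 2 \<le> x + X s \<omega>" if "0 \<le> s" "s \<le> t / 2 ^ n" for s
      using that b(2)[of s] n 0 x by (cases "s = 0") auto
    have "(\<lambda>i. wmin x n i \<omega>) \<longlonglongrightarrow> 0"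
    proof (rule LIMSEQ_I)
      fix \<epsilon> :: real assume "0 < \<epsilon>"
      then obtain k where k: "1 / real (Suc k) < min \<epsilon> (x / 2)"
        using nat_approx_posE[of "min \<epsilon> (x / 2)"] x by auto
      from na obtain m j where mj: "j \<le> 2 ^ m" "x + X (grid m j) \<omega> < 1 / real (Suc k)"
        unfolding alive_def by (force simp: not_le)
      have "t / 2 ^ n < grid m j"
        using small[OF grid_nonneg, of m j] mj(2) k by linarith
      then have jn: "1 / 2 ^ n < real j / 2 ^ m" using t by (simp add: grid_def field_simps)
      show "\<exists>i0. \<forall>i\<ge>i0. norm (wmin x n i \<omega> - 0) < \<epsilon>"
      proof (intro exI allI impI)
        fix i assume i: "m \<le> i"
        let ?j = "j * 2 ^ (n + i - m)"
        have "?j \<le> 2 ^ m * 2 ^ (n + i - m)" using mj(1) by (rule mult_right_mono) simp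
        also have "\<dots> = 2 ^ (n + i)" using i by (simp add: power_add[symmetric])
        finally have j1: "?j \<le> 2 ^ (n + i)" .
        have "real (2 ^ i) \<le> real ?j"
        proof -
          have "(2::real) ^ (n + i - m) = 2 ^ (n + i) / 2 ^ m" using i by (intro power_diff) auto
          then have "real ?j = real j / 2 ^ m * 2 ^ (n + i)" by simp
          moreover have "1 / 2 ^ n * 2 ^ (n + i) \<le> real j / 2 ^ m * 2 ^ (n + i)"
            using jn by (intro mult_right_mono) auto
          moreover have "(1 / 2 ^ n * 2 ^ (n + i) :: real) = 2 ^ i" by (simp add: power_add)
          ultimately show ?thesis by simp
        qed
        then have j2: "2 ^ i \<le> ?j" by (simp only: of_nat_le_iff)
        let ?A = "(\<lambda>j. x + X (real j * (t / 2 ^ (n + i))) \<omega>) ` {2 ^ i..2 ^ (n + i)}"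
        have ne: "?A \<noteq> {}" "finite ?A" by auto
        have "wmin x n i \<omega> \<le> x + X (grid (n + i) ?j) \<omega>"
          unfolding wmin_def grid_def using j1 j2 by (intro Min_le) (auto simp del: of_nat_mult of_nat_power)
        also have "\<dots> = x + X (grid m j) \<omega>" using i by (subst grid_refine) auto
        finally have "wmin x n i \<omega> < \<epsilon>" using mj(2) k by linarith
        moreover have "0 \<le> wmin x n i \<omega>"
          unfolding wmin_def using ne nn by (subst Min_ge_iff) (auto simp: grid_def)
        ultimately show "norm (wmin x n i \<omega> - 0) < \<epsilon>" by simp
      qed
    qed
    then show False using nt by blast
   qed
  qed
qed

text \<open>In one direction every time before \<open>t\<close> is a limit from the right of grid
  points, so the uniform margin in \<open>alive\<close> passes to the whole path. In the other,
  survival gives nonnegativity on the grids, which almost surely implies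
  \<open>alive\<close>.\<close>

lemma alive_iff_exit:
  assumes x: "0 < x"
  shows "AE \<omega> in M. alive x \<omega> \<longleftrightarrow> ereal t < exit_time (\<lambda>s. x + X s \<omega>)"
  using right_continuous nonneg_imp_alive[OF x]
proof eventually_elim
  case (elim \<omega>)
  note rc = elim(1)[rule_format]
  show ?case
  proof
    assume alive: "alive x \<omega>"
    then obtain k where k: "\<And>m j. j \<le> 2 ^ m \<Longrightarrow> 1 / real (Suc k) \<le> x + X (grid m j) \<omega>"
      unfolding alive_def by blast
    have pos: "0 < x + X s \<omega>" if s: "0 \<le> s" "s \<le> t" for s
    proof (cases "s = t")
      case True
      then show ?thesis using alive_pos_end[OF alive] by simp
    next
      case False
      then have s: "0 \<le> s" "s < t" using that by auto
      \<comment> \<open>Floor plus one selects the first grid point strictly after \<open>s\<close>;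
        strictness is needed for convergence along \<open>at_right s\<close>.\<close>
      define j where "j m = nat \<lfloor>s * 2 ^ m / t\<rfloor> + 1" for m :: nat
      have fl: "real (nat \<lfloor>s * 2 ^ m / t\<rfloor>) = of_int \<lfloor>s * 2 ^ m / t\<rfloor>" for m
        using s t by (simp add: of_nat_nat)
      have j: "s * 2 ^ m / t < real (j m)" "real (j m) \<le> s * 2 ^ m / t + 1" for m
        unfolding j_def of_nat_add fl by linarith+
      have jle: "j m \<le> 2 ^ m" for m
      proof -
        have "s * 2 ^ m / t < 2 ^ m" using s t by (simp add: field_simps)
        then have "\<lfloor>s * 2 ^ m / t\<rfloor> < 2 ^ m" by (simp add: floor_less_iff)
        then have "nat \<lfloor>s * 2 ^ m / t\<rfloor> < 2 ^ m" using s t by (simp add: nat_less_iff)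
        then show ?thesis unfolding j_def Suc_eq_plus1[symmetric] by (rule Suc_leI)
      qed
      have g: "s < grid m (j m)" "grid m (j m) \<le> s + t / 2 ^ m" for m
      proof -
        have "s * 2 ^ m / t * (t / 2 ^ m) < real (j m) * (t / 2 ^ m)" "real (j m) * (t / 2 ^ m) \<le> (s * 2 ^ m / t + 1) * (t / 2 ^ m)"
          by (rule mult_strict_right_mono[OF j(1)] mult_right_mono[OF j(2)], use t in simp)+
        moreover have "s * 2 ^ m / t * (t / 2 ^ m) = s" using t by simp
        moreover have e: "(s * 2 ^ m / t + 1) * (t / 2 ^ m) = s + t / 2 ^ m" using t by (simp add: field_simps)
        ultimately show "s < grid m (j m)" "grid m (j m) \<le> s + t / 2 ^ m"
          unfolding grid_def by (simp_all only: e)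
      qed
      have "(\<lambda>m. grid m (j m)) \<longlonglongrightarrow> s"
      proof (rule tendsto_sandwich[of "\<lambda>_. s" _ _ "\<lambda>m. s + t / 2 ^ m"])
        show "(\<lambda>m. s + t / 2 ^ m) \<longlonglongrightarrow> s" by real_asymp
      qed (use g(2) less_imp_le[OF g(1)] in auto)
      then have "filterlim (\<lambda>m. grid m (j m)) (at_right s) sequentially"
        using g(1) less_imp_neq[OF g(1), THEN not_sym] by (simp add: filterlim_at)
      then have "(\<lambda>m. x + X (grid m (j m)) \<omega>) \<longlonglongrightarrow> x + X s \<omega>"
        by (intro tendsto_intros filterlim_compose[OF rc[OF s(1)]])
      then have "1 / real (Suc k) \<le> x + X s \<omega>"
        using k[OF jle] by (intro LIMSEQ_le_const) auto
      moreover have "0 < 1 / real (Suc k)" by simp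
      ultimately show ?thesis by linarith
    qed
    \<comment> \<open>The exit time must exceed \<open>t\<close> strictly, so positivity at
      \<open>t\<close> is extended to a short interval on its right.\<close>
    have "((\<lambda>s. x + X s \<omega>) \<longlongrightarrow> x + X t \<omega>) (at_right t)" using t by (intro tendsto_intros rc) simp
    then have "eventually (\<lambda>s. 0 < x + X s \<omega>) (at_right t)" using pos[of t] t by (intro order_tendstoD) auto
    then obtain b where b: "t < b" "\<And>s. t < s \<Longrightarrow> s < b \<Longrightarrow> 0 < x + X s \<omega>"
      unfolding eventually_at_right_field by blast
    have "ereal b \<le> exit_time (\<lambda>s. x + X s \<omega>)" unfolding exit_time_def
    proof (rule Inf_greatest)
      fix e assume "e \<in> {ereal s |s. 0 \<le> s \<and> x + X s \<omega> \<notin> {0<..}}"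
      then obtain s where s: "e = ereal s" "0 \<le> s" "\<not> 0 < x + X s \<omega>" by auto
      then have "b \<le> s" using pos[of s] b(2)[of s] by (meson not_le)
      then show "ereal b \<le> e" using s by simp
    qed
    then show "ereal t < exit_time (\<lambda>s. x + X s \<omega>)" using b(1) by (meson less_ereal.simps(1) less_le_trans)
  next
    assume ex: "ereal t < exit_time (\<lambda>s. x + X s \<omega>)"
    have "0 \<le> x + X (grid m j) \<omega>" if j: "j \<le> 2 ^ m" for m j
    proof (rule ccontr)
      assume "\<not> 0 \<le> x + X (grid m j) \<omega>"
      then have "exit_time (\<lambda>s. x + X s \<omega>) \<le> ereal (grid m j)" unfolding exit_time_def
        by (intro Inf_lower) (use grid_nonneg in auto)
      moreover have "grid m j \<le> t"
        using mult_right_mono[of "real j" "2 ^ m" "t / 2 ^ m"] j t by (simp add: grid_def)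
      ultimately show False using ex by (metis ereal_less_eq(3) leD order_trans)
    qed
    then show "alive x \<omega>" using elim(2) by blast
  qed
qed

section \<open>The killed expectation\<close>

definition killed_mean :: "(real \<Rightarrow> real) \<Rightarrow> real \<Rightarrow> real" where
  "killed_mean f x = expectation (\<lambda>\<omega>. f (x + X t \<omega>) * indicator {\<omega>. alive x \<omega>} \<omega>)"

lemma X_t_measurable [measurable]: "X t \<in> borel_measurable M"
  using t by simp

text \<open>\<open>alive\<close> is measurable for \<open>M\<close> and agrees almost surely with
  the exit event, which becomes measurable in the completion for that reason; so the integral can be
  taken over \<open>M\<close> itself.\<close>

lemma killed_semigroup_eq:
  assumes x: "0 < x" and f [measurable]: "f \<in> borel_measurable borel"
  shows "killed_semigroup M X t f x = killed_mean f x"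
proof -
  let ?e = "\<lambda>\<omega>. ereal t < exit_time (\<lambda>s. x + X s \<omega>)"
  have ae: "AE \<omega> in completion M. alive x \<omega> \<longleftrightarrow> ?e \<omega>"
    using alive_iff_exit[OF x] by (rule AE_completion)
  let ?A = "{\<omega> \<in> space M. alive x \<omega>}" and ?E = "{\<omega> \<in> space M. ?e \<omega>}"
  have A: "?A \<in> sets M" by measurable
  then have A': "?A \<in> sets (completion M)" by (rule sets_completionI_sets)
  have ae': "AE \<omega> in completion M. \<omega> \<in> ?A \<longleftrightarrow> \<omega> \<in> ?E" using ae by eventually_elim auto
  have E: "?E \<in> sets (completion M)"
    by (rule completion.in_sets_AE[OF _ A']) (use ae' in auto)
  have Xm: "(\<lambda>\<omega>. f (x + X t \<omega>)) \<in> borel_measurable M" by measurable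
  then have Xm': "(\<lambda>\<omega>. f (x + X t \<omega>)) \<in> borel_measurable (completion M)" by (rule measurable_completion)
  have "killed_semigroup M X t f x = (LINT \<omega>|completion M. f (x + X t \<omega>) * indicator ?E \<omega>)"
    unfolding killed_semigroup_def by (intro Bochner_Integration.integral_cong refl) (simp add: indicator_def)
  also have "\<dots> = (LINT \<omega>|completion M. f (x + X t \<omega>) * indicator ?A \<omega>)"
  proof (rule integral_cong_AE)
    show "AE \<omega> in completion M. f (x + X t \<omega>) * indicator ?E \<omega> = f (x + X t \<omega>) * indicator ?A \<omega>"
      using ae' by eventually_elim (auto simp: indicator_def)
  qed (use Xm' A' E in \<open>auto intro!: borel_measurable_times borel_measurable_indicator\<close>)
  also have "\<dots> = (LINT \<omega>|M. f (x + X t \<omega>) * indicator ?A \<omega>)"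
    using Xm A by (intro integral_completion) measurable
  also have "\<dots> = killed_mean f x" unfolding killed_mean_def
    by (intro Bochner_Integration.integral_cong refl) (simp add: indicator_def)
  finally show ?thesis .
qed

lemma killed_mean_integrable:
  fixes C :: real
  assumes f [measurable]: "f \<in> borel_measurable borel" and b: "\<And>y. 0 < y \<Longrightarrow> \<bar>f y\<bar> \<le> C"
  shows "integrable M (\<lambda>\<omega>. f (x + X t \<omega>) * indicator {\<omega>. alive x \<omega>} \<omega>)"
  by (rule integrable_const_bound[where B="\<bar>C\<bar>"])
     (use b alive_pos_end in \<open>force simp: indicator_def intro!: AE_I2\<close>)+

lemma killed_mean_cong: "(\<And>y. 0 < y \<Longrightarrow> f y = g y) \<Longrightarrow> killed_mean f x = killed_mean g x"
  unfolding killed_mean_def using alive_pos_end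
  by (intro Bochner_Integration.integral_cong refl) (simp add: indicator_def)

text \<open>The dyadic grids are nested: once the path is negative at one grid point, the walks on
  all finer grids are killed. Otherwise the path is almost surely alive and none of them is
  killed.\<close>

lemma killed_mean_limit:
  assumes x: "0 < x" and g [measurable]: "g \<in> borel_measurable borel" and b: "\<And>y. \<bar>g y\<bar> \<le> C"
  shows "(\<lambda>m. killed_walk (distr M borel (X (t / 2 ^ m))) g (2 ^ m) x) \<longlonglongrightarrow> killed_mean g x"
proof -
  have "killed_walk (distr M borel (X (t / 2 ^ m))) g (2 ^ m) x =
      expectation (\<lambda>\<omega>. g (x + X t \<omega>) * (\<Prod>j\<le>2 ^ m. indicator {0<..} (x + X (grid m j) \<omega>)))" for m
    using walk_expectation[OF _ g b, of "t / 2 ^ m" "2 ^ m" x] t by (simp add: grid_def)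
  moreover have "(\<lambda>m. expectation (\<lambda>\<omega>. g (x + X t \<omega>) * (\<Prod>j\<le>2 ^ m. indicator {0<..} (x + X (grid m j) \<omega>)))) \<longlonglongrightarrow> killed_mean g x"
    unfolding killed_mean_def
  proof (rule integral_dominated_convergence[where w="\<lambda>_. \<bar>C\<bar>"])
    show "AE \<omega> in M. (\<lambda>m. g (x + X t \<omega>) * (\<Prod>j\<le>2 ^ m. indicator {0<..} (x + X (grid m j) \<omega>))) \<longlonglongrightarrow>
        g (x + X t \<omega>) * indicator {\<omega>. alive x \<omega>} \<omega>"
      using nonneg_imp_alive[OF x]
    proof eventually_elim
      case (elim \<omega>)
      have "(\<lambda>m. \<Prod>j\<le>2 ^ m. indicator {0<..} (x + X (grid m j) \<omega>) :: real) \<longlonglongrightarrow> indicator {\<omega>. alive x \<omega>} \<omega>"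
      proof (cases "alive x \<omega>")
        case True
        then show ?thesis using alive_pos[OF True] by (simp add: indicator_def)
      next
        case False
        then obtain m j where mj: "j \<le> 2 ^ m" "x + X (grid m j) \<omega> < 0" using elim by (auto simp: not_le)
        have "(\<Prod>j\<le>2 ^ m'. indicator {0<..} (x + X (grid m' j) \<omega>) :: real) = 0" if "m \<le> m'" for m'
        proof (rule prod_zero)
          have "j * 2 ^ (m' - m) \<le> 2 ^ m * 2 ^ (m' - m)" using mj(1) by (rule mult_right_mono) simp
          also have "\<dots> = 2 ^ m'" using that by (simp add: power_add[symmetric])
          finally have "j * 2 ^ (m' - m) \<in> {..2 ^ m'}" by simp
          moreover have "indicator {0<..} (x + X (grid m' (j * 2 ^ (m' - m))) \<omega>) = (0 :: real)"
            using mj(2) by (simp add: grid_refine[OF that])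
          ultimately show "\<exists>j\<in>{..2 ^ m'}. indicator {0<..} (x + X (grid m' j) \<omega>) = (0 :: real)" by blast
        qed simp
        then have "eventually (\<lambda>m. (\<Prod>j\<le>2 ^ m. indicator {0<..} (x + X (grid m j) \<omega>) :: real) = 0) sequentially"
          by (auto simp: eventually_sequentially)
        then show ?thesis using False by (simp add: tendsto_eventually)
      qed
      then show ?case by (intro tendsto_mult tendsto_const)
    qed
    show "AE \<omega> in M. norm (g (x + X t \<omega>) * (\<Prod>j\<le>2 ^ m. indicator {0<..} (x + X (grid m j) \<omega>))) \<le> \<bar>C\<bar>" for m
    proof (rule AE_I2)
      fix \<omega>
      have "0 \<le> (\<Prod>j\<le>2 ^ m. indicator {0<..} (x + X (grid m j) \<omega>) :: real)"
        "(\<Prod>j\<le>2 ^ m. indicator {0<..} (x + X (grid m j) \<omega>) :: real) \<le> 1"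
        by (auto intro!: prod_nonneg prod_le_1 simp: indicator_def)
      then have "\<bar>g (x + X t \<omega>) * (\<Prod>j\<le>2 ^ m. indicator {0<..} (x + X (grid m j) \<omega>))\<bar> \<le> \<bar>C\<bar> * 1"
        unfolding abs_mult using b[of "x + X t \<omega>"] by (intro mult_mono) auto
      then show "norm (g (x + X t \<omega>) * (\<Prod>j\<le>2 ^ m. indicator {0<..} (x + X (grid m j) \<omega>))) \<le> \<bar>C\<bar>" by simp
    qed
  qed auto
  ultimately show ?thesis by simp
qed

text \<open>Both alternatives survive a small shift of the starting point: an alive path has a
  margin \<open>1 / (k + 1)\<close>, half of which may be spent, and a path that is not alive is
  almost surely strictly negative at some grid point.\<close>

lemma alive_local:
  assumes x: "0 < x"
  shows "AE \<omega> in M. eventually (\<lambda>y. alive y \<omega> = alive x \<omega>) (nhds x)"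
  using nonneg_imp_alive[OF x]
proof eventually_elim
  case (elim \<omega>)
  show ?case
  proof (cases "alive x \<omega>")
    case True
    then obtain k where k: "\<And>m j. j \<le> 2 ^ m \<Longrightarrow> 1 / real (Suc k) \<le> x + X (grid m j) \<omega>"
      unfolding alive_def by blast
    have "alive y \<omega>" if y: "x - 1 / (2 * real (Suc k)) < y" for y
      unfolding alive_def
    proof (intro exI[of _ "2 * k + 1"] allI impI)
      fix m j assume "j \<le> (2::nat) ^ m"
      moreover have "1 / real (Suc (2 * k + 1)) = 1 / real (Suc k) - 1 / (2 * real (Suc k))" by (simp add: field_simps)
      ultimately show "1 / real (Suc (2 * k + 1)) \<le> y + X (grid m j) \<omega>" using k[of j m] y by linarith
    qed
    moreover have "eventually (\<lambda>y. x - 1 / (2 * real (Suc k)) < y) (nhds x)"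
      by (rule order_tendstoD(1)[OF filterlim_ident]) simp
    ultimately show ?thesis using True by (auto elim: eventually_mono)
  next
    case False
    then obtain m j where mj: "j \<le> 2 ^ m" "x + X (grid m j) \<omega> < 0" using elim by (auto simp: not_le)
    have "\<not> alive y \<omega>" if "y < - X (grid m j) \<omega>" for y
      using alive_pos[of y \<omega> j m] mj(1) that by linarith
    moreover have "eventually (\<lambda>y. y < - X (grid m j) \<omega>) (nhds x)"
      using mj(2) by (intro order_tendstoD(2)[OF filterlim_ident]) simp
    ultimately show ?thesis using False by (auto elim: eventually_mono)
  qed
qed

lemma killed_mean_isCont:
  assumes x: "0 < x" and f: "continuous_on UNIV f" and b: "\<And>y. \<bar>f y\<bar> \<le> C"
  shows "isCont (killed_mean f) x"
proof (rule continuous_at_sequentiallyI)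
  fix u :: "nat \<Rightarrow> real" assume u: "u \<longlonglongrightarrow> x"
  have [measurable]: "f \<in> borel_measurable borel" using f by (rule borel_measurable_continuous_onI)
  show "(\<lambda>n. killed_mean f (u n)) \<longlonglongrightarrow> killed_mean f x" unfolding killed_mean_def
  proof (rule integral_dominated_convergence[where w="\<lambda>_. \<bar>C\<bar>"])
    show "AE \<omega> in M. (\<lambda>n. f (u n + X t \<omega>) * indicator {\<omega>. alive (u n) \<omega>} \<omega>) \<longlonglongrightarrow>
        f (x + X t \<omega>) * indicator {\<omega>. alive x \<omega>} \<omega>"
      using alive_local[OF x]
    proof eventually_elim
      case (elim \<omega>)
      have "eventually (\<lambda>n. alive (u n) \<omega> = alive x \<omega>) sequentially"
        using filterlim_iff[THEN iffD1, OF u] elim by blast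
      then have "eventually (\<lambda>n. (indicator {\<omega>. alive (u n) \<omega>} \<omega> :: real) = indicator {\<omega>. alive x \<omega>} \<omega>) sequentially"
        by (rule eventually_mono) (simp add: indicator_def)
      then have "(\<lambda>n. indicator {\<omega>. alive (u n) \<omega>} \<omega> :: real) \<longlonglongrightarrow> indicator {\<omega>. alive x \<omega>} \<omega>"
        by (rule tendsto_eventually)
      moreover have "(\<lambda>n. f (u n + X t \<omega>)) \<longlonglongrightarrow> f (x + X t \<omega>)"
        using f u by (intro isCont_tendsto_compose[of _ f] tendsto_intros) (auto simp: continuous_on_eq_continuous_at)
      ultimately show ?case by (intro tendsto_mult)
    qed
    show "AE \<omega> in M. norm (f (u n + X t \<omega>) * indicator {\<omega>. alive (u n) \<omega>} \<omega>) \<le> \<bar>C\<bar>" for n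
      using b by (auto simp: indicator_def intro!: AE_I2 order_trans[OF b])
  qed auto
qed

end

section \<open>The spectral representation of the kernel\<close>

lemma isCont_measurable_hl:
  fixes f :: "real \<Rightarrow> real"
  assumes "\<And>x. 0 < x \<Longrightarrow> isCont f x"
  shows "f \<in> borel_measurable hl"
  using assms by (intro continuous_on_measurable_hl continuous_at_imp_continuous_on) auto

text \<open>The overlap of two one-sided exponentials at distance \<open>s\<close>. The decay rate
  depends on the direction of the shift.\<close>

lemma laplace_correlation:
  fixes a b s :: real
  assumes a: "0 < a" and b: "0 < b"
  shows "(\<integral>x. exp (- a * x) * (indicator {0<..} (x + s) * exp (- b * (x + s))) \<partial>hl) =
    exp (- (if 0 \<le> s then b else a) * \<bar>s\<bar>) / (a + b)"
proof -
  have ab: "(\<integral>x. exp (- (a + b) * x) \<partial>hl) = 1 / (a + b)" using a b by (intro hl_exp_real) simp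
  show ?thesis
  proof (cases "0 \<le> s")
    case True
    have "(\<integral>x. exp (- a * x) * (indicator {0<..} (x + s) * exp (- b * (x + s))) \<partial>hl) = (\<integral>x. exp (- b * s) * exp (- (a + b) * x) \<partial>hl)"
      using True by (intro Bochner_Integration.integral_cong refl) (simp add: mult_exp_exp algebra_simps)
    then show ?thesis using True ab by simp
  next
    case False
    have "(\<integral>x. exp (- a * x) * (indicator {0<..} (x + s) * exp (- b * (x + s))) \<partial>hl) =
        (\<integral>x. indicator {0<..} x * (exp (- a * x) * (indicator {0<..} (x + s) * exp (- b * (x + s)))) \<partial>lborel)"
      by (simp add: set_integral_hl[symmetric] set_lebesgue_integral_def)
    also have "\<dots> = (\<integral>x. indicator {0<..} (x - s) * (exp (- a * (x - s)) * (indicator {0<..} x * exp (- b * x))) \<partial>lborel)"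
      by (subst lborel_integral_real_affine[where c=1 and t="- s"]) (auto simp: algebra_simps)
    also have "\<dots> = (\<integral>x. indicator {0<..} x * (exp (a * s) * exp (- (a + b) * x)) \<partial>lborel)"
      using False by (intro Bochner_Integration.integral_cong refl) (auto simp: mult_exp_exp indicator_def algebra_simps)
    also have "\<dots> = (\<integral>x. exp (a * s) * exp (- (a + b) * x) \<partial>hl)"
      by (simp only: set_integral_hl[symmetric] set_lebesgue_integral_def real_scaleR_def)
    also have "\<dots> = exp (a * s) * (1 / (a + b))" unfolding ab[symmetric] by (rule integral_mult_right_zero)
    finally show ?thesis using False by simp
  qed
qed

text \<open>The fraction is the real part of \<open>g i * cnj (g j)\<close>, where
  \<open>g i\<close> is the Fourier transform of \<open>exp (- real (Suc i) * x)\<close> on the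
  half-line; so the double sum is a squared modulus.\<close>

lemma expsum_fourier:
  "(\<Sum>i\<le>n. \<Sum>j\<le>n. c i * c j * ((real (Suc i) * real (Suc j) + z\<^sup>2) / (((real (Suc i))\<^sup>2 + z\<^sup>2) * ((real (Suc j))\<^sup>2 + z\<^sup>2)))) =
    (cmod (\<integral>x. exp (- (\<i> * of_real (z * x))) * of_real (expsum c n x) \<partial>hl))\<^sup>2"
proof -
  define g where "g i = 1 / (of_nat (Suc i) + \<i> * of_real z)" for i
  have gi: "integrable hl (\<lambda>x. exp (- (of_nat (Suc i) + \<i> * of_real z) * of_real x))"
    "(\<integral>x. exp (- (of_nat (Suc i) + \<i> * of_real z) * of_real x) \<partial>hl) = g i" for i
    unfolding g_def by (intro hl_exp; simp)+
  have "(\<integral>x. exp (- (\<i> * of_real (z * x))) * of_real (expsum c n x) \<partial>hl) =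
      (\<integral>x. (\<Sum>i\<le>n. of_real (c i) * exp (- (of_nat (Suc i) + \<i> * of_real z) * of_real x)) \<partial>hl)"
  proof (intro Bochner_Integration.integral_cong refl)
    fix x
    have "exp (- (\<i> * of_real (z * x))) * complex_of_real (exp (- real (Suc i) * x)) =
        exp (- (of_nat (Suc i) + \<i> * of_real z) * of_real x)" for i
      unfolding exp_of_real[symmetric] mult_exp_exp by (simp add: algebra_simps)
    then show "exp (- (\<i> * of_real (z * x))) * complex_of_real (expsum c n x) =
        (\<Sum>i\<le>n. of_real (c i) * exp (- (of_nat (Suc i) + \<i> * of_real z) * of_real x))"
      unfolding expsum_def of_real_sum of_real_mult sum_distrib_left
      by (intro sum.cong refl) (metis mult.left_commute of_real_mult)
  qed
  also have "\<dots> = (\<Sum>i\<le>n. of_real (c i) * g i)"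
    by (subst Bochner_Integration.integral_sum) (auto simp: gi(2)[simplified] intro!: gi(1)[simplified])
  finally have S: "(\<integral>x. exp (- (\<i> * of_real (z * x))) * of_real (expsum c n x) \<partial>hl) = (\<Sum>i\<le>n. of_real (c i) * g i)" .
  have gg: "Re (g i * cnj (g j)) = (real (Suc i) * real (Suc j) + z\<^sup>2) / (((real (Suc i))\<^sup>2 + z\<^sup>2) * ((real (Suc j))\<^sup>2 + z\<^sup>2))" for i j
  proof -
    have "Re (g i) = real (Suc i) / ((real (Suc i))\<^sup>2 + z\<^sup>2)" "Im (g i) = - z / ((real (Suc i))\<^sup>2 + z\<^sup>2)" for i
      unfolding g_def by (simp_all only: Re_divide Im_divide, simp_all)
    then show ?thesis
      by (simp add: times_divide_times_eq add_divide_distrib[symmetric] power2_eq_square del: of_nat_Suc)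
  qed
  have "(cmod (\<Sum>i\<le>n. of_real (c i) * g i))\<^sup>2 = Re ((\<Sum>i\<le>n. of_real (c i) * g i) * cnj (\<Sum>i\<le>n. of_real (c i) * g i))"
    by (simp only: complex_norm_square[symmetric] Re_complex_of_real)
  also have "\<dots> = (\<Sum>i\<le>n. \<Sum>j\<le>n. c i * c j * Re (g i * cnj (g j)))"
    unfolding cnj_sum sum_product Re_sum by (intro sum.cong refl) (simp add: algebra_simps)
  finally show ?thesis unfolding S gg ..
qed

text \<open>The bound on \<open>F l\<close> may depend on \<open>l\<close>; integrability in the
  spectral variable is a result, not an assumption.\<close>

locale halfline_kernel = levy_walk +
  fixes F :: "real \<Rightarrow> real \<Rightarrow> real"
  assumes symmetric: "distr M borel (\<lambda>\<omega>. - X t \<omega>) = distr M borel (X t)"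
    and weight_integrable: "integrable hl (\<lambda>l. exp (- t * \<psi> (l\<^sup>2)))"
    and F_continuous: "0 < l \<Longrightarrow> continuous_on {0<..} (F l)"
    and F_bounded: "0 < l \<Longrightarrow> bounded (F l ` {0<..})"
    and F_laplace: "0 < l \<Longrightarrow> 0 < a \<Longrightarrow> (\<integral>y. exp (- a * y) * F l y \<partial>hl) = eig a l"
begin

text \<open>The spectral measure with the decaying weight built in; spectral integrals become inner
  products in the \<open>L\<^sup>2\<close> space of a finite measure.\<close>

definition rho :: "real measure" where "rho = density hl (\<lambda>l. ennreal (phi t l))"

lemma space_rho [simp]: "space rho = {0<..}"
  by (simp add: rho_def)

lemma sets_rho [measurable_cong, simp]: "sets rho = sets hl"
  by (simp add: rho_def)

lemma phi_integrable: "integrable hl (phi t)"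
  using weight_integrable by (simp add: phi_def[abs_def])

lemma rho_integrable: "h \<in> borel_measurable hl \<Longrightarrow> integrable rho h \<longleftrightarrow> integrable hl (\<lambda>l. phi t l * h l)"
  and rho_integral: "h \<in> borel_measurable hl \<Longrightarrow> (\<integral>l. h l \<partial>rho) = (\<integral>l. phi t l * h l \<partial>hl)"
  for h :: "real \<Rightarrow> real"
  unfolding rho_def using phi_range(1)[OF t]
  by (subst integrable_density integral_density; auto intro!: measurable_hl)+

lemma eig_measurable [measurable]: "0 < a \<Longrightarrow> eig a \<in> borel_measurable hl"
  using eig_integral_limit(1)[OF _ _ t weight_integrable] by blast

lemma eig_square: "0 < a \<Longrightarrow> integrable rho (\<lambda>l. (eig a l)\<^sup>2)"
  by (subst rho_integrable)
     (use eig_integral_limit(2)[of a a, OF _ _ t weight_integrable] in \<open>auto simp: phi_def power2_eq_square mult.assoc\<close>)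

section \<open>The double Laplace transform of the killed semigroup\<close>

definition killed_exp :: "real \<Rightarrow> real \<Rightarrow> real" where "killed_exp b = killed_mean (\<lambda>y. exp (- b * y))"

lemma killed_exp_bounded: "0 < b \<Longrightarrow> 0 \<le> killed_exp b x" "0 < b \<Longrightarrow> killed_exp b x \<le> 1"
proof -
  assume b: "0 < b"
  show "0 \<le> killed_exp b x" unfolding killed_exp_def killed_mean_def by (intro Bochner_Integration.integral_nonneg) simp
  have "killed_exp b x \<le> expectation (\<lambda>_. 1)" unfolding killed_exp_def killed_mean_def
    by (intro integral_mono killed_mean_integrable[where C=1])
       (use b alive_pos_end in \<open>auto simp: indicator_def mult_pos_pos less_imp_le\<close>)
  then show "killed_exp b x \<le> 1" by (simp add: prob_space)
qed

text \<open>\<open>exp (- b * y)\<close> is unbounded for negative \<open>y\<close>; replacing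
  \<open>y\<close> by \<open>max y 0\<close> makes it bounded and leaves the killed mean unchanged,
  as only positive end points count.\<close>

lemma killed_exp_isCont: "0 < b \<Longrightarrow> 0 < x \<Longrightarrow> isCont (killed_exp b) x"
proof -
  assume "0 < b" "0 < x"
  then have "isCont (killed_mean (\<lambda>y. exp (- b * max y 0))) x"
    by (intro killed_mean_isCont[where C=1] continuous_intros) auto
  moreover have "killed_exp b = killed_mean (\<lambda>y. exp (- b * max y 0))"
    unfolding killed_exp_def by (intro ext killed_mean_cong) simp
  ultimately show ?thesis by simp
qed

lemma killed_exp_measurable [measurable]: "0 < b \<Longrightarrow> killed_exp b \<in> borel_measurable hl"
  by (rule isCont_measurable_hl[OF killed_exp_isCont])

text \<open>The coefficient formula with index \<open>2 ^ m\<close> and step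
  \<open>t / 2 ^ m\<close> always carries the weight for time \<open>t\<close>. As \<open>m\<close>
  grows, the left-hand sides converge by \<open>killed_mean_limit\<close>, the right-hand sides by
  \<open>eig_integral_limit\<close>.\<close>

lemma killed_exp_laplace:
  assumes a: "0 < a" and b: "0 < b"
  shows "(\<integral>x. exp (- a * x) * killed_exp b x \<partial>hl) = 2 / pi * (\<integral>l. eig a l * eig b l \<partial>rho)"
proof -
  let ?\<mu> = "\<lambda>m. distr M borel (X (t / 2 ^ m))"
  let ?u = "\<lambda>m k. killed_walk (?\<mu> m) (\<lambda>x. exp (- b * x)) k"
  have W: "walk_chars (?\<mu> m) (\<lambda>k. distr M borel (X (real k * (t / 2 ^ m)))) (phi (t / 2 ^ m))" for m
    using t by (intro walk_chars) simp
  have u: "?u m k \<in> borel_measurable borel" "0 \<le> ?u m k x" "?u m k x \<le> 1" for m k x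
  proof -
    interpret W: walk_chars "?\<mu> m" "\<lambda>k. distr M borel (X (real k * (t / 2 ^ m)))" "phi (t / 2 ^ m)" by (rule W)
    show "?u m k \<in> borel_measurable borel" using W.v_measurable[of b k] by (simp add: W.v_def)
    show "0 \<le> ?u m k x" "?u m k x \<le> 1" using W.v_bounds(1,2)[of b k x] b by (simp_all add: W.v_def)
  qed
  note ia = hl_exp_real[OF a]
  have coeff: "(\<integral>x. exp (- a * x) * ?u m (2 ^ m) x \<partial>hl) =
      2 / pi * (\<integral>l. exp (- t * \<psi> (l\<^sup>2)) * eig_step (t / 2 ^ m) a l * eig_step (t / 2 ^ m) b l \<partial>hl)" for m
  proof -
    interpret W: walk_chars "?\<mu> m" "\<lambda>k. distr M borel (X (real k * (t / 2 ^ m)))" "phi (t / 2 ^ m)" by (rule W)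
    have B: "\<bar>\<integral>x. exp (- a * x) * ?u m k x \<partial>hl\<bar> \<le> 1 / a" for k
    proof -
      have "norm (\<integral>x. exp (- a * x) * ?u m k x \<partial>hl) \<le> (\<integral>x. exp (- a * x) \<partial>hl)"
        by (rule norm_integral_le[OF integrable_hl_bounded_mult[OF ia(1), where B=1] ia(1)])
           (use u in \<open>auto intro!: measurable_hl AE_I2 mult_left_le simp: abs_mult\<close>)
      then show ?thesis using ia(2) by simp
    qed
    have td: "real (2 ^ m) * (t / 2 ^ m) = t" by simp
    show ?thesis
      using coefficient_formula[OF a b, of "t / 2 ^ m" "2 ^ m", where c="\<lambda>k. \<integral>x. exp (- a * x) * ?u m k x \<partial>hl", unfolded td,
          OF _ _ weight_integrable B W.killed_walk_generating_function[OF a b]] t by simp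
  qed
  have "(\<lambda>m. \<integral>x. exp (- a * x) * ?u m (2 ^ m) x \<partial>hl) \<longlonglongrightarrow> (\<integral>x. exp (- a * x) * killed_exp b x \<partial>hl)"
  proof (rule integral_dominated_convergence[where w="\<lambda>x. exp (- a * x)"])
    show "AE x in hl. (\<lambda>m. exp (- a * x) * ?u m (2 ^ m) x) \<longlonglongrightarrow> exp (- a * x) * killed_exp b x"
    proof (rule AE_I2)
      fix x assume "x \<in> space hl"
      then have x: "0 < x" by simp
      have "(\<lambda>m. killed_walk (?\<mu> m) (\<lambda>y. exp (- b * max y 0)) (2 ^ m) x) \<longlonglongrightarrow> killed_mean (\<lambda>y. exp (- b * max y 0)) x"
        by (rule killed_mean_limit[OF x, where C=1]) (use b in auto)
      moreover have "killed_walk (?\<mu> m) (\<lambda>y. exp (- b * max y 0)) k = ?u m k" for m k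
        by (rule killed_walk_cong) simp
      moreover have "killed_mean (\<lambda>y. exp (- b * max y 0)) x = killed_exp b x" unfolding killed_exp_def by (rule killed_mean_cong) simp
      ultimately show "(\<lambda>m. exp (- a * x) * ?u m (2 ^ m) x) \<longlonglongrightarrow> exp (- a * x) * killed_exp b x"
        by (intro tendsto_mult tendsto_const) simp
    qed
    show "AE x in hl. norm (exp (- a * x) * ?u m (2 ^ m) x) \<le> exp (- a * x)" for m
      using u by (auto intro!: AE_I2 mult_left_le simp: abs_mult)
  qed (use ia u b in \<open>auto intro!: measurable_hl\<close>)
  moreover have "(\<lambda>m. \<integral>x. exp (- a * x) * ?u m (2 ^ m) x \<partial>hl) \<longlonglongrightarrow>
      2 / pi * (\<integral>l. exp (- t * \<psi> (l\<^sup>2)) * eig a l * eig b l \<partial>hl)"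
    unfolding coeff by (intro tendsto_mult tendsto_const eig_integral_limit(3)[OF a b t weight_integrable])
  ultimately have "(\<integral>x. exp (- a * x) * killed_exp b x \<partial>hl) = 2 / pi * (\<integral>l. exp (- t * \<psi> (l\<^sup>2)) * eig a l * eig b l \<partial>hl)"
    by (rule LIMSEQ_unique)
  also have "(\<integral>l. exp (- t * \<psi> (l\<^sup>2)) * eig a l * eig b l \<partial>hl) = (\<integral>l. eig a l * eig b l \<partial>rho)"
    using a b by (subst rho_integral) (auto simp: phi_def mult.assoc)
  finally show ?thesis .
qed

lemma eig_prod_integrable:
  assumes "0 < a" "0 < b"
  shows "integrable rho (\<lambda>l. eig a l * eig b l)"
  using assms eig_integral_limit(2)[OF assms t weight_integrable]
  by (subst rho_integrable) (auto simp: phi_def mult.assoc)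

text \<open>The spectral transform of \<open>expsum c n\<close>, that is, its integral against
  \<open>F l\<close>.\<close>

definition eig_sum :: "(nat \<Rightarrow> real) \<Rightarrow> nat \<Rightarrow> real \<Rightarrow> real" where
  "eig_sum c n l = (\<Sum>i\<le>n. c i * eig (real (Suc i)) l)"

lemma eig_sum_measurable [measurable]: "eig_sum c n \<in> borel_measurable hl"
  unfolding eig_sum_def[abs_def] by (intro borel_measurable_sum borel_measurable_times borel_measurable_const eig_measurable) simp

lemma eig_sum_prod:
  "integrable rho (\<lambda>l. eig_sum c n l * eig_sum d m l)"
  "(\<integral>l. eig_sum c n l * eig_sum d m l \<partial>rho) = (\<Sum>i\<le>n. \<Sum>j\<le>m. c i * d j * (\<integral>l. eig (real (Suc i)) l * eig (real (Suc j)) l \<partial>rho))"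
proof -
  have e: "eig_sum c n l * eig_sum d m l = (\<Sum>i\<le>n. \<Sum>j\<le>m. c i * d j * (eig (real (Suc i)) l * eig (real (Suc j)) l))" for l
    unfolding eig_sum_def sum_product by (intro sum.cong refl) (simp only: ac_simps)
  have i: "integrable rho (\<lambda>l. eig (real (Suc i)) l * eig (real (Suc j)) l)" for i j
    by (rule eig_prod_integrable) simp_all
  show "integrable rho (\<lambda>l. eig_sum c n l * eig_sum d m l)" unfolding e
    by (intro Bochner_Integration.integrable_sum integrable_mult_right i)
  show "(\<integral>l. eig_sum c n l * eig_sum d m l \<partial>rho) = (\<Sum>i\<le>n. \<Sum>j\<le>m. c i * d j * (\<integral>l. eig (real (Suc i)) l * eig (real (Suc j)) l \<partial>rho))"
    unfolding e by (subst Bochner_Integration.integral_sum, intro Bochner_Integration.integrable_sum integrable_mult_right i,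
        intro sum.cong refl, subst Bochner_Integration.integral_sum, intro integrable_mult_right i,
        intro sum.cong refl integral_mult_right_zero)
qed

lemma killed_mean_expsum: "killed_mean (expsum d m) x = (\<Sum>j\<le>m. d j * killed_exp (real (Suc j)) x)"
proof -
  have i: "integrable M (\<lambda>\<omega>. exp (- real (Suc j) * (x + X t \<omega>)) * indicator {\<omega>. alive x \<omega>} \<omega>)" for j
    by (rule killed_mean_integrable[where C=1]) (auto simp del: of_nat_Suc)
  have "killed_mean (expsum d m) x = expectation (\<lambda>\<omega>. \<Sum>j\<le>m. d j * (exp (- real (Suc j) * (x + X t \<omega>)) * indicator {\<omega>. alive x \<omega>} \<omega>))"
    unfolding killed_mean_def expsum_def by (intro Bochner_Integration.integral_cong refl) (simp only: sum_distrib_right mult.assoc)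
  also have "\<dots> = (\<Sum>j\<le>m. expectation (\<lambda>\<omega>. d j * (exp (- real (Suc j) * (x + X t \<omega>)) * indicator {\<omega>. alive x \<omega>} \<omega>)))"
    by (intro Bochner_Integration.integral_sum integrable_mult_right i)
  finally show ?thesis unfolding killed_exp_def killed_mean_def by (simp only: integral_mult_right_zero)
qed

lemma killed_exp_pair_integrable: "0 < a \<Longrightarrow> 0 < b \<Longrightarrow> integrable hl (\<lambda>x. exp (- a * x) * killed_exp b x)"
  by (rule integrable_hl_bounded_mult[OF hl_exp_real(1), where B=1]) (use killed_exp_bounded in auto)

lemma killed_mean_form: "(\<integral>x. expsum c n x * killed_mean (expsum d m) x \<partial>hl) = 2 / pi * (\<integral>l. eig_sum c n l * eig_sum d m l \<partial>rho)"
proof -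
  have i: "integrable hl (\<lambda>x. exp (- real (Suc i) * x) * killed_exp (real (Suc j)) x)" for i j
    by (rule killed_exp_pair_integrable) simp_all
  have "(\<integral>x. expsum c n x * killed_mean (expsum d m) x \<partial>hl) =
      (\<integral>x. (\<Sum>i\<le>n. \<Sum>j\<le>m. c i * d j * (exp (- real (Suc i) * x) * killed_exp (real (Suc j)) x)) \<partial>hl)"
    unfolding killed_mean_expsum expsum_def sum_product
    by (intro Bochner_Integration.integral_cong sum.cong refl) (simp only: ac_simps)
  also have "\<dots> = (\<Sum>i\<le>n. \<Sum>j\<le>m. c i * d j * (\<integral>x. exp (- real (Suc i) * x) * killed_exp (real (Suc j)) x \<partial>hl))"
    by (subst Bochner_Integration.integral_sum, intro Bochner_Integration.integrable_sum integrable_mult_right i,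
        intro sum.cong refl, subst Bochner_Integration.integral_sum, intro integrable_mult_right i,
        intro sum.cong refl integral_mult_right_zero)
  also have "\<dots> = (\<Sum>i\<le>n. \<Sum>j\<le>m. 2 / pi * (c i * d j * (\<integral>l. eig (real (Suc i)) l * eig (real (Suc j)) l \<partial>rho)))"
    by (intro sum.cong refl, subst killed_exp_laplace) (simp_all del: of_nat_Suc)
  finally show ?thesis by (simp only: eig_sum_prod(2) sum_distrib_left)
qed

section \<open>Comparison with the free process\<close>

definition free_exp :: "real \<Rightarrow> real \<Rightarrow> real" where
  "free_exp b x = expectation (\<lambda>\<omega>. indicator {0<..} (x + X t \<omega>) * exp (- b * (x + X t \<omega>)))"

text \<open>The real part of \<open>1 / ((a + \<i> * z) * (b - \<i> * z))\<close>, the Fourier side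
  of the correlation of two one-sided exponentials.\<close>

definition corr :: "real \<Rightarrow> real \<Rightarrow> real \<Rightarrow> real" where
  "corr a b z = (a * b + z\<^sup>2) / ((a\<^sup>2 + z\<^sup>2) * (b\<^sup>2 + z\<^sup>2))"

lemma exp_abs_X:
  assumes a: "0 < a"
  shows "expectation (\<lambda>\<omega>. exp (- a * \<bar>X t \<omega>\<bar>)) = (\<integral>z. 2 * a / (pi * (a\<^sup>2 + z\<^sup>2)) * phi t z \<partial>hl)"
proof -
  interpret W: walk_chars "distr M borel (X t)" "\<lambda>k. distr M borel (X (real k * t))" "phi t"
    using t by (intro walk_chars) simp
  have "expectation (\<lambda>\<omega>. exp (- a * \<bar>X t \<omega>\<bar>)) = (\<integral>s. exp (- a * \<bar>s + 0\<bar>) \<partial>distr M borel (X (real 1 * t)))"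
    by (subst integral_distr) auto
  also have "\<dots> = (\<integral>z. phi t z \<partial>hc a)" unfolding W.exp_abs_expectation[OF a] by simp
  finally show ?thesis by (simp add: hc_integral(2)[OF a])
qed

lemma free_exp_bounds: "0 < b \<Longrightarrow> 0 \<le> free_exp b x" "0 < b \<Longrightarrow> free_exp b x \<le> 1"
  and free_exp_arg_integrable: "0 < b \<Longrightarrow> integrable M (\<lambda>\<omega>. indicator {0<..} (x + X t \<omega>) * exp (- b * (x + X t \<omega>)))"
proof -
  assume b: "0 < b"
  have bd: "0 \<le> indicator {0<..} y * exp (- b * y)" "indicator {0<..} y * exp (- b * y) \<le> 1" for y
    using b by (auto simp: indicator_def)
  show i: "integrable M (\<lambda>\<omega>. indicator {0<..} (x + X t \<omega>) * exp (- b * (x + X t \<omega>)))"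
    by (rule integrable_const_bound[where B=1]) (use bd in \<open>auto simp: abs_of_nonneg\<close>)
  show "0 \<le> free_exp b x" unfolding free_exp_def by (intro Bochner_Integration.integral_nonneg bd)
  have "free_exp b x \<le> expectation (\<lambda>_. 1)" unfolding free_exp_def by (rule integral_mono[OF i]) (use bd in auto)
  then show "free_exp b x \<le> 1" by (simp add: prob_space)
qed

lemma free_exp_measurable [measurable]: "free_exp b \<in> borel_measurable borel"
  unfolding free_exp_def[abs_def] by measurable

lemma corr_integrable:
  assumes a: "0 < a"
  shows "integrable hl (\<lambda>z. a / (a\<^sup>2 + z\<^sup>2) * phi t z)"
proof (rule Bochner_Integration.integrable_bound)
  show "integrable hl (\<lambda>z. 1 / a * phi t z)" using phi_integrable by simp
  show "AE z in hl. norm (a / (a\<^sup>2 + z\<^sup>2) * phi t z) \<le> norm (1 / a * phi t z)"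
  proof (rule AE_I2)
    fix z :: real
    have "a / (a\<^sup>2 + z\<^sup>2) \<le> a / a\<^sup>2" using a by (intro divide_left_mono) (auto simp: add_pos_nonneg)
    also have "\<dots> = 1 / a" by (simp add: power2_eq_square)
    finally have "a / (a\<^sup>2 + z\<^sup>2) * phi t z \<le> 1 / a * phi t z" by (rule mult_right_mono[OF _ less_imp_le[OF phi_range(3)]])
    moreover have "0 \<le> a / (a\<^sup>2 + z\<^sup>2) * phi t z" using a less_imp_le[OF phi_range(3)[of t z]] by simp
    ultimately show "norm (a / (a\<^sup>2 + z\<^sup>2) * phi t z) \<le> norm (1 / a * phi t z)"
      unfolding real_norm_def by (metis abs_ge_self abs_of_nonneg order_trans)
  qed
qed (auto intro!: measurable_hl)

lemma corr_split:
  fixes a b z :: real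
  assumes a: "0 < a" and b: "0 < b"
  shows "corr a b z = (a / (a\<^sup>2 + z\<^sup>2) + b / (b\<^sup>2 + z\<^sup>2)) / (a + b)"
proof -
  have pos: "0 < a\<^sup>2 + z\<^sup>2" "0 < b\<^sup>2 + z\<^sup>2" "0 < a + b" using a b by (auto simp: add_pos_nonneg)
  have "a * (b\<^sup>2 + z\<^sup>2) + b * (a\<^sup>2 + z\<^sup>2) = (a + b) * (a * b + z\<^sup>2)" by algebra
  moreover have "a / (a\<^sup>2 + z\<^sup>2) + b / (b\<^sup>2 + z\<^sup>2) = (a * (b\<^sup>2 + z\<^sup>2) + b * (a\<^sup>2 + z\<^sup>2)) / ((a\<^sup>2 + z\<^sup>2) * (b\<^sup>2 + z\<^sup>2))"
    by (rule add_frac_eq) (use pos in auto)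
  ultimately show ?thesis using pos by (simp add: corr_def)
qed

lemma corr_phi_integrable: "0 < a \<Longrightarrow> 0 < b \<Longrightarrow> integrable hl (\<lambda>z. corr a b z * phi t z)"
proof -
  assume a: "0 < a" and b: "0 < b"
  have "integrable hl (\<lambda>z. (a / (a\<^sup>2 + z\<^sup>2) * phi t z + b / (b\<^sup>2 + z\<^sup>2) * phi t z) / (a + b))"
    by (intro Bochner_Integration.integrable_divide Bochner_Integration.integrable_add corr_integrable a b)
  then show "integrable hl (\<lambda>z. corr a b z * phi t z)"
    unfolding corr_split[OF a b] by (simp add: distrib_right)
qed

text \<open>The one-sided correlation \<open>q\<close> is asymmetric. Symmetry of \<open>X t\<close>
  permits replacing it by the mean of \<open>q s\<close> and \<open>q (- s)\<close>, a sum of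
  exponentials in \<open>\<bar>s\<bar>\<close>, whose expectations are integrals of
  \<open>phi t\<close> by \<open>exp_abs_X\<close>.\<close>

lemma free_exp_laplace:
  assumes a: "0 < a" and b: "0 < b"
  shows "(\<integral>x. exp (- a * x) * free_exp b x \<partial>hl) = 1 / pi * (\<integral>z. corr a b z * phi t z \<partial>hl)"
proof -
  interpret h: sigma_finite_measure hl by (rule sigma_finite_hl)
  interpret P: pair_sigma_finite hl M ..
  define q where "q s = exp (- (if 0 \<le> s then b else a) * \<bar>s\<bar>) / (a + b)" for s
  have [measurable]: "q \<in> borel_measurable borel" unfolding q_def[abs_def] by measurable
  have qb: "0 \<le> q s" "q s \<le> 1 / (a + b)" for s
    using a b by (auto simp: q_def divide_right_mono)
  have qi: "integrable M (\<lambda>\<omega>. q (X t \<omega>))" "integrable M (\<lambda>\<omega>. q (- X t \<omega>))"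
    using qb by (auto intro!: integrable_const_bound[where B="1 / (a + b)"])
  have ei: "integrable M (\<lambda>\<omega>. exp (- c * \<bar>X t \<omega>\<bar>))" if "0 < c" for c
    using that by (intro integrable_const_bound[where B=1]) auto
  let ?h = "\<lambda>x \<omega>. exp (- a * x) * (indicator {0<..} (x + X t \<omega>) * exp (- b * (x + X t \<omega>)))"
  have hm: "(\<lambda>(x, \<omega>). ?h x \<omega>) \<in> borel_measurable (borel \<Otimes>\<^sub>M M)" by measurable
  have i: "integrable (hl \<Otimes>\<^sub>M M) (\<lambda>(x, \<omega>). ?h x \<omega>)"
  proof (rule integrable_pair_dominated[where g="\<lambda>x. exp (- a * x)" and h="\<lambda>_. 1"])
    show "(\<lambda>(x, \<omega>). ?h x \<omega>) \<in> borel_measurable (hl \<Otimes>\<^sub>M M)" by (rule measurable_pair_hl[OF hm])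
    show "integrable hl (\<lambda>x. exp (- a * x))" by (rule hl_exp_real[OF a])
  qed (use b in \<open>auto intro: h.sigma_finite_measure_axioms sigma_finite_measure_axioms simp: indicator_def\<close>)
  have "(\<integral>x. exp (- a * x) * free_exp b x \<partial>hl) = (\<integral>x. (\<integral>\<omega>. ?h x \<omega> \<partial>M) \<partial>hl)"
    unfolding free_exp_def by simp
  also have "\<dots> = (\<integral>\<omega>. (\<integral>x. ?h x \<omega> \<partial>hl) \<partial>M)" by (rule P.Fubini_integral[OF i, symmetric])
  also have "\<dots> = expectation (\<lambda>\<omega>. q (X t \<omega>))" unfolding laplace_correlation[OF a b] q_def ..
  finally have 1: "(\<integral>x. exp (- a * x) * free_exp b x \<partial>hl) = expectation (\<lambda>\<omega>. q (X t \<omega>))" .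
  have "expectation (\<lambda>\<omega>. q (X t \<omega>)) = (\<integral>s. q s \<partial>distr M borel (X t))" by (rule integral_distr[symmetric]) auto
  also have "\<dots> = (\<integral>s. q s \<partial>distr M borel (\<lambda>\<omega>. - X t \<omega>))" by (simp only: symmetric)
  also have "\<dots> = expectation (\<lambda>\<omega>. q (- X t \<omega>))" by (rule integral_distr) auto
  finally have "2 * expectation (\<lambda>\<omega>. q (X t \<omega>)) = expectation (\<lambda>\<omega>. q (X t \<omega>) + q (- X t \<omega>))"
    using qi by simp
  also have "\<dots> = expectation (\<lambda>\<omega>. (exp (- a * \<bar>X t \<omega>\<bar>) + exp (- b * \<bar>X t \<omega>\<bar>)) / (a + b))"
    by (intro Bochner_Integration.integral_cong refl) (auto simp: q_def add_divide_distrib)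
  also have "\<dots> = (expectation (\<lambda>\<omega>. exp (- a * \<bar>X t \<omega>\<bar>)) + expectation (\<lambda>\<omega>. exp (- b * \<bar>X t \<omega>\<bar>))) / (a + b)"
    using ei[OF a] ei[OF b] by simp
  also have "\<dots> = 2 / pi * ((\<integral>z. a / (a\<^sup>2 + z\<^sup>2) * phi t z \<partial>hl) + (\<integral>z. b / (b\<^sup>2 + z\<^sup>2) * phi t z \<partial>hl)) / (a + b)"
  proof -
    have "expectation (\<lambda>\<omega>. exp (- c * \<bar>X t \<omega>\<bar>)) = 2 / pi * (\<integral>z. c / (c\<^sup>2 + z\<^sup>2) * phi t z \<partial>hl)" if "0 < c" for c
      unfolding exp_abs_X[OF that] integral_mult_right_zero[symmetric] by (simp add: mult.assoc)
    then show ?thesis using a b by (simp add: distrib_left)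
  qed
  also have "\<dots> = 2 / pi * (\<integral>z. (a / (a\<^sup>2 + z\<^sup>2) * phi t z + b / (b\<^sup>2 + z\<^sup>2) * phi t z) / (a + b) \<partial>hl)"
    using corr_integrable[OF a] corr_integrable[OF b] by (simp only: integral_divide_zero Bochner_Integration.integral_add times_divide_eq_right)
  also have "\<dots> = 2 * (1 / pi * (\<integral>z. corr a b z * phi t z \<partial>hl))"
    unfolding corr_split[OF a b] by (simp add: distrib_right)
  finally show ?thesis using 1 by simp
qed

text \<open>The killed process is dominated by the free one, whose quadratic form is diagonalised by the Fourier
  transform.\<close>

lemma energy_bound:
  assumes nn: "\<And>y. 0 < y \<Longrightarrow> 0 \<le> expsum c n y"
  shows "(\<integral>l. (eig_sum c n l)\<^sup>2 \<partial>rho) \<le> (\<integral>x. expsum c n x \<partial>hl)\<^sup>2 * (\<integral>z. phi t z \<partial>hl) / 2"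
proof -
  let ?f = "expsum c n"
  define Gf where "Gf x = (\<Sum>j\<le>n. c j * free_exp (real (Suc j)) x)" for x
  have Gi: "integrable hl (\<lambda>x. exp (- real (Suc i) * x) * free_exp (real (Suc j)) x)" for i j
    by (rule integrable_hl_bounded_mult[OF hl_exp_real(1), where B=1])
       (use free_exp_bounds[of "real (Suc j)"] in \<open>auto intro!: measurable_hl simp del: of_nat_Suc\<close>)
  have Ki: "integrable hl (\<lambda>x. exp (- real (Suc i) * x) * killed_exp (real (Suc j)) x)" for i j
    by (rule killed_exp_pair_integrable) simp_all
  have eG: "?f x * Gf x = (\<Sum>i\<le>n. \<Sum>j\<le>n. c i * c j * (exp (- real (Suc i) * x) * free_exp (real (Suc j)) x))" for x
    unfolding Gf_def expsum_def sum_product by (intro sum.cong refl) (simp only: ac_simps)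
  have eK: "?f x * killed_mean ?f x = (\<Sum>i\<le>n. \<Sum>j\<le>n. c i * c j * (exp (- real (Suc i) * x) * killed_exp (real (Suc j)) x))" for x
    unfolding killed_mean_expsum unfolding expsum_def sum_product by (intro sum.cong refl) (simp only: ac_simps)
  \<comment> \<open>Killing only removes paths, and the function is nonnegative at the positive end
    points of the removed ones.\<close>
  have KG: "killed_mean ?f x \<le> Gf x" for x
  proof -
    have "Gf x = expectation (\<lambda>\<omega>. \<Sum>j\<le>n. c j * (indicator {0<..} (x + X t \<omega>) * exp (- real (Suc j) * (x + X t \<omega>))))"
      unfolding Gf_def free_exp_def
      by (subst Bochner_Integration.integral_sum, intro integrable_mult_right free_exp_arg_integrable, simp,
          intro sum.cong refl integral_mult_right_zero[symmetric])
    also have "\<dots> = expectation (\<lambda>\<omega>. indicator {0<..} (x + X t \<omega>) * ?f (x + X t \<omega>))"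
      unfolding expsum_def sum_distrib_left by (intro Bochner_Integration.integral_cong sum.cong refl) (simp only: ac_simps)
    finally have Gf: "Gf x = expectation (\<lambda>\<omega>. indicator {0<..} (x + X t \<omega>) * ?f (x + X t \<omega>))" .
    have fb: "\<bar>?f y\<bar> \<le> (\<Sum>j\<le>n. \<bar>c j\<bar>)" if "0 < y" for y
      unfolding expsum_def using that
      by (intro order_trans[OF sum_abs] sum_mono) (auto simp: abs_mult mult_left_le simp del: of_nat_Suc)
    have fm [measurable]: "?f \<in> borel_measurable borel" unfolding expsum_def[abs_def] by measurable
    have "0 \<le> (\<Sum>j\<le>n. \<bar>c j\<bar>)" by (intro sum_nonneg) simp
    then have "\<bar>indicator {0<..} y * ?f y\<bar> \<le> (\<Sum>j\<le>n. \<bar>c j\<bar>)" for y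
      using fb by (auto simp: indicator_def)
    then have "integrable M (\<lambda>\<omega>. indicator {0<..} (x + X t \<omega>) * ?f (x + X t \<omega>))"
      by (intro integrable_const_bound[where B="\<Sum>j\<le>n. \<bar>c j\<bar>"]) auto
    moreover have "integrable M (\<lambda>\<omega>. ?f (x + X t \<omega>) * indicator {\<omega>. alive x \<omega>} \<omega>)"
      by (rule killed_mean_integrable[OF fm fb])
    moreover have "?f (x + X t \<omega>) * indicator {\<omega>. alive x \<omega>} \<omega> \<le> indicator {0<..} (x + X t \<omega>) * ?f (x + X t \<omega>)" for \<omega>
      using alive_pos_end[of x \<omega>] nn[of "x + X t \<omega>"] by (auto simp: indicator_def)
    ultimately show ?thesis unfolding Gf killed_mean_def by (intro integral_mono)
  qed
  \<comment> \<open>For a nonnegative function the modulus of the Fourier transform is at most the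
    total mass.\<close>
  have corr: "(\<Sum>i\<le>n. \<Sum>j\<le>n. c i * c j * corr (real (Suc i)) (real (Suc j)) z) \<le> (\<integral>x. ?f x \<partial>hl)\<^sup>2" for z
  proof -
    have "norm (\<integral>x. exp (- (\<i> * of_real (z * x))) * of_real (?f x) \<partial>hl) \<le> (\<integral>x. ?f x \<partial>hl)"
    proof (rule norm_integral_le)
      have n: "cmod (exp (- (\<i> * of_real (z * x))) * of_real (?f x)) = \<bar>?f x\<bar>" for x by (simp add: norm_mult)
      have [measurable]: "?f \<in> borel_measurable borel" unfolding expsum_def[abs_def] by measurable
      show "integrable hl (\<lambda>x. exp (- (\<i> * of_real (z * x))) * of_real (?f x))"
        by (rule Bochner_Integration.integrable_bound[OF expsum_integrable]) (auto simp: norm_mult intro!: measurable_hl)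
      show "AE x in hl. norm (exp (- (\<i> * of_real (z * x))) * of_real (?f x)) \<le> ?f x"
        unfolding n by (auto intro!: AE_I2 simp: nn)
    qed (rule expsum_integrable)
    then have "(cmod (\<integral>x. exp (- (\<i> * of_real (z * x))) * of_real (?f x) \<partial>hl))\<^sup>2 \<le> (\<integral>x. ?f x \<partial>hl)\<^sup>2"
      by (rule power_mono) simp
    then show ?thesis unfolding corr_def expsum_fourier .
  qed
  have ci: "integrable hl (\<lambda>z. corr (real (Suc i)) (real (Suc j)) z * phi t z)" for i j
    by (rule corr_phi_integrable) simp_all
  have "2 / pi * (\<integral>l. (eig_sum c n l)\<^sup>2 \<partial>rho) = (\<integral>x. ?f x * killed_mean ?f x \<partial>hl)"
    unfolding killed_mean_form power2_eq_square ..
  also have "\<dots> \<le> (\<integral>x. ?f x * Gf x \<partial>hl)"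
  proof (rule integral_mono)
    show "integrable hl (\<lambda>x. ?f x * killed_mean ?f x)" "integrable hl (\<lambda>x. ?f x * Gf x)"
      unfolding eG eK by (intro Bochner_Integration.integrable_sum integrable_mult_right Gi Ki)+
    show "?f x * killed_mean ?f x \<le> ?f x * Gf x" if "x \<in> space hl" for x
      using that by (intro mult_left_mono KG nn) simp
  qed
  also have "\<dots> = (\<Sum>i\<le>n. \<Sum>j\<le>n. c i * c j * (\<integral>x. exp (- real (Suc i) * x) * free_exp (real (Suc j)) x \<partial>hl))"
    unfolding eG by (subst Bochner_Integration.integral_sum, intro Bochner_Integration.integrable_sum integrable_mult_right Gi,
        intro sum.cong refl, subst Bochner_Integration.integral_sum, intro integrable_mult_right Gi,
        intro sum.cong refl integral_mult_right_zero)
  also have "\<dots> = (\<Sum>i\<le>n. \<Sum>j\<le>n. 1 / pi * (c i * c j * (\<integral>z. corr (real (Suc i)) (real (Suc j)) z * phi t z \<partial>hl)))"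
    by (intro sum.cong refl, subst free_exp_laplace) (simp_all del: of_nat_Suc)
  also have "\<dots> = 1 / pi * (\<Sum>i\<le>n. \<Sum>j\<le>n. c i * c j * (\<integral>z. corr (real (Suc i)) (real (Suc j)) z * phi t z \<partial>hl))"
    by (simp only: sum_distrib_left)
  also have "(\<Sum>i\<le>n. \<Sum>j\<le>n. c i * c j * (\<integral>z. corr (real (Suc i)) (real (Suc j)) z * phi t z \<partial>hl)) =
      (\<integral>z. (\<Sum>i\<le>n. \<Sum>j\<le>n. c i * c j * (corr (real (Suc i)) (real (Suc j)) z * phi t z)) \<partial>hl)"
    by (subst Bochner_Integration.integral_sum, intro Bochner_Integration.integrable_sum integrable_mult_right ci,
        intro sum.cong refl, subst Bochner_Integration.integral_sum, intro integrable_mult_right ci,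
        intro sum.cong refl integral_mult_right_zero[symmetric])
  also have "1 / pi * \<dots> \<le> 1 / pi * (\<integral>z. (\<integral>x. ?f x \<partial>hl)\<^sup>2 * phi t z \<partial>hl)"
  proof (intro mult_left_mono integral_mono)
    show "integrable hl (\<lambda>z. (\<Sum>i\<le>n. \<Sum>j\<le>n. c i * c j * (corr (real (Suc i)) (real (Suc j)) z * phi t z)))"
      by (intro Bochner_Integration.integrable_sum integrable_mult_right ci)
    show "integrable hl (\<lambda>z. (\<integral>x. ?f x \<partial>hl)\<^sup>2 * phi t z)" using phi_integrable by simp
    show "(\<Sum>i\<le>n. \<Sum>j\<le>n. c i * c j * (corr (real (Suc i)) (real (Suc j)) z * phi t z)) \<le> (\<integral>x. ?f x \<partial>hl)\<^sup>2 * phi t z" for z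
      using mult_right_mono[OF corr[of z] less_imp_le[OF phi_range(3)[of t z]]]
      by (simp only: sum_distrib_right mult.assoc)
  qed simp
  also have "\<dots> = 1 / pi * ((\<integral>x. ?f x \<partial>hl)\<^sup>2 * (\<integral>z. phi t z \<partial>hl))" by simp
  finally show ?thesis by (simp add: field_simps)
qed

section \<open>Inversion of the Laplace transforms\<close>

lemma F_measurable_space: "0 < l \<Longrightarrow> F l \<in> borel_measurable hl"
  by (rule continuous_on_measurable_hl[OF F_continuous])

lemma F_bound: "0 < l \<Longrightarrow> \<exists>B. \<forall>y>0. \<bar>F l y\<bar> \<le> B"
  using F_bounded[of l] unfolding bounded_iff by auto

lemma F_isCont: "0 < l \<Longrightarrow> 0 < x \<Longrightarrow> isCont (F l) x"
  using F_continuous[of l] by (simp add: continuous_on_eq_continuous_at)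

lemma eig_sum_eq: "0 < l \<Longrightarrow> eig_sum c n l = (\<integral>y. expsum c n y * F l y \<partial>hl)"
proof -
  assume l: "0 < l"
  obtain B where B: "\<And>y. 0 < y \<Longrightarrow> \<bar>F l y\<bar> \<le> B" using F_bound[OF l] by blast
  have "(\<integral>y. exp (- real (Suc i) * y) * F l y \<partial>hl) = eig (real (Suc i)) l" for i
    by (rule F_laplace[OF l]) simp
  moreover have "(\<integral>y. expsum c n y * F l y \<partial>hl) = (\<Sum>i\<le>n. c i * (\<integral>y. exp (- real (Suc i) * y) * F l y \<partial>hl))"
    by (rule expsum_integral_mult[OF F_measurable_space[OF l] B])
  ultimately show "eig_sum c n l = (\<integral>y. expsum c n y * F l y \<partial>hl)" by (simp only: eig_sum_def)
qed

text \<open>The constant of \<open>energy_bound\<close> for functions of mass at most 2, since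
  \<open>2\<^sup>2 / 2 = 2\<close>.\<close>

definition energy_const :: real where "energy_const = 2 * (\<integral>z. phi t z \<partial>hl)"

text \<open>Along an approximate identity at \<open>x\<close> the transforms \<open>eig_sum\<close>
  tend to \<open>F l x\<close> for each \<open>l\<close>, by continuity of \<open>F l\<close>, while
  \<open>energy_bound\<close> keeps them bounded in mean square. So \<open>l \<mapsto> F l x\<close>
  is a weak limit and obeys a bound that does not depend on \<open>x\<close>.\<close>

lemma F_approx:
  assumes x: "0 < x"
  obtains c N where "expsum_delta x c N"
    and "(\<lambda>l. F l x) \<in> borel_measurable rho" "integrable rho (\<lambda>l. (F l x)\<^sup>2)" "(\<integral>l. (F l x)\<^sup>2 \<partial>rho) \<le> energy_const"
    and "\<And>h. h \<in> borel_measurable rho \<Longrightarrow> integrable rho (\<lambda>l. (h l)\<^sup>2) \<Longrightarrow>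
      (\<lambda>j. \<integral>l. eig_sum (c j) (N j) l * h l \<partial>rho) \<longlonglongrightarrow> (\<integral>l. F l x * h l \<partial>rho)"
proof -
  obtain c' N' where d': "expsum_delta x c' N'" by (rule expsum_approx[OF x])
  have "(\<lambda>j. \<integral>y. expsum (c' j) (N' j) y * 1 \<partial>hl) \<longlonglongrightarrow> 1"
    by (rule expsum_deltaD(2)[OF d', where B=1]) auto
  then have "eventually (\<lambda>j. (\<integral>y. expsum (c' j) (N' j) y \<partial>hl) < 2) sequentially"
    by (intro order_tendstoD(2)) auto
  \<comment> \<open>The masses tend to 1; dropping finitely many terms makes all of them smaller
    than 2, which is where \<open>energy_const\<close> comes from.\<close>
  then obtain j0 where j0: "\<And>j. j0 \<le> j \<Longrightarrow> (\<integral>y. expsum (c' j) (N' j) y \<partial>hl) < 2"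
    by (auto simp: eventually_sequentially)
  define c N where "c j = c' (j + j0)" and "N j = N' (j + j0)" for j
  have d: "expsum_delta x c N"
    unfolding expsum_delta_def c_def N_def
  proof (intro conjI allI impI)
    show "0 \<le> expsum (c' (j + j0)) (N' (j + j0)) y" if "0 < y" for j y by (rule expsum_deltaD(1)[OF d' that])
    fix h :: "real \<Rightarrow> real" and B assume "h \<in> borel_measurable hl" "\<forall>y>0. \<bar>h y\<bar> \<le> B" "isCont h x"
    then show "(\<lambda>j. \<integral>y. expsum (c' (j + j0)) (N' (j + j0)) y * h y \<partial>hl) \<longlonglongrightarrow> h x"
      by (intro LIMSEQ_ignore_initial_segment[of "\<lambda>j. \<integral>y. expsum (c' j) (N' j) y * h y \<partial>hl"] expsum_deltaD(2)[OF d']) auto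
  qed
  have le: "(\<integral>l. (eig_sum (c j) (N j) l)\<^sup>2 \<partial>rho) \<le> energy_const" for j
  proof -
    let ?I = "\<integral>y. expsum (c j) (N j) y \<partial>hl"
    have nn: "0 \<le> expsum (c j) (N j) y" if "0 < y" for y by (rule expsum_deltaD(1)[OF d that])
    have "0 \<le> ?I" by (intro Bochner_Integration.integral_nonneg) (auto intro: nn)
    moreover have "?I < 2" using j0[of "j + j0"] by (simp add: c_def N_def)
    ultimately have "?I\<^sup>2 \<le> 2\<^sup>2" by (intro power_mono) auto
    moreover have "0 \<le> (\<integral>z. phi t z \<partial>hl)"
      using phi_range(3) by (intro Bochner_Integration.integral_nonneg less_imp_le)
    ultimately have "?I\<^sup>2 * (\<integral>z. phi t z \<partial>hl) / 2 \<le> 2\<^sup>2 * (\<integral>z. phi t z \<partial>hl) / 2"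
      by (intro divide_right_mono mult_right_mono) auto
    then show ?thesis using energy_bound[OF nn] by (simp add: energy_const_def)
  qed
  have lim: "(\<lambda>j. eig_sum (c j) (N j) l) \<longlonglongrightarrow> F l x" if "l \<in> space rho" for l
  proof -
    have l: "0 < l" using that by simp
    obtain B where B: "\<And>y. 0 < y \<Longrightarrow> \<bar>F l y\<bar> \<le> B" using F_bound[OF l] by blast
    show ?thesis unfolding eig_sum_eq[OF l]
      by (rule expsum_deltaD(2)[OF d F_measurable_space[OF l] B F_isCont[OF l x]])
  qed
  have m: "eig_sum (c j) (N j) \<in> borel_measurable rho" for j using eig_sum_measurable by simp
  have i: "integrable rho (\<lambda>l. (eig_sum (c j) (N j) l)\<^sup>2)" for j
    unfolding power2_eq_square by (rule eig_sum_prod(1))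
  show ?thesis
    by (rule that[OF d]) (rule L2_bounded_weak_limit[OF m i le lim]; assumption)+
qed

lemma F_measurable: "0 < x \<Longrightarrow> (\<lambda>l. F l x) \<in> borel_measurable rho"
  and F_square: "0 < x \<Longrightarrow> integrable rho (\<lambda>l. (F l x)\<^sup>2)"
  and F_square_le: "0 < x \<Longrightarrow> (\<integral>l. (F l x)\<^sup>2 \<partial>rho) \<le> energy_const"
  using F_approx by blast+

lemma square_prod_integrable:
  fixes f g :: "real \<Rightarrow> real"
  assumes [measurable]: "f \<in> borel_measurable rho" "g \<in> borel_measurable rho"
    and "integrable rho (\<lambda>l. (f l)\<^sup>2)" "integrable rho (\<lambda>l. (g l)\<^sup>2)"
  shows "integrable rho (\<lambda>l. f l * g l)" "(\<integral>l. \<bar>f l * g l\<bar> \<partial>rho) \<le> ((\<integral>l. (f l)\<^sup>2 \<partial>rho) + (\<integral>l. (g l)\<^sup>2 \<partial>rho)) / 2"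
proof -
  have i: "integrable rho (\<lambda>l. ((f l)\<^sup>2 + (g l)\<^sup>2) / 2)" using assms by auto
  have le: "\<bar>f l * g l\<bar> \<le> ((f l)\<^sup>2 + (g l)\<^sup>2) / 2" for l
    using sum_squares_bound[of "\<bar>f l\<bar>" "\<bar>g l\<bar>"] by (simp add: abs_mult)
  show f: "integrable rho (\<lambda>l. f l * g l)"
    by (rule Bochner_Integration.integrable_bound[OF i]) (use le in \<open>auto intro!: AE_I2 order_trans[OF le]\<close>)
  have "(\<integral>l. \<bar>f l * g l\<bar> \<partial>rho) \<le> (\<integral>l. ((f l)\<^sup>2 + (g l)\<^sup>2) / 2 \<partial>rho)"
    by (rule integral_mono[OF integrable_abs[OF f] i le])
  then show "(\<integral>l. \<bar>f l * g l\<bar> \<partial>rho) \<le> ((\<integral>l. (f l)\<^sup>2 \<partial>rho) + (\<integral>l. (g l)\<^sup>2 \<partial>rho)) / 2"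
    using assms by simp
qed

definition kernel :: "real \<Rightarrow> real \<Rightarrow> real" where
  "kernel x y = 2 / pi * (\<integral>l. F l x * F l y \<partial>rho)"

text \<open>An approximate identity at \<open>x\<close> applied to \<open>killed_exp_laplace\<close>
  undoes the first Laplace transform: continuity of \<open>killed_exp b\<close> gives the limit on
  one side, weak convergence the limit on the other.\<close>

lemma killed_exp_eq:
  assumes x: "0 < x" and b: "0 < b"
  shows "killed_exp b x = 2 / pi * (\<integral>l. F l x * eig b l \<partial>rho)"
proof -
  obtain c N where d: "expsum_delta x c N"
    and w: "\<And>h. h \<in> borel_measurable rho \<Longrightarrow> integrable rho (\<lambda>l. (h l)\<^sup>2) \<Longrightarrow>
      (\<lambda>j. \<integral>l. eig_sum (c j) (N j) l * h l \<partial>rho) \<longlonglongrightarrow> (\<integral>l. F l x * h l \<partial>rho)"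
    by (rule F_approx[OF x], rule that, assumption+)
  have bm: "\<bar>killed_exp b y\<bar> \<le> 1" for y using killed_exp_bounded[OF b, of y] by simp
  have e: "(\<integral>y. expsum (c j) (N j) y * killed_exp b y \<partial>hl) = 2 / pi * (\<integral>l. eig_sum (c j) (N j) l * eig b l \<partial>rho)" for j
  proof -
    have "integrable rho (\<lambda>l. eig (real (Suc i)) l * eig b l)" for i
      by (rule eig_prod_integrable[OF _ b]) simp
    then have i: "integrable rho (\<lambda>l. c j i * (eig (real (Suc i)) l * eig b l))" for i by (rule integrable_mult_right)
    have "(\<integral>l. eig_sum (c j) (N j) l * eig b l \<partial>rho) = (\<Sum>i\<le>N j. c j i * (\<integral>l. eig (real (Suc i)) l * eig b l \<partial>rho))"
      unfolding eig_sum_def sum_distrib_right mult.assoc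
      by (subst Bochner_Integration.integral_sum, rule i, intro sum.cong refl integral_mult_right_zero)
    moreover have "(\<integral>y. expsum (c j) (N j) y * killed_exp b y \<partial>hl) = (\<Sum>i\<le>N j. c j i * (2 / pi * (\<integral>l. eig (real (Suc i)) l * eig b l \<partial>rho)))"
      unfolding expsum_integral_mult[OF killed_exp_measurable[OF b] bm]
      by (intro sum.cong refl, subst killed_exp_laplace[OF _ b]) (simp_all del: of_nat_Suc)
    ultimately show ?thesis by (simp only: sum_distrib_left mult.left_commute)
  qed
  have "(\<lambda>j. \<integral>y. expsum (c j) (N j) y * killed_exp b y \<partial>hl) \<longlonglongrightarrow> killed_exp b x"
    by (rule expsum_deltaD(2)[OF d killed_exp_measurable[OF b] bm killed_exp_isCont[OF b x]])
  moreover have "(\<lambda>j. \<integral>y. expsum (c j) (N j) y * killed_exp b y \<partial>hl) \<longlonglongrightarrow> 2 / pi * (\<integral>l. F l x * eig b l \<partial>rho)"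
    unfolding e using b by (intro tendsto_mult tendsto_const w eig_square) simp
  ultimately show ?thesis by (rule LIMSEQ_unique)
qed

text \<open>The killed semigroup preserves positivity, so its form at two nonnegative
  \<open>expsum\<close> functions is nonnegative. The limits are taken one variable at a time, since
  each factor is known to converge only weakly.\<close>

lemma kernel_nonneg:
  assumes x: "0 < x" and y: "0 < y"
  shows "0 \<le> kernel x y"
proof -
  obtain c N where d: "expsum_delta x c N"
    and w: "\<And>h. h \<in> borel_measurable rho \<Longrightarrow> integrable rho (\<lambda>l. (h l)\<^sup>2) \<Longrightarrow>
      (\<lambda>j. \<integral>l. eig_sum (c j) (N j) l * h l \<partial>rho) \<longlonglongrightarrow> (\<integral>l. F l x * h l \<partial>rho)"
    by (rule F_approx[OF x], rule that, assumption+)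
  obtain c' N' where d': "expsum_delta y c' N'"
    and w': "\<And>h. h \<in> borel_measurable rho \<Longrightarrow> integrable rho (\<lambda>l. (h l)\<^sup>2) \<Longrightarrow>
      (\<lambda>j. \<integral>l. eig_sum (c' j) (N' j) l * h l \<partial>rho) \<longlonglongrightarrow> (\<integral>l. F l y * h l \<partial>rho)"
    by (rule F_approx[OF y], rule that, assumption+)
  have 0: "0 \<le> (\<integral>l. eig_sum (c j) (N j) l * eig_sum (c' k) (N' k) l \<partial>rho)" for j k
  proof -
    have "0 \<le> killed_mean (expsum (c' k) (N' k)) u" for u unfolding killed_mean_def
      using alive_pos_end expsum_deltaD(1)[OF d', of _ k]
      by (intro Bochner_Integration.integral_nonneg) (simp add: indicator_def)
    then have "0 \<le> (\<integral>u. expsum (c j) (N j) u * killed_mean (expsum (c' k) (N' k)) u \<partial>hl)"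
      using expsum_deltaD(1)[OF d] by (intro Bochner_Integration.integral_nonneg mult_nonneg_nonneg) auto
    then show ?thesis unfolding killed_mean_form using pi_gt_zero by (auto simp: zero_le_divide_iff)
  qed
  have "0 \<le> (\<integral>l. F l x * eig_sum (c' k) (N' k) l \<partial>rho)" for k
  proof (rule LIMSEQ_le_const)
    show "(\<lambda>j. \<integral>l. eig_sum (c j) (N j) l * eig_sum (c' k) (N' k) l \<partial>rho) \<longlonglongrightarrow> (\<integral>l. F l x * eig_sum (c' k) (N' k) l \<partial>rho)"
      by (rule w) (use eig_sum_measurable eig_sum_prod(1) in \<open>auto simp: power2_eq_square\<close>)
  qed (use 0 in blast)
  moreover have "(\<lambda>k. \<integral>l. eig_sum (c' k) (N' k) l * F l x \<partial>rho) \<longlonglongrightarrow> (\<integral>l. F l y * F l x \<partial>rho)"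
    by (rule w'[OF F_measurable[OF x] F_square[OF x]])
  ultimately have "0 \<le> (\<integral>l. F l y * F l x \<partial>rho)"
    by (intro LIMSEQ_le_const) (auto simp: mult.commute)
  then show ?thesis by (simp add: kernel_def mult.commute)
qed

text \<open>The function is measurable in \<open>l\<close> and continuous in \<open>y\<close>, and
  \<open>y\<close> is approximated by the dyadic number \<open>r n y\<close> just above it, which
  takes countably many values and stays positive.\<close>

lemma F_pair_measurable: "(\<lambda>(y, l). F l y) \<in> borel_measurable (hl \<Otimes>\<^sub>M rho)"
proof -
  define r where "r n y = (real (nat \<lfloor>y * 2 ^ n\<rfloor>) + 1) / 2 ^ n" for n :: nat and y :: real
  have rpos: "0 < r n y" for n y by (simp add: r_def add_nonneg_pos)
  have "(\<lambda>z. F (snd z) (r n (fst z))) \<in> borel_measurable (hl \<Otimes>\<^sub>M rho)" for n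
  proof -
    let ?g = "\<lambda>z::real \<times> real. nat \<lfloor>fst z * 2 ^ n\<rfloor>"
    have fm: "fst \<in> borel_measurable (hl \<Otimes>\<^sub>M rho)"
      by (rule measurable_compose[OF measurable_fst measurable_hl[OF measurable_ident_sets[OF refl]]])
    have g: "?g \<in> measurable (hl \<Otimes>\<^sub>M rho) (count_space UNIV)" using fm by measurable
    have f: "(\<lambda>z. F (snd z) ((real k + 1) / 2 ^ n)) \<in> borel_measurable (hl \<Otimes>\<^sub>M rho)" for k :: nat
      by (rule measurable_compose[OF measurable_snd F_measurable]) (simp add: add_nonneg_pos)
    show ?thesis unfolding r_def by (rule measurable_compose_countable[OF f g])
  qed
  moreover have "(\<lambda>n. F (snd z) (r n (fst z))) \<longlonglongrightarrow> F (snd z) (fst z)" if "z \<in> space (hl \<Otimes>\<^sub>M rho)" for z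
  proof -
    have z: "0 < fst z" "0 < snd z" using that by (auto simp: space_pair_measure)
    have "(\<lambda>n. r n (fst z)) \<longlonglongrightarrow> fst z"
    proof (rule tendsto_sandwich)
      have fl: "real (nat \<lfloor>fst z * 2 ^ n\<rfloor>) = of_int \<lfloor>fst z * 2 ^ n\<rfloor>" for n :: nat
        using z by (simp add: of_nat_nat)
      have fr: "fst z * 2 ^ n \<le> of_int \<lfloor>fst z * 2 ^ n\<rfloor> + 1" "of_int \<lfloor>fst z * 2 ^ n\<rfloor> + 1 \<le> fst z * 2 ^ n + 1" for n :: nat
        by linarith+
      have "fst z = fst z * 2 ^ n / 2 ^ n" "fst z + 1 / 2 ^ n = (fst z * 2 ^ n + 1) / 2 ^ n" for n :: nat
        by (simp_all add: add_divide_distrib)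
      then have "fst z \<le> r n (fst z)" "r n (fst z) \<le> fst z + 1 / 2 ^ n" for n
        using fr[of n, THEN divide_right_mono[of _ _ "2 ^ n"]] unfolding r_def fl by (metis zero_le_numeral zero_le_power)+
      then show "eventually (\<lambda>n. fst z \<le> r n (fst z)) sequentially"
        "eventually (\<lambda>n. r n (fst z) \<le> fst z + 1 / 2 ^ n) sequentially" by simp_all
      show "(\<lambda>n. fst z + 1 / 2 ^ n) \<longlonglongrightarrow> fst z" by real_asymp
    qed simp
    then show ?thesis by (rule isCont_tendsto_compose[OF F_isCont[OF z(2,1)]])
  qed
  ultimately have "(\<lambda>z. F (snd z) (fst z)) \<in> borel_measurable (hl \<Otimes>\<^sub>M rho)"
    by (rule borel_measurable_LIMSEQ_real[where u="\<lambda>n z. F (snd z) (r n (fst z))", rotated])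
  then show ?thesis by (simp only: case_prod_unfold)
qed

lemma finite_measure_rho: "finite_measure rho"
proof
  have "emeasure rho (space rho) = (\<integral>\<^sup>+l. ennreal (phi t l) \<partial>hl)"
    unfolding rho_def by (subst emeasure_density) (auto intro!: measurable_hl nn_integral_cong simp: indicator_def sets_restrict_space_iff)
  also have "\<dots> = ennreal (\<integral>l. phi t l \<partial>hl)"
    using phi_range(3) by (intro nn_integral_eq_integral phi_integrable) (auto intro!: AE_I2 less_imp_le)
  finally show "emeasure rho (space rho) \<noteq> \<infinity>" by simp
qed

text \<open>Fubini is justified because the inner integral of
  \<open>\<bar>F l x * F l y\<bar>\<close> is at most \<open>energy_const\<close> for all
  \<open>y\<close>, and \<open>exp (- b * y)\<close> supplies integrability in
  \<open>y\<close>.\<close>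

lemma kernel_laplace:
  assumes x: "0 < x" and b: "0 < b"
  shows "integrable hl (\<lambda>y. exp (- b * y) * kernel x y)" "(\<integral>y. exp (- b * y) * kernel x y \<partial>hl) = killed_exp b x"
    and "kernel x \<in> borel_measurable hl"
proof -
  interpret h: sigma_finite_measure hl by (rule sigma_finite_hl)
  interpret r: finite_measure rho by (rule finite_measure_rho)
  interpret P: pair_sigma_finite hl rho ..
  note [measurable] = F_measurable[OF x] F_pair_measurable
  let ?h = "\<lambda>y l. exp (- b * y) * (F l x * F l y)"
  have em: "(\<lambda>z. exp (- b * fst z)) \<in> borel_measurable (hl \<Otimes>\<^sub>M rho)"
    by (rule measurable_compose[OF measurable_fst measurable_hl]) simp
  have fm: "(\<lambda>z. F (snd z) x) \<in> borel_measurable (hl \<Otimes>\<^sub>M rho)"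
    by (rule measurable_compose[OF measurable_snd F_measurable[OF x]])
  have FF: "(\<lambda>z. F (snd z) (fst z)) \<in> borel_measurable (hl \<Otimes>\<^sub>M rho)"
    using F_pair_measurable by (simp only: case_prod_unfold)
  have hm: "(\<lambda>(y, l). ?h y l) \<in> borel_measurable (hl \<Otimes>\<^sub>M rho)"
    unfolding case_prod_unfold by (intro borel_measurable_times em fm FF)
  have inner: "integrable rho (\<lambda>l. F l x * F l y)" "(\<integral>l. \<bar>F l x * F l y\<bar> \<partial>rho) \<le> energy_const" if "0 < y" for y
    using square_prod_integrable[OF F_measurable[OF x] F_measurable[OF that] F_square[OF x] F_square[OF that]]
      F_square_le[OF x] F_square_le[OF that] by auto
  have i: "integrable (hl \<Otimes>\<^sub>M rho) (\<lambda>(y, l). ?h y l)"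
  proof (rule P.Fubini_integrable[OF hm])
    show "AE y in hl. integrable rho (\<lambda>l. case (y, l) of (y, l) \<Rightarrow> ?h y l)"
      using inner(1) by (auto intro!: AE_I2)
    have ne: "(\<integral>l. norm (case (y, l) of (y, l) \<Rightarrow> ?h y l) \<partial>rho) = exp (- b * y) * (\<integral>l. \<bar>F l x * F l y\<bar> \<partial>rho)" for y
      by (simp add: abs_mult mult.assoc)
    show "integrable hl (\<lambda>y. \<integral>l. norm (case (y, l) of (y, l) \<Rightarrow> ?h y l) \<partial>rho)"
    proof (rule Bochner_Integration.integrable_bound)
      show "integrable hl (\<lambda>y. energy_const * exp (- b * y))" using hl_exp_real(1)[OF b] by simp
      show "(\<lambda>y. \<integral>l. norm (case (y, l) of (y, l) \<Rightarrow> ?h y l) \<partial>rho) \<in> borel_measurable hl"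
        by (rule r.borel_measurable_lebesgue_integral)
           (use measurable_compose[OF hm borel_measurable_norm] in \<open>simp add: case_prod_unfold\<close>)
      show "AE y in hl. norm (\<integral>l. norm (case (y, l) of (y, l) \<Rightarrow> ?h y l) \<partial>rho) \<le> norm (energy_const * exp (- b * y))"
      proof (rule AE_I2)
        fix y assume "y \<in> space hl"
        then have "(\<integral>l. \<bar>F l x * F l y\<bar> \<partial>rho) \<le> \<bar>energy_const\<bar>" "0 \<le> (\<integral>l. \<bar>F l x * F l y\<bar> \<partial>rho)"
          using inner(2)[of y] by (auto intro: Bochner_Integration.integral_nonneg)
        then show "norm (\<integral>l. norm (case (y, l) of (y, l) \<Rightarrow> ?h y l) \<partial>rho) \<le> norm (energy_const * exp (- b * y))"
          unfolding ne by (simp add: abs_mult mult.commute mult_left_mono)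
      qed
    qed
  qed
  have e: "(\<integral>l. ?h y l \<partial>rho) = pi / 2 * (exp (- b * y) * kernel x y)" for y
    by (simp add: kernel_def)
  show "kernel x \<in> borel_measurable hl" unfolding kernel_def[abs_def]
  proof (intro borel_measurable_times borel_measurable_const r.borel_measurable_lebesgue_integral)
    show "(\<lambda>(y, l). F l x * F l y) \<in> borel_measurable (hl \<Otimes>\<^sub>M rho)"
      unfolding case_prod_unfold by (intro borel_measurable_times fm FF)
  qed
  have ip: "integrable hl (\<lambda>y. pi / 2 * (exp (- b * y) * kernel x y))"
    using P.integrable_fst'[OF i] by (simp only: split e)
  from integrable_mult_right[OF ip, of "2 / pi"] show "integrable hl (\<lambda>y. exp (- b * y) * kernel x y)" by simp
  have "pi / 2 * (\<integral>y. exp (- b * y) * kernel x y \<partial>hl) = (\<integral>y. \<integral>l. ?h y l \<partial>rho \<partial>hl)"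
    unfolding e by simp
  also have "\<dots> = (\<integral>l. \<integral>y. ?h y l \<partial>hl \<partial>rho)" by (rule P.Fubini_integral[OF i, symmetric])
  also have "\<dots> = (\<integral>l. F l x * eig b l \<partial>rho)"
  proof (intro Bochner_Integration.integral_cong refl)
    fix l assume "l \<in> space rho"
    then have "(\<integral>y. exp (- b * y) * F l y \<partial>hl) = eig b l" using b by (intro F_laplace) simp_all
    moreover have "(\<integral>y. ?h y l \<partial>hl) = (\<integral>y. F l x * (exp (- b * y) * F l y) \<partial>hl)"
      by (simp only: mult.left_commute)
    ultimately show "(\<integral>y. ?h y l \<partial>hl) = F l x * eig b l" by simp
  qed
  finally show "(\<integral>y. exp (- b * y) * kernel x y \<partial>hl) = killed_exp b x"
    unfolding killed_exp_eq[OF x b] by (simp add: field_simps)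
qed

text \<open>\<open>M1\<close> is the law of the end point restricted to survival and
  \<open>M2\<close> has density \<open>kernel x\<close>, which is a genuine measure with the right
  Laplace transforms because the kernel is nonnegative. Their equality extends the formula from
  exponentials to bounded Borel functions.\<close>

theorem killed_mean_density:
  assumes x: "0 < x" and f [measurable]: "f \<in> borel_measurable borel" and b: "bounded (range f)"
  shows "integrable hl (\<lambda>y. kernel x y * f y)" "killed_mean f x = (\<integral>y. kernel x y * f y \<partial>hl)"
proof -
  define M1 where "M1 = distr (density M (\<lambda>\<omega>. ennreal (indicator {\<omega>. alive x \<omega>} \<omega>))) borel (\<lambda>\<omega>. x + X t \<omega>)"
  define q where "q y = indicator {0<..} y * kernel x y" for y
  define M2 where "M2 = density lborel (\<lambda>y. ennreal (q y))"
  have qm [measurable]: "q \<in> borel_measurable borel"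
    using kernel_laplace(3)[OF x zero_less_one] unfolding q_def[abs_def]
    by (subst (asm) borel_measurable_restrict_space_iff) auto
  have q0: "0 \<le> q y" for y using kernel_nonneg[OF x, of y] by (auto simp: q_def indicator_def)
  have i1: "integral\<^sup>L M1 g = killed_mean g x" if [measurable]: "g \<in> borel_measurable borel" for g
    unfolding M1_def killed_mean_def
    by (subst integral_distr; (subst integral_density)?) (auto simp: mult.commute)
  have nn1: "(\<integral>\<^sup>+y. ennreal (g y) \<partial>M1) = ennreal (killed_mean g x)"
    if [measurable]: "g \<in> borel_measurable borel" and g: "\<And>y. 0 \<le> g y" "\<And>y. 0 < y \<Longrightarrow> \<bar>g y\<bar> \<le> 1" for g
  proof -
    have "(\<integral>\<^sup>+y. ennreal (g y) \<partial>M1) = (\<integral>\<^sup>+\<omega>. ennreal (indicator {\<omega>. alive x \<omega>} \<omega>) * ennreal (g (x + X t \<omega>)) \<partial>M)"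
      unfolding M1_def by (subst nn_integral_distr; (subst nn_integral_density)?) auto
    also have "\<dots> = (\<integral>\<^sup>+\<omega>. ennreal (g (x + X t \<omega>) * indicator {\<omega>. alive x \<omega>} \<omega>) \<partial>M)"
      by (intro nn_integral_cong) (simp add: indicator_def)
    also have "\<dots> = ennreal (killed_mean g x)" unfolding killed_mean_def
      by (rule nn_integral_eq_integral[OF killed_mean_integrable]) (use g in \<open>auto intro: AE_I2\<close>)
    finally show ?thesis .
  qed
  have M: "M1 = M2"
  proof (rule measure_eq_laplace)
    show "sets M1 = sets borel" "sets M2 = sets borel" by (simp_all add: M1_def M2_def)
    show "AE y in M1. 0 < y" unfolding M1_def
      using alive_pos_end by (subst AE_distr_iff; (subst AE_density)?) (auto intro!: AE_I2 simp: indicator_def)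
    have "0 < y" if "0 < q y" for y using that by (cases "0 < y") (simp_all add: q_def)
    then show "AE y in M2. 0 < y" unfolding M2_def
      by (subst AE_density) auto
    have "(\<integral>\<^sup>+y. ennreal (exp (- real (Suc i) * y)) \<partial>M1) = ennreal (killed_exp (real (Suc i)) x)" for i
      unfolding killed_exp_def by (rule nn1) (auto simp del: of_nat_Suc)
    moreover have "(\<integral>\<^sup>+y. ennreal (exp (- real (Suc i) * y)) \<partial>M2) = ennreal (killed_exp (real (Suc i)) x)" for i
    proof -
      have "(\<integral>\<^sup>+y. ennreal (exp (- real (Suc i) * y)) \<partial>M2) = (\<integral>\<^sup>+y. ennreal (q y) * ennreal (exp (- real (Suc i) * y)) \<partial>lborel)"
        unfolding M2_def by (subst nn_integral_density) auto
      also have "\<dots> = (\<integral>\<^sup>+y. ennreal (exp (- real (Suc i) * y) * kernel x y) * indicator {0<..} y \<partial>lborel)"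
        by (intro nn_integral_cong) (auto simp: q_def indicator_def ennreal_mult''[symmetric] mult.commute)
      also have "\<dots> = (\<integral>\<^sup>+y. ennreal (exp (- real (Suc i) * y) * kernel x y) \<partial>hl)"
        by (rule nn_integral_restrict_space[symmetric]) simp
      also have "\<dots> = ennreal (\<integral>y. exp (- real (Suc i) * y) * kernel x y \<partial>hl)"
        using kernel_nonneg[OF x] by (intro nn_integral_eq_integral kernel_laplace(1)[OF x]) (auto intro!: AE_I2)
      also have "\<dots> = ennreal (killed_exp (real (Suc i)) x)" by (subst kernel_laplace(2)[OF x]) simp_all
      finally show ?thesis .
    qed
    ultimately show "(\<integral>\<^sup>+y. ennreal (exp (- real (Suc i) * y)) \<partial>M1) = (\<integral>\<^sup>+y. ennreal (exp (- real (Suc i) * y)) \<partial>M2)"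
      "(\<integral>\<^sup>+y. ennreal (exp (- y)) \<partial>M1) < \<infinity>" for i
      using \<open>\<And>i. (\<integral>\<^sup>+y. ennreal (exp (- real (Suc i) * y)) \<partial>M1) = ennreal (killed_exp (real (Suc i)) x)\<close>[of 0] by simp_all
  qed
  obtain B where B: "\<And>y. \<bar>f y\<bar> \<le> B" using b unfolding bounded_iff by auto
  have "integrable M1 f"
    unfolding M1_def
    by (subst integrable_distr_eq; (subst integrable_density)?)
       (use killed_mean_integrable[OF f B, of x] in \<open>auto simp: mult.commute\<close>)
  then have "integrable lborel (\<lambda>y. q y * f y)"
    unfolding M M2_def by (subst (asm) integrable_density) (use q0 in auto)
  then show "integrable hl (\<lambda>y. kernel x y * f y)"
    unfolding set_integrable_hl[symmetric] set_integrable_def by (simp add: q_def mult.assoc)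
  have "killed_mean f x = integral\<^sup>L M2 f" using i1[OF f] M by simp
  also have "\<dots> = (\<integral>y. q y * f y \<partial>lborel)"
    unfolding M2_def by (subst integral_density) (use q0 in auto)
  also have "\<dots> = (\<integral>y. kernel x y * f y \<partial>hl)"
    unfolding set_integral_hl[symmetric] set_lebesgue_integral_def by (simp add: q_def mult.assoc)
  finally show "killed_mean f x = (\<integral>y. kernel x y * f y \<partial>hl)" .
qed

end

section \<open>Identification of the given eigenfunctions and conclusion\<close>

context levy_symbol
begin

text \<open>\<open>eigenfunction_log\<close> and \<open>ln (ratio l z)\<close> agree for positive
  \<open>z\<close> except at the null point \<open>z = l\<close>, and the kernel with its prefactor
  \<open>1 / pi\<close> is half the density of \<open>hc a\<close>.\<close>

lemma eigenfunction_laplace_of_real: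
  assumes a: "0 < a" and l: "0 < l" and d: "deriv \<psi> (l\<^sup>2) = \<psi>' (l\<^sup>2)"
  shows "eigenfunction_laplace \<psi> l (of_real a) = of_real (eig a l)"
proof -
  have elog: "eigenfunction_log \<psi> l z = (if z = l then 0 else ln (ratio l z))" if z: "0 < z" for z
  proof (cases "z = l")
    case False
    have "\<psi>' (l\<^sup>2) * (l\<^sup>2 - z\<^sup>2) / (\<psi> (l\<^sup>2) - \<psi> (z\<^sup>2)) = ratio l z"
    proof (cases "z < l")
      case True
      then have "z\<^sup>2 < l\<^sup>2" using z by (simp add: power_strict_mono)
      then show ?thesis using less[of "z\<^sup>2" "l\<^sup>2"] z by (simp add: ratio_def)
    next
      case ge: False
      then have "l\<^sup>2 < z\<^sup>2" using False l by (simp add: power_strict_mono)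
      then have "ratio l z = \<psi>' (l\<^sup>2) * (z\<^sup>2 - l\<^sup>2) / (\<psi> (z\<^sup>2) - \<psi> (l\<^sup>2))"
        using less[of "l\<^sup>2" "z\<^sup>2"] l by (simp add: ratio_def)
      also have "\<dots> = (- (\<psi>' (l\<^sup>2) * (l\<^sup>2 - z\<^sup>2))) / (- (\<psi> (l\<^sup>2) - \<psi> (z\<^sup>2)))" by (simp add: right_diff_distrib)
      also have "\<dots> = \<psi>' (l\<^sup>2) * (l\<^sup>2 - z\<^sup>2) / (\<psi> (l\<^sup>2) - \<psi> (z\<^sup>2))" by (rule minus_divide_divide)
      finally show ?thesis by (rule sym)
    qed
    then show ?thesis using False by (simp add: eigenfunction_log_def d)
  qed (simp add: eigenfunction_log_def)
  let ?I = "\<integral>z. ln (ratio l z) \<partial>hc a"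
  have "(LBINT \<zeta>:{0<..}. complex_of_real a / ((of_real a)\<^sup>2 + (of_real \<zeta>)\<^sup>2) * of_real (eigenfunction_log \<psi> l \<zeta>)) =
      (\<integral>\<zeta>. complex_of_real (a / (a\<^sup>2 + \<zeta>\<^sup>2) * (if \<zeta> = l then 0 else ln (ratio l \<zeta>))) \<partial>hl)"
    unfolding set_integral_hl by (intro Bochner_Integration.integral_cong refl) (simp add: elog)
  also have "\<dots> = of_real (\<integral>\<zeta>. a / (a\<^sup>2 + \<zeta>\<^sup>2) * (if \<zeta> = l then 0 else ln (ratio l \<zeta>)) \<partial>hl)"
    by (rule integral_complex_of_real)
  also have "(\<integral>\<zeta>. a / (a\<^sup>2 + \<zeta>\<^sup>2) * (if \<zeta> = l then 0 else ln (ratio l \<zeta>)) \<partial>hl) = (\<integral>\<zeta>. a / (a\<^sup>2 + \<zeta>\<^sup>2) * ln (ratio l \<zeta>) \<partial>hl)"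
  proof (rule integral_cong_AE)
    have "AE \<zeta> in hl. \<zeta> \<noteq> l"
      by (subst AE_restrict_space_iff) (use AE_lborel_singleton[of l] in \<open>auto elim: eventually_mono\<close>)
    then show "AE \<zeta> in hl. a / (a\<^sup>2 + \<zeta>\<^sup>2) * (if \<zeta> = l then 0 else ln (ratio l \<zeta>)) = a / (a\<^sup>2 + \<zeta>\<^sup>2) * ln (ratio l \<zeta>)"
      by eventually_elim simp
  qed (auto intro!: measurable_hl)
  also have "(\<integral>\<zeta>. a / (a\<^sup>2 + \<zeta>\<^sup>2) * ln (ratio l \<zeta>) \<partial>hl) = pi / 2 * ?I"
  proof -
    have "?I = (\<integral>\<zeta>. 2 / pi * (a / (a\<^sup>2 + \<zeta>\<^sup>2) * ln (ratio l \<zeta>)) \<partial>hl)"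
      by (subst hc_integral(2)[OF a]) (auto simp: mult.assoc intro!: Bochner_Integration.integral_cong)
    also have "\<dots> = 2 / pi * (\<integral>\<zeta>. a / (a\<^sup>2 + \<zeta>\<^sup>2) * ln (ratio l \<zeta>) \<partial>hl)" by (rule integral_mult_right_zero)
    finally have I: "?I = 2 / pi * (\<integral>\<zeta>. a / (a\<^sup>2 + \<zeta>\<^sup>2) * ln (ratio l \<zeta>) \<partial>hl)" .
    show ?thesis unfolding I by simp
  qed
  finally show ?thesis
    unfolding eigenfunction_laplace_def eig_def by (simp only:) (simp add: exp_of_real[symmetric])
qed

end

text \<open>Applied to exclude a bounded \<psi>: its weight would stay above a positive constant on
  a half-line of infinite measure.\<close>

lemma integrable_hl_const_zero:
  fixes c :: real
  assumes i: "integrable hl (\<lambda>_. c)"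
  shows "c = 0"
proof (rule ccontr)
  assume c: "c \<noteq> 0"
  define n where "n = (\<integral>x. \<bar>c\<bar> \<partial>hl) / \<bar>c\<bar> + 1"
  have ic: "integrable hl (\<lambda>_. \<bar>c\<bar>)" using i by (rule integrable_abs)
  have n0: "0 < n" unfolding n_def by (intro add_nonneg_pos divide_nonneg_nonneg Bochner_Integration.integral_nonneg) auto
  have "n * \<bar>c\<bar> = (\<integral>x. indicator {0<..n} (x::real) * \<bar>c\<bar> \<partial>lborel)" using n0 by simp
  also have "\<dots> \<le> (\<integral>x. indicator {0<..} (x::real) * \<bar>c\<bar> \<partial>lborel)"
  proof (rule Bochner_Integration.integral_mono)
    show "integrable lborel (\<lambda>x. indicator {0<..n} x * \<bar>c\<bar>)" using n0 by simp
    show "integrable lborel (\<lambda>x::real. indicator {0<..} x * \<bar>c\<bar>)"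
      using ic by (simp add: set_integrable_hl[symmetric] set_integrable_def)
  qed (auto simp: indicator_def)
  also have "\<dots> = (\<integral>x. \<bar>c\<bar> \<partial>hl)" by (simp only: set_integral_hl[symmetric] set_lebesgue_integral_def real_scaleR_def)
  finally show False using c by (simp add: n_def distrib_right)
qed

theorem theorem1p7:
  fixes M :: "'a measure" and X :: "real \<Rightarrow> 'a \<Rightarrow> real"
    and \<psi> :: "real \<Rightarrow> real" and F :: "real \<Rightarrow> real \<Rightarrow> real" and t :: real
  assumes "levy_process M X"
    and "symmetric_process M X"
    and "\<not> constant_process M X"
    and "complete_Bernstein \<psi>"
    and "\<And>s \<xi>. s \<ge> 0 \<Longrightarrow>
           char (distr M borel (X s)) \<xi> = of_real (exp (- s * \<psi> (\<xi>\<^sup>2)))"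
    and "\<And>l. l > 0 \<Longrightarrow> halfline_eigenfunction \<psi> l (F l)"
    and "t > 0"
    and "set_integrable lborel {0<..} (\<lambda>\<xi>. exp (- t * \<psi> (\<xi>\<^sup>2)))"
  shows "(\<forall>x>0. \<forall>y>0.
            set_integrable lborel {0<..} (\<lambda>l. exp (- t * \<psi> (l\<^sup>2)) * F l x * F l y)) \<and>
         killed_transition_density M X t
           (\<lambda>x y. 2 / pi * (LBINT l:{0<..}. exp (- t * \<psi> (l\<^sup>2)) * F l x * F l y))"
proof -
  note chars = assms(5)
  have w: "integrable hl (\<lambda>\<xi>. exp (- t * \<psi> (\<xi>\<^sup>2)))" using assms(8) by (simp only: set_integrable_hl)
  note D = complete_Bernstein_deriv[OF assms(4)]
  interpret pM: prob_space M using assms(1) by (simp add: levy_process_def)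
  have X1: "X 1 \<in> borel_measurable M" using assms(1) by (simp add: levy_process_def)
  interpret X1: real_distribution "distr M borel (X 1)" using X1 by (rule pM.real_distribution_distr)
  \<comment> \<open>The Bernstein representation speaks of positive arguments only. The
    characteristic function at time 1 fixes the value of \<psi> at 0 and, being continuous, its
    limit there.\<close>
  have psi_char: "\<psi> x = - ln (Re (char (distr M borel (X 1)) (sqrt x)))" if "0 \<le> x" for x
    using that chars[of 1 "sqrt x"] by simp
  have psi0: "\<psi> 0 = 0" using psi_char[of 0] by (simp add: X1.char_zero)
  have "((\<lambda>x. - ln (Re (char (distr M borel (X 1)) (sqrt x)))) \<longlongrightarrow> - ln (Re (char (distr M borel (X 1)) (sqrt 0)))) (at_right 0)"
    by (intro tendsto_intros isCont_tendsto_compose[OF X1.isCont_char]) (auto simp: X1.char_zero)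
  then have "((\<lambda>x. - ln (Re (char (distr M borel (X 1)) (sqrt x)))) \<longlongrightarrow> 0) (at_right 0)"
    by (simp add: X1.char_zero)
  then have psi0': "(\<psi> \<longlongrightarrow> 0) (at_right 0)"
  proof (rule Lim_transform_eventually)
    show "eventually (\<lambda>x. - ln (Re (char (distr M borel (X 1)) (sqrt x))) = \<psi> x) (at_right 0)"
      by (rule eventually_mono[OF eventually_at_right_less]) (simp add: psi_char)
  qed
  have mono: "\<psi> x \<le> \<psi> y" if "0 < x" "x \<le> y" for x y
    by (rule DERIV_nonneg_imp_nondecreasing[OF \<open>x \<le> y\<close>]) (use D(1,2) that in \<open>meson less_le_trans\<close>)
  have at_inf: "filterlim \<psi> at_top at_top"
  proof (rule ccontr)
    assume "\<not> filterlim \<psi> at_top at_top"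
    then obtain Z where Z: "\<not> eventually (\<lambda>x. Z \<le> \<psi> x) at_top" unfolding filterlim_at_top by blast
    have le: "\<psi> x \<le> Z" if "0 < x" for x
    proof (rule ccontr)
      assume "\<not> \<psi> x \<le> Z"
      then have "\<forall>y\<ge>x. Z \<le> \<psi> y" using mono[OF that] by force
      then show False using Z by (auto simp: eventually_at_top_linorder)
    qed
    have "integrable hl (\<lambda>_. exp (- t * Z))"
    proof (rule Bochner_Integration.integrable_bound[OF w])
      show "AE \<xi> in hl. norm (exp (- t * Z)) \<le> norm (exp (- t * \<psi> (\<xi>\<^sup>2)))"
        using le assms(7) by (auto intro!: AE_I2)
    qed simp
    from integrable_hl_const_zero[OF this] show False by simp
  qed
  \<comment> \<open>A zero of the derivative would spread: to the left because
    \<open>x\<^sup>2 * deriv \<psi> x\<close> increases, to the right because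
    \<open>deriv \<psi>\<close> decreases. Then \<psi> would be constant, contrary to
    \<open>at_inf\<close>.\<close>
  have pos: "0 < deriv \<psi> x" if x: "0 < x" for x
  proof (rule ccontr)
    assume "\<not> 0 < deriv \<psi> x"
    then have x0: "deriv \<psi> x = 0" using D(2)[OF x] by simp
    have 0: "deriv \<psi> y = 0" if y: "0 < y" for y
    proof (cases "y \<le> x")
      case True
      then have "y\<^sup>2 * deriv \<psi> y \<le> 0" using D(4)[OF y True] x0 by simp
      then show ?thesis using y D(2)[OF y] by (simp add: mult_le_0_iff)
    next
      case False
      then show ?thesis using D(3)[OF x, of y] D(2)[OF y] x0 by simp
    qed
    have "\<psi> y = \<psi> 1" if y: "1 < y" for y
    proof -
      have "\<exists>z>1. z < y \<and> \<psi> y - \<psi> 1 = (y - 1) * 0"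
        by (rule MVT2[OF y]) (use D(1) 0 in force)
      then show ?thesis by auto
    qed
    moreover have "eventually (\<lambda>y. \<psi> 1 + 1 \<le> \<psi> y \<and> 1 < y) at_top"
      using at_inf eventually_gt_at_top[of 1] unfolding filterlim_at_top by (auto intro: eventually_conj)
    then obtain y where "\<psi> 1 + 1 \<le> \<psi> y" "1 < y" by (auto simp: eventually_at_top_linorder)
    ultimately show False by force
  qed
  interpret levy_symbol \<psi> "deriv \<psi>"
    by unfold_locales (use D pos psi0 psi0' at_inf in auto)
  interpret halfline_kernel \<psi> "deriv \<psi>" M X t F
  proof unfold_locales
    show "levy_process M X" by fact
    show "char (distr M borel (X s)) \<xi> = of_real (exp (- s * \<psi> (\<xi>\<^sup>2)))" if "0 \<le> s" for s \<xi> by (rule chars[OF that])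
    show "0 < t" by fact
    show "distr M borel (\<lambda>\<omega>. - X t \<omega>) = distr M borel (X t)"
      using assms(2,7) by (simp add: symmetric_process_def)
    show "integrable hl (\<lambda>l. exp (- t * \<psi> (l\<^sup>2)))" by (rule w)
    fix l :: real assume l: "0 < l"
    show "continuous_on {0<..} (F l)" "bounded (F l ` {0<..})"
      using assms(6)[OF l] by (simp_all add: halfline_eigenfunction_def)
    show "(\<integral>y. exp (- a * y) * F l y \<partial>hl) = eig a l" if a: "0 < a" for a
    proof -
      have "(LBINT x:{0<..}. exp (- of_real a * of_real x) * of_real (F l x)) = eigenfunction_laplace \<psi> l (of_real a)"
        using assms(6)[OF l] a by (simp add: halfline_eigenfunction_def)
      moreover have "(LBINT x:{0<..}. exp (- of_real a * of_real x) * of_real (F l x)) = complex_of_real (\<integral>y. exp (- a * y) * F l y \<partial>hl)"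
        unfolding set_integral_hl integral_complex_of_real[symmetric]
        by (intro Bochner_Integration.integral_cong refl) (simp add: exp_of_real[symmetric])
      ultimately show ?thesis
        unfolding eigenfunction_laplace_of_real[OF a l refl] by (simp only: of_real_eq_iff)
    qed
  qed
  have FF: "(\<lambda>l. F l x * F l y) \<in> borel_measurable hl" if "0 < x" "0 < y" for x y
    using F_measurable[OF that(1)] F_measurable[OF that(2)] by simp
  have "integrable hl (\<lambda>l. phi t l * (F l x * F l y))" if "0 < x" "0 < y" for x y
    using square_prod_integrable(1)[OF F_measurable[OF that(1)] F_measurable[OF that(2)] F_square[OF that(1)] F_square[OF that(2)]]
    by (simp only: rho_integrable[OF FF[OF that]])
  then have 1: "set_integrable lborel {0<..} (\<lambda>l. exp (- t * \<psi> (l\<^sup>2)) * F l x * F l y)" if "0 < x" "0 < y" for x y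
    using that by (simp add: set_integrable_hl phi_def mult.assoc)
  have kernel: "2 / pi * (LBINT l:{0<..}. exp (- t * \<psi> (l\<^sup>2)) * F l x * F l y) = kernel x y" if "0 < x" "0 < y" for x y
    unfolding kernel_def rho_integral[OF FF[OF that]] by (simp add: set_integral_hl phi_def mult.assoc)
  let ?kernel = "\<lambda>x y. 2 / pi * (LBINT l:{0<..}. exp (- t * \<psi> (l\<^sup>2)) * F l x * F l y)"
  have "killed_transition_density M X t ?kernel"
    unfolding killed_transition_density_def set_integrable_hl set_integral_hl
  proof (intro allI ballI impI)
    fix x :: real and f :: "real \<Rightarrow> real"
    assume x: "0 < x" and f: "f \<in> borel_measurable borel" "bounded (range f)"
    have e: "2 / pi * (\<integral>l. exp (- t * \<psi> (l\<^sup>2)) * F l x * F l y \<partial>hl) = kernel x y" if "y \<in> space hl" for y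
      using kernel[OF x, of y] that by (simp add: set_integral_hl)
    have "integrable hl (\<lambda>y. 2 / pi * (\<integral>l. exp (- t * \<psi> (l\<^sup>2)) * F l x * F l y \<partial>hl) * f y) \<longleftrightarrow> integrable hl (\<lambda>y. kernel x y * f y)"
      by (intro Bochner_Integration.integrable_cong refl) (simp only: e)
    moreover have "(\<integral>y. 2 / pi * (\<integral>l. exp (- t * \<psi> (l\<^sup>2)) * F l x * F l y \<partial>hl) * f y \<partial>hl) = (\<integral>y. kernel x y * f y \<partial>hl)"
      by (intro Bochner_Integration.integral_cong refl) (simp only: e)
    ultimately show "integrable hl (\<lambda>y. 2 / pi * (\<integral>l. exp (- t * \<psi> (l\<^sup>2)) * F l x * F l y \<partial>hl) * f y) \<and>
        killed_semigroup M X t f x = (\<integral>y. 2 / pi * (\<integral>l. exp (- t * \<psi> (l\<^sup>2)) * F l x * F l y \<partial>hl) * f y \<partial>hl)"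
      unfolding killed_semigroup_eq[OF x f(1)] using killed_mean_density[OF x f] by simp
  qed
  with 1 show ?thesis by blast
qed

end
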